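(* Let $P=(X,\prec)$ be a poset with $|X|=n$, let $z_1,z_2,z_3\in X$ be distinct, and let $k,\ell\ge 1$ be integers. Let $\mathrm{F}(a,b)$ be the number of linear extensions $L$ of $P$ with $L(z_2)-L(z_1)=a$ and $L(z_3)-L(z_2)=b$. Suppose that $\mathrm{F}(k,\ell+2)\,\mathrm{F}(k+2,\ell)>0$. Then $$\mathrm{F}(k+1,\ell)\,\mathrm{F}(k,\ell+1)\ \ge\ \mathrm{F}(k,\ell)\,\mathrm{F}(k+1,\ell+1)\Big(\tfrac12+\tfrac{1}{2\sqrt{(2nk-2n-k+2)(2n\ell-2n-\ell+2)}}\Big).$$
   Context: A linear extension of $P$ is a bijection $L:X\to\{1,\dots,n\}$ with $L(u)<L(v)$ whenever $u\prec v$. *)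

theory Defs
  imports Complex_Main "HOL-Library.FuncSet"
begin

definition strict_poset_on :: "'a set \<Rightarrow> ('a \<Rightarrow> 'a \<Rightarrow> bool) \<Rightarrow> bool" where
  "strict_poset_on X prec \<longleftrightarrow> irreflp_on X prec \<and> transp_on X prec"

text \<open>
  Linear extensions are functions on \<open>X\<close> only. They are represented by total functions that
  are \<open>undefined\<close> outside \<open>X\<close>, so that the cardinality of the set below counts each linear
  extension exactly once.
\<close>

definition linear_extensions :: "'a set \<Rightarrow> ('a \<Rightarrow> 'a \<Rightarrow> bool) \<Rightarrow> ('a \<Rightarrow> nat) set" where
  "linear_extensions X prec =
     {L \<in> extensional X. bij_betw L X {1..card X} \<and> (\<forall>u\<in>X. \<forall>v\<in>X. prec u v \<longrightarrow> L u < L v)}"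

definition num_ext_gaps ::
  "'a set \<Rightarrow> ('a \<Rightarrow> 'a \<Rightarrow> bool) \<Rightarrow> 'a \<Rightarrow> 'a \<Rightarrow> 'a \<Rightarrow> int \<Rightarrow> int \<Rightarrow> nat" where
  "num_ext_gaps X prec z1 z2 z3 a b =
     card {L \<in> linear_extensions X prec.
             int (L z2) - int (L z1) = a \<and> int (L z3) - int (L z2) = b}"

end

theory Submission
  imports Defs "HOL-Analysis.Analysis" "HOL-Computational_Algebra.Polynomial"
begin

text \<open>
  The hypothesis allows us to assume \<open>z1 \<prec> z2 \<prec> z3\<close>, and adding a least and a greatest element does not
  change \<open>F\<close>. Write \<open>x, a, b, c, p, q\<close> for \<open>F\<close> at \<open>(k,l)\<close>, \<open>(k+1,l)\<close>, \<open>(k,l+1)\<close>, \<open>(k+1,l+1)\<close>, \<open>(k+2,l)\<close>,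
  \<open>(k,l+2)\<close>. These six numbers are mixed volumes of slices of the order polytope, so the
  Alexandrov-Fenchel inequality yields \<open>(a b - x c)\<^sup>2 \<le> (a\<^sup>2 - x p) (b\<^sup>2 - x q)\<close>, hence
  \<open>x (c + sqrt (p q)) \<le> 2 a b\<close>. If \<open>k, l \<ge> 2\<close>, moving one or two elements across the marks shows
  \<open>c \<le> k n q\<close> and \<open>c \<le> l n p\<close>, which is enough.

  For \<open>k = 1\<close> (and dually \<open>l = 1\<close>) moves are too weak. Here a version of the four functions theorem,
  applied to strictly order-preserving maps into a fine chain with movable marks, gives a convolution
  inequality between the sequences \<open>F 1\<close> and \<open>F 2\<close>. Both sequences are log-concave without internal
  zeros, so the terms of the convolution decay geometrically away from the central ones \<open>x c\<close> and
  \<open>a b\<close>; together with \<open>x q / b\<^sup>2 \<le> y (2 - y)\<close> for \<open>y = x c / (a b)\<close> this bounds \<open>y\<close>.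

  Mixed volumes are defined combinatorially, by recursion over the faces of a generic system of
  difference inequalities. The Alexandrov-Fenchel inequality is proved by induction on the dimension
  with the Bochner method of Shenfeld and van Handel; the two-dimensional faces are hexagons or their
  degenerations. Mixed volumes are additive under cutting along an incomparable pair, which reduces
  the count of linear extensions to chains.
\<close>

text \<open>The six counts are the entries of one 3x3 Gram matrix: fix \<open>k - 1\<close> slots in
  direction 0, \<open>l - 1\<close> in direction 1, all others but two in direction 2, and fill the
  last two slots with 0, 1 or 2. The pair 2,2 gives \<open>x\<close>, 0,2 gives \<open>a\<close>,
  1,2 gives \<open>b\<close>, 0,1 gives \<open>c\<close>, 0,0 gives \<open>p\<close> and 1,1 gives
  \<open>q\<close>. The determinant inequality expresses the hyperbolicity of this matrix. The two
  factors under the root are \<open>A = (2 n - 1) (k - 1) + 1\<close> and \<open>B\<close>, the same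
  with \<open>l\<close>. From \<open>c \<le> A q\<close> and \<open>c \<le> B p\<close> follows
  \<open>sqrt (p q) \<ge> c / sqrt (A B)\<close>, and then
  \<open>x (c + sqrt (p q)) \<le> 2 a b\<close> becomes the theorem. Since
  \<open>A - k n = (n - 1) (k - 2)\<close>, moves suffice from \<open>k = 2\<close> on. At
  \<open>k = 1\<close>, however, \<open>A\<close> is 1 while moves lose a factor of order
  \<open>n\<close>; this obstacle forces the second method. A slice of the order polytope need not
  be simple, but the Bochner induction runs over polytopes of one simple type. So the combinatorial
  type is read off a generic perturbation \<open>w0\<close>, while the mixed volumes are taken at
  the unperturbed right-hand sides, which are limits of that type.\<close>

text \<open>The Bochner method for symmetric matrices: \<open>pull\<close> keeps every eigenvalue of the matrix, relative
  to the weights \<open>m / h\<close>, out of the interval \<open>(0, 1)\<close>, and \<open>h\<close> is the Perron-Frobenius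
  eigenvector for the simple eigenvalue \<open>1\<close>.\<close>

lemma hyperbolic_of_children:
  fixes M :: "'i \<Rightarrow> 'i \<Rightarrow> real" and h m :: "'i \<Rightarrow> real"
  assumes fin: "finite I"
    and sym: "\<And>i j. i \<in> I \<Longrightarrow> j \<in> I \<Longrightarrow> M i j = M j i"
    and nonneg: "\<And>i j. i \<in> I \<Longrightarrow> j \<in> I \<Longrightarrow> i \<noteq> j \<Longrightarrow> M i j \<ge> 0"
    and conn: "\<And>A. A \<subseteq> I \<Longrightarrow> A \<noteq> {} \<Longrightarrow> A \<noteq> I \<Longrightarrow> \<exists>i\<in>A. \<exists>j\<in>I - A. M i j > 0"
    and h: "\<And>i. i \<in> I \<Longrightarrow> h i > 0"
    and m: "\<And>i. i \<in> I \<Longrightarrow> m i = (\<Sum>j\<in>I. M i j * h j)"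
    and mpos: "\<And>i. i \<in> I \<Longrightarrow> m i > 0"
    and pull: "\<And>x. (\<Sum>i\<in>I. \<Sum>j\<in>I. x i * M i j * x j) \<le> (\<Sum>i\<in>I. h i * (\<Sum>j\<in>I. M i j * x j)\<^sup>2 / m i)"
    and orth: "(\<Sum>i\<in>I. x i * m i) = 0"
  shows "(\<Sum>i\<in>I. \<Sum>j\<in>I. x i * M i j * x j) \<le> 0"
proof (rule ccontr)
  define q where "q = (\<lambda>x. \<Sum>i\<in>I. \<Sum>j\<in>I. x i * M i j * x j)"
  define D where "D = (\<lambda>x::'i \<Rightarrow> real. \<Sum>i\<in>I. m i / h i * (x i)\<^sup>2)"
  define orthog where "orthog = (\<lambda>x::'i \<Rightarrow> real. (\<Sum>i\<in>I. x i * m i) = 0)"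
  assume "\<not> ?thesis"
  then have q0: "q x > 0" by (simp add: q_def)
  have wpos: "m i / h i > 0" if "i \<in> I" for i using h mpos that by simp
  have Dnn: "D y \<ge> 0" for y
    unfolding D_def using wpos by (intro sum_nonneg mult_nonneg_nonneg) (auto simp: less_imp_le)
  have Dzero: "y i = 0" if "D y = 0" "i \<in> I" for y i
  proof -
    have "m i / h i * (y i)\<^sup>2 = 0"
      using that fin wpos unfolding D_def
      by (subst (asm) sum_nonneg_eq_0_iff) (auto simp del: times_divide_eq_left intro!: mult_nonneg_nonneg simp: less_imp_le)
    then show ?thesis using wpos[OF that(2)] by auto
  qed
  have Dscale: "D (\<lambda>i. c * y i) = c\<^sup>2 * D y" for c y
    unfolding D_def by (simp add: sum_distrib_left power_mult_distrib algebra_simps)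
  have qscale: "q (\<lambda>i. c * y i) = c\<^sup>2 * q y" for c y
    unfolding q_def by (simp add: sum_distrib_left power2_eq_square algebra_simps)
  have Dx: "D x > 0"
  proof -
    have "D x \<noteq> 0"
    proof
      assume "D x = 0"
      then have "q x = 0" unfolding q_def using Dzero by (intro sum.neutral ballI) auto
      then show False using q0 by simp
    qed
    then show ?thesis using Dnn[of x] by linarith
  qed
  \<comment> \<open>The quotient of \<open>q\<close> by \<open>D\<close> is maximised over the unit
    sphere of \<open>D\<close> in the hyperplane orthogonal to \<open>m\<close>. Coordinates outside
    \<open>I\<close> are pinned to 0, which makes this set compact in the product topology.\<close>
  define K where "K = {y. (\<forall>i. i \<notin> I \<longrightarrow> y i = 0) \<and> orthog y \<and> D y = 1}"
  define x1 where "x1 = (\<lambda>i. if i \<in> I then x i / sqrt (D x) else 0)"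
  have x1I: "q x1 = q (\<lambda>i. (1 / sqrt (D x)) * x i)" "D x1 = D (\<lambda>i. (1 / sqrt (D x)) * x i)"
    unfolding q_def D_def x1_def by (auto intro!: sum.cong)
  have "orthog x1" unfolding orthog_def x1_def using orth
    by (simp add: sum_divide_distrib[symmetric] cong: sum.cong)
  then have x1K: "x1 \<in> K" unfolding K_def using x1I(2) Dx Dscale[of "1 / sqrt (D x)" x]
    by (auto simp: x1_def power_divide)
  have qx1: "q x1 > 0" using x1I(1) qscale[of "1 / sqrt (D x)" x] q0 Dx by simp
  define B where "B = Max (insert 1 ((\<lambda>i. sqrt (h i / m i)) ` I))"
  have bound: "\<bar>y i\<bar> \<le> B" if "y \<in> K" "i \<in> I" for y i
  proof -
    have "m i / h i * (y i)\<^sup>2 \<le> D y" unfolding D_def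
      using fin that wpos by (intro member_le_sum) (auto simp del: times_divide_eq_left intro!: mult_nonneg_nonneg simp: less_imp_le)
    also have "D y = 1" using that by (simp add: K_def)
    finally have "(y i)\<^sup>2 \<le> h i / m i" using h[OF that(2)] mpos[OF that(2)]
      by (simp add: field_simps)
    then have "\<bar>y i\<bar> \<le> sqrt (h i / m i)" using real_le_rsqrt real_sqrt_le_mono by fastforce
    also have "\<dots> \<le> B" unfolding B_def using fin that by (intro Max_ge) auto
    finally show ?thesis .
  qed
  define S where "S = (\<lambda>i. if i \<in> I then {-B..B} else {0::real})"
  have "compactin (product_topology (\<lambda>_::'i. euclidean) UNIV) (Pi\<^sub>E UNIV S)"
    unfolding compactin_PiE by (auto simp: S_def)
  then have cS: "compact (Pi\<^sub>E UNIV S)" by (simp add: euclidean_product_topology)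
  have contq: "continuous_on A q" for A unfolding q_def by (intro continuous_intros continuous_on_product_coordinates[THEN continuous_on_subset]) auto
  have contD: "continuous_on A D" for A unfolding D_def by (intro continuous_intros continuous_on_product_coordinates[THEN continuous_on_subset]) auto
  have conto: "continuous_on A (\<lambda>y::'i \<Rightarrow> real. \<Sum>i\<in>I. y i * m i)" for A
    by (intro continuous_intros continuous_on_product_coordinates[THEN continuous_on_subset]) auto
  have "closed ({y. orthog y} \<inter> {y. D y = 1})"
    unfolding orthog_def by (intro closed_Int closed_Collect_eq conto contD continuous_intros)
  then have "compact (Pi\<^sub>E UNIV S \<inter> ({y. orthog y} \<inter> {y. D y = 1}))"
    using cS by (rule compact_Int_closed[rotated])
  moreover have "Pi\<^sub>E UNIV S \<inter> ({y. orthog y} \<inter> {y. D y = 1}) = K"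
  proof (rule set_eqI)
    fix y
    show "y \<in> Pi\<^sub>E UNIV S \<inter> ({y. orthog y} \<inter> {y. D y = 1}) \<longleftrightarrow> y \<in> K"
    proof
      assume y: "y \<in> K"
      have "y i \<in> S i" for i
        using bound[OF y, of i] y by (cases "i \<in> I") (auto simp: S_def K_def abs_le_iff)
      then show "y \<in> Pi\<^sub>E UNIV S \<inter> ({y. orthog y} \<inter> {y. D y = 1})" using y by (auto simp: K_def)
    next
      assume y: "y \<in> Pi\<^sub>E UNIV S \<inter> ({y. orthog y} \<inter> {y. D y = 1})"
      have "y i = 0" if "i \<notin> I" for i
      proof -
        have "y i \<in> S i" using y by auto
        then show ?thesis using that by (simp add: S_def)
      qed
      then show "y \<in> K" using y by (auto simp: K_def)
    qed
  qed
  ultimately have "compact K" by simp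
  then obtain y where yK: "y \<in> K" and ymax: "\<And>z. z \<in> K \<Longrightarrow> q z \<le> q y"
    using continuous_attains_sup[of K q] x1K contq by auto
  define lam where "lam = q y"
  have lam: "lam > 0" using ymax[OF x1K] qx1 lam_def by simp
  have yo: "orthog y" and Dy: "D y = 1" using yK by (auto simp: K_def)
  have max_all: "q z \<le> lam * D z" if "orthog z" for z
  proof (cases "D z = 0")
    case True
    then have "q z = 0" unfolding q_def using Dzero by (intro sum.neutral ballI) auto
    then show ?thesis using True by simp
  next
    case False
    then have Dz: "D z > 0" using Dnn[of z] by linarith
    define z1 where "z1 = (\<lambda>i. if i \<in> I then z i / sqrt (D z) else 0)"
    have z1I: "q z1 = q (\<lambda>i. (1 / sqrt (D z)) * z i)" "D z1 = D (\<lambda>i. (1 / sqrt (D z)) * z i)"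
      unfolding q_def D_def z1_def by (auto intro!: sum.cong)
    have "orthog z1" unfolding orthog_def z1_def using that
      by (simp add: orthog_def sum_divide_distrib[symmetric] cong: sum.cong)
    then have "z1 \<in> K" unfolding K_def using z1I(2) Dz Dscale[of "1 / sqrt (D z)" z]
      by (auto simp: z1_def power_divide)
    from ymax[OF this] have "q z / D z \<le> lam"
      using z1I(1) qscale[of "1 / sqrt (D z)" z] Dz by (simp add: lam_def power_divide)
    then show ?thesis using Dz by (simp add: field_simps)
  qed
  define N where "N = (\<lambda>i. \<Sum>j\<in>I. M i j * y j)"
  \<comment> \<open>Residual of the eigenvalue equation at the maximiser. By symmetry of
    \<open>M\<close> it is again orthogonal to \<open>m\<close>, hence an admissible variation, and
    maximality forces \<open>D r = 0\<close>.\<close>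
  define r where "r = (\<lambda>i. h i / m i * N i - lam * y i)"
  have ro: "orthog r"
  proof -
    have "(\<Sum>i\<in>I. r i * m i) = (\<Sum>i\<in>I. h i * N i) - lam * (\<Sum>i\<in>I. y i * m i)"
    proof -
      have "r i * m i = h i * N i - lam * (y i * m i)" if "i \<in> I" for i
        using mpos[OF that] unfolding r_def by (simp add: algebra_simps)
      then show ?thesis by (simp add: sum_subtractf sum_distrib_left)
    qed
    also have "(\<Sum>i\<in>I. h i * N i) = (\<Sum>i\<in>I. \<Sum>j\<in>I. h i * M i j * y j)"
      unfolding N_def by (simp add: sum_distrib_left mult.assoc)
    also have "\<dots> = (\<Sum>j\<in>I. \<Sum>i\<in>I. h i * M i j * y j)" by (rule sum.swap)
    also have "\<dots> = (\<Sum>j\<in>I. y j * m j)"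
      using m sym by (intro sum.cong) (auto simp: sum_distrib_left algebra_simps intro!: sum.cong)
    finally show ?thesis using yo by (simp add: orthog_def)
  qed
  have qexp: "q (\<lambda>i. y i + t * r i) = q y + 2 * t * (\<Sum>i\<in>I. r i * N i) + t\<^sup>2 * q r" for t
  proof -
    have "q (\<lambda>i. y i + t * r i) = q y + t * (\<Sum>i\<in>I. \<Sum>j\<in>I. r i * M i j * y j)
        + t * (\<Sum>i\<in>I. \<Sum>j\<in>I. y i * M i j * r j) + t\<^sup>2 * q r"
      unfolding q_def by (simp add: sum_distrib_left sum.distrib[symmetric] power2_eq_square algebra_simps)
    also have "(\<Sum>i\<in>I. \<Sum>j\<in>I. y i * M i j * r j) = (\<Sum>j\<in>I. \<Sum>i\<in>I. y i * M i j * r j)" by (rule sum.swap)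
    also have "\<dots> = (\<Sum>i\<in>I. \<Sum>j\<in>I. r i * M i j * y j)"
      using sym by (intro sum.cong refl) (simp add: algebra_simps)
    finally show ?thesis unfolding N_def by (simp add: sum_distrib_left mult.assoc algebra_simps)
  qed
  have Dexp: "D (\<lambda>i. y i + t * r i) = 1 + 2 * t * (\<Sum>i\<in>I. m i / h i * y i * r i) + t\<^sup>2 * D r" for t
    unfolding Dy[symmetric] D_def
    by (simp add: sum_distrib_left sum.distrib[symmetric] power2_eq_square algebra_simps)
  have lin: "(\<Sum>i\<in>I. r i * N i) - lam * (\<Sum>i\<in>I. m i / h i * y i * r i) = D r"
    unfolding D_def sum_distrib_left sum_subtractf[symmetric]
  proof (rule sum.cong[OF refl])
    fix i assume "i \<in> I"
    then have "N i = m i / h i * (r i + lam * y i)" using h[of i] mpos[of i] unfolding r_def by simp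
    then show "r i * N i - lam * (m i / h i * y i * r i) = m i / h i * (r i)\<^sup>2"
      by (simp add: power2_eq_square algebra_simps)
  qed
  have key: "2 * t * D r + t\<^sup>2 * (q r - lam * D r) \<le> 0" for t
  proof -
    have "orthog (\<lambda>i. y i + t * r i)" using yo ro unfolding orthog_def
      by (simp add: distrib_right sum.distrib mult.assoc sum_distrib_left[symmetric])
    from max_all[OF this] have "q y + 2 * t * (\<Sum>i\<in>I. r i * N i) + t\<^sup>2 * q r
       \<le> lam * (1 + 2 * t * (\<Sum>i\<in>I. m i / h i * y i * r i) + t\<^sup>2 * D r)"
      unfolding qexp Dexp .
    then have "2 * t * ((\<Sum>i\<in>I. r i * N i) - lam * (\<Sum>i\<in>I. m i / h i * y i * r i))
        + t\<^sup>2 * (q r - lam * D r) \<le> 0"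
      by (simp add: lam_def algebra_simps)
    then show ?thesis unfolding lin .
  qed
  have "D r = 0"
  proof (rule ccontr)
    assume "D r \<noteq> 0"
    then have Dr: "D r > 0" using Dnn[of r] by linarith
    define e where "e = \<bar>q r - lam * D r\<bar> + 1"
    have e: "e > 0" "- e \<le> q r - lam * D r" unfolding e_def by auto
    have "2 * (D r / e) * D r + (D r / e)\<^sup>2 * (- e) \<le> 2 * (D r / e) * D r + (D r / e)\<^sup>2 * (q r - lam * D r)"
      using e by (intro add_left_mono mult_left_mono) auto
    also have "\<dots> \<le> 0" by (rule key)
    finally have "D r * D r / e \<le> 0" using e by (simp add: power2_eq_square field_simps)
    then show False using Dr e by (simp add: divide_le_0_iff mult_le_0_iff)
  qed
  then have eig: "N i = lam * (m i / h i) * y i" if "i \<in> I" for i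
  proof -
    have "r i = 0" by (rule Dzero[OF \<open>D r = 0\<close> that])
    then show ?thesis using h[OF that] mpos[OF that] unfolding r_def by (simp add: field_simps)
  qed
  have qy: "q y = lam * D y" using Dy lam_def by simp
  have "q y \<le> (\<Sum>i\<in>I. h i * (N i)\<^sup>2 / m i)" unfolding q_def N_def by (rule pull)
  also have "\<dots> = lam\<^sup>2 * D y" unfolding D_def sum_distrib_left
  proof (rule sum.cong[OF refl])
    fix i assume i: "i \<in> I"
    show "h i * (N i)\<^sup>2 / m i = lam\<^sup>2 * (m i / h i * (y i)\<^sup>2)"
      unfolding eig[OF i] using h[OF i] mpos[OF i]
      by (simp add: power2_eq_square field_simps)
  qed
  \<comment> \<open>For an eigenvector, \<open>pull\<close> reads
    \<open>lam \<le> lam * lam\<close>.\<close>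
  finally have lam1: "lam \<ge> 1" using lam Dy qy by (simp add: power2_eq_square)
  define u where "u = (\<lambda>i. y i / h i)"
  \<comment> \<open>The Dirichlet form of \<open>y / h\<close> equals \<open>2 - 2 * lam\<close>, so
    it is nonpositive although its terms are nonnegative. Hence \<open>y / h\<close> is constant by
    connectivity, and a nonzero multiple of \<open>h\<close> is not orthogonal to
    \<open>m\<close>.\<close>
  have lap: "(\<Sum>i\<in>I. \<Sum>j\<in>I. M i j * h i * h j * (u i - u j)\<^sup>2) = 2 * D y - 2 * q y"
  proof -
    have e: "M i j * h i * h j * (u i - u j)\<^sup>2 =
        M i j * h j / h i * (y i)\<^sup>2 + M i j * h i / h j * (y j)\<^sup>2 - 2 * (y i * M i j * y j)"
      if "i \<in> I" "j \<in> I" for i j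
    proof -
      have y: "y i = u i * h i" "y j = u j * h j" and nz: "h i \<noteq> 0" "h j \<noteq> 0"
        using h[OF that(1)] h[OF that(2)] unfolding u_def by auto
      have "M i j * h j / h i * (y i)\<^sup>2 = M i j * h j * h i * (u i)\<^sup>2"
        "M i j * h i / h j * (y j)\<^sup>2 = M i j * h j * h i * (u j)\<^sup>2"
        unfolding y using nz by (simp_all add: power2_eq_square)
      then show ?thesis unfolding y by (simp add: power2_eq_square algebra_simps)
    qed
    have a: "(\<Sum>i\<in>I. \<Sum>j\<in>I. M i j * h j / h i * (y i)\<^sup>2) = D y"
      unfolding D_def using m
      by (intro sum.cong refl) (simp add: sum_distrib_right sum_divide_distrib)
    have b: "(\<Sum>i\<in>I. \<Sum>j\<in>I. M i j * h i / h j * (y j)\<^sup>2) = D y"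
      unfolding a[symmetric] by (subst sum.swap) (intro sum.cong refl, simp add: sym)
    have "(\<Sum>i\<in>I. \<Sum>j\<in>I. M i j * h i * h j * (u i - u j)\<^sup>2) =
      (\<Sum>i\<in>I. \<Sum>j\<in>I. M i j * h j / h i * (y i)\<^sup>2 + M i j * h i / h j * (y j)\<^sup>2 - 2 * (y i * M i j * y j))"
      using e by (intro sum.cong refl) auto
    also have "\<dots> = 2 * D y - 2 * q y"
      unfolding sum.distrib sum_subtractf a b q_def by (simp add: sum_distrib_left)
    finally show ?thesis .
  qed
  have termnn: "M i j * h i * h j * (u i - u j)\<^sup>2 \<ge> 0" if "i \<in> I" "j \<in> I" for i j
    using nonneg[OF that] h[OF that(1)] h[OF that(2)] by (cases "i = j") auto
  have "(\<Sum>i\<in>I. \<Sum>j\<in>I. M i j * h i * h j * (u i - u j)\<^sup>2) \<le> 0"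
    using lap lam1 Dy qy by simp
  then have "(\<Sum>i\<in>I. \<Sum>j\<in>I. M i j * h i * h j * (u i - u j)\<^sup>2) = 0"
    using termnn by (intro antisym sum_nonneg) auto
  then have t0: "M i j * h i * h j * (u i - u j)\<^sup>2 = 0" if "i \<in> I" "j \<in> I" for i j
    using fin that termnn by (subst (asm) sum_nonneg_eq_0_iff)
      (auto intro!: sum_nonneg simp: sum_nonneg_eq_0_iff)
  have "I \<noteq> {}" using Dy by (auto simp: D_def)
  then obtain i0 where i0: "i0 \<in> I" by auto
  have const: "u i = u i0" if "i \<in> I" for i
  proof (rule ccontr)
    assume ne: "u i \<noteq> u i0"
    define A where "A = {j \<in> I. u j = u i0}"
    have "A \<subseteq> I" "A \<noteq> {}" "A \<noteq> I" using i0 that ne by (auto simp: A_def)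
    from conn[OF this] obtain i' j' where *: "i' \<in> A" "j' \<in> I - A" "M i' j' > 0" by blast
    then have "i' \<in> I" "j' \<in> I" by (auto simp: A_def)
    from t0[OF this] * h[OF this(1)] h[OF this(2)] show False by (auto simp: A_def)
  qed
  have "y i = u i0 * h i" if "i \<in> I" for i using const[OF that] h[OF that]
    by (simp add: u_def field_simps)
  then have "(\<Sum>i\<in>I. y i * m i) = u i0 * (\<Sum>i\<in>I. h i * m i)"
    by (simp add: sum_distrib_left mult.assoc)
  moreover have "(\<Sum>i\<in>I. h i * m i) > 0" using fin i0 h mpos by (intro sum_pos) auto
  ultimately have "u i0 = 0" using yo by (simp add: orthog_def)
  then have "D y = 0" using \<open>\<And>i. i \<in> I \<Longrightarrow> y i = u i0 * h i\<close> by (simp add: D_def)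
  then show False using Dy by simp
qed

section \<open>Generic systems of difference inequalities\<close>

text \<open>The system stands for the polytope of all \<open>a\<close> with \<open>w0 e + a (tgt e) - a (src e) \<ge> 0\<close>, taken modulo
  constants; \<open>generic\<close> makes it a simple polytope. A face is given by
  its set of tight inequalities.\<close>

locale difference_system =
  fixes V :: "'v set" and E :: "'e set" and src tgt :: "'e \<Rightarrow> 'v" and w0 :: "'e \<Rightarrow> real"
  assumes finV: "finite V" and neV: "V \<noteq> {}" and finE: "finite E"
    and srcV: "\<And>e. e \<in> E \<Longrightarrow> src e \<in> V" and tgtV: "\<And>e. e \<in> E \<Longrightarrow> tgt e \<in> V"
    and generic: "\<And>S a r. S \<subseteq> E \<Longrightarrow> (\<forall>e\<in>S. w0 e + (a (tgt e) - a (src e)) = 0) \<Longrightarrow>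
      \<exists>b::'v \<Rightarrow> real. \<forall>e\<in>S. b (tgt e) - b (src e) = r e"
    and bounded: "\<And>b u v. (\<forall>e\<in>E. b (tgt e) - b (src e) \<ge> (0::real)) \<Longrightarrow> u \<in> V \<Longrightarrow> v \<in> V \<Longrightarrow> b u = b v"
begin

definition df :: "('v \<Rightarrow> real) \<Rightarrow> 'e \<Rightarrow> real" where "df b e = b (tgt e) - b (src e)"

definition slack :: "('e \<Rightarrow> real) \<Rightarrow> ('v \<Rightarrow> real) \<Rightarrow> 'e \<Rightarrow> real" where "slack v a e = v e + df a e"

definition indep :: "'e set \<Rightarrow> bool" where "indep S \<longleftrightarrow> (\<forall>r. \<exists>b. \<forall>e\<in>S. df b e = r e)"

definition flat :: "'e set \<Rightarrow> ('v \<Rightarrow> real) \<Rightarrow> bool" where "flat S b \<longleftrightarrow> (\<forall>e\<in>S. df b e = 0)"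

definition face :: "'e set \<Rightarrow> bool" where
  "face S \<longleftrightarrow> S \<subseteq> E \<and> (\<exists>a. (\<forall>e\<in>S. slack w0 a e = 0) \<and> (\<forall>e\<in>E - S. slack w0 a e > 0))"

definition link :: "'e set \<Rightarrow> 'e set" where "link S = {e \<in> E - S. face (insert e S)}"

definition dim :: nat where "dim = card V - 1"

text \<open>For \<open>S \<subseteq> E\<close> the classes are the connected components of the graph
  with edge set \<open>S\<close>. Defining them through the potentials that are constant along
  \<open>S\<close> avoids paths.\<close>

definition blk :: "'e set \<Rightarrow> 'v rel" where
  "blk S = {(u, v). u \<in> V \<and> v \<in> V \<and> (\<forall>b. flat S b \<longrightarrow> b u = b v)}"

lemma df_lin: "df (\<lambda>v. c * a v + b v) e = c * df a e + df b e"
  by (simp add: df_def algebra_simps)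

lemma slack_add: "slack v (\<lambda>u. c * b u + a u) e = slack v a e + c * df b e"
  by (simp add: slack_def df_lin)

lemma equiv_blk: "equiv V (blk S)"
  by (rule equivI) (auto simp: blk_def refl_on_def sym_def trans_def)

lemma blk_edge: "f \<in> S \<Longrightarrow> f \<in> E \<Longrightarrow> (src f, tgt f) \<in> blk S"
  using srcV tgtV by (auto simp: blk_def flat_def df_def)

lemma flat_ind:
  assumes "S \<subseteq> E" "\<And>u v. (u, v) \<in> blk S \<Longrightarrow> u \<in> A \<longleftrightarrow> v \<in> A"
  shows "flat S (indicator A)"
  unfolding flat_def
proof
  fix f assume "f \<in> S"
  then have "(src f, tgt f) \<in> blk S" using blk_edge assms by auto
  from assms(2)[OF this] show "df (indicator A) f = 0" by (auto simp: df_def indicator_def)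
qed

lemma indepE:
  assumes "indep S" obtains b where "\<And>e. e \<in> S \<Longrightarrow> df b e = r e"
  using assms unfolding indep_def by (auto elim!: allE[where x = r])

lemma indep_mono: "indep S \<Longrightarrow> R \<subseteq> S \<Longrightarrow> indep R"
  unfolding indep_def by (meson subsetD)

lemma indep_edge_sep:
  assumes "indep (insert e S)" "e \<notin> S"
  shows "(src e, tgt e) \<notin> blk S"
proof -
  obtain b where "\<And>f. f \<in> insert e S \<Longrightarrow> df b f = (if f = e then 1 else 0)"
    using indepE[OF assms(1), of "\<lambda>f. if f = e then 1 else 0"] by metis
  note b = this
  have "df b f = 0" if "f \<in> S" for f using b[of f] that assms(2) by auto
  then have "flat S b" by (simp add: flat_def)
  moreover have "b (src e) \<noteq> b (tgt e)" using b[of e] by (auto simp: df_def)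
  ultimately show ?thesis by (auto simp: blk_def)
qed

text \<open>An independent edge joins two different components, and only these merge: a potential
  that separates two nodes outside them becomes flat on \<open>e\<close> after adding a multiple of
  the indicator of the block of \<open>src e\<close>.\<close>

lemma blk_insert:
  assumes "insert e S \<subseteq> E" "indep (insert e S)" "e \<notin> S"
  shows "blk (insert e S) = blk S \<union> (blk S `` {src e} \<union> blk S `` {tgt e}) \<times> (blk S `` {src e} \<union> blk S `` {tgt e})"
    (is "_ = _ \<union> (?A \<union> ?B) \<times> (?A \<union> ?B)")
proof -
  have sep: "(src e, tgt e) \<notin> blk S" by (rule indep_edge_sep) (use assms in auto)
  have eE: "e \<in> E" "src e \<in> V" "tgt e \<in> V" using assms srcV tgtV by auto
  have AB: "src e \<in> ?A" "tgt e \<in> ?B" using eE by (auto simp: blk_def)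
  have mono: "blk S \<subseteq> blk (insert e S)" by (auto simp: blk_def flat_def)
  have trans': "(u, w) \<in> blk S" if "(u, v) \<in> blk S" "(v, w) \<in> blk S" for u v w
    using that by (auto simp: blk_def)
  have sym': "(v, u) \<in> blk S" if "(u, v) \<in> blk S" for u v
    using that by (auto simp: blk_def)
  have up: "(?A \<union> ?B) \<times> (?A \<union> ?B) \<subseteq> blk (insert e S)"
  proof -
    have "b u = b (src e)" if "u \<in> ?A \<union> ?B" "flat (insert e S) b" for u b
    proof -
      have "flat S b" "b (tgt e) = b (src e)" using that(2) by (auto simp: flat_def df_def)
      then show ?thesis using that(1) unfolding blk_def by auto
    qed
    then show ?thesis by (auto simp: blk_def) (metis Un_iff Image_singleton_iff)+
  qed
  have "(u, v) \<in> blk S \<union> (?A \<union> ?B) \<times> (?A \<union> ?B)" if uv: "(u, v) \<in> blk (insert e S)" for u v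
  proof (rule ccontr)
    assume n: "(u, v) \<notin> blk S \<union> (?A \<union> ?B) \<times> (?A \<union> ?B)"
    have V: "u \<in> V" "v \<in> V" using uv by (auto simp: blk_def)
    have fA: "flat S (indicator ?A)" by (rule flat_ind) (use assms trans' sym' in blast)+
    have fB: "flat S (indicator ?B)" by (rule flat_ind) (use assms trans' sym' in blast)+
    have nA: "tgt e \<notin> ?A" "src e \<notin> ?B" using sep sym' by auto
    have fAB: "flat (insert e S) (\<lambda>u. indicator ?A u + indicator ?B u)"
      using fA fB nA AB by (auto simp: flat_def df_def indicator_def split: if_splits)
    have disj: "?A \<inter> ?B = {}" using nA(1) trans' sym' by blast
    have all: "b u = b v" if "flat (insert e S) b" for b using uv that by (auto simp: blk_def)
    have iff: "(u \<in> ?A \<union> ?B) = (v \<in> ?A \<union> ?B)"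
    proof -
      have "indicat_real (?A \<union> ?B) w = indicat_real ?A w + indicat_real ?B w" for w
        using disj by (auto simp: indicator_def)
      then have "indicat_real (?A \<union> ?B) u = indicat_real (?A \<union> ?B) v" using all[OF fAB] by simp
      then show ?thesis by (auto simp: indicator_def split: if_splits)
    qed
    then have uA: "u \<notin> ?A \<union> ?B" "v \<notin> ?A \<union> ?B" using n by auto
    from n V obtain b where b: "flat S b" "b u \<noteq> b v" by (auto simp: blk_def)
    have "flat (insert e S) (\<lambda>w. df b e * indicator ?A w + b w)"
      using b(1) fA nA AB by (auto simp: flat_def df_def indicator_def)
    from all[OF this] uA b(2) show False by (auto simp: indicator_def)
  qed
  then show ?thesis using mono up by auto
qed

text \<open>An independent set is a forest, so each of its edges lowers the number of components by
  one. Thus \<open>card S\<close> is the codimension of a face, and \<open>dim\<close> tight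
  inequalities make a vertex.\<close>

lemma card_blk:
  assumes "S \<subseteq> E" "indep S"
  shows "card (V // blk S) + card S = card V"
proof -
  have "finite S" using assms finE finite_subset by auto
  then show ?thesis using assms
  proof (induction S)
    case empty
    have "(u, v) \<in> blk {} \<longleftrightarrow> u \<in> V \<and> v \<in> V \<and> u = v" for u v
    proof
      assume "(u, v) \<in> blk {}"
      then have "u \<in> V" "v \<in> V" "\<And>b::'v \<Rightarrow> real. b u = b v" by (auto simp: blk_def flat_def)
      from this(1,2) this(3)[of "indicator {u}"]
      have "u \<in> V" "v \<in> V" "(indicator {u} :: 'v \<Rightarrow> real) u = indicator {u} v" by auto
      then show "u \<in> V \<and> v \<in> V \<and> u = v" by (auto simp: indicator_def split: if_splits)
    qed (auto simp: blk_def)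
    then have "V // blk {} = (\<lambda>v. {v}) ` V" by (auto simp: quotient_def)
    then show ?case by (simp add: card_image)
  next
    case (insert e S)
    let ?A = "blk S `` {src e}" and ?B = "blk S `` {tgt e}"
    have sub: "insert e S \<subseteq> E" and ind: "indep (insert e S)" using insert by auto
    have eV: "src e \<in> V" "tgt e \<in> V" using sub srcV tgtV by auto
    have IH: "card (V // blk S) + card S = card V"
      using insert.IH sub indep_mono[OF ind] by auto
    have sep: "(src e, tgt e) \<notin> blk S" using indep_edge_sep[OF ind] insert by auto
    have eq: "equiv V (blk S)" by (rule equiv_blk)
    have ne: "?A \<noteq> ?B" using sep eV eq by (metis eq_equiv_class)
    have AQ: "?A \<in> V // blk S" "?B \<in> V // blk S" using eV by (auto simp: quotientI)
    have b: "blk (insert e S) = blk S \<union> (?A \<union> ?B) \<times> (?A \<union> ?B)"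
      using blk_insert[OF sub ind] insert by auto
    have cls: "blk (insert e S) `` {u} = (if u \<in> ?A \<union> ?B then ?A \<union> ?B else blk S `` {u})" if "u \<in> V" for u
    proof -
      have "blk S `` {u} \<subseteq> ?A \<union> ?B" if "u \<in> ?A \<union> ?B"
        using that eq unfolding equiv_def sym_def trans_def by blast
      then show ?thesis unfolding b by auto
    qed
    have own: "blk S `` {u} = ?A" if "u \<in> ?A" for u using that eq by (metis Image_singleton_iff equiv_class_eq)
    have own': "blk S `` {u} = ?B" if "u \<in> ?B" for u using that eq by (metis Image_singleton_iff equiv_class_eq)
    have self: "u \<in> blk S `` {u}" if "u \<in> V" for u using that by (auto simp: blk_def)
    have srcA: "src e \<in> ?A" using self eV by auto
    have Q: "V // blk (insert e S) = insert (?A \<union> ?B) (V // blk S - {?A, ?B})"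
    proof (rule set_eqI)
      fix C
      have "C \<in> V // blk (insert e S) \<longleftrightarrow> (\<exists>u\<in>V. C = (if u \<in> ?A \<union> ?B then ?A \<union> ?B else blk S `` {u}))"
        unfolding quotient_def using cls by auto
      also have "\<dots> \<longleftrightarrow> C = ?A \<union> ?B \<or> (\<exists>u\<in>V. u \<notin> ?A \<union> ?B \<and> C = blk S `` {u})"
        using srcA eV by auto
      also have "(\<exists>u\<in>V. u \<notin> ?A \<union> ?B \<and> C = blk S `` {u}) \<longleftrightarrow> C \<in> V // blk S - {?A, ?B}"
      proof
        assume "\<exists>u\<in>V. u \<notin> ?A \<union> ?B \<and> C = blk S `` {u}"
        then obtain u where "u \<in> V" "u \<notin> ?A \<union> ?B" "C = blk S `` {u}" by auto
        then show "C \<in> V // blk S - {?A, ?B}" using self[of u] by (auto simp: quotientI)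
      next
        assume C: "C \<in> V // blk S - {?A, ?B}"
        then obtain u where u: "u \<in> V" "C = blk S `` {u}" by (auto simp: quotient_def)
        then show "\<exists>u\<in>V. u \<notin> ?A \<union> ?B \<and> C = blk S `` {u}" using C own[of u] own'[of u] by auto
      qed
      finally show "C \<in> V // blk (insert e S) \<longleftrightarrow> C \<in> insert (?A \<union> ?B) (V // blk S - {?A, ?B})" by auto
    qed
    have fq: "finite (V // blk S)" using finV eq by (simp add: equiv_def finite_quotient refl_on_def blk_def quotient_def)
    have "?A \<union> ?B \<notin> V // blk S"
    proof
      assume "?A \<union> ?B \<in> V // blk S"
      from quotient_disj[OF eq this AQ(1)] quotient_disj[OF eq this AQ(2)] srcA self[OF eV(2)] ne
      show False by blast
    qed
    then have "card (V // blk (insert e S)) = Suc (card (V // blk S - {?A, ?B}))"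
      unfolding Q using fq by auto
    also have "card (V // blk S - {?A, ?B}) = card (V // blk S) - 2"
      using AQ ne fq by (subst card_Diff_subset) auto
    also have "card (V // blk S) \<ge> 2"
      using card_mono[OF fq, of "{?A, ?B}"] AQ ne by auto
    then have "Suc (card (V // blk S) - 2) = card (V // blk S) - 1" by auto
    finally show ?case using IH insert.hyps \<open>card (V // blk S) \<ge> 2\<close> by auto
  qed
qed

lemma flat_blk: "flat S b \<Longrightarrow> (u, v) \<in> blk S \<Longrightarrow> b u = b v" by (auto simp: blk_def)

lemma card_V: "card V = Suc dim"
  using finV neV by (simp add: dim_def card_gt_0_iff)

lemma indep_card_le:
  assumes "S \<subseteq> E" "indep S" shows "card S \<le> dim"
proof -
  have "V // blk S \<noteq> {}" using neV by (auto simp: quotient_def)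
  moreover have "finite (V // blk S)" using finV by (simp add: quotient_def)
  ultimately have "card (V // blk S) \<ge> 1" by (simp add: card_gt_0_iff Suc_le_eq)
  then show ?thesis using card_blk[OF assms] card_V by simp
qed

lemma face_sub: "face S \<Longrightarrow> S \<subseteq> E" by (simp add: face_def)

lemma face_fin: "face S \<Longrightarrow> finite S" using face_sub[of S] finE by (auto intro: finite_subset)

lemma face_indep: "face S \<Longrightarrow> indep S"
  unfolding face_def indep_def slack_def df_def using generic[of S] by blast

lemma face_card_le: "face S \<Longrightarrow> card S \<le> dim"
  using indep_card_le face_sub face_indep by auto

lemma flat_const:
  assumes "S \<subseteq> E" "indep S" "card S = dim" "flat S b" "u \<in> V" "v \<in> V"
  shows "b u = b v"
proof -
  have "card (V // blk S) = 1" using card_blk[OF assms(1,2)] assms(3) card_V by simp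
  then obtain C where C: "V // blk S = {C}" by (auto simp: card_1_singleton_iff)
  have "blk S `` {u} = C" "blk S `` {v} = C" using C assms(5,6) by (auto simp: quotient_def)
  then have "(u, v) \<in> blk S" using equiv_blk[of S] assms(5,6) by (metis eq_equiv_class)
  then show ?thesis using flat_blk assms(4) by auto
qed

lemma flat_nonconst:
  assumes "S \<subseteq> E" "indep S" "card S < dim"
  obtains b u v where "flat S b" "u \<in> V" "v \<in> V" "b u \<noteq> b v"
proof -
  have "card (V // blk S) \<ge> 2" using card_blk[OF assms(1,2)] assms(3) card_V by simp
  then obtain C D where CD: "C \<in> V // blk S" "D \<in> V // blk S" "C \<noteq> D"
  proof -
    have "finite (V // blk S)" using finV by (simp add: quotient_def)
    then show ?thesis using that card_le_Suc0_iff_eq[of "V // blk S"] \<open>card (V // blk S) \<ge> 2\<close> by auto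
  qed
  obtain u v where uv: "u \<in> V" "v \<in> V" "C = blk S `` {u}" "D = blk S `` {v}"
    using CD by (auto simp: quotient_def)
  then have "(u, v) \<notin> blk S" using CD equiv_class_eq[OF equiv_blk] by metis
  then show ?thesis using that uv by (auto simp: blk_def)
qed

text \<open>This is simplicity: the tight inequalities are independent, so a short step can relax
  exactly those outside \<open>R\<close> without violating the strict ones.\<close>

lemma face_down:
  assumes "face S" "R \<subseteq> S" shows "face R"
proof -
  obtain a where a: "\<forall>e\<in>S. slack w0 a e = 0" "\<forall>e\<in>E - S. slack w0 a e > 0" and SE: "S \<subseteq> E"
    using assms(1) by (auto simp: face_def)
  obtain b where b: "\<And>e. e \<in> S \<Longrightarrow> df b e = (if e \<in> R then 0 else 1)"
    using indepE[OF face_indep[OF assms(1)], of "\<lambda>e. if e \<in> R then 0 else 1"] by metis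
  have "\<exists>t>0. \<forall>e\<in>E - S. slack w0 a e + t * df b e > 0"
  proof -
    have "\<forall>\<^sub>F t in at_right 0. \<forall>e\<in>E - S. slack w0 a e + t * df b e > 0"
    proof (rule eventually_ball_finite)
      show "\<forall>e\<in>E - S. \<forall>\<^sub>F t in at_right 0. slack w0 a e + t * df b e > 0"
      proof
        fix e assume "e \<in> E - S"
        then have p: "slack w0 a e > 0" using a by auto
        have "((\<lambda>t. slack w0 a e + t * df b e) \<longlongrightarrow> slack w0 a e + 0 * df b e) (at_right 0)"
          by (intro tendsto_intros)
        then show "\<forall>\<^sub>F t in at_right 0. slack w0 a e + t * df b e > 0"
          using p by (auto dest!: order_tendstoD(1))
      qed
    qed (use finE in auto)
    then have "\<forall>\<^sub>F t in at_right 0. (t::real) > 0 \<and> (\<forall>e\<in>E - S. slack w0 a e + t * df b e > 0)"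
      using eventually_at_right_less[of "0::real"] by eventually_elim auto
    then show ?thesis using eventually_happens[of _ "at_right (0::real)"] by auto
  qed
  then obtain t where t: "t > 0" "\<forall>e\<in>E - S. slack w0 a e + t * df b e > 0" by auto
  let ?a = "\<lambda>u. t * b u + a u"
  have "\<forall>e\<in>R. slack w0 ?a e = 0" unfolding slack_add using a b assms(2) by auto
  moreover have "\<forall>e\<in>E - R. slack w0 ?a e > 0" unfolding slack_add using a b t
    by (metis DiffD1 DiffD2 DiffI add.left_neutral mult.right_neutral)
  ultimately show ?thesis using assms(2) SE by (auto simp: face_def)
qed

lemma tight_face:
  assumes "\<forall>e\<in>E. slack w0 a e \<ge> 0"
  shows "face {e \<in> E. slack w0 a e = 0}"
  using assms unfolding face_def by (force intro!: exI[of _ a] simp: order_less_le)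

text \<open>Ratio test of the simplex method. By \<open>bounded\<close> a nonconstant direction must
  decrease some slack, and by \<open>dir\<close> no such slack is zero at the start, so the step has
  positive length.\<close>

lemma ray_hits:
  assumes feas: "\<forall>e\<in>E. slack w0 a e \<ge> 0"
    and dir: "\<And>e. e \<in> E \<Longrightarrow> slack w0 a e = 0 \<Longrightarrow> df b e \<ge> 0"
    and nc: "u \<in> V" "v \<in> V" "b u \<noteq> b v"
  shows "\<exists>t e. t > 0 \<and> (\<forall>e\<in>E. slack w0 (\<lambda>u. t * b u + a u) e \<ge> 0) \<and> e \<in> E \<and> df b e < 0 \<and>
    slack w0 (\<lambda>u. t * b u + a u) e = 0"
proof -
  define N where "N = {e \<in> E. df b e < 0}"
  have "N \<noteq> {}" using bounded[of b u v] nc unfolding N_def df_def by (force simp: not_le)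
  moreover have finN: "finite N" using finE by (simp add: N_def)
  ultimately have img: "finite ((\<lambda>e. slack w0 a e / (- df b e)) ` N)" "(\<lambda>e. slack w0 a e / (- df b e)) ` N \<noteq> {}" by auto
  define t where "t = Min ((\<lambda>e. slack w0 a e / (- df b e)) ` N)"
  obtain e where e: "e \<in> N" "t = slack w0 a e / (- df b e)" using Min_in[OF img] t_def by auto
  have e': "e \<in> E" "df b e < 0" using e by (auto simp: N_def)
  have "slack w0 a e > 0" using dir[OF e'(1)] e'(2) feas e'(1) by (metis order_less_le not_le)
  then have t: "t > 0" using e' e by (simp add: divide_pos_neg)
  have z: "slack w0 (\<lambda>u. t * b u + a u) e = 0" unfolding slack_add using e e' by (simp add: field_simps)
  have "\<forall>f\<in>E. slack w0 (\<lambda>u. t * b u + a u) f \<ge> 0"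
  proof
    fix f assume f: "f \<in> E"
    show "slack w0 (\<lambda>u. t * b u + a u) f \<ge> 0"
    proof (cases "df b f < 0")
      case True
      then have "t \<le> slack w0 a f / (- df b f)" unfolding t_def using f img by (intro Min_le) (auto simp: N_def)
      then show ?thesis unfolding slack_add using True by (simp add: field_simps)
    next
      case False
      then show ?thesis unfolding slack_add using t feas f by simp
    qed
  qed
  then show ?thesis using t e' z by blast
qed

text \<open>A nonconstant direction flat on \<open>S\<close> runs inside the face until a further
  inequality becomes tight, which lowers the dimension.\<close>

lemma vertex_above:
  assumes "face S"
  obtains T where "S \<subseteq> T" "face T" "card T = dim"
proof -
  have "\<exists>T. S \<subseteq> T \<and> face T \<and> card T = dim" using assms
  proof (induction "dim - card S" arbitrary: S rule: less_induct)
    case less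
    show ?case
    proof (cases "card S = dim")
      case True then show ?thesis using less by auto
    next
      case False
      then have lt: "card S < dim" using face_card_le[OF less.prems] by auto
      obtain b u v where b: "flat S b" "u \<in> V" "v \<in> V" "b u \<noteq> b v"
        using flat_nonconst[OF face_sub[OF less.prems] face_indep[OF less.prems] lt] by metis
      obtain a where a: "\<forall>e\<in>S. slack w0 a e = 0" "\<forall>e\<in>E - S. slack w0 a e > 0"
        using less.prems by (auto simp: face_def)
      have feas: "\<forall>e\<in>E. slack w0 a e \<ge> 0" using a by (metis DiffI less_eq_real_def)
      have dir: "df b e \<ge> 0" if "e \<in> E" "slack w0 a e = 0" for e
      proof -
        have "e \<in> S" using that a(2) by force
        then show ?thesis using b(1) by (auto simp: flat_def)
      qed
      obtain t e where t: "t > 0" "\<forall>e\<in>E. slack w0 (\<lambda>u. t * b u + a u) e \<ge> 0" "e \<in> E" "df b e < 0"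
        "slack w0 (\<lambda>u. t * b u + a u) e = 0" using ray_hits[OF feas dir b(2-4)] by auto
      let ?S = "{e \<in> E. slack w0 (\<lambda>u. t * b u + a u) e = 0}"
      have f: "face ?S" by (rule tight_face[OF t(2)])
      have sub: "S \<subseteq> ?S" using a b(1) face_sub[OF less.prems] unfolding slack_add flat_def by auto
      have "e \<notin> S" using t(4) b(1) by (auto simp: flat_def)
      then have "S \<subset> ?S" using sub t by auto
      then have "card S < card ?S" using face_fin[OF f] psubset_card_mono by blast
      then have "dim - card ?S < dim - card S" using lt by simp
      from less.hyps[OF this f] obtain T where "?S \<subseteq> T" "face T" "card T = dim" by auto
      then show ?thesis using sub by blast
    qed
  qed
  then show ?thesis using that by auto
qed

lemma link_fin: "finite (link S)" using finE by (simp add: link_def)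

lemma link_face: "e \<in> link S \<Longrightarrow> face (insert e S)" by (simp add: link_def)

lemma link_sub: "face S \<Longrightarrow> e \<in> link S \<Longrightarrow> e \<in> E \<and> e \<notin> S" by (simp add: link_def)

lemma link_insert: "e \<in> link S \<Longrightarrow> f \<in> link (insert e S) \<Longrightarrow> f \<in> link S \<and> f \<noteq> e"
  unfolding link_def using face_down[of "insert f (insert e S)" "insert f S"] by auto

lemma card_link: "face S \<Longrightarrow> e \<in> link S \<Longrightarrow> card (insert e S) = Suc (card S)"
  using face_fin by (simp add: link_def)

text \<open>A one-dimensional face is a segment. Its only direction modulo constants is the
  indicator of one of the two blocks; following it both ways reaches an end each, and two different
  ends cannot have the same orientation between the blocks.\<close>

lemma ridge:
  assumes S: "face S" "Suc (card S) = dim"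
  obtains e f where "link S = {e, f}" "e \<noteq> f" "\<And>b. flat S b \<Longrightarrow> df b e + df b f = 0"
    "\<And>A B. V // blk S = {A, B} \<Longrightarrow> A \<noteq> B \<Longrightarrow> src e \<in> A \<and> tgt e \<in> B \<and> src f \<in> B \<and> tgt f \<in> A \<or> src f \<in> A \<and> tgt f \<in> B \<and> src e \<in> B \<and> tgt e \<in> A"
proof -
  note SE = face_sub[OF S(1)] and Si = face_indep[OF S(1)]
  have "card (V // blk S) = 2" using card_blk[OF SE Si] S(2) card_V by simp
  then obtain A B where AB: "V // blk S = {A, B}" "A \<noteq> B" by (auto simp: card_2_iff)
  have eq: "equiv V (blk S)" by (rule equiv_blk)
  have un: "A \<union> B = V" using Union_quotient[OF eq] AB by auto
  have disj: "A \<inter> B = {}" using quotient_disj[OF eq] AB by blast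
  have same: "u \<in> A \<longleftrightarrow> v \<in> A" if "(u, v) \<in> blk S" for u v
  proof -
    have A: "A \<in> V // blk S" using AB by auto
    have "(v, u) \<in> blk S" using that by (auto simp: blk_def)
    then show ?thesis using in_quotient_imp_closed[OF eq A] that by blast
  qed
  have rel: "(u, v) \<in> blk S" if "u \<in> C" "v \<in> C" "C = A \<or> C = B" for u v C
  proof -
    have "C \<in> V // blk S" using AB that by auto
    then show ?thesis using in_quotient_imp_in_rel[OF eq, of C u v] that by auto
  qed
  have fl: "flat S (indicator B)"
  proof (rule flat_ind[OF SE])
    fix u v assume uv: "(u, v) \<in> blk S"
    then have "u \<in> V" "v \<in> V" by (auto simp: blk_def)
    then show "u \<in> B \<longleftrightarrow> v \<in> B" using same[OF uv] un disj by blast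
  qed
  obtain a where a: "\<forall>e\<in>S. slack w0 a e = 0" "\<forall>e\<in>E - S. slack w0 a e > 0"
    using S by (auto simp: face_def)
  have feas: "\<forall>e\<in>E. slack w0 a e \<ge> 0" using a by (metis DiffI less_eq_real_def)
  have "A \<noteq> {}" "B \<noteq> {}" using AB in_quotient_imp_non_empty[OF eq] by blast+
  then obtain x y where xy: "x \<in> A" "y \<in> B" by auto
  have xyV: "x \<in> V" "y \<in> V" using xy un by auto
  have go: "\<exists>e\<in>link S. df (\<lambda>u. s * indicator B u) e < 0" if s: "s \<noteq> 0" for s
  proof -
    let ?b = "\<lambda>u. s * indicator B u"
    have fb: "flat S ?b" using fl by (auto simp: flat_def df_def simp flip: right_diff_distrib)
    have dir: "df ?b e \<ge> 0" if "e \<in> E" "slack w0 a e = 0" for e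
    proof -
      have "e \<in> S" using that a(2) by force
      then show ?thesis using fb by (auto simp: flat_def)
    qed
    have "?b x \<noteq> ?b y" using xy disj s by (auto simp: indicator_def)
    from ray_hits[OF feas dir xyV this]
    obtain t e where t: "t > 0" "\<forall>e\<in>E. slack w0 (\<lambda>u. t * ?b u + a u) e \<ge> 0" "e \<in> E" "df ?b e < 0"
      "slack w0 (\<lambda>u. t * ?b u + a u) e = 0" by auto
    let ?S = "{e \<in> E. slack w0 (\<lambda>u. t * ?b u + a u) e = 0}"
    have f: "face ?S" by (rule tight_face[OF t(2)])
    have eS: "e \<notin> S" using t(4) fb by (auto simp: flat_def)
    have "insert e S \<subseteq> ?S" using a fb SE t unfolding slack_add flat_def by auto
    then have "face (insert e S)" using face_down[OF f] by auto
    then show ?thesis using eS t by (auto simp: link_def)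
  qed
  have val: "e \<in> link S \<Longrightarrow> (src e \<in> A \<and> tgt e \<in> B) \<or> (src e \<in> B \<and> tgt e \<in> A)" for e
  proof -
    assume e: "e \<in> link S"
    then have "(src e, tgt e) \<notin> blk S" using indep_edge_sep face_indep[OF link_face[OF e]] link_sub[OF S(1) e] by auto
    moreover have "src e \<in> V" "tgt e \<in> V" using link_sub[OF S(1) e] srcV tgtV by auto
    ultimately show ?thesis using un rel by blast
  qed
  have uniq: "e = f" if ef: "e \<in> link S" "f \<in> link S" and side: "src e \<in> A \<longleftrightarrow> src f \<in> A" for e f
  proof (rule ccontr)
    assume ne: "e \<noteq> f"
    have fe: "face (insert e S)" "face (insert f S)" using ef link_face by auto
    obtain p where p: "\<forall>g\<in>insert e S. slack w0 p g = 0" "\<forall>g\<in>E - insert e S. slack w0 p g > 0"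
      using fe by (auto simp: face_def)
    obtain q where q: "\<forall>g\<in>insert f S. slack w0 q g = 0" "\<forall>g\<in>E - insert f S. slack w0 q g > 0"
      using fe by (auto simp: face_def)
    define b where "b = (\<lambda>u. q u - p u)"
    have fb: "flat S b"
      unfolding flat_def
    proof
      fix g assume "g \<in> S"
      then have "slack w0 p g = 0" "slack w0 q g = 0" using p q by auto
      then show "df b g = 0" by (simp add: b_def slack_def df_def)
    qed
    have c: "b u = b v" if "u \<in> C" "v \<in> C" "C = A \<or> C = B" for u v C
      using flat_blk[OF fb rel[OF that]] .
    have ef': "e \<in> E" "f \<in> E" "e \<notin> S" "f \<notin> S" using ef link_sub[OF S(1)] by auto
    have "df b e = df b f"
      using val[OF ef(1)] val[OF ef(2)] side disj c unfolding df_def by (metis disjoint_iff)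
    moreover have "df b e = slack w0 q e - slack w0 p e" "df b f = slack w0 q f - slack w0 p f"
      by (auto simp: b_def slack_def df_def)
    moreover have "slack w0 p e = 0" "slack w0 q f = 0" "slack w0 q e > 0" "slack w0 p f > 0"
      using p q ne ef' by auto
    ultimately show False by linarith
  qed
  obtain e where e: "e \<in> link S" "df (\<lambda>u. 1 * indicator B u) e < 0" using go[of 1] by auto
  obtain f where f: "f \<in> link S" "df (\<lambda>u. -1 * indicator B u) f < 0" using go[of "-1"] by auto
  have eB: "src e \<in> B \<and> tgt e \<in> A" using val[OF e(1)] e(2) disj by (auto simp: df_def indicator_def split: if_splits)
  have fB: "src f \<in> A \<and> tgt f \<in> B" using val[OF f(1)] f(2) disj by (auto simp: df_def indicator_def split: if_splits)
  have ne: "e \<noteq> f" using eB fB disj by auto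
  have "link S = {e, f}"
  proof -
    have "g = e \<or> g = f" if g: "g \<in> link S" for g
      using uniq[OF g e(1)] uniq[OF g f(1)] val[OF g] eB fB disj by blast
    then show ?thesis using e f by auto
  qed
  moreover have "df b e + df b f = 0" if "flat S b" for b
  proof -
    have "b (tgt f) = b (src e)" "b (src f) = b (tgt e)"
      using flat_blk[OF that] rel eB fB by blast+
    then show ?thesis by (simp add: df_def)
  qed
  moreover have "src e \<in> A' \<and> tgt e \<in> B' \<and> src f \<in> B' \<and> tgt f \<in> A' \<or> src f \<in> A' \<and> tgt f \<in> B' \<and> src e \<in> B' \<and> tgt e \<in> A'"
    if "V // blk S = {A', B'}" "A' \<noteq> B'" for A' B'
    using that AB eB fB by (auto simp: doubleton_eq_iff)
  ultimately show ?thesis using that ne by blast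
qed

section \<open>Mixed volumes\<close>

definition pot :: "'e set \<Rightarrow> ('e \<Rightarrow> real) \<Rightarrow> 'v \<Rightarrow> real" where
  "pot S v = (SOME a. \<forall>e\<in>S. slack v a e = 0)"

text \<open>The slack of \<open>pot S v\<close> at \<open>e\<close> is the support number of the
  facet \<open>e\<close>, seen from a point of the affine hull of the face. The usual factor 1/d of
  the volume recursion is dropped; in this normalisation a chain gets the value 0 or 1, and linear
  extensions are counted without a factorial.\<close>

fun W :: "'e set \<Rightarrow> ('e \<Rightarrow> real) list \<Rightarrow> real" where
  "W S [] = (if face S then 1 else 0)"
| "W S (v # vs) = (\<Sum>e\<in>link S. slack v (pot S v) e * W (insert e S) vs)"

lemma pot: assumes "indep S" "e \<in> S" shows "slack v (pot S v) e = 0"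
proof -
  obtain b where "\<And>e. e \<in> S \<Longrightarrow> df b e = - v e" using indepE[OF assms(1), of "\<lambda>e. - v e"] by metis
  then have "\<exists>a. \<forall>e\<in>S. slack v a e = 0" by (intro exI[of _ b]) (simp add: slack_def)
  then have "\<forall>e\<in>S. slack v (pot S v) e = 0" unfolding pot_def by (rule someI_ex)
  then show ?thesis using assms(2) by auto
qed

lemma slack_diff: "slack v a e = slack v b e + df (\<lambda>u. a u - b u) e"
  by (simp add: slack_def df_def)

lemma flat_diff:
  assumes "\<And>e. e \<in> S \<Longrightarrow> slack v a e = 0" "\<And>e. e \<in> S \<Longrightarrow> slack v b e = 0"
  shows "flat S (\<lambda>u. a u - b u)"
  using assms slack_diff[of v a _ b] by (auto simp: flat_def)

text \<open>A direction inside the affine hull of the face \<open>S\<close> that lowers the slack of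
  \<open>e\<close> at unit rate. It carries a gauge for \<open>S\<close> to a gauge for the facet
  \<open>e\<close>.\<close>

definition dirn :: "'e set \<Rightarrow> 'e \<Rightarrow> 'v \<Rightarrow> real" where
  "dirn S e = (SOME q. flat S q \<and> df q e = -1)"

lemma dirn:
  assumes "face S" "e \<in> link S" shows "flat S (dirn S e)" "df (dirn S e) e = -1"
proof -
  have "indep (insert e S)" "e \<notin> S" using face_indep[OF link_face[OF assms(2)]] link_sub[OF assms] by auto
  then obtain b where b: "\<And>f. f \<in> insert e S \<Longrightarrow> df b f = (if f = e then -1 else 0)"
    using indepE[of "insert e S" "\<lambda>f. if f = e then -1 else 0"] by metis
  have "flat S b" unfolding flat_def using b \<open>e \<notin> S\<close> by (metis insertI2)
  moreover have "df b e = -1" using b[of e] by simp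
  ultimately have "\<exists>q. flat S q \<and> df q e = -1" by blast
  then have "flat S (dirn S e) \<and> df (dirn S e) e = -1" unfolding dirn_def by (rule someI_ex)
  then show "flat S (dirn S e)" "df (dirn S e) e = -1" by auto
qed

text \<open>Matrix of the bilinear form \<open>W S (x # z # ws)\<close> in the support numbers of
  the facets of \<open>S\<close>. Off the diagonal stand the faces of codimension two; the diagonal
  collects the correction for moving the gauge onto the facet \<open>e\<close>. Its symmetry is the
  source of the symmetry of \<open>W\<close> in its arguments.\<close>

definition MM :: "'e set \<Rightarrow> ('e \<Rightarrow> real) list \<Rightarrow> 'e \<Rightarrow> 'e \<Rightarrow> real" where
  "MM S ws e f = (if e \<noteq> f then (if f \<in> link (insert e S) then W (insert f (insert e S)) ws else 0)
     else (\<Sum>g\<in>link (insert e S). df (dirn S e) g * W (insert g (insert e S)) ws))"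

lemma link_swap: "e \<in> link S \<Longrightarrow> f \<in> link (insert e S) \<Longrightarrow> e \<in> link (insert f S)"
  by (auto simp: link_def insert_commute)

lemma MM_sym:
  assumes "e \<in> link S" "f \<in> link S" shows "MM S ws e f = MM S ws f e"
  using link_swap[OF assms(1), of f] link_swap[OF assms(2), of e]
  by (auto simp: MM_def insert_commute)

lemma MM_sum:
  assumes "face S" "e \<in> link S"
  shows "(\<Sum>f\<in>link S. MM S ws e f * c f) =
    (\<Sum>f\<in>link (insert e S). (c f + c e * df (dirn S e) f) * W (insert f (insert e S)) ws)"
proof -
  have sub: "link (insert e S) \<subseteq> link S - {e}" using link_insert[OF assms(2)] by auto
  have "(\<Sum>f\<in>link S. MM S ws e f * c f) = MM S ws e e * c e + (\<Sum>f\<in>link S - {e}. MM S ws e f * c f)"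
    using assms(2) link_fin by (simp add: sum.remove)
  also have "(\<Sum>f\<in>link S - {e}. MM S ws e f * c f) =
      (\<Sum>f\<in>link (insert e S). W (insert f (insert e S)) ws * c f)"
    using sub link_fin by (intro sum.mono_neutral_cong_right) (auto simp: MM_def)
  finally show ?thesis
    by (simp add: MM_def sum_distrib_left sum_distrib_right sum.distrib[symmetric] algebra_simps)
qed

text \<open>\<open>W\<close> is the mixed volume of a face. Minkowski's closing relation for the facet volumes makes
  the recursive definition independent of the chosen potentials.\<close>

lemma closing:
  assumes "face S" "card S + 1 + length vs = dim" "flat S b"
  shows "(\<Sum>e\<in>link S. df b e * W (insert e S) vs) = 0"
  using assms
proof (induction vs arbitrary: S b)
  case Nil
  have "Suc (card S) = dim" using Nil(2) by simp
  from ridge[OF Nil(1) this] obtain e f where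
    ef: "link S = {e, f}" "e \<noteq> f" "\<And>b. flat S b \<Longrightarrow> df b e + df b f = 0" by metis
  then show ?case using ef(3)[OF Nil(3)] link_face[of e S] link_face[of f S] by simp
next
  case (Cons w vs)
  let ?a = "pot S w" and ?b = b
  have S: "face S" by fact
  have cl: "(\<Sum>f\<in>link (insert e S). df b f * W (insert f (insert e S)) vs) = 0"
    if "e \<in> link S" "flat (insert e S) b" for e b
    using Cons.IH[OF link_face[OF that(1)] _ that(2)] Cons.prems card_link[OF S that(1)] by simp
  have exp: "W (insert e S) (w # vs) = (\<Sum>f\<in>link S. MM S vs e f * slack w ?a f)" if e: "e \<in> link S" for e
  proof -
    let ?a' = "\<lambda>u. slack w ?a e * dirn S e u + ?a u"
    have z: "slack w ?a' g = 0" if "g \<in> insert e S" for g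
    proof (cases "g = e")
      case True then show ?thesis unfolding slack_add using dirn[OF S e] by simp
    next
      case False
      then show ?thesis unfolding slack_add using dirn[OF S e] pot[OF face_indep[OF S]] that by (auto simp: flat_def)
    qed
    let ?p = "pot (insert e S) w"
    have fl: "flat (insert e S) (\<lambda>u. ?p u - ?a' u)"
      by (rule flat_diff[OF pot z]) (use face_indep link_face e in auto)
    have "W (insert e S) (w # vs) = (\<Sum>f\<in>link (insert e S). slack w ?p f * W (insert f (insert e S)) vs)" by simp
    also have "\<dots> = (\<Sum>f\<in>link (insert e S). slack w ?a' f * W (insert f (insert e S)) vs) +
       (\<Sum>f\<in>link (insert e S). df (\<lambda>u. ?p u - ?a' u) f * W (insert f (insert e S)) vs)"
      unfolding sum.distrib[symmetric] slack_diff[of w ?p _ ?a'] by (simp add: distrib_right)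
    also have "\<dots> = (\<Sum>f\<in>link (insert e S). slack w ?a' f * W (insert f (insert e S)) vs)"
      using cl[OF e fl] by simp
    also have "\<dots> = (\<Sum>f\<in>link S. MM S vs e f * slack w ?a f)"
      unfolding MM_sum[OF S e] slack_add by simp
    finally show ?thesis .
  qed
  \<comment> \<open>This is the closing relation of the facet \<open>f\<close>, for \<open>b\<close>
    corrected along \<open>dirn S f\<close> so as to be flat there. Symmetry of \<open>MM\<close>
    reduces the sum over the facets of \<open>S\<close> to these relations.\<close>
  have zero: "(\<Sum>e\<in>link S. MM S vs f e * df b e) = 0" if f: "f \<in> link S" for f
  proof -
    have "flat (insert f S) (\<lambda>u. df b f * dirn S f u + b u)"
      using dirn[OF S f] Cons.prems(3) unfolding flat_def df_lin by auto
    from cl[OF f this] show ?thesis unfolding MM_sum[OF S f] df_lin by (simp add: add.commute)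
  qed
  have "(\<Sum>e\<in>link S. df b e * W (insert e S) (w # vs)) =
      (\<Sum>e\<in>link S. \<Sum>f\<in>link S. df b e * (MM S vs e f * slack w ?a f))"
    using exp by (intro sum.cong refl) (simp add: sum_distrib_left)
  also have "\<dots> = (\<Sum>f\<in>link S. \<Sum>e\<in>link S. df b e * (MM S vs e f * slack w ?a f))" by (rule sum.swap)
  also have "\<dots> = (\<Sum>f\<in>link S. slack w ?a f * (\<Sum>e\<in>link S. MM S vs f e * df b e))"
    using MM_sym[of _ S _ vs] by (intro sum.cong refl) (simp add: sum_distrib_left algebra_simps)
  also have "\<dots> = 0" using zero by simp
  finally show ?case .
qed

lemma W_gauge:
  assumes "face S" "card S + length (v # vs) = dim" "\<And>e. e \<in> S \<Longrightarrow> slack v a e = 0"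
  shows "W S (v # vs) = (\<Sum>e\<in>link S. slack v a e * W (insert e S) vs)"
proof -
  let ?p = "pot S v"
  have fl: "flat S (\<lambda>u. ?p u - a u)"
    by (rule flat_diff[OF pot assms(3)]) (use face_indep assms in auto)
  have "W S (v # vs) = (\<Sum>e\<in>link S. slack v a e * W (insert e S) vs) +
       (\<Sum>e\<in>link S. df (\<lambda>u. ?p u - a u) e * W (insert e S) vs)"
    unfolding sum.distrib[symmetric] W.simps slack_diff[of v ?p _ a] by (simp add: distrib_right)
  then show ?thesis using closing[OF assms(1) _ fl, of vs] assms(2) by simp
qed

lemma W_link:
  assumes S: "face S" and c: "card S + length (x # z # ws) = dim" and e: "e \<in> link S"
    and a: "\<And>f. f \<in> S \<Longrightarrow> slack z a f = 0"
  shows "W (insert e S) (z # ws) = (\<Sum>f\<in>link S. MM S ws e f * slack z a f)"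
proof -
  let ?a' = "\<lambda>u. slack z a e * dirn S e u + a u"
  have z: "slack z ?a' g = 0" if "g \<in> insert e S" for g
    unfolding slack_add using dirn[OF S e] a that by (cases "g = e") (auto simp: flat_def)
  have "W (insert e S) (z # ws) = (\<Sum>f\<in>link (insert e S). slack z ?a' f * W (insert f (insert e S)) ws)"
    by (rule W_gauge[OF link_face[OF e] _ z]) (use c card_link[OF S e] in auto)
  also have "\<dots> = (\<Sum>f\<in>link S. MM S ws e f * slack z a f)"
    unfolding MM_sum[OF S e] slack_add by simp
  finally show ?thesis .
qed

lemma W_form:
  assumes S: "face S" and c: "card S + length (x # z # ws) = dim"
    and a: "\<And>f. f \<in> S \<Longrightarrow> slack x a f = 0" and b: "\<And>f. f \<in> S \<Longrightarrow> slack z b f = 0"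
  shows "W S (x # z # ws) = (\<Sum>e\<in>link S. \<Sum>f\<in>link S. slack x a e * MM S ws e f * slack z b f)"
proof -
  have "W S (x # z # ws) = (\<Sum>e\<in>link S. slack x a e * W (insert e S) (z # ws))"
    by (rule W_gauge[OF S c a])
  also have "\<dots> = (\<Sum>e\<in>link S. slack x a e * (\<Sum>f\<in>link S. MM S ws e f * slack z b f))"
    using W_link[OF S c _ b] by (intro sum.cong refl) simp
  finally show ?thesis by (simp add: sum_distrib_left mult.assoc)
qed

lemma W_swap:
  assumes S: "face S" and c: "card S + length (x # z # ws) = dim"
  shows "W S (x # z # ws) = W S (z # x # ws)"
proof -
  note p = pot[OF face_indep[OF S]]
  have c': "card S + length (z # x # ws) = dim" using c by simp
  have "W S (x # z # ws) = (\<Sum>e\<in>link S. \<Sum>f\<in>link S. slack x (pot S x) e * MM S ws e f * slack z (pot S z) f)"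
    by (rule W_form[OF S c p p])
  also have "\<dots> = (\<Sum>e\<in>link S. \<Sum>f\<in>link S. slack z (pot S z) e * MM S ws e f * slack x (pot S x) f)"
    by (subst sum.swap) (intro sum.cong refl, simp add: MM_sym)
  also have "\<dots> = W S (z # x # ws)" by (rule W_form[OF S c' p p, symmetric])
  finally show ?thesis .
qed

lemma W_swap1:
  assumes S: "face S" and c: "card S + length (u # x # z # ws) = dim"
  shows "W S (u # x # z # ws) = W S (u # z # x # ws)"
proof -
  have "W (insert e S) (x # z # ws) = W (insert e S) (z # x # ws)" if "e \<in> link S" for e
    by (rule W_swap[OF link_face[OF that]]) (use c card_link[OF S that] in auto)
  then show ?thesis unfolding W.simps(2)[of S u] by (intro sum.cong refl) (simp del: W.simps)
qed

text \<open>For vertices \<open>T\<close> the vector \<open>pot T v\<close> is the corresponding vertex of the polytope with right-hand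
  side \<open>v\<close>; so \<open>adm\<close> says that this polytope has the same combinatorial type as the one of \<open>w0\<close>, and
  \<open>wadm\<close> that it is a degeneration of it.\<close>

definition adm :: "('e \<Rightarrow> real) \<Rightarrow> bool" where
  "adm v \<longleftrightarrow> (\<forall>T. face T \<longrightarrow> card T = dim \<longrightarrow> (\<forall>e\<in>E - T. slack v (pot T v) e > 0))"

definition wadm :: "('e \<Rightarrow> real) \<Rightarrow> bool" where
  "wadm v \<longleftrightarrow> (\<forall>T. face T \<longrightarrow> card T = dim \<longrightarrow> (\<forall>e\<in>E - T. slack v (pot T v) e \<ge> 0))"

lemma vertex_slack:
  assumes "face T" "card T = dim" "\<And>f. f \<in> T \<Longrightarrow> slack v a f = 0" "e \<in> E"
  shows "slack v a e = slack v (pot T v) e"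
proof -
  have fl: "flat T (\<lambda>u. a u - pot T v u)"
    by (rule flat_diff[OF assms(3) pot]) (use face_indep assms in auto)
  have "df (\<lambda>u. a u - pot T v u) e = 0"
    using flat_const[OF face_sub face_indep _ fl, of "src e" "tgt e"] assms(1,2,4) srcV tgtV
    unfolding df_def by auto
  then show ?thesis unfolding slack_diff[of v a e "pot T v"] by simp
qed

lemma adm_w0: "adm w0"
  unfolding adm_def
proof (intro allI impI ballI)
  fix T e assume T: "face T" "card T = dim" "e \<in> E - T"
  obtain a where a: "\<forall>e\<in>T. slack w0 a e = 0" "\<forall>e\<in>E - T. slack w0 a e > 0"
    using T by (auto simp: face_def)
  then have "slack w0 a e > 0" using T(3) by blast
  moreover have "slack w0 a e = slack w0 (pot T w0) e"
    by (rule vertex_slack[OF T(1,2)]) (use a T(3) in auto)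
  ultimately show "slack w0 (pot T w0) e > 0" by simp
qed

lemma slack_lin: "slack (\<lambda>e. v e + c * w e) (\<lambda>u. a u + c * b u) e = slack v a e + c * slack w b e"
  by (simp add: slack_def df_def algebra_simps)

lemma adm_add:
  assumes "wadm v" "adm w" "c > 0" shows "adm (\<lambda>e. v e + c * w e)"
  unfolding adm_def
proof (intro allI impI ballI)
  fix T e assume T: "face T" "card T = dim" "e \<in> E - T"
  let ?a = "\<lambda>u. pot T v u + c * pot T w u"
  have "slack (\<lambda>e. v e + c * w e) ?a f = 0" if "f \<in> T" for f
    unfolding slack_lin using pot[OF face_indep[OF T(1)] that] by simp
  from vertex_slack[OF T(1,2) this, of e] T(3)
  have "slack (\<lambda>e. v e + c * w e) (pot T (\<lambda>e. v e + c * w e)) e = slack v (pot T v) e + c * slack w (pot T w) e"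
    unfolding slack_lin by simp
  then show "slack (\<lambda>e. v e + c * w e) (pot T (\<lambda>e. v e + c * w e)) e > 0"
    using assms T unfolding adm_def wadm_def by (simp add: add_nonneg_pos)
qed

text \<open>Take the barycentre of the vertices of the face, in the polytope of \<open>v\<close>. It
  is off every facet \<open>e\<close>, because some vertex of the face is not on \<open>e\<close>:
  start at a vertex \<open>T\<close> on \<open>e\<close> and go to the other end of the edge
  \<open>T - {e}\<close>.\<close>

lemma adm_gauge:
  assumes S: "face S" and c: "card S < dim" and v: "adm v"
  obtains a where "\<And>e. e \<in> S \<Longrightarrow> slack v a e = 0" "\<And>e. e \<in> link S \<Longrightarrow> slack v a e > 0"
proof -
  define TT where "TT = {T. face T \<and> card T = dim \<and> S \<subseteq> T}"
  have "TT \<subseteq> Pow E" using face_sub by (auto simp: TT_def)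
  then have fin: "finite TT" using finE finite_subset by auto
  have ne: "TT \<noteq> {}" using vertex_above[OF S] by (auto simp: TT_def)
  then have n0: "real (card TT) > 0" using fin by (simp add: card_gt_0_iff)
  define a where "a = (\<lambda>u. (\<Sum>T\<in>TT. pot T v u) / card TT)"
  have sl: "slack v a e = (\<Sum>T\<in>TT. slack v (pot T v) e) / card TT" for e
  proof -
    have "(\<Sum>T\<in>TT. slack v (pot T v) e) = real (card TT) * v e + (\<Sum>T\<in>TT. pot T v (tgt e)) - (\<Sum>T\<in>TT. pot T v (src e))"
      by (simp add: slack_def df_def sum.distrib sum_subtractf)
    then show ?thesis using n0 by (simp add: slack_def df_def a_def field_simps)
  qed
  have "slack v a e = 0" if "e \<in> S" for e
  proof -
    have "slack v (pot T v) e = 0" if "T \<in> TT" for T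
      using that \<open>e \<in> S\<close> pot[OF face_indep, of T e v] by (auto simp: TT_def)
    then show ?thesis unfolding sl by simp
  qed
  moreover have "slack v a e > 0" if e: "e \<in> link S" for e
  proof -
    have nn: "slack v (pot T v) e \<ge> 0" if "T \<in> TT" for T
    proof (cases "e \<in> T")
      case True then show ?thesis using that pot[OF face_indep, of T e v] by (auto simp: TT_def)
    next
      case False
      then have "slack v (pot T v) e > 0" using that v link_sub[OF S e] unfolding adm_def TT_def by blast
      then show ?thesis by simp
    qed
    obtain T where T: "insert e S \<subseteq> T" "face T" "card T = dim" by (rule vertex_above[OF link_face[OF e]])
    let ?R = "T - {e}"
    have R: "face ?R" using face_down[OF T(2)] by auto
    have "Suc (card ?R) = dim"
    proof -
      have "card T = Suc (card ?R)" by (rule card.remove) (use T face_fin[OF T(2)] in auto)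
      then show ?thesis using T(3) by linarith
    qed
    from ridge[OF R this] obtain g h where gh: "link ?R = {g, h}" "g \<noteq> h" by metis
    then obtain e' where e': "e' \<in> link ?R" "e' \<noteq> e" by blast
    let ?T = "insert e' ?R"
    have "card ?T = dim" using card_link[OF R e'(1)] \<open>Suc (card ?R) = dim\<close> by simp
    then have "?T \<in> TT" using link_face[OF e'(1)] T(1) link_sub[OF S e] by (auto simp: TT_def)
    moreover have "e \<notin> ?T" using e' by auto
    then have "slack v (pot ?T v) e > 0"
      using v link_sub[OF S e] \<open>card ?T = dim\<close> link_face[OF e'(1)] by (auto simp: adm_def)
    ultimately have "(\<Sum>T\<in>TT. slack v (pot T v) e) > 0" using fin nn by (intro sum_pos2) auto
    then show ?thesis unfolding sl using n0 by simp
  qed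
  ultimately show ?thesis using that by blast
qed

lemma link_nonempty: assumes "face S" "card S < dim" shows "link S \<noteq> {}"
proof -
  obtain T where T: "S \<subseteq> T" "face T" "card T = dim" using vertex_above[OF assms(1)] .
  then have "S \<noteq> T" using assms by auto
  then obtain e where "e \<in> T" "e \<notin> S" using T by auto
  then have "face (insert e S)" "e \<in> E" using face_down[OF T(2)] T face_sub by auto
  then show ?thesis using \<open>e \<notin> S\<close> by (auto simp: link_def)
qed

lemma W_pos:
  assumes "face S" "card S + length vs = dim" "\<And>v. v \<in> set vs \<Longrightarrow> adm v"
  shows "W S vs > 0"
  using assms
proof (induction vs arbitrary: S)
  case Nil then show ?case by simp
next
  case (Cons v vs)
  have c: "card S < dim" using Cons.prems by simp
  obtain a where a: "\<And>e. e \<in> S \<Longrightarrow> slack v a e = 0" "\<And>e. e \<in> link S \<Longrightarrow> slack v a e > 0"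
    using adm_gauge[OF Cons.prems(1) c, of v] Cons.prems by auto
  have "W S (v # vs) = (\<Sum>e\<in>link S. slack v a e * W (insert e S) vs)"
    by (rule W_gauge[OF Cons.prems(1,2) a(1)])
  also have "\<dots> > 0"
  proof (rule sum_pos[OF link_fin link_nonempty[OF Cons.prems(1) c]])
    fix e assume e: "e \<in> link S"
    have "W (insert e S) vs > 0"
      by (rule Cons.IH[OF link_face[OF e]]) (use Cons.prems card_link[OF Cons.prems(1) e] in auto)
    then show "slack v a e * W (insert e S) vs > 0" using a(2)[OF e] by simp
  qed
  finally show ?case .
qed

text \<open>The edge that leaves the vertex by relaxing \<open>f\<close> is followed to its other
  end.\<close>

lemma simplex_pivot:
  assumes T: "face T" "card T = dim" "f \<in> T" and y: "flat (T - {f}) y" "df y f = 1"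
  obtains t g where "t > 0" "g \<noteq> f" "face (insert g (T - {f}))" "card (insert g (T - {f})) = dim"
    "\<And>e. e \<in> E \<Longrightarrow> slack w0 (pot (insert g (T - {f})) w0) e = slack w0 (pot T w0) e + t * df y e"
proof -
  let ?a = "pot T w0" and ?R = "T - {f}"
  have TE: "T \<subseteq> E" using face_sub[OF T(1)] .
  have pos: "slack w0 ?a e > 0" if "e \<in> E - T" for e using adm_w0 T that by (auto simp: adm_def)
  have zer: "slack w0 ?a e = 0" if "e \<in> T" for e by (rule pot[OF face_indep[OF T(1)] that])
  have feas: "\<forall>e\<in>E. slack w0 ?a e \<ge> 0" using pos zer by (metis DiffI less_eq_real_def)
  have dir: "df y e \<ge> 0" if "e \<in> E" "slack w0 ?a e = 0" for e
  proof -
    have "e \<in> T" using that pos by force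
    then show ?thesis using y by (cases "e = f") (auto simp: flat_def)
  qed
  have fE: "f \<in> E" using T TE by auto
  have "y (src f) \<noteq> y (tgt f)" using y(2) by (auto simp: df_def)
  from ray_hits[OF feas dir srcV[OF fE] tgtV[OF fE] this] obtain t g where
    t: "t > 0" "\<forall>e\<in>E. slack w0 (\<lambda>u. t * y u + ?a u) e \<ge> 0" "g \<in> E" "df y g < 0"
      "slack w0 (\<lambda>u. t * y u + ?a u) g = 0" by auto
  let ?S = "{e \<in> E. slack w0 (\<lambda>u. t * y u + ?a u) e = 0}"
  have "g \<notin> T" using t(4) y by (cases "g = f") (auto simp: flat_def)
  have fS: "face ?S" by (rule tight_face[OF t(2)])
  have sub: "insert g ?R \<subseteq> ?S" using t y zer TE unfolding slack_add flat_def by auto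
  have c: "card (insert g ?R) = dim"
  proof -
    have "card T = Suc (card ?R)" by (rule card.remove) (use T face_fin[OF T(1)] in auto)
    moreover have "card (insert g ?R) = Suc (card ?R)" using face_fin[OF T(1)] \<open>g \<notin> T\<close> by simp
    ultimately show ?thesis using T(2) by linarith
  qed
  have f': "face (insert g ?R)" using face_down[OF fS sub] .
  have "slack w0 (pot (insert g ?R) w0) e = slack w0 ?a e + t * df y e" if "e \<in> E" for e
  proof -
    have "slack w0 (\<lambda>u. t * y u + ?a u) h = 0" if "h \<in> insert g ?R" for h using sub that by blast
    from vertex_slack[OF f' c this \<open>e \<in> E\<close>] show ?thesis unfolding slack_add by simp
  qed
  then show ?thesis using that[OF t(1) _ f' c] \<open>g \<notin> T\<close> T(3) by blast
qed

lemma vertex_link: "face T \<Longrightarrow> S \<subseteq> T \<Longrightarrow> T - S \<subseteq> link S"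
  using face_down[of T "insert _ S"] face_sub[of T] by (auto simp: link_def)

text \<open>At a simple vertex the edge directions \<open>y f\<close> form a basis of the potentials
  modulo constants, dual to the tight inequalities.\<close>

lemma vertex_expand:
  assumes T: "face T" "card T = dim"
    and y: "\<And>f. f \<in> T \<Longrightarrow> flat (T - {f}) (y f) \<and> df (y f) f = 1" and "e \<in> E"
    and b: "\<And>f. f \<in> S \<Longrightarrow> df b f = 0" "S \<subseteq> T"
  shows "df b e = (\<Sum>f\<in>T - S. df b f * df (y f) e)"
proof -
  define c where "c = (\<lambda>u. b u - (\<Sum>f\<in>T. df b f * y f u))"
  have dc: "df c g = df b g - (\<Sum>f\<in>T. df b f * df (y f) g)" for g
    unfolding c_def df_def by (simp add: sum_subtractf right_diff_distrib)
  have "flat T c" unfolding flat_def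
  proof
    fix g assume g: "g \<in> T"
    have "(\<Sum>f\<in>T. df b f * df (y f) g) = df b g * df (y g) g"
    proof -
      have "df (y f) g = 0" if "f \<in> T - {g}" for f using y[of f] that g by (auto simp: flat_def)
      then show ?thesis using face_fin[OF T(1)] g by (subst sum.remove[OF _ g]) (auto intro!: sum.neutral)
    qed
    then show "df c g = 0" unfolding dc using y[OF g] by simp
  qed
  then have "df c e = 0"
    using flat_const[OF face_sub[OF T(1)] face_indep[OF T(1)] T(2), of c "src e" "tgt e"] srcV tgtV assms(4)
    by (auto simp: df_def)
  then have "df b e = (\<Sum>f\<in>T. df b f * df (y f) e)" unfolding dc by simp
  also have "\<dots> = (\<Sum>f\<in>T - S. df b f * df (y f) e)"
    using b face_fin[OF T(1)] by (intro sum.mono_neutral_right) auto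
  finally show ?thesis .
qed

lemma vertex_dirs:
  assumes "face T" obtains y where "\<And>f. f \<in> T \<Longrightarrow> flat (T - {f}) (y f) \<and> df (y f) f = 1"
proof -
  have "\<exists>q. flat (T - {f}) q \<and> df q f = 1" if "f \<in> T" for f
  proof -
    obtain b where b: "\<And>e. e \<in> T \<Longrightarrow> df b e = (if e = f then 1 else 0)"
      using indepE[OF face_indep[OF assms], of "\<lambda>e. if e = f then 1 else 0"] by metis
    then show ?thesis using that by (intro exI[of _ b]) (auto simp: flat_def)
  qed
  then show ?thesis using that by metis
qed

text \<open>The facets of a face are connected: by the simplex method every vertex can be joined to a
  given vertex along improving edges.\<close>

lemma link_connected:
  assumes S: "face S" and c: "card S + 2 \<le> dim" and A: "A \<subseteq> link S" "A \<noteq> {}" "A \<noteq> link S"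
  shows "\<exists>e\<in>A. \<exists>f\<in>link S - A. f \<in> link (insert e S)"
proof (rule ccontr)
  assume no: "\<not> ?thesis"
  \<comment> \<open>Facets through a common vertex are pairwise adjacent. So if no facet in
    \<open>A\<close> were adjacent to one outside, the facets of \<open>S\<close> at a vertex would
    lie all inside or all outside \<open>A\<close>.\<close>
  have dich: "T - S \<subseteq> A" if T: "face T" "S \<subseteq> T" and meet: "(T - S) \<inter> A \<noteq> {}" for T
  proof (rule ccontr)
    assume "\<not> T - S \<subseteq> A"
    then obtain f e where fe: "f \<in> T - S" "f \<notin> A" "e \<in> T - S" "e \<in> A" using meet by auto
    have "face (insert f (insert e S))" using face_down[OF T(1)] fe T(2) by auto
    then have "f \<in> link (insert e S)" using fe face_sub[OF T(1)] by (auto simp: link_def)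
    moreover have "f \<in> link S" using vertex_link[OF T] fe by auto
    ultimately show False using no fe by auto
  qed
  obtain e1 e2 where e12: "e1 \<in> A" "e2 \<in> link S" "e2 \<notin> A" using A by auto
  have e1: "e1 \<in> link S" using e12 A by auto
  obtain T1 where T1: "insert e1 S \<subseteq> T1" "face T1" "card T1 = dim"
    by (rule vertex_above[OF link_face[OF e1]])
  obtain T2 where T2: "insert e2 S \<subseteq> T2" "face T2" "card T2 = dim"
    by (rule vertex_above[OF link_face[OF e12(2)]])
  have e1S: "e1 \<notin> S" "e2 \<notin> S" using link_sub[OF S] e12 A by auto
  \<comment> \<open>Objective of the simplex method: the total slack of the inequalities tight at
    the target \<open>T2\<close>. At a vertex with all its facets in \<open>A\<close> it is
    positive, since otherwise \<open>e2\<close> would be tight there; hence the minimiser among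
    these vertices still has an improving edge.\<close>
  define Ph where "Ph = (\<lambda>T. \<Sum>f\<in>T2 - S. slack w0 (pot T w0) f)"
  define VA where "VA = {T. face T \<and> card T = dim \<and> S \<subseteq> T \<and> T - S \<subseteq> A}"
  have "VA \<subseteq> Pow E" using face_sub by (auto simp: VA_def)
  then have finVA: "finite VA" using finE finite_subset by auto
  have "T1 \<in> VA" using T1 e12 e1S dich[OF T1(2)] by (auto simp: VA_def)
  then obtain T where T: "T \<in> VA" "\<And>T'. T' \<in> VA \<Longrightarrow> Ph T \<le> Ph T'"
    using finVA ex_min_if_finite[of "Ph ` VA"] by (auto simp: not_less)
  have T': "face T" "card T = dim" "S \<subseteq> T" "T - S \<subseteq> A" using T by (auto simp: VA_def)
  have T2E: "T2 \<subseteq> E" using face_sub T2 by auto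
  have nn: "slack w0 (pot T w0) f \<ge> 0" if "f \<in> E" for f
    using pot[OF face_indep[OF T'(1)], of f w0] adm_w0 T' that unfolding adm_def by (cases "f \<in> T") (auto intro: less_imp_le)
  have "Ph T > 0"
  proof (rule ccontr)
    assume "\<not> Ph T > 0"
    then have "Ph T = 0" using nn T2E by (auto simp: Ph_def intro!: antisym sum_nonneg)
    then have "\<forall>f\<in>T2 - S. slack w0 (pot T w0) f = 0"
      unfolding Ph_def using nn T2E face_fin[OF T2(2)] by (subst (asm) sum_nonneg_eq_0_iff) auto
    then have "slack w0 (pot T w0) e2 = 0" using T2 e1S by auto
    moreover have "e2 \<in> E" using T2 T2E by auto
    ultimately have "e2 \<in> T" using adm_w0 T'(1,2) unfolding adm_def by (metis DiffI less_irrefl)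
    then show False using T'(4) e1S e12 by auto
  qed
  obtain y where y: "\<And>f. f \<in> T \<Longrightarrow> flat (T - {f}) (y f) \<and> df (y f) f = 1" using vertex_dirs[OF T'(1)] by blast
  define b where "b = (\<lambda>u. pot T2 w0 u - pot T w0 u)"
  have sl: "slack w0 (pot T2 w0) e = slack w0 (pot T w0) e + df b e" for e
    by (simp add: b_def slack_def df_def)
  have bS: "df b f = 0" if "f \<in> S" for f
  proof -
    have "slack w0 (pot T w0) f = 0" "slack w0 (pot T2 w0) f = 0"
      using pot[OF face_indep] T' T2 that by auto
    then show ?thesis using sl[of f] by simp
  qed
  have nn2: "slack w0 (pot T2 w0) f \<ge> 0" if "f \<in> E" for f
    using pot[OF face_indep[OF T2(2)], of f w0] adm_w0 T2 that unfolding adm_def by (cases "f \<in> T2") (auto intro: less_imp_le)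
  have dbpos: "df b f \<ge> 0" if "f \<in> T - S" for f
    using sl[of f] nn2[of f] pot[OF face_indep[OF T'(1)], of f w0] that face_sub[OF T'(1)] by auto
  have "(\<Sum>g\<in>T2 - S. df b g) = - Ph T"
  proof -
    have "df b g = - slack w0 (pot T w0) g" if "g \<in> T2 - S" for g
      using sl[of g] pot[OF face_indep[OF T2(2)], of g w0] that by auto
    then show ?thesis by (simp add: Ph_def sum_negf)
  qed
  moreover have "(\<Sum>g\<in>T2 - S. df b g) = (\<Sum>g\<in>T2 - S. \<Sum>f\<in>T - S. df b f * df (y f) g)"
    using T2E by (intro sum.cong refl vertex_expand[OF T'(1,2) y _ bS T'(3)]) auto
  moreover have "\<dots> = (\<Sum>f\<in>T - S. df b f * (\<Sum>g\<in>T2 - S. df (y f) g))"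
    by (subst sum.swap) (simp add: sum_distrib_left)
  ultimately have "(\<Sum>f\<in>T - S. df b f * (\<Sum>g\<in>T2 - S. df (y f) g)) < 0" using \<open>Ph T > 0\<close> by simp
  then obtain f where f: "f \<in> T - S" "df b f * (\<Sum>g\<in>T2 - S. df (y f) g) < 0"
    by (meson not_le sum_nonneg)
  then have neg: "(\<Sum>g\<in>T2 - S. df (y f) g) < 0" using dbpos[OF f(1)] by (simp add: mult_less_0_iff)
  have fT: "f \<in> T" using f by auto
  obtain t g where tg: "t > 0" "g \<noteq> f" "face (insert g (T - {f}))" "card (insert g (T - {f})) = dim"
    "\<And>e. e \<in> E \<Longrightarrow> slack w0 (pot (insert g (T - {f})) w0) e = slack w0 (pot T w0) e + t * df (y f) e"
    by (rule simplex_pivot[OF T'(1,2) fT]) (use y[OF fT] in blast)+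
  let ?T = "insert g (T - {f})"
  have "Ph ?T = Ph T + t * (\<Sum>g\<in>T2 - S. df (y f) g)"
    unfolding Ph_def using tg(5) T2E by (simp add: subset_iff sum.distrib sum_distrib_left)
  then have "Ph ?T < Ph T" using neg tg(1) by (simp add: mult_less_0_iff)
  \<comment> \<open>The face has dimension at least two, so the pivot keeps some other facet of the
    old vertex, and that one lies in \<open>A\<close>.\<close>
  moreover have "?T \<in> VA"
  proof -
    have ST: "S \<subseteq> ?T" using T'(3) f by auto
    have "card (T - S) \<ge> 2" using c T' card_Diff_subset[of S T] face_fin[OF S] by simp
    then have "card (T - S - {f}) \<ge> 1" using f face_fin[OF T'(1)] by (simp add: card_Diff_singleton)
    then obtain f' where "f' \<in> T - S - {f}" by (metis card.empty ex_in_conv not_one_le_zero)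
    then have "(?T - S) \<inter> A \<noteq> {}" using T'(4) by blast
    then show ?thesis using dich[OF tg(3) ST] tg ST by (auto simp: VA_def)
  qed
  ultimately show False using T(2) by force
qed

end

section \<open>Two-dimensional faces\<close>

text \<open>The area form of a hexagon with sides parallel to the roots of \<open>A\<^sub>2\<close>: a rectangle minus two
  triangles, so that the form is \<open>2 a b - c\<^sup>2 - d\<^sup>2\<close> for linear forms \<open>a, b, c, d\<close>.\<close>

definition hexagon where
  "hexagon y01 y02 y12 y10 y20 y21 x01 x02 x12 x10 x20 (x21::real) =
    y01 * (x02 + x21 - x01) + y10 * (x12 + x20 - x10) + y02 * (x01 + x12 - x02) +
    y20 * (x21 + x10 - x20) + y12 * (x10 + x02 - x12) + y21 * (x20 + x01 - x21)"

lemma hexagon_hyperbolic: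
  assumes pos: "hexagon h01 h02 h12 h10 h20 h21 h01 h02 h12 h10 h20 h21 > 0"
    and orth: "hexagon x01 x02 x12 x10 x20 x21 h01 h02 h12 h10 h20 h21 = 0"
  shows "hexagon x01 x02 x12 x10 x20 x21 x01 x02 x12 x10 x20 x21 \<le> 0"
proof (rule ccontr)
  \<comment> \<open>\<open>A\<close> and \<open>B\<close> are the sides of the circumscribed
    rectangle, \<open>C\<close> and \<open>D\<close> the legs of the two triangles cut off.\<close>
  define A B C D where "A = x01 + x10" and "B = x02 + x20" and "C = x10 + x02 - x12" and "D = x01 + x20 - x21"
  define A' B' C' D' where "A' = h01 + h10" and "B' = h02 + h20" and "C' = h10 + h02 - h12" and "D' = h01 + h20 - h21"
  note defs = A_def B_def C_def D_def A'_def B'_def C'_def D'_def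
  assume "\<not> ?thesis"
  then have xx: "2 * A * B - C\<^sup>2 - D\<^sup>2 > 0"
    unfolding defs hexagon_def by (simp add: power2_eq_square algebra_simps)
  have hh: "2 * A' * B' - C'\<^sup>2 - D'\<^sup>2 > 0"
    using pos unfolding defs hexagon_def by (simp add: power2_eq_square algebra_simps)
  have xh: "A * B' + A' * B = C * C' + D * D'"
    using orth unfolding defs hexagon_def by (simp add: algebra_simps)
  \<comment> \<open>Cauchy-Schwarz on the triangles and the arithmetic-geometric mean on the
    rectangles give strictly ordered bounds for two quantities that orthogonality makes
    equal.\<close>
  have "(C * C' + D * D')\<^sup>2 \<le> (C\<^sup>2 + D\<^sup>2) * (C'\<^sup>2 + D'\<^sup>2)"
    using zero_le_power2[of "C * D' - D * C'"] by (simp add: power2_eq_square algebra_simps)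
  also have "\<dots> < (2 * A * B) * (2 * A' * B')"
    using xx hh by (intro mult_strict_mono') auto
  also have "\<dots> \<le> (A * B' + A' * B)\<^sup>2"
    using zero_le_power2[of "A * B' - A' * B"] by (simp add: power2_eq_square algebra_simps)
  finally show False using xh by simp
qed

context difference_system
begin

definition ED :: "'e set \<Rightarrow> 'v set \<Rightarrow> 'v set \<Rightarrow> 'e set" where
  "ED S A B = {e \<in> link S. src e \<in> A \<and> tgt e \<in> B}"

text \<open>Support number of the side of the hexagon that belongs to the ordered pair
  \<open>A\<close>, \<open>B\<close>. If this side is missing, its line is put through the corner of
  the sides via \<open>C\<close>; then the missing side has length zero, and one area formula covers
  all degenerate hexagons.\<close>

definition virt :: "'e set \<Rightarrow> ('e \<Rightarrow> real) \<Rightarrow> 'v set \<Rightarrow> 'v set \<Rightarrow> 'v set \<Rightarrow> real" where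
  "virt S x A B C = (if ED S A B = {} then sum x (ED S A C) + sum x (ED S C B) else sum x (ED S A B))"

lemma three_blocks:
  assumes "face S" "card S + 2 = dim" "V // blk S = {A, B, C}"
  shows "A \<noteq> B" "A \<noteq> C" "B \<noteq> C"
    and "A \<union> B \<union> C = V" "A \<inter> B = {}" "A \<inter> C = {}" "B \<inter> C = {}"
    and "A \<noteq> {}" "B \<noteq> {}" "C \<noteq> {}"
proof -
  have c: "card {A, B, C} = 3"
    using card_blk[OF face_sub face_indep, OF assms(1,1)] assms(2,3) card_V by simp
  show ne: "A \<noteq> B" "A \<noteq> C" "B \<noteq> C" using c by (auto simp: card_insert_if split: if_splits)
  show "A \<union> B \<union> C = V" using Union_quotient[OF equiv_blk, of S] assms(3) by auto
  show "A \<inter> B = {}" "A \<inter> C = {}" "B \<inter> C = {}"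
    using quotient_disj[OF equiv_blk, of _ S] assms(3) ne by (metis insertI1 insertI2)+
  show "A \<noteq> {}" "B \<noteq> {}" "C \<noteq> {}"
    using in_quotient_imp_non_empty[OF equiv_blk, of _ S] assms(3) by auto
qed

lemma block_rel: "A \<in> V // blk S \<Longrightarrow> u \<in> A \<Longrightarrow> v \<in> A \<Longrightarrow> (u, v) \<in> blk S"
  using in_quotient_imp_in_rel[OF equiv_blk, of A S u v] by auto

lemma block_flat: "A \<in> V // blk S \<Longrightarrow> u \<in> A \<Longrightarrow> v \<in> A \<Longrightarrow> flat S b \<Longrightarrow> b u = b v"
  using flat_blk block_rel by blast

lemma block_ind:
  assumes "S \<subseteq> E" "A \<in> V // blk S" shows "flat S (indicator A)"
proof (rule flat_ind[OF assms(1)])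
  fix u v assume uv: "(u, v) \<in> blk S"
  then have vu: "(v, u) \<in> blk S" by (auto simp: blk_def)
  show "u \<in> A \<longleftrightarrow> v \<in> A"
    using in_quotient_imp_closed[OF equiv_blk assms(2) _ uv] in_quotient_imp_closed[OF equiv_blk assms(2) _ vu] by blast
qed

lemma link_cross:
  assumes "face S" "e \<in> link S" "A \<in> V // blk S" shows "\<not> (src e \<in> A \<and> tgt e \<in> A)"
  using block_rel[OF assms(3)] indep_edge_sep[OF face_indep[OF link_face[OF assms(2)]]] link_sub[OF assms(1,2)] by auto

text \<open>On the face the slacks of two such inequalities differ by a constant, so it is
  impossible that each is tight somewhere while the other is strict.\<close>

lemma ED_unique:
  assumes S: "face S" and AB: "A \<in> V // blk S" "B \<in> V // blk S" and e: "e \<in> ED S A B" and f: "f \<in> ED S A B"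
  shows "e = f"
proof (rule ccontr)
  assume ne: "e \<noteq> f"
  have fe: "face (insert e S)" "face (insert f S)" using e f link_face by (auto simp: ED_def)
  obtain p where p: "\<forall>g\<in>insert e S. slack w0 p g = 0" "\<forall>g\<in>E - insert e S. slack w0 p g > 0"
    using fe(1) unfolding face_def by blast
  obtain q where q: "\<forall>g\<in>insert f S. slack w0 q g = 0" "\<forall>g\<in>E - insert f S. slack w0 q g > 0"
    using fe(2) unfolding face_def by blast
  define b where "b = (\<lambda>u. q u - p u)"
  have fb: "flat S b" unfolding b_def by (rule flat_diff[of S w0]) (use p q in auto)
  have "df b e = df b f"
    using block_flat[OF AB(1) _ _ fb, of "src e" "src f"] block_flat[OF AB(2) _ _ fb, of "tgt e" "tgt f"] e f
    by (auto simp: df_def ED_def)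
  moreover have "slack w0 q e = slack w0 p e + df b e" "slack w0 q f = slack w0 p f + df b f"
    unfolding b_def by (rule slack_diff)+
  moreover have "slack w0 p e = 0" "slack w0 q f = 0" using p q by auto
  moreover have "slack w0 q e > 0" "slack w0 p f > 0"
    using p(2) q(2) ne e f link_sub[OF S] by (auto simp: ED_def)
  ultimately show False by linarith
qed

lemma ED_sum:
  assumes "face S" "A \<in> V // blk S" "B \<in> V // blk S" "e \<in> ED S A B"
  shows "sum x (ED S A B) = x e"
proof -
  have "ED S A B = {e}" using ED_unique[OF assms(1,2,3) _ assms(4)] assms(4) by blast
  then show ?thesis by simp
qed

text \<open>On the face the slack from \<open>A\<close> to \<open>C\<close> is the sum of the two
  other slacks plus a constant. This constant is positive because a third side would be strict at
  their common corner; but then it is tight nowhere.\<close>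

lemma ED_transit:
  assumes S: "face S" and ABC: "A \<in> V // blk S" "B \<in> V // blk S" "C \<in> V // blk S"
    and e: "e \<in> ED S A B" and f: "f \<in> ED S B C" and ef: "f \<in> link (insert e S)"
  shows "ED S A C = {}"
proof (rule ccontr)
  assume "ED S A C \<noteq> {}"
  then obtain k where k: "k \<in> ED S A C" by auto
  have fe: "face (insert f (insert e S))" using link_face[OF ef] .
  obtain p where p: "\<forall>g\<in>insert f (insert e S). slack w0 p g = 0" "\<forall>g\<in>E - insert f (insert e S). slack w0 p g > 0"
    using fe unfolding face_def by blast
  have "face (insert k S)" using k link_face by (auto simp: ED_def)
  then obtain q where q: "\<forall>g\<in>insert k S. slack w0 q g = 0" "\<forall>g\<in>E - insert k S. slack w0 q g > 0"
    unfolding face_def by blast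
  have qn: "slack w0 q g \<ge> 0" if "g \<in> E" for g using q that by (cases "g \<in> insert k S") (auto intro: less_imp_le)
  define b where "b = (\<lambda>u. q u - p u)"
  have fb: "flat S b" unfolding b_def by (rule flat_diff[of S w0]) (use p q in auto)
  have sub: "e \<in> E" "f \<in> E" "k \<in> E" "k \<notin> S" using e f k link_sub[OF S] by (auto simp: ED_def)
  have "df b k = df b e + df b f"
    using block_flat[OF ABC(1) _ _ fb, of "src e" "src k"] block_flat[OF ABC(2) _ _ fb, of "tgt e" "src f"]
      block_flat[OF ABC(3) _ _ fb, of "tgt f" "tgt k"] e f k
    by (auto simp: df_def ED_def)
  moreover have "slack w0 q g = slack w0 p g + df b g" for g unfolding b_def by (rule slack_diff)
  note this[of e] this[of f] this[of k]
  moreover have "slack w0 p e = 0" "slack w0 p f = 0" "slack w0 q k = 0" using p q by auto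
  moreover have "slack w0 q e \<ge> 0" "slack w0 q f \<ge> 0" using qn sub by auto
  moreover have "slack w0 p k > 0"
  proof -
    have eq: "X = Y" if "u \<in> X" "u \<in> Y" "X \<in> V // blk S" "Y \<in> V // blk S" for u X Y
      using quotient_disj[OF equiv_blk that(3,4)] that by blast
    have "k \<noteq> e"
    proof
      assume "k = e"
      then have "B = C" using eq[of "tgt e" B C] e k ABC by (auto simp: ED_def)
      then show False using link_cross[OF S, of f C] f ABC by (auto simp: ED_def)
    qed
    moreover have "k \<noteq> f"
    proof
      assume "k = f"
      then have "A = B" using eq[of "src f" A B] f k ABC by (auto simp: ED_def)
      then show False using link_cross[OF S, of e B] e ABC by (auto simp: ED_def)
    qed
    ultimately show ?thesis using p(2) sub by auto
  qed
  ultimately show False by linarith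
qed

text \<open>Minimise the functional of the missing normal over the vertices of the polygon. At the
  optimum this normal is a nonnegative combination of the normals of the two tight sides, and among
  the remaining root directions only the two via \<open>C\<close> can produce it.\<close>

lemma ED_missing:
  assumes S: "face S" and c: "card S + 2 = dim" and ABC: "V // blk S = {A, B, C}" and miss: "ED S A B = {}"
  shows "ED S A C \<noteq> {}" "ED S C B \<noteq> {}"
proof -
  note tb = three_blocks[OF S c ABC]
  have Q: "A \<in> V // blk S" "B \<in> V // blk S" "C \<in> V // blk S" using ABC by auto
  obtain p q r where pqr: "p \<in> A" "q \<in> B" "r \<in> C" using tb by blast
  define TT where "TT = {T. face T \<and> card T = dim \<and> S \<subseteq> T}"
  have "TT \<subseteq> Pow E" using face_sub by (auto simp: TT_def)
  then have fin: "finite TT" using finE finite_subset by auto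
  have "\<exists>T. S \<subseteq> T \<and> face T \<and> card T = dim" by (rule vertex_above[OF S]) blast
  then have ne: "TT \<noteq> {}" by (auto simp: TT_def)
  define c where "c = (\<lambda>T. pot T w0 q - pot T w0 p)"
  obtain T where T: "T \<in> TT" "\<And>T'. T' \<in> TT \<Longrightarrow> c T \<le> c T'"
    using arg_min_if_finite[OF fin ne, of c] by (auto simp: not_less)
  have T': "face T" "card T = dim" "S \<subseteq> T" using T by (auto simp: TT_def)
  have "card (T - S) = 2" using T' assms(2) card_Diff_subset[of S T] face_fin[OF S] by simp
  then obtain e f where ef: "T - S = {e, f}" "e \<noteq> f" by (auto simp: card_2_iff)
  obtain y where y: "\<And>f. f \<in> T \<Longrightarrow> flat (T - {f}) (y f) \<and> df (y f) f = 1"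
    by (rule vertex_dirs[OF T'(1)]) blast
  have opt: "y g q - y g p \<ge> 0" if g: "g \<in> T - S" for g
  proof (rule ccontr)
    assume neg: "\<not> y g q - y g p \<ge> 0"
    have gT: "g \<in> T" using g by auto
    obtain t k where tk: "t > 0" "k \<noteq> g" "face (insert k (T - {g}))" "card (insert k (T - {g})) = dim"
      "\<And>e. e \<in> E \<Longrightarrow> slack w0 (pot (insert k (T - {g})) w0) e = slack w0 (pot T w0) e + t * df (y g) e"
      by (rule simplex_pivot[OF T'(1,2) gT]) (use y[OF gT] in blast)+
    let ?T = "insert k (T - {g})"
    define b where "b = (\<lambda>u. pot ?T w0 u - pot T w0 u - t * y g u)"
    have "df b e = 0" if "e \<in> E" for e using tk(5)[OF that] by (simp add: b_def slack_def df_def algebra_simps)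
    then have "b p = b q" using bounded[of b p q] pqr tb(4) by (auto simp: df_def)
    then have "c ?T = c T + t * (y g q - y g p)" by (simp add: b_def c_def algebra_simps)
    then have "c ?T < c T" using tk(1) neg by (simp add: mult_less_0_iff not_le)
    moreover have "?T \<in> TT" using tk T'(3) g by (auto simp: TT_def)
    ultimately show False using T(2) by force
  qed
  have efT: "e \<in> T" "f \<in> T" "e \<in> link S" "f \<in> link S"
    using ef vertex_link[OF T'(1,3)] by auto
  have ye: "flat S (y e)" "flat S (y f)" "df (y e) e = 1" "df (y f) f = 1" "df (y e) f = 0" "df (y f) e = 0"
  proof -
    have "S \<subseteq> T - {e}" "S \<subseteq> T - {f}" using ef T'(3) by auto
    then show "flat S (y e)" "flat S (y f)" using y[OF efT(1)] y[OF efT(2)] by (auto simp: flat_def)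
    show "df (y e) e = 1" "df (y f) f = 1" "df (y e) f = 0" "df (y f) e = 0"
      using y[OF efT(1)] y[OF efT(2)] efT ef(2) by (auto simp: flat_def)
  qed
  define P where "P = (\<lambda>g u v. df (y e) g = y e v - y e u \<and> df (y f) g = y f v - y f u)"
  have val: "(g \<in> ED S A C \<and> P g p r) \<or> (g \<in> ED S C A \<and> P g r p) \<or>
     (g \<in> ED S C B \<and> P g r q) \<or> (g \<in> ED S B C \<and> P g q r) \<or> (g \<in> ED S B A \<and> P g q p)" if g: "g \<in> link S" for g
  proof -
    have V: "src g \<in> V" "tgt g \<in> V" using link_sub[OF S g] srcV tgtV by auto
    have PA: "P g u v" if "src g \<in> X" "u \<in> X" "X \<in> V // blk S" "tgt g \<in> Y" "v \<in> Y" "Y \<in> V // blk S" for X Y u v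
    proof -
      note s = block_flat[OF that(3,1,2)] block_flat[OF that(6,4,5)]
      show ?thesis unfolding P_def df_def
        unfolding s(1)[OF ye(1)] s(1)[OF ye(2)] s(2)[OF ye(1)] s(2)[OF ye(2)] by simp
    qed
    have n: "\<not> (src g \<in> A \<and> tgt g \<in> A)" "\<not> (src g \<in> B \<and> tgt g \<in> B)" "\<not> (src g \<in> C \<and> tgt g \<in> C)"
      using link_cross[OF S g] Q by auto
    have "\<not> (src g \<in> A \<and> tgt g \<in> B)" using miss g by (auto simp: ED_def)
    then consider "src g \<in> A" "tgt g \<in> C" | "src g \<in> C" "tgt g \<in> A" | "src g \<in> C" "tgt g \<in> B" |
       "src g \<in> B" "tgt g \<in> C" | "src g \<in> B" "tgt g \<in> A" using V n tb(4) by blast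
    then show ?thesis
    proof cases
      case 1 then show ?thesis using PA[OF _ pqr(1) Q(1) _ pqr(3) Q(3)] g by (simp add: ED_def)
    next
      case 2 then show ?thesis using PA[OF _ pqr(3) Q(3) _ pqr(1) Q(1)] g by (simp add: ED_def)
    next
      case 3 then show ?thesis using PA[OF _ pqr(3) Q(3) _ pqr(2) Q(2)] g by (simp add: ED_def)
    next
      case 4 then show ?thesis using PA[OF _ pqr(2) Q(2) _ pqr(3) Q(3)] g by (simp add: ED_def)
    next
      case 5 then show ?thesis using PA[OF _ pqr(2) Q(2) _ pqr(1) Q(1)] g by (simp add: ED_def)
    qed
  qed
  have oe: "y e q - y e p \<ge> 0" "y f q - y f p \<ge> 0" using opt ef by auto
  have "(e \<in> ED S A C \<and> f \<in> ED S C B) \<or> (f \<in> ED S A C \<and> e \<in> ED S C B)"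
  proof (rule ccontr)
    assume n: "\<not> ?thesis"
    show False
      using val[OF efT(3)] val[OF efT(4)] unfolding P_def
      by (elim disjE conjE; insert ye oe n; (linarith | blast))
  qed
  then show "ED S A C \<noteq> {}" "ED S C B \<noteq> {}" by auto
qed

text \<open>When all sides are parallel to the roots, the length of a side is the sum of the support
  numbers of its two neighbours minus its own; \<open>virt\<close> supplies the neighbours when they
  are missing.\<close>

lemma W_edge:
  assumes S: "face S" and c: "card S + 2 = dim" and ABC: "V // blk S = {A, B, C}" and e: "e \<in> ED S A B"
    and a: "\<And>f. f \<in> S \<Longrightarrow> slack x a f = 0"
  shows "W (insert e S) [x] = virt S (slack x a) A C B + virt S (slack x a) C B A - slack x a e"
proof -
  note tb = three_blocks[OF S c ABC]
  have Q: "A \<in> V // blk S" "B \<in> V // blk S" "C \<in> V // blk S" using ABC by auto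
  have SE: "S \<subseteq> E" using face_sub[OF S] .
  have eL: "e \<in> link S" "src e \<in> A" "tgt e \<in> B" using e by (auto simp: ED_def)
  have fe: "face (insert e S)" using link_face[OF eL(1)] .
  have ce: "Suc (card (insert e S)) = dim" using card_link[OF S eL(1)] c by simp
  obtain f g where fg: "link (insert e S) = {f, g}" "f \<noteq> g" "\<And>b. flat (insert e S) b \<Longrightarrow> df b f + df b g = 0"
    using ridge[OF fe ce] by metis
  have fC: "flat (insert e S) (indicator C)"
    using block_ind[OF SE Q(3)] eL tb(6,7) by (auto simp: flat_def df_def indicator_def)
  have cross: "(src k \<in> C \<and> tgt k \<in> A \<union> B) \<or> (src k \<in> A \<union> B \<and> tgt k \<in> C)" if k: "k \<in> link (insert e S)" for k
  proof -
    have kS: "k \<in> link S" using link_insert[OF eL(1) k] by auto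
    have V: "src k \<in> V" "tgt k \<in> V" using link_sub[OF S kS] srcV tgtV by auto
    have nk: "(src k, tgt k) \<notin> blk (insert e S)"
      using indep_edge_sep[OF face_indep[OF link_face[OF k]]] link_sub[OF fe k] by auto
    have sub: "blk S \<subseteq> blk (insert e S)" by (auto simp: blk_def flat_def)
    have ee: "(src e, tgt e) \<in> blk (insert e S)" using blk_edge[of e "insert e S"] face_sub[OF fe] by auto
    have "(u, v) \<in> blk (insert e S)" if "u \<in> A \<union> B" "v \<in> A \<union> B" for u v
    proof -
      have "(w, src e) \<in> blk (insert e S)" if "w \<in> A \<union> B" for w
      proof (cases "w \<in> A")
        case True then show ?thesis using block_rel[OF Q(1) True eL(2)] sub by auto
      next
        case False
        then have "(w, tgt e) \<in> blk (insert e S)" using that block_rel[OF Q(2) _ eL(3), of w] sub by auto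
        then show ?thesis using ee by (auto simp: blk_def)
      qed
      from this[OF that(1)] this[OF that(2)] show ?thesis by (auto simp: blk_def)
    qed
    then show ?thesis using nk V tb(4) link_cross[OF S kS Q(3)] by blast
  qed
  have nC: "u \<notin> C" if "u \<in> A \<union> B" for u using that tb(6,7) by auto
  have "df (indicator C) f + df (indicator C) g = 0" using fg(3)[OF fC] .
  then have opp: "src f \<in> C \<longleftrightarrow> src g \<notin> C"
    using cross[of f] cross[of g] fg(1) nC[of "tgt f"] nC[of "tgt g"] nC[of "src f"] nC[of "src g"] by (auto simp: df_def indicator_def split: if_splits)
  define k1 where "k1 = (if src f \<in> C then g else f)"
  define k2 where "k2 = (if src f \<in> C then f else g)"
  have lk: "link (insert e S) = {k1, k2}" "k1 \<noteq> k2" using fg by (auto simp: k1_def k2_def)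
  have k1: "src k1 \<in> A \<union> B" "tgt k1 \<in> C" and k2: "src k2 \<in> C" "tgt k2 \<in> A \<union> B"
    using cross[of f] cross[of g] fg(1) opp nC by (auto simp: k1_def k2_def)
  have kS: "k1 \<in> link S" "k2 \<in> link S" using link_insert[OF eL(1)] lk by auto
  let ?a = "\<lambda>u. (- slack x a e) * indicator B u + a u"
  have z: "slack x ?a h = 0" if "h \<in> insert e S" for h
    unfolding slack_add using that a[of h] block_ind[OF SE Q(2)] eL tb(5)
    by (cases "h = e") (auto simp: flat_def df_def indicator_def)
  have "W (insert e S) [x] = (\<Sum>h\<in>link (insert e S). slack x ?a h * W (insert h (insert e S)) [])"
    by (rule W_gauge[OF fe _ z]) (use ce in auto)
  also have "\<dots> = slack x ?a k1 + slack x ?a k2"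
    unfolding lk(1) using lk(2) link_face[of k1 "insert e S"] link_face[of k2 "insert e S"] lk(1) by simp
  \<comment> \<open>The end \<open>k1\<close> is either the side from \<open>A\<close> to
    \<open>C\<close> itself or the side from \<open>B\<close> to \<open>C\<close>. In the second
    case \<open>ED_transit\<close> shows that the former is missing, and \<open>virt\<close> passes
    through \<open>e\<close>.\<close>
  also have "slack x ?a k1 = virt S (slack x a) A C B"
  proof (cases "src k1 \<in> A")
    case True
    then have k: "k1 \<in> ED S A C" using k1 kS by (auto simp: ED_def)
    then have "virt S (slack x a) A C B = slack x a k1" using ED_sum[OF S Q(1,3) k, of "slack x a"] k by (auto simp: virt_def)
    then show ?thesis unfolding slack_add using True k1 tb(5,7) by (auto simp: df_def indicator_def)
  next
    case False
    then have k: "k1 \<in> ED S B C" "src k1 \<in> B" using k1 kS by (auto simp: ED_def)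
    have "ED S A C = {}" by (rule ED_transit[OF S Q(1,2,3) e k(1)]) (use lk in auto)
    then have "virt S (slack x a) A C B = slack x a e + slack x a k1"
      using ED_sum[OF S Q(2,3) k(1), of "slack x a"] ED_sum[OF S Q(1,2) e, of "slack x a"] by (simp add: virt_def)
    moreover have "df (indicator B) k1 = (-1 :: real)" using k k1 tb(7) by (auto simp: df_def indicator_def)
    ultimately show ?thesis unfolding slack_add by simp
  qed
  also have "slack x ?a k2 = virt S (slack x a) C B A - slack x a e"
  proof (cases "tgt k2 \<in> B")
    case True
    then have k: "k2 \<in> ED S C B" using k2 kS by (auto simp: ED_def)
    then have "virt S (slack x a) C B A = slack x a k2" using ED_sum[OF S Q(3,2) k, of "slack x a"] k by (auto simp: virt_def)
    moreover have "df (indicator B) k2 = (1 :: real)" using True k2 tb(7) by (auto simp: df_def indicator_def)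
    ultimately show ?thesis unfolding slack_add by simp
  next
    case False
    then have k: "k2 \<in> ED S C A" "tgt k2 \<in> A" using k2 kS by (auto simp: ED_def)
    have "k2 \<in> link (insert e S)" using lk by auto
    then have "e \<in> link (insert k2 S)" using link_swap[OF eL(1)] by auto
    then have "ED S C B = {}" by (rule ED_transit[OF S Q(3,1,2) k(1) e])
    then have "virt S (slack x a) C B A = slack x a k2 + slack x a e"
      using ED_sum[OF S Q(3,1) k(1), of "slack x a"] ED_sum[OF S Q(1,2) e, of "slack x a"] by (simp add: virt_def)
    moreover have "df (indicator B) k2 = (0 :: real)" using k k2 tb(5,7) by (auto simp: df_def indicator_def)
    ultimately show ?thesis unfolding slack_add by simp
  qed
  finally show ?thesis by simp
qed

text \<open>The six terms of the area form are support number times length. A missing side adds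
  nothing, because \<open>virt\<close> gives it length zero.\<close>

lemma W_polygon:
  assumes S: "face S" and c: "card S + 2 = dim" and ABC: "V // blk S = {A, B, C}"
    and a: "\<And>f. f \<in> S \<Longrightarrow> slack x a f = 0" and b: "\<And>f. f \<in> S \<Longrightarrow> slack y b f = 0"
  shows "W S [y, x] = hexagon
     (virt S (slack y b) A B C) (virt S (slack y b) A C B) (virt S (slack y b) B C A)
     (virt S (slack y b) B A C) (virt S (slack y b) C A B) (virt S (slack y b) C B A)
     (virt S (slack x a) A B C) (virt S (slack x a) A C B) (virt S (slack x a) B C A)
     (virt S (slack x a) B A C) (virt S (slack x a) C A B) (virt S (slack x a) C B A)"
proof -
  note tb = three_blocks[OF S c ABC]
  have perm: "V // blk S = {A, C, B}" "V // blk S = {B, A, C}" "V // blk S = {B, C, A}" "V // blk S = {C, A, B}" "V // blk S = {C, B, A}"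
    using ABC by auto
  have "W S [y, x] = (\<Sum>e\<in>link S. slack y b e * W (insert e S) [x])"
    by (rule W_gauge[OF S _ b]) (use c in auto)
  also have "link S = ED S A B \<union> ED S A C \<union> ED S B C \<union> ED S B A \<union> ED S C A \<union> ED S C B"
  proof -
    have "e \<in> ED S A B \<union> ED S A C \<union> ED S B C \<union> ED S B A \<union> ED S C A \<union> ED S C B" if e: "e \<in> link S" for e
    proof -
      have "src e \<in> A \<union> B \<union> C" "tgt e \<in> A \<union> B \<union> C" using link_sub[OF S e] srcV tgtV tb(4) by auto
      moreover have "\<not> (src e \<in> A \<and> tgt e \<in> A)" "\<not> (src e \<in> B \<and> tgt e \<in> B)" "\<not> (src e \<in> C \<and> tgt e \<in> C)"
        using link_cross[OF S e] ABC by auto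
      ultimately show ?thesis using e unfolding ED_def by blast
    qed
    then show ?thesis by (auto simp: ED_def)
  qed
  also have "(\<Sum>e\<in>\<dots>. slack y b e * W (insert e S) [x]) =
     (\<Sum>e\<in>ED S A B. slack y b e * W (insert e S) [x]) + (\<Sum>e\<in>ED S A C. slack y b e * W (insert e S) [x]) +
     (\<Sum>e\<in>ED S B C. slack y b e * W (insert e S) [x]) + (\<Sum>e\<in>ED S B A. slack y b e * W (insert e S) [x]) +
     (\<Sum>e\<in>ED S C A. slack y b e * W (insert e S) [x]) + (\<Sum>e\<in>ED S C B. slack y b e * W (insert e S) [x])"
  proof -
    have fin: "finite (ED S P R)" for P R using link_fin[of S] by (simp add: ED_def)
    have "(ED S A B \<union> ED S A C \<union> ED S B C \<union> ED S B A \<union> ED S C A) \<inter> ED S C B = {}"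
      "(ED S A B \<union> ED S A C \<union> ED S B C \<union> ED S B A) \<inter> ED S C A = {}"
      "(ED S A B \<union> ED S A C \<union> ED S B C) \<inter> ED S B A = {}"
      "(ED S A B \<union> ED S A C) \<inter> ED S B C = {}" "ED S A B \<inter> ED S A C = {}"
      unfolding ED_def using tb(5,6,7) by blast+
    then show ?thesis by (simp add: sum.union_disjoint fin)
  qed
  also have "(\<Sum>e\<in>ED S P R. slack y b e * W (insert e S) [x]) =
      virt S (slack y b) P R T * (virt S (slack x a) P T R + virt S (slack x a) T R P - virt S (slack x a) P R T)"
    if PRT: "V // blk S = {P, R, T}" for P R T
  proof (cases "ED S P R = {}")
    case True
    have "ED S P T \<noteq> {}" "ED S T R \<noteq> {}" using ED_missing[OF S c PRT True] by auto
    then show ?thesis using True by (simp add: virt_def)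
  next
    case False
    then obtain e where e: "e \<in> ED S P R" by auto
    have PQ: "P \<in> V // blk S" "R \<in> V // blk S" using PRT by auto
    show ?thesis using ED_sum[OF S PQ e, of "\<lambda>e. slack y b e * W (insert e S) [x]"]
      ED_sum[OF S PQ e, of "slack y b"] ED_sum[OF S PQ e, of "slack x a"] W_edge[OF S c PRT e a] False
      by (simp add: virt_def)
  qed
  note this[OF ABC] and this[OF perm(1)] and this[OF perm(2)] and this[OF perm(3)] and this[OF perm(4)] and this[OF perm(5)]
  ultimately show ?thesis by (simp add: hexagon_def)
qed

lemma polygon_hyperbolic:
  assumes S: "face S" and c: "card S + 2 = dim" and h: "adm h" and orth: "W S [x, h] = 0"
  shows "W S [x, x] \<le> 0"
proof -
  have "card (V // blk S) = 3"
    using card_blk[OF face_sub face_indep, OF S S] c card_V by simp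
  then obtain A B C where ABC: "V // blk S = {A, B, C}" by (auto simp: card_3_iff)
  note p = pot[OF face_indep[OF S]]
  define v where "v = (\<lambda>x. virt S (slack x (pot S x)))"
  have poly: "W S [y, x] = hexagon (v y A B C) (v y A C B) (v y B C A) (v y B A C) (v y C A B) (v y C B A)
     (v x A B C) (v x A C B) (v x B C A) (v x B A C) (v x C A B) (v x C B A)" for x y
    unfolding v_def by (rule W_polygon[OF S c ABC p p])
  have "W S [h, h] > 0" by (rule W_pos[OF S]) (use c h in auto)
  then show ?thesis using orth unfolding poly by (rule hexagon_hyperbolic)
qed

section \<open>The Alexandrov-Fenchel inequality\<close>

lemma W_nonface: "\<not> face S \<Longrightarrow> W S vs = 0"
proof (cases vs)
  case (Cons v us)
  assume "\<not> face S"
  then have "link S = {}" using face_down[of "insert _ S" S] by (auto simp: link_def)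
  then show ?thesis by (simp add: Cons)
qed simp

text \<open>Sets that are not faces have mixed volume zero, so the sum may run over all of
  \<open>E - S\<close>. In this form systems with different edge sets can be compared term by
  term.\<close>

lemma W_gauge_all:
  assumes "card S + length (v # vs) = dim" "\<And>e. e \<in> S \<Longrightarrow> slack v a e = 0"
  shows "W S (v # vs) = (\<Sum>e\<in>E - S. slack v a e * W (insert e S) vs)"
proof (cases "face S")
  case True
  have "W S (v # vs) = (\<Sum>e\<in>link S. slack v a e * W (insert e S) vs)" by (rule W_gauge[OF True assms])
  also have "\<dots> = (\<Sum>e\<in>E - S. slack v a e * W (insert e S) vs)"
    using finE W_nonface by (intro sum.mono_neutral_left) (auto simp: link_def)
  finally show ?thesis .
next
  case False
  then have "\<not> face (insert e S)" for e using face_down[of "insert e S" S] by auto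
  then show ?thesis using False by (simp add: W_nonface del: W.simps)
qed

lemma W_lin:
  assumes "face S" "card S + length (x # vs) = dim"
  shows "W S ((\<lambda>e. x e + c * y e) # vs) = W S (x # vs) + c * W S (y # vs)"
proof -
  have d: "card S + length ((\<lambda>e. x e + c * y e) # vs) = dim" using assms(2) by simp
  have "W S ((\<lambda>e. x e + c * y e) # vs) = (\<Sum>e\<in>link S. slack (\<lambda>e. x e + c * y e) (\<lambda>u. pot S x u + c * pot S y u) e * W (insert e S) vs)"
    by (rule W_gauge[OF assms(1) d]) (simp add: slack_lin pot[OF face_indep[OF assms(1)]])
  then show ?thesis by (simp add: slack_lin distrib_right sum.distrib sum_distrib_left mult.assoc)
qed

lemma W_quad:
  assumes S: "face S" and d: "card S + 2 + length vs = dim"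
  shows "W S ((\<lambda>e. x e + c * y e) # (\<lambda>e. x e + c * y e) # vs) =
    W S (x # x # vs) + 2 * c * W S (x # y # vs) + c\<^sup>2 * W S (y # y # vs)"
    and "W S ((\<lambda>e. x e + c * y e) # y # vs) = W S (x # y # vs) + c * W S (y # y # vs)"
proof -
  have l: "W S ((\<lambda>e. x e + c * y e) # z # vs) = W S (x # z # vs) + c * W S (y # z # vs)" for z
    by (rule W_lin[OF S]) (use d in simp)
  have s: "W S (u # z # vs) = W S (z # u # vs)" for u z by (rule W_swap[OF S]) (use d in simp)
  show "W S ((\<lambda>e. x e + c * y e) # y # vs) = W S (x # y # vs) + c * W S (y # y # vs)" by (rule l)
  show "W S ((\<lambda>e. x e + c * y e) # (\<lambda>e. x e + c * y e) # vs) =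
    W S (x # x # vs) + 2 * c * W S (x # y # vs) + c\<^sup>2 * W S (y # y # vs)"
    unfolding l s[of _ "\<lambda>e. x e + c * y e"] using s[of x y] by (simp add: power2_eq_square algebra_simps del: W.simps)
qed

lemma reverse_cauchy_schwarz:
  assumes S: "face S" and d: "card S + 2 + length vs = dim"
    and hyp: "\<And>x. W S (x # h # vs) = 0 \<Longrightarrow> W S (x # x # vs) \<le> 0" and pos: "W S (h # h # vs) > 0"
  shows "W S (x # x # vs) * W S (h # h # vs) \<le> (W S (x # h # vs))\<^sup>2"
proof -
  define c where "c = - W S (x # h # vs) / W S (h # h # vs)"
  have ch: "c * W S (h # h # vs) = - W S (x # h # vs)" using pos by (simp add: c_def del: W.simps)
  have "W S ((\<lambda>e. x e + c * h e) # h # vs) = 0" unfolding W_quad(2)[OF S d] ch by (simp del: W.simps)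
  from hyp[OF this] have "W S (x # x # vs) + 2 * c * W S (x # h # vs) + c * (c * W S (h # h # vs)) \<le> 0"
    unfolding W_quad(1)[OF S d] by (simp add: power2_eq_square algebra_simps del: W.simps)
  then have "W S (x # x # vs) \<le> - c * W S (x # h # vs)" unfolding ch by (simp add: algebra_simps del: W.simps)
  then have "W S (x # x # vs) * W S (h # h # vs) \<le> - c * W S (x # h # vs) * W S (h # h # vs)"
    using pos by (intro mult_right_mono) auto
  also have "\<dots> = - (c * W S (h # h # vs)) * W S (x # h # vs)" by (simp add: algebra_simps del: W.simps)
  also have "\<dots> = (W S (x # h # vs))\<^sup>2" unfolding ch by (simp add: power2_eq_square del: W.simps)
  finally show ?thesis .
qed

text \<open>Correcting \<open>x\<close> by a multiple of \<open>k\<close> makes it orthogonal to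
  \<open>h\<close>. So negativity on the orthogonal complement of one positive vector passes to that
  of another.\<close>

lemma hyperbolic_change:
  assumes S: "face S" and d: "card S + 2 + length vs = dim"
    and hyp: "\<And>x. W S (x # h # vs) = 0 \<Longrightarrow> W S (x # x # vs) \<le> 0"
    and pos: "W S (k # h # vs) > 0" "W S (k # k # vs) > 0" and orth: "W S (x # k # vs) = 0"
  shows "W S (x # x # vs) \<le> 0"
proof -
  define c where "c = - W S (x # h # vs) / W S (k # h # vs)"
  have "W S ((\<lambda>e. x e + c * k e) # h # vs) = W S (x # h # vs) + c * W S (k # h # vs)"
    by (rule W_lin[OF S]) (use d in simp)
  also have "\<dots> = 0" using pos by (simp add: c_def del: W.simps)
  finally have "W S ((\<lambda>e. x e + c * k e) # (\<lambda>e. x e + c * k e) # vs) \<le> 0" by (rule hyp)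
  then have "W S (x # x # vs) + c\<^sup>2 * W S (k # k # vs) \<le> 0"
    unfolding W_quad(1)[OF S d] orth by (simp del: W.simps)
  moreover have "c\<^sup>2 * W S (k # k # vs) \<ge> 0" using pos by (simp del: W.simps)
  ultimately show ?thesis by linarith
qed

theorem alexandrov_fenchel_hyperbolic:
  assumes "face S" "card S + 2 + length vs = dim" "\<And>v. v \<in> set vs \<Longrightarrow> adm v" "adm h"
    and "W S (x # h # vs) = 0"
  shows "W S (x # x # vs) \<le> 0"
  using assms
proof (induction vs arbitrary: S h x)
  case Nil
  then show ?case using polygon_hyperbolic[of S h x] by simp
next
  case (Cons v ws)
  have S: "face S" and d: "card S + 3 + length ws = dim" and v: "adm v" and ws: "\<And>v. v \<in> set ws \<Longrightarrow> adm v"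
    using Cons.prems by auto
  define m where "m = (\<lambda>e. W (insert e S) (v # v # ws))"
  obtain a where a: "\<And>e. e \<in> S \<Longrightarrow> slack v a e = 0" "\<And>e. e \<in> link S \<Longrightarrow> slack v a e > 0"
    by (rule adm_gauge[OF S _ v]) (use d in auto)
  have dl: "card (insert e S) + 2 + length ws = dim" if "e \<in> link S" for e
    using card_link[OF S that] d by simp
  have Mpos: "W (insert f (insert e S)) (v # ws) > 0" if "e \<in> link S" "f \<in> link (insert e S)" for e f
    by (rule W_pos[OF link_face[OF that(2)]])
      (use card_link[OF link_face[OF that(1)] that(2)] dl[OF that(1)] v ws in auto)
  have mpos: "m e > 0" if "e \<in> link S" for e
    unfolding m_def by (rule W_pos[OF link_face[OF that]]) (use dl[OF that] v ws in auto)
  \<comment> \<open>The case in which \<open>h\<close> equals the first fixed argument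
    \<open>v\<close>: here the positive gauge \<open>slack v a\<close> serves as the
    Perron-Frobenius vector. Other \<open>h\<close> follow by
    \<open>hyperbolic_change\<close>.\<close>
  have main: "W S (x # x # v # ws) \<le> 0" if orth: "W S (x # v # v # ws) = 0" for x
  proof -
    define xi where "xi = slack x (pot S x)"
    have px: "slack x (pot S x) f = 0" if "f \<in> S" for f using pot[OF face_indep[OF S] that] .
    have "W S (x # x # v # ws) = (\<Sum>e\<in>link S. \<Sum>f\<in>link S. xi e * MM S (v # ws) e f * xi f)"
      unfolding xi_def by (rule W_form[OF S _ px px]) (use d in simp)
    also have "\<dots> \<le> 0"
    proof (rule hyperbolic_of_children[where h = "slack v a" and m = m])
      show "finite (link S)" by (rule link_fin)
      show "MM S (v # ws) e f = MM S (v # ws) f e" if "e \<in> link S" "f \<in> link S" for e f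
        by (rule MM_sym[OF that])
      show "MM S (v # ws) e f \<ge> 0" if "e \<in> link S" "f \<in> link S" "e \<noteq> f" for e f
        using that Mpos[OF that(1), of f] by (auto simp: MM_def simp del: W.simps)
      show "\<exists>e\<in>A. \<exists>f\<in>link S - A. MM S (v # ws) e f > 0" if A: "A \<subseteq> link S" "A \<noteq> {}" "A \<noteq> link S" for A
      proof -
        obtain e f where ef: "e \<in> A" "f \<in> link S - A" "f \<in> link (insert e S)"
          using link_connected[OF S _ A] d by auto
        then have "e \<noteq> f" "e \<in> link S" using A by auto
        then have "MM S (v # ws) e f > 0" using ef Mpos[of e f] by (simp add: MM_def del: W.simps)
        then show ?thesis using ef by blast
      qed
      show "slack v a e > 0" if "e \<in> link S" for e using a(2)[OF that] .
      show "m e = (\<Sum>f\<in>link S. MM S (v # ws) e f * slack v a f)" if "e \<in> link S" for e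
        unfolding m_def by (rule W_link[OF S _ that a(1)]) (use d in auto)
      show "m e > 0" if "e \<in> link S" for e by (rule mpos[OF that])
      show "(\<Sum>e\<in>link S. xi e * m e) = 0"
        using orth unfolding W.simps(2)[of S x] xi_def m_def .
      show "(\<Sum>e\<in>link S. \<Sum>f\<in>link S. y e * MM S (v # ws) e f * y f)
         \<le> (\<Sum>e\<in>link S. slack v a e * (\<Sum>f\<in>link S. MM S (v # ws) e f * y f)\<^sup>2 / m e)" for y
      proof -
        \<comment> \<open>Every vector on the facets is a vector of support numbers: take it as
          right-hand side, with the zero potential as gauge.\<close>
        define z where "z = (\<lambda>e. if e \<in> link S then y e else 0)"
        have z0: "slack z (\<lambda>_. 0) f = 0" if "f \<in> S" for f
          using that link_sub[OF S] by (auto simp: slack_def df_def z_def)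
        have zl: "slack z (\<lambda>_. 0) f = y f" if "f \<in> link S" for f
          using that by (auto simp: slack_def df_def z_def)
        have n: "(\<Sum>f\<in>link S. MM S (v # ws) e f * y f) = W (insert e S) (z # v # ws)" if e: "e \<in> link S" for e
        proof -
          have "W (insert e S) (z # v # ws) = (\<Sum>f\<in>link S. MM S (v # ws) e f * slack z (\<lambda>_. 0) f)"
            by (rule W_link[OF S _ e z0]) (use d in auto)
          then show ?thesis using zl by (simp del: W.simps)
        qed
        have "(\<Sum>e\<in>link S. \<Sum>f\<in>link S. y e * MM S (v # ws) e f * y f) = W S (z # z # v # ws)"
        proof -
          have "W S (z # z # v # ws) = (\<Sum>e\<in>link S. \<Sum>f\<in>link S. slack z (\<lambda>_. 0) e * MM S (v # ws) e f * slack z (\<lambda>_. 0) f)"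
            by (rule W_form[OF S _ z0 z0]) (use d in simp)
          then show ?thesis using zl by (simp del: W.simps)
        qed
        \<comment> \<open>With \<open>v\<close> in front, the form is a sum over the facets. On each
          of them the induction hypothesis gives the reverse Cauchy-Schwarz inequality for
          \<open>z\<close> and \<open>v\<close>, and its sum is the estimate
          \<open>pull\<close>.\<close>
        also have "\<dots> = W S (z # v # z # ws)" by (rule W_swap1[OF S]) (use d in simp)
        also have "\<dots> = W S (v # z # z # ws)" by (rule W_swap[OF S]) (use d in simp)
        also have "\<dots> = (\<Sum>e\<in>link S. slack v a e * W (insert e S) (z # z # ws))"
          by (rule W_gauge[OF S _ a(1)]) (use d in auto)
        also have "\<dots> \<le> (\<Sum>e\<in>link S. slack v a e * (\<Sum>f\<in>link S. MM S (v # ws) e f * y f)\<^sup>2 / m e)"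
        proof (rule sum_mono)
          fix e assume e: "e \<in> link S"
          have "W (insert e S) (z # z # ws) * W (insert e S) (v # v # ws) \<le> (W (insert e S) (z # v # ws))\<^sup>2"
            by (rule reverse_cauchy_schwarz[OF link_face[OF e] dl[OF e]])
              (use Cons.IH[OF link_face[OF e] dl[OF e] ws v] mpos[OF e] in \<open>auto simp: m_def simp del: W.simps\<close>)
          then have "W (insert e S) (z # z # ws) \<le> (\<Sum>f\<in>link S. MM S (v # ws) e f * y f)\<^sup>2 / m e"
            using mpos[OF e] unfolding n[OF e] m_def by (simp add: field_simps del: W.simps)
          then have "slack v a e * W (insert e S) (z # z # ws) \<le> slack v a e * ((\<Sum>f\<in>link S. MM S (v # ws) e f * y f)\<^sup>2 / m e)"
            using a(2)[OF e] by (intro mult_left_mono) auto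
          then show "slack v a e * W (insert e S) (z # z # ws) \<le> slack v a e * (\<Sum>f\<in>link S. MM S (v # ws) e f * y f)\<^sup>2 / m e"
            by (simp del: W.simps)
        qed
        finally show ?thesis .
      qed
    qed
    finally show ?thesis .
  qed
  show ?case
  proof (rule hyperbolic_change[OF S, where h = v and k = h])
    show "card S + 2 + length (v # ws) = dim" using d by simp
    show "W S (h # v # v # ws) > 0" "W S (h # h # v # ws) > 0"
      by (rule W_pos[OF S]; use d v ws Cons.prems in auto)+
  qed (use main Cons.prems in auto)
qed

lemma W_continuous:
  assumes "face S" "card S + length us = dim"
  shows "continuous_on UNIV (\<lambda>t::real. W S (map (\<lambda>(w, u) e. w e + t * u e) us))"
  using assms
proof (induction us arbitrary: S)
  case Nil then show ?case by simp
next
  case (Cons p us)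
  obtain w u where p: "p = (w, u)" by (cases p)
  have eq: "W S (map (\<lambda>(w, u) e. w e + t * u e) (p # us)) =
     (\<Sum>e\<in>link S. (slack w (pot S w) e + t * slack u (pot S u) e) * W (insert e S) (map (\<lambda>(w, u) e. w e + t * u e) us))" for t
  proof -
    have "W S ((\<lambda>e. w e + t * u e) # map (\<lambda>(w, u) e. w e + t * u e) us) =
       (\<Sum>e\<in>link S. slack (\<lambda>e. w e + t * u e) (\<lambda>v. pot S w v + t * pot S u v) e *
          W (insert e S) (map (\<lambda>(w, u) e. w e + t * u e) us))"
      by (rule W_gauge[OF Cons.prems(1)]) (use Cons.prems in \<open>auto simp: slack_lin pot[OF face_indep]\<close>)
    then show ?thesis by (simp add: p slack_lin del: W.simps)
  qed
  have "continuous_on UNIV (\<lambda>t. W (insert e S) (map (\<lambda>(w, u) e. w e + t * u e) us))" if "e \<in> link S" for e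
    by (rule Cons.IH[OF link_face[OF that]]) (use Cons.prems card_link[OF Cons.prems(1) that] in auto)
  then show ?case unfolding eq by (intro continuous_intros)
qed

text \<open>Adding \<open>t\<close> times the admissible \<open>w0\<close> turns weakly admissible
  arguments into admissible ones; then \<open>t\<close> tends to 0. The argument \<open>x\<close> is
  arbitrary and stays unperturbed.\<close>

theorem alexandrov_fenchel:
  assumes f: "face {}" and d: "2 + length vs = dim" and vs: "\<And>v. v \<in> set vs \<Longrightarrow> wadm v" and y: "wadm y"
  shows "W {} (x # x # vs) * W {} (y # y # vs) \<le> (W {} (x # y # vs))\<^sup>2"
proof -
  define sh where "sh = (\<lambda>t::real. \<lambda>(w, u) (e::'e). w e + t * u e :: real)"
  define ps where "ps = map (\<lambda>v. (v, w0)) vs"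
  have m0: "map (sh 0) ps = vs" by (simp add: ps_def sh_def o_def)
  have c: "continuous_on UNIV (\<lambda>t. W {} (map (sh t) (p # q # ps)))" for p q
    unfolding sh_def by (rule W_continuous[OF f]) (use d in \<open>simp add: ps_def\<close>)
  let ?x = "(x, \<lambda>_. 0)" and ?y = "(y, w0)"
  define G where "G = (\<lambda>t. (W {} (map (sh t) (?x # ?y # ps)))\<^sup>2
     - W {} (map (sh t) (?x # ?x # ps)) * W {} (map (sh t) (?y # ?y # ps)))"
  have "continuous_on UNIV G" unfolding G_def by (intro continuous_intros c)
  then have "(G \<longlongrightarrow> G 0) (at_right 0)"
    by (metis UNIV_I continuous_on_def tendsto_within_subset top_greatest)
  moreover have "\<forall>\<^sub>F t in at_right 0. G t \<ge> 0"
    using eventually_at_right_less[of "0::real"]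
  proof eventually_elim
    fix t :: real assume t: "0 < t"
    have ay: "adm (sh t ?y)" unfolding sh_def using adm_add[OF y adm_w0 t] by simp
    have avs: "adm v" if "v \<in> set (map (sh t) ps)" for v
      using that adm_add[OF vs adm_w0 t] by (auto simp: ps_def sh_def)
    have d': "card ({}::'e set) + 2 + length (map (sh t) ps) = dim" using d by (simp add: ps_def)
    have "W {} (z # z # map (sh t) ps) * W {} (sh t ?y # sh t ?y # map (sh t) ps) \<le> (W {} (z # sh t ?y # map (sh t) ps))\<^sup>2" for z
    proof (rule reverse_cauchy_schwarz[OF f d'])
      show "W {} (x # x # map (sh t) ps) \<le> 0" if "W {} (x # sh t ?y # map (sh t) ps) = 0" for x
        by (rule alexandrov_fenchel_hyperbolic[OF f d' avs ay that])
      show "W {} (sh t ?y # sh t ?y # map (sh t) ps) > 0"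
        by (rule W_pos[OF f]) (use d' ay avs in auto)
    qed
    then show "G t \<ge> 0" unfolding G_def list.map by (simp del: W.simps)
  qed
  ultimately have "G 0 \<ge> 0" by (intro tendsto_lowerbound[of G]) auto
  then show ?thesis unfolding G_def list.map m0 by (simp add: sh_def del: W.simps)
qed

end

section \<open>Genericity and cuts\<close>

lemma functional_sum:
  fixes \<phi> :: "('v \<Rightarrow> real) \<Rightarrow> real"
  assumes lin: "\<And>c a b. \<phi> (\<lambda>u. c * a u + b u) = c * \<phi> a + \<phi> b" and "finite R"
  shows "\<phi> (\<lambda>u. b u + (\<Sum>f\<in>R. c f * bb f u)) = \<phi> b + (\<Sum>f\<in>R. c f * \<phi> (bb f))"
  using assms(2)
proof (induction R)
  case (insert f R)
  have "(\<lambda>u. b u + (\<Sum>f\<in>insert f R. c f * bb f u)) = (\<lambda>u. c f * bb f u + (b u + (\<Sum>f\<in>R. c f * bb f u)))"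
    using insert.hyps by (simp add: algebra_simps)
  then show ?case using lin[of "c f" "bb f" "\<lambda>u. b u + (\<Sum>f\<in>R. c f * bb f u)"] insert by simp
qed simp

lemma functionals_dichotomy:
  fixes \<phi> :: "'e \<Rightarrow> ('v \<Rightarrow> real) \<Rightarrow> real"
  assumes "finite S" and "\<And>e c a b. \<phi> e (\<lambda>u. c * a u + b u) = c * \<phi> e a + \<phi> e b"
  shows "(\<forall>r. \<exists>b. \<forall>e\<in>S. \<phi> e b = r e) \<or> (\<exists>c. (\<exists>e\<in>S. c e \<noteq> 0) \<and> (\<forall>b. (\<Sum>e\<in>S. c e * \<phi> e b) = 0))"
  using assms(1)
proof (induction S)
  case empty then show ?case by simp
next
  case (insert e S)
  have lin: "\<phi> g (\<lambda>u. b u + (\<Sum>f\<in>S. c f * bb f u)) = \<phi> g b + (\<Sum>f\<in>S. c f * \<phi> g (bb f))" for g b c bb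
    by (rule functional_sum[OF assms(2) insert(1)])
  show ?case
  proof (cases "\<exists>c. (\<exists>e\<in>S. c e \<noteq> 0) \<and> (\<forall>b. (\<Sum>e\<in>S. c e * \<phi> e b) = 0)")
    case True
    then obtain c where c: "\<exists>e\<in>S. c e \<noteq> 0" "\<forall>b. (\<Sum>e\<in>S. c e * \<phi> e b) = 0" by auto
    have "(\<Sum>f\<in>S. (c(e := 0)) f * \<phi> f b) = (\<Sum>f\<in>S. c f * \<phi> f b)" for b
      using insert.hyps by (intro sum.cong) auto
    moreover have "\<exists>f\<in>insert e S. (c(e := 0)) f \<noteq> 0" using c(1) insert.hyps by force
    ultimately show ?thesis using c insert.hyps by (intro disjI2 exI[of _ "c(e := 0)"]) simp
  next
    case False
    then have surj: "\<forall>r. \<exists>b. \<forall>e\<in>S. \<phi> e b = r e" using insert.IH by auto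
    have "\<forall>f. \<exists>b. \<forall>g\<in>S. \<phi> g b = (if g = f then 1 else 0)"
    proof
      fix f show "\<exists>b. \<forall>g\<in>S. \<phi> g b = (if g = f then 1 else 0)"
        using surj[rule_format, of "\<lambda>g. if g = f then 1 else 0"] .
    qed
    then obtain bb where bb: "\<And>f g. g \<in> S \<Longrightarrow> \<phi> g (bb f) = (if g = f then 1 else 0)" by metis
    define cc where "cc = (\<lambda>f. if f = e then 1 else - \<phi> e (bb f))"
    show ?thesis
    proof (cases "\<forall>b. (\<Sum>f\<in>insert e S. cc f * \<phi> f b) = 0")
      case True
      then show ?thesis by (intro disjI2 exI[of _ cc]) (auto simp: cc_def)
    next
      case False
      then obtain b where b: "(\<Sum>f\<in>insert e S. cc f * \<phi> f b) \<noteq> 0" by auto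
      define d where "d = (\<lambda>u. b u + (\<Sum>f\<in>S. (- \<phi> f b) * bb f u))"
      have dS: "\<phi> g d = 0" if "g \<in> S" for g
      proof -
        have "(\<Sum>f\<in>S. (- \<phi> f b) * \<phi> g (bb f)) = (\<Sum>f\<in>S. if f = g then - \<phi> g b else 0)"
          by (intro sum.cong) (auto simp: bb[OF that])
        then show ?thesis unfolding d_def lin using that insert.hyps(1) by simp
      qed
      have "\<phi> e d = \<phi> e b + (\<Sum>f\<in>S. (- \<phi> f b) * \<phi> e (bb f))" unfolding d_def lin ..
      also have "\<dots> = (\<Sum>f\<in>insert e S. cc f * \<phi> f b)"
      proof -
        have "(\<Sum>f\<in>S. cc f * \<phi> f b) = (\<Sum>f\<in>S. (- \<phi> f b) * \<phi> e (bb f))"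
          using insert.hyps by (intro sum.cong) (auto simp: cc_def)
        then show ?thesis using insert.hyps by (simp add: cc_def)
      qed
      finally have de: "\<phi> e d \<noteq> 0" using b by simp
      have "\<exists>b. \<forall>f\<in>insert e S. \<phi> f b = r f" for r
      proof -
        obtain b0 where b0: "\<forall>f\<in>S. \<phi> f b0 = r f" using surj by blast
        define c0 where "c0 = (r e - \<phi> e b0) / \<phi> e d"
        have "\<phi> f (\<lambda>u. c0 * d u + b0 u) = r f" if "f \<in> insert e S" for f
          using that de b0 dS unfolding assms(2) c0_def by (cases "f = e") auto
        then show ?thesis by blast
      qed
      then show ?thesis by blast
    qed
  qed
qed

text \<open>A path needs a newly inserted edge only once, so each edge at most doubles the error and
  adds \<open>\<theta>\<close>. The exponential constant is crude, but the perturbation is chosen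
  small enough for it.\<close>

lemma rtrancl_potential_bound:
  fixes f :: "'b \<Rightarrow> real"
  assumes "finite R" "(i, j) \<in> R\<^sup>*" "\<And>x y. (x, y) \<in> R \<Longrightarrow> f y - f x \<ge> - \<theta>" "\<theta> \<ge> 0"
  shows "f j - f i \<ge> - (2 ^ card R * \<theta>)"
proof -
  have "f j - f i \<ge> - ((2 ^ card R - 1) * \<theta>)"
    using assms(1,2,3)
  proof (induction R arbitrary: i j)
    case empty then show ?case by simp
  next
    case (insert p R)
    obtain x y where p: "p = (x, y)" by (cases p)
    have IH: "f v - f u \<ge> - ((2 ^ card R - 1) * \<theta>)" if "(u, v) \<in> R\<^sup>*" for u v
      using insert.IH[OF that] insert.prems(2) by auto
    have K: "(2 ^ card R - 1) * \<theta> \<ge> 0" using assms(4) by simp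
    have c: "2 ^ card (insert p R) = 2 * (2 ^ card R :: real)" using insert.hyps by simp
    from insert.prems(1) have "(i, j) \<in> R\<^sup>* \<or> ((i, x) \<in> R\<^sup>* \<and> (y, j) \<in> R\<^sup>*)"
      unfolding p rtrancl_insert by auto
    then show ?case
    proof
      assume "(i, j) \<in> R\<^sup>*"
      from IH[OF this] have "f j - f i \<ge> - ((2 ^ card R - 1) * \<theta>)" .
      then show ?thesis unfolding c using K assms(4) by (simp add: algebra_simps)
    next
      assume "(i, x) \<in> R\<^sup>* \<and> (y, j) \<in> R\<^sup>*"
      then have "f x - f i \<ge> - ((2 ^ card R - 1) * \<theta>)" "f j - f y \<ge> - ((2 ^ card R - 1) * \<theta>)"
        using IH by auto
      moreover have "f y - f x \<ge> - \<theta>" using insert.prems(2)[of x y] p by simp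
      ultimately show ?thesis unfolding c by (simp add: algebra_simps)
    qed
  qed
  then show ?thesis using assms(4) by (simp add: algebra_simps)
qed

text \<open>Small antisymmetric weights avoiding finitely many hyperplanes: take powers of a small number
  \<open>\<theta>\<close>, so that every hyperplane excludes only the roots of a nonzero polynomial.\<close>

lemma generic_weights:
  fixes Y :: "'b set" and K :: "('b \<times> 'b) set \<Rightarrow> real" and c :: "('b \<times> 'b) set \<Rightarrow> 'b \<times> 'b \<Rightarrow> real"
  assumes Y: "finite Y" and \<delta>: "\<delta> > 0"
  obtains g :: "'b \<times> 'b \<Rightarrow> real" where
    "\<And>i j. g (j, i) = - g (i, j)" "\<And>e. \<bar>g e\<bar> \<le> \<delta>"
    "\<And>S. S \<subseteq> Y \<times> Y - Id \<Longrightarrow> (\<forall>i j. (i, j) \<in> S \<longrightarrow> (j, i) \<notin> S) \<Longrightarrow> \<exists>e\<in>S. c S e \<noteq> 0 \<Longrightarrow>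
      K S + (\<Sum>e\<in>S. c S e * g e) \<noteq> 0"
proof -
  obtain r :: "'b \<Rightarrow> nat" where r: "inj_on r Y" using finite_imp_inj_to_nat_seg[OF Y] by blast
  \<comment> \<open>The exponent depends on the unordered pair only, is injective on oriented edge
    sets, and is never 0, so the constant term \<open>K S\<close> does not interfere with the
    coefficients of the edges.\<close>
  define code where "code = (\<lambda>(i, j). Suc (prod_encode (min (r i) (r j), max (r i) (r j))))"
  define sg where "sg = (\<lambda>(i, j). if r i < r j then 1 else if r j < r i then -1 else (0::real))"
  define SS where "SS = {S. S \<subseteq> Y \<times> Y - Id \<and> (\<forall>i j. (i, j) \<in> S \<longrightarrow> (j, i) \<notin> S) \<and> (\<exists>e\<in>S. c S e \<noteq> 0)}"
  define P where "P = (\<lambda>S. [:K S:] + (\<Sum>e\<in>S. monom (c S e * sg e) (code e)))"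
  have "SS \<subseteq> Pow (Y \<times> Y)" by (auto simp: SS_def)
  then have finSS: "finite SS" using Y finite_subset by (metis finite_Pow_iff finite_cartesian_product)
  have inj: "inj_on code S" if S: "S \<in> SS" for S
  proof (rule inj_onI)
    fix e f assume e: "e \<in> S" and f: "f \<in> S" and eq: "code e = code f"
    obtain i j k l where ef: "e = (i, j)" "f = (k, l)" by (cases e, cases f) auto
    have Y4: "i \<in> Y" "j \<in> Y" "k \<in> Y" "l \<in> Y" using S e f ef by (auto simp: SS_def)
    have "min (r i) (r j) = min (r k) (r l)" "max (r i) (r j) = max (r k) (r l)"
      using eq by (auto simp: code_def ef)
    then have "(r i = r k \<and> r j = r l) \<or> (r i = r l \<and> r j = r k)" by (cases "r i \<le> r j"; cases "r k \<le> r l") auto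
    then have "(i = k \<and> j = l) \<or> (i = l \<and> j = k)" using r Y4 by (auto simp: inj_on_def)
    then show "e = f" using S e f ef by (auto simp: SS_def)
  qed
  have sgn: "sg e \<noteq> 0" if "S \<in> SS" "e \<in> S" for S e
    using that r by (cases e) (auto simp: SS_def sg_def inj_on_def)
  have finS: "finite S" if "S \<in> SS" for S using that Y by (auto simp: SS_def intro: finite_subset[of S "Y \<times> Y"])
  have nz: "P S \<noteq> 0" if S: "S \<in> SS" for S
  proof -
    obtain e where e: "e \<in> S" "c S e \<noteq> 0" using S by (auto simp: SS_def)
    have "code e \<noteq> 0" by (simp add: code_def split: prod.splits)
    then have "coeff [:K S:] (code e) = 0" by (simp add: coeff_pCons split: nat.splits)
    then have "coeff (P S) (code e) = (\<Sum>f\<in>S. coeff (monom (c S f * sg f) (code f)) (code e))"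
      unfolding P_def by (simp add: coeff_sum)
    also have "\<dots> = (\<Sum>f\<in>S. if f = e then c S e * sg e else 0)"
    proof (rule sum.cong[OF refl])
      fix f assume "f \<in> S"
      then have "code f = code e \<longleftrightarrow> f = e" using inj[OF S] e(1) by (auto simp: inj_on_def)
      then show "coeff (monom (c S f * sg f) (code f)) (code e) = (if f = e then c S e * sg e else 0)" by auto
    qed
    also have "\<dots> \<noteq> 0" using e finS[OF S] sgn[OF S e(1)] by simp
    finally show ?thesis by auto
  qed
  have "finite (\<Union>S\<in>SS. {x. poly (P S) x = 0})" using finSS poly_roots_finite nz by auto
  moreover have "infinite {0<..<min \<delta> 1}" using \<delta> by simp
  ultimately obtain \<theta> where \<theta>: "\<theta> \<in> {0<..<min \<delta> 1}" "\<theta> \<notin> (\<Union>S\<in>SS. {x. poly (P S) x = 0})"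
    by (meson finite_subset subsetI)
  define g where "g = (\<lambda>e. sg e * \<theta> ^ code e)"
  show ?thesis
  proof (rule that[of g])
    show "g (j, i) = - g (i, j)" for i j by (auto simp: g_def sg_def code_def min.commute max.commute)
    show "\<bar>g e\<bar> \<le> \<delta>" for e
    proof -
      have "\<bar>sg e\<bar> \<le> 1" by (cases e) (auto simp: sg_def)
      moreover have "\<theta> ^ code e \<le> \<theta> ^ 1" using \<theta>(1) by (intro power_decreasing) (auto simp: code_def split: prod.splits)
      ultimately have "\<bar>sg e\<bar> * \<theta> ^ code e \<le> 1 * \<theta>" using \<theta>(1) by (intro mult_mono) auto
      then show ?thesis using \<theta>(1) by (simp add: g_def abs_mult)
    qed
    show "K S + (\<Sum>e\<in>S. c S e * g e) \<noteq> 0"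
      if "S \<subseteq> Y \<times> Y - Id" "\<forall>i j. (i, j) \<in> S \<longrightarrow> (j, i) \<notin> S" "\<exists>e\<in>S. c S e \<noteq> 0" for S
    proof -
      have "S \<in> SS" using that by (auto simp: SS_def)
      then have "poly (P S) \<theta> \<noteq> 0" using \<theta>(2) by auto
      then show ?thesis by (simp add: P_def poly_sum poly_monom g_def mult.assoc)
    qed
  qed
qed

text \<open>The hyperplane of \<open>p\<close> cuts the polytope in two. The parts share the new
  facet, whose support numbers have opposite signs in the two recursions and cancel; the other
  facets are additive by induction.\<close>

lemma cut_additive:
  fixes V :: "'v set" and E :: "'e set"
  assumes A: "difference_system V E src tgt w0"
    and B: "difference_system V (insert p E) src tgt w0"
    and C: "difference_system V (insert q E) src tgt w0"
    and pq: "src q = tgt p" "tgt q = src p" "w0 q = - w0 p" "p \<notin> E" "q \<notin> E"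
    and S: "S \<subseteq> E" "card S + length vs = card V - 1" and vs: "\<And>v. v \<in> set vs \<Longrightarrow> v q = - v p"
  shows "difference_system.W E src tgt w0 S vs =
    difference_system.W (insert p E) src tgt w0 S vs + difference_system.W (insert q E) src tgt w0 S vs"
proof -
  interpret A: difference_system V E src tgt w0 by (rule A)
  interpret B: difference_system V "insert p E" src tgt w0 by (rule B)
  interpret C: difference_system V "insert q E" src tgt w0 by (rule C)
  have sq: "A.slack v a q = - A.slack v a p" if "v q = - v p" for v a
    using pq that by (simp add: A.slack_def A.df_def)
  have Bf: "B.face S \<longleftrightarrow> (\<exists>a. (\<forall>e\<in>S. A.slack w0 a e = 0) \<and> (\<forall>e\<in>E - S. A.slack w0 a e > 0) \<and> A.slack w0 a p > 0)"
    if "S \<subseteq> E" for S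
  proof -
    have "insert p E - S = insert p (E - S)" using that pq by auto
    then show ?thesis using that unfolding B.face_def by auto
  qed
  have Cf: "C.face S \<longleftrightarrow> (\<exists>a. (\<forall>e\<in>S. A.slack w0 a e = 0) \<and> (\<forall>e\<in>E - S. A.slack w0 a e > 0) \<and> A.slack w0 a p < 0)"
    if "S \<subseteq> E" for S
  proof -
    have "insert q E - S = insert q (E - S)" using that pq by auto
    then show ?thesis using that sq[of w0] pq(3) unfolding C.face_def by auto
  qed
  have BCf: "B.face (insert p S) \<longleftrightarrow> C.face (insert q S)" if "S \<subseteq> E" for S
  proof -
    have "insert p E - insert p S = E - S" "insert q E - insert q S = E - S" using that pq by auto
    then show ?thesis using that sq[of w0] pq(3) unfolding B.face_def C.face_def by auto
  qed
  have BC: "B.W (insert p S) us = C.W (insert q S) us" if "S \<subseteq> E" "\<And>v. v \<in> set us \<Longrightarrow> v q = - v p" for S us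
    using that
  proof (induction us arbitrary: S)
    case Nil then show ?case using BCf by simp
  next
    case (Cons v us)
    have l: "B.link (insert p S) = C.link (insert q S)"
    proof -
      have i: "insert e (insert p S) = insert p (insert e S)" "insert e (insert q S) = insert q (insert e S)" for e by auto
      show ?thesis unfolding B.link_def C.link_def i using Cons.prems(1) pq BCf by auto
    qed
    have sub: "e \<in> E" if "e \<in> C.link (insert q S)" for e using that by (auto simp: C.link_def)
    have "v q = - v p" using Cons.prems by simp
    then have po: "B.pot (insert p S) v = C.pot (insert q S) v"
      unfolding B.pot_def C.pot_def using sq[of v] by simp
    have "B.W (insert e (insert p S)) us = C.W (insert e (insert q S)) us" if "e \<in> C.link (insert q S)" for e
      using Cons.IH[of "insert e S"] sub[OF that] Cons.prems by (simp add: insert_commute)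
    then show ?case unfolding B.W.simps C.W.simps l po by (intro sum.cong) auto
  qed
  show ?thesis using S vs
  proof (induction vs arbitrary: S)
    case Nil
    then have cS: "card S = A.dim" "card S = B.dim" by (auto simp: A.dim_def B.dim_def)
    show ?case
    proof (cases "A.face S")
      case False
      then have "\<not> B.face S" "\<not> C.face S" using Bf[OF Nil(1)] Cf[OF Nil(1)] Nil(1) by (auto simp: A.face_def)
      then show ?thesis using False by simp
    next
      case True
      obtain a where a: "\<forall>e\<in>S. A.slack w0 a e = 0" "\<forall>e\<in>E - S. A.slack w0 a e > 0"
        using True by (auto simp: A.face_def)
      have uni: "A.slack w0 b p = A.slack w0 a p" if b: "\<forall>e\<in>S. A.slack w0 b e = 0" for b
      proof -
        have fl: "A.flat S (\<lambda>u. b u - a u)" by (rule A.flat_diff[of S w0]) (use a b in auto)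
        have "src p \<in> V" "tgt p \<in> V" using B.srcV B.tgtV by auto
        then have "A.df (\<lambda>u. b u - a u) p = 0"
          using A.flat_const[OF Nil(1) A.face_indep[OF True] cS(1) fl, of "src p" "tgt p"] by (simp add: A.df_def)
        then show ?thesis using A.slack_diff[of w0 b p a] by simp
      qed
      \<comment> \<open>A vertex is never on the cut, since genericity would make its
        \<open>dim\<close> tight inequalities together with \<open>p\<close> independent.\<close>
      have nz: "A.slack w0 a p \<noteq> 0"
      proof
        assume z: "A.slack w0 a p = 0"
        have "B.indep (insert p S)"
          unfolding B.indep_def B.df_def
          using B.generic[of "insert p S" a] Nil(1) a z by (auto simp: A.slack_def A.df_def)
        then have "card (insert p S) \<le> B.dim" using B.indep_card_le[of "insert p S"] Nil(1) by auto
        moreover have "card (insert p S) = Suc (card S)"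
          using pq(4) Nil(1) A.face_fin[OF True] by (intro card_insert_disjoint) auto
        ultimately show False using cS by simp
      qed
      show ?thesis
      proof (cases "A.slack w0 a p > 0")
        case pos: True
        have "B.face S" using Bf[OF Nil(1)] a pos by blast
        moreover have "\<not> C.face S" using Cf[OF Nil(1)] uni pos by force
        ultimately show ?thesis using True by simp
      next
        case neg: False
        then have "C.face S" using Cf[OF Nil(1)] a nz by (metis linorder_neqE_linordered_idom)
        moreover have "\<not> B.face S" using Bf[OF Nil(1)] uni neg by force
        ultimately show ?thesis using True by simp
      qed
    qed
  next
    case (Cons v vs)
    have dims: "A.dim = card V - 1" "B.dim = card V - 1" "C.dim = card V - 1"
      by (auto simp: A.dim_def B.dim_def C.dim_def)
    show ?case
    proof (cases "A.face S")
      case False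
      then have n: "\<not> B.face S" "\<not> C.face S" using Bf[OF Cons.prems(1)] Cf[OF Cons.prems(1)] Cons.prems(1)
        by (auto simp: A.face_def)
      show ?thesis unfolding A.W_nonface[OF False] B.W_nonface[OF n(1)] C.W_nonface[OF n(2)] by simp
    next
      case True
      define a where "a = A.pot S v"
      have a: "A.slack v a e = 0" if "e \<in> S" for e unfolding a_def using A.pot[OF A.face_indep[OF True] that] .
      have fin: "finite (E - S)" using A.finE by auto
      have cI: "card (insert e S) + length vs = card V - 1" if "e \<in> E - S" for e
        using that Cons.prems(2) A.face_fin[OF True] by simp
      have Aw: "A.W S (v # vs) = (\<Sum>e\<in>E - S. A.slack v a e * A.W (insert e S) vs)"
        by (rule A.W_gauge_all[OF _ a]) (use Cons.prems dims in auto)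
      have Bw: "B.W S (v # vs) = A.slack v a p * B.W (insert p S) vs + (\<Sum>e\<in>E - S. A.slack v a e * B.W (insert e S) vs)"
      proof -
        have "B.W S (v # vs) = (\<Sum>e\<in>insert p E - S. A.slack v a e * B.W (insert e S) vs)"
          by (rule B.W_gauge_all[OF _ a]) (use Cons.prems dims in auto)
        moreover have "insert p E - S = insert p (E - S)" "p \<notin> E - S" using Cons.prems pq by auto
        ultimately show ?thesis using fin by simp
      qed
      have Cw: "C.W S (v # vs) = A.slack v a q * C.W (insert q S) vs + (\<Sum>e\<in>E - S. A.slack v a e * C.W (insert e S) vs)"
      proof -
        have "C.W S (v # vs) = (\<Sum>e\<in>insert q E - S. A.slack v a e * C.W (insert e S) vs)"
          by (rule C.W_gauge_all[OF _ a]) (use Cons.prems dims in auto)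
        moreover have "insert q E - S = insert q (E - S)" "q \<notin> E - S" using Cons.prems pq by auto
        ultimately show ?thesis using fin by simp
      qed
      have "A.slack v a q = - A.slack v a p" using sq Cons.prems by simp
      moreover have "B.W (insert p S) vs = C.W (insert q S) vs" using BC[OF Cons.prems(1)] Cons.prems by simp
      moreover have "(\<Sum>e\<in>E - S. A.slack v a e * A.W (insert e S) vs) =
          (\<Sum>e\<in>E - S. A.slack v a e * B.W (insert e S) vs) + (\<Sum>e\<in>E - S. A.slack v a e * C.W (insert e S) vs)"
        unfolding sum.distrib[symmetric]
      proof (rule sum.cong[OF refl])
        fix e assume e: "e \<in> E - S"
        have "A.W (insert e S) vs = B.W (insert e S) vs + C.W (insert e S) vs"
          using Cons.IH[of "insert e S"] e Cons.prems cI[OF e] by auto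
        then show "A.slack v a e * A.W (insert e S) vs = A.slack v a e * B.W (insert e S) vs + A.slack v a e * C.W (insert e S) vs"
          by (simp add: distrib_left)
      qed
      ultimately show ?thesis unfolding Aw Bw Cw by simp
    qed
  qed
qed

section \<open>The order polytope of a poset with three marked elements\<close>

text \<open>The five points are spaced by about 1, apart from one near coincidence at which the
  \<open>p\<close> values agree. The tolerance 3/8 is 1/4 plus twice 1/16, as needed for
  \<open>vertex_order\<close>.\<close>

lemma five_points_order:
  fixes xb x1 x2 x3 xt pb p1 p2 p3 pt s t u :: real
  assumes "x1 = x2 - 1" "x3 = x2 + 1" "xt = xb + 3" "p1 = p2 - s" "p3 = p2 + t" "pt = pb + (s + t + u)"
    "s \<ge> 0" "t \<ge> 0" "u \<ge> 0"
    "\<bar>x1 - xb\<bar> \<le> 1 / 16 \<and> pb = p1 \<or> \<bar>x3 - xt\<bar> \<le> 1 / 16 \<and> pt = p3"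
    and mem: "(x, p) \<in> {(xb, pb), (x1, p1), (x2, p2), (x3, p3), (xt, pt)}" "(y, q) \<in> {(xb, pb), (x1, p1), (x2, p2), (x3, p3), (xt, pt)}"
    and xy: "y - x \<ge> - (3 / 8)"
  shows "p \<le> q"
proof -
  have "x = xb \<and> p = pb \<or> x = x1 \<and> p = p1 \<or> x = x2 \<and> p = p2 \<or> x = x3 \<and> p = p3 \<or> x = xt \<and> p = pt"
    "y = xb \<and> q = pb \<or> y = x1 \<and> q = p1 \<or> y = x2 \<and> q = p2 \<or> y = x3 \<and> q = p3 \<or> y = xt \<and> q = pt"
    using mem by auto
  then show ?thesis using assms(10)
    by (elim disjE conjE; insert assms(1-9) xy; linarith)
qed

locale gap_config =
  fixes Y :: "'b set" and bot top z1 z2 z3 :: 'b and g :: "'b \<times> 'b \<Rightarrow> real"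
  assumes finY: "finite Y" and inY: "bot \<in> Y" "top \<in> Y" "z1 \<in> Y" "z2 \<in> Y" "z3 \<in> Y"
    and dist: "distinct [bot, top, z1, z2, z3]"
begin

text \<open>The real position of \<open>y\<close> is \<open>off s t u y + a (nd y)\<close>: the elements \<open>z1\<close>, \<open>z3\<close> are tied to \<open>z2\<close> at
  distances \<open>s\<close>, \<open>t\<close>, and \<open>top\<close> is tied to \<open>bot\<close> at distance \<open>s + t + u\<close>. So \<open>H s t u\<close> is the
  right-hand side of a slice of the order polytope, and the antisymmetric \<open>g\<close> perturbs it.\<close>

definition nd :: "'b \<Rightarrow> 'b" where
  "nd i = (if i = z1 \<or> i = z3 then z2 else if i = top then bot else i)"

definition off :: "real \<Rightarrow> real \<Rightarrow> real \<Rightarrow> 'b \<Rightarrow> real" where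
  "off s t u i = (if i = z1 then - s else if i = z3 then t else if i = top then s + t + u else 0)"

definition H :: "real \<Rightarrow> real \<Rightarrow> real \<Rightarrow> 'b \<times> 'b \<Rightarrow> real" where
  "H s t u e = off s t u (snd e) - off s t u (fst e)"

definition w0 :: "'b \<times> 'b \<Rightarrow> real" where "w0 e = H 1 1 1 e + g e"

abbreviation (input) "esrc \<equiv> (\<lambda>e. nd (fst e))"
abbreviation (input) "etgt \<equiv> (\<lambda>e. nd (snd e))"

definition oriented :: "('b \<times> 'b) set \<Rightarrow> bool" where
  "oriented S \<longleftrightarrow> S \<subseteq> Y \<times> Y - Id \<and> (\<forall>i j. (i, j) \<in> S \<longrightarrow> (j, i) \<notin> S)"

definition spanning :: "('b \<times> 'b) set \<Rightarrow> bool" where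
  "spanning E \<longleftrightarrow> (\<forall>i\<in>Y. (bot, i) \<in> E\<^sup>* \<and> (i, top) \<in> E\<^sup>*)"

lemma card_nodes: "card (nd ` Y) = card Y - 3"
proof -
  have "nd ` Y = Y - {z1, z3, top}"
  proof
    show "nd ` Y \<subseteq> Y - {z1, z3, top}" using inY dist by (auto simp: nd_def)
    show "Y - {z1, z3, top} \<subseteq> nd ` Y"
    proof
      fix y assume "y \<in> Y - {z1, z3, top}"
      then have "nd y = y" "y \<in> Y" by (auto simp: nd_def)
      then show "y \<in> nd ` Y" by force
    qed
  qed
  moreover have "card {z1, z3, top} = 3" using dist by auto
  ultimately show ?thesis using inY finY by (simp add: card_Diff_subset)
qed

end

text \<open>The bound on \<open>g\<close> makes the errors along any path add up to at most 1/16.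
  Genericity concerns oriented edge sets, because by antisymmetry opposite edges describe the same
  hyperplane.\<close>

locale generic_config = gap_config Y bot top z1 z2 z3 g
  for Y :: "'b set" and bot top z1 z2 z3 :: 'b and g :: "'b \<times> 'b \<Rightarrow> real" +
  assumes g_anti: "\<And>i j. g (j, i) = - g (i, j)"
    and g_small: "\<And>e. \<bar>g e\<bar> \<le> 1 / (16 * 2 ^ card (Y \<times> Y))"
    and g_generic: "\<And>S a r. oriented S \<Longrightarrow> (\<forall>e\<in>S. w0 e + (a (nd (snd e)) - a (nd (fst e))) = 0) \<Longrightarrow>
      \<exists>b::'b \<Rightarrow> real. \<forall>e\<in>S. b (nd (snd e)) - b (nd (fst e)) = r e"
begin

lemma system:
  assumes "oriented E" "spanning E"
  shows "difference_system (nd ` Y) E esrc etgt w0"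
proof
  have E: "E \<subseteq> Y \<times> Y" using assms(1) by (auto simp: oriented_def)
  show "finite (nd ` Y)" "nd ` Y \<noteq> {}" using finY inY by auto
  show "finite E" using E finY by (meson finite_SigmaI finite_subset)
  show "\<And>e. e \<in> E \<Longrightarrow> nd (fst e) \<in> nd ` Y" "\<And>e. e \<in> E \<Longrightarrow> nd (snd e) \<in> nd ` Y" using E by auto
  show "\<exists>b::'b \<Rightarrow> real. \<forall>e\<in>S. b (nd (snd e)) - b (nd (fst e)) = r e"
    if "S \<subseteq> E" "\<forall>e\<in>S. w0 e + (a (nd (snd e)) - a (nd (fst e))) = 0" for S a and r :: "'b \<times> 'b \<Rightarrow> real"
  proof (rule g_generic[OF _ that(2)])
    show "oriented S" using assms(1) that(1) unfolding oriented_def by blast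
  qed
  fix b :: "'b \<Rightarrow> real" and u v
  assume b: "\<forall>e\<in>E. 0 \<le> b (nd (snd e)) - b (nd (fst e))" and uv: "u \<in> nd ` Y" "v \<in> nd ` Y"
  have mono: "b (nd i) \<le> b (nd j)" if "(i, j) \<in> E\<^sup>*" for i j
    using that
  proof (induction rule: rtrancl_induct)
    case (step y z)
    then show ?case using b[rule_format, of "(y, z)"] by simp
  qed simp
  have "nd top = nd bot" using dist by (simp add: nd_def)
  then have c: "b (nd i) = b (nd bot)" if "i \<in> Y" for i
    using mono[of bot i] mono[of i top] that assms(2) by (force simp: spanning_def)
  show "b u = b v" using uv c by auto
qed

abbreviation "FW E \<equiv> difference_system.W E esrc etgt w0"

text \<open>Components in \<open>Y\<close> itself, before \<open>nd\<close> ties the marks together: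
  elements of one class sit at the same position, whereas \<open>blk\<close> relates nodes that
  merely move together.\<close>

definition bl :: "('b \<times> 'b) set \<Rightarrow> ('b \<times> 'b) set" where "bl S = (S \<union> S\<inverse>)\<^sup>*"

definition pos_at :: "real \<Rightarrow> real \<Rightarrow> real \<Rightarrow> ('b \<Rightarrow> real) \<Rightarrow> 'b \<Rightarrow> real" where
  "pos_at s t u a i = off s t u i + a (nd i)"

lemma bl_sym: "(i, j) \<in> bl S \<Longrightarrow> (j, i) \<in> bl S"
  unfolding bl_def by (metis converse_Un converse_converse rtrancl_converseD sup_commute)

lemma bl_trans: "(i, j) \<in> bl S \<Longrightarrow> (j, k) \<in> bl S \<Longrightarrow> (i, k) \<in> bl S"
  unfolding bl_def by (rule rtrancl_trans)

lemma bl_refl [simp]: "(i, i) \<in> bl S" by (simp add: bl_def)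

lemma bl_insert:
  "(x, y) \<in> bl (insert e S) \<longleftrightarrow> (x, y) \<in> bl S \<or> (x, fst e) \<in> bl S \<and> (snd e, y) \<in> bl S \<or> (x, snd e) \<in> bl S \<and> (fst e, y) \<in> bl S"
proof
  obtain p q where e: "e = (p, q)" by (cases e)
  show "(x, y) \<in> bl S \<or> (x, fst e) \<in> bl S \<and> (snd e, y) \<in> bl S \<or> (x, snd e) \<in> bl S \<and> (fst e, y) \<in> bl S"
    if "(x, y) \<in> bl (insert e S)"
    using that unfolding bl_def[of "insert e S"]
  proof (induction rule: rtrancl_induct)
    case base then show ?case by simp
  next
    case (step y z)
    have "(y, z) \<in> bl S \<or> (y = p \<and> z = q) \<or> (y = q \<and> z = p)"
      using step(2) e by (auto simp: bl_def)
    then consider "(y, z) \<in> bl S" | "y = p" "z = q" | "y = q" "z = p" by blast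
    then show ?case
    proof cases
      case 1
      then show ?thesis using step(3) bl_trans[of _ y S z] by blast
    next
      case 2 then show ?thesis using step(3) e by auto
    next
      case 3 then show ?thesis using step(3) e by auto
    qed
  qed
  have mono: "bl S \<subseteq> bl (insert e S)" unfolding bl_def by (rule rtrancl_mono) auto
  have pq: "(p, q) \<in> bl (insert e S)" "(q, p) \<in> bl (insert e S)" unfolding bl_def e by auto
  show "(x, y) \<in> bl (insert e S)"
    if "(x, y) \<in> bl S \<or> (x, fst e) \<in> bl S \<and> (snd e, y) \<in> bl S \<or> (x, snd e) \<in> bl S \<and> (fst e, y) \<in> bl S"
  proof -
    have m: "(u, v) \<in> bl (insert e S)" if "(u, v) \<in> bl S" for u v using that mono by auto
    from that have "(x, y) \<in> bl S \<or> (x, p) \<in> bl S \<and> (q, y) \<in> bl S \<or> (x, q) \<in> bl S \<and> (p, y) \<in> bl S"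
      by (simp add: e)
    then show ?thesis
    proof (elim disjE conjE)
      assume "(x, p) \<in> bl S" "(q, y) \<in> bl S"
      then show ?thesis using bl_trans[OF bl_trans[OF m pq(1)] m] e by auto
    next
      assume "(x, q) \<in> bl S" "(p, y) \<in> bl S"
      then show ?thesis using bl_trans[OF bl_trans[OF m pq(2)] m] e by auto
    qed (use m e in auto)
  qed
qed

lemma pos_bl:
  assumes "(i, j) \<in> bl S" "\<And>e. e \<in> S \<Longrightarrow> H s t u e + (a (nd (snd e)) - a (nd (fst e))) = 0"
  shows "pos_at s t u a i = pos_at s t u a j"
  using assms(1) unfolding bl_def
proof (induction rule: rtrancl_induct)
  case (step y z)
  then have "(y, z) \<in> S \<or> (z, y) \<in> S" by auto
  then show ?case using assms(2)[of "(y, z)"] assms(2)[of "(z, y)"] step.IH by (auto simp: H_def pos_at_def)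
qed simp

lemma path_almost_monotone:
  assumes "R \<subseteq> Y \<times> Y" "(i, j) \<in> R\<^sup>*" "\<And>x y. (x, y) \<in> R \<Longrightarrow> X y - X x \<ge> - (1 / (16 * 2 ^ card (Y \<times> Y)))"
  shows "X j - X i \<ge> - (1 / 16 :: real)"
proof -
  have fin: "finite (Y \<times> Y)" using finY by simp
  have c: "card R \<le> card (Y \<times> Y)" using card_mono[OF fin assms(1)] .
  have "X j - X i \<ge> - (2 ^ card R * (1 / (16 * 2 ^ card (Y \<times> Y))))"
    by (rule rtrancl_potential_bound[OF finite_subset[OF assms(1) fin] assms(2,3)]) auto
  moreover have "(2::real) ^ card R \<le> 2 ^ card (Y \<times> Y)" using c by (intro power_increasing) auto
  then have "(2::real) ^ card R * (1 / (16 * 2 ^ card (Y \<times> Y))) \<le> 1 / 16" by (simp add: field_simps)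
  ultimately show ?thesis by linarith
qed

lemma near_bl:
  assumes S: "S \<subseteq> Y \<times> Y" "(i, j) \<in> bl S" and t: "\<And>e. e \<in> S \<Longrightarrow> w0 e + (a (nd (snd e)) - a (nd (fst e))) = 0"
  shows "\<bar>pos_at 1 1 1 a j - pos_at 1 1 1 a i\<bar> \<le> 1 / 16"
proof -
  let ?X = "pos_at 1 1 1 a"
  have st: "?X y - ?X x \<ge> - (1 / (16 * 2 ^ card (Y \<times> Y)))" if "(x, y) \<in> S \<union> S\<inverse>" for x y
    using that t[of "(x, y)"] t[of "(y, x)"] g_small[of "(x, y)"] g_small[of "(y, x)"]
    by (auto simp: w0_def H_def pos_at_def)
  have sub: "S \<union> S\<inverse> \<subseteq> Y \<times> Y" using S by auto
  have "?X v - ?X u \<ge> - (1 / 16)" if "(u, v) \<in> bl S" for u v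
    by (rule path_almost_monotone[OF sub _ st]) (use that in \<open>auto simp: bl_def\<close>)
  from this[OF S(2)] this[OF bl_sym[OF S(2)]] show ?thesis by linarith
qed

end

locale config_system = generic_config Y bot top z1 z2 z3 g
  for Y :: "'b set" and bot top z1 z2 z3 :: 'b and g :: "'b \<times> 'b \<Rightarrow> real" +
  fixes E :: "('b \<times> 'b) set"
  assumes oE: "oriented E" and sE: "spanning E"
begin

sublocale difference_system "nd ` Y" E esrc etgt w0
  by (rule system[OF oE sE])

lemma EY: "E \<subseteq> Y \<times> Y" using oE by (auto simp: oriented_def)

lemma slack_pos: "slack (H s t u) a (i, j) = pos_at s t u a j - pos_at s t u a i"
  by (simp add: slack_def df_def H_def pos_at_def)

lemma slack_w0: "slack w0 a (i, j) = pos_at 1 1 1 a j - pos_at 1 1 1 a i + g (i, j)"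
  by (simp add: slack_def df_def H_def pos_at_def w0_def)

lemma pos_refs:
  "pos_at s t u a z1 = pos_at s t u a z2 - s" "pos_at s t u a z3 = pos_at s t u a z2 + t"
  "pos_at s t u a top = pos_at s t u a bot + (s + t + u)"
  using dist by (auto simp: pos_at_def off_def nd_def)

lemma tight_bl:
  assumes "face S" "\<And>e. e \<in> S \<Longrightarrow> slack w0 a e = 0" "(i, j) \<in> bl S"
  shows "\<bar>pos_at 1 1 1 a j - pos_at 1 1 1 a i\<bar> \<le> 1 / 16"
  by (rule near_bl[OF _ assms(3)]) (use assms face_sub[OF assms(1)] EY in \<open>auto simp: slack_def df_def\<close>)

lemma feasible_path:
  assumes "\<And>e. e \<in> E \<Longrightarrow> slack w0 a e \<ge> 0" "(i, j) \<in> E\<^sup>*"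
  shows "pos_at 1 1 1 a j - pos_at 1 1 1 a i \<ge> - (1 / 16)"
proof (rule path_almost_monotone[OF EY assms(2)])
  fix x y assume "(x, y) \<in> E"
  then show "pos_at 1 1 1 a y - pos_at 1 1 1 a x \<ge> - (1 / (16 * 2 ^ card (Y \<times> Y)))"
    using assms(1)[of "(x, y)"] g_small[of "(x, y)"] unfolding slack_w0 by linarith
qed

section \<open>Vertices of the perturbed slice\<close>

context
  fixes T
  assumes T: "face T" and cT: "card T = dim"
begin

text \<open>A component without a reference point could be translated alone, which is impossible at
  a vertex.\<close>

lemma block_has_ref:
  assumes i: "i \<in> Y" shows "\<exists>r\<in>{bot, z1, z2, z3, top}. (i, r) \<in> bl T"
proof (rule ccontr)
  assume n: "\<not> ?thesis"
  define b where "b = (\<lambda>v. if (i, v) \<in> bl T then 1 else (0::real))"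
  have ni: "nd j = j" if "(i, j) \<in> bl T" for j using n that by (auto simp: nd_def)
  have nn: "(i, nd j) \<in> bl T \<longleftrightarrow> (i, j) \<in> bl T" for j using ni[of j] n by (auto simp: nd_def)
  have "flat T b"
    unfolding flat_def
  proof
    fix e assume e: "e \<in> T"
    then have "(fst e, snd e) \<in> bl T" by (auto simp: bl_def)
    then have "(i, fst e) \<in> bl T \<longleftrightarrow> (i, snd e) \<in> bl T"
      using bl_trans[of i "fst e" T "snd e"] bl_trans[of i "snd e" T "fst e"] bl_sym[of "fst e" "snd e"] by blast
    then show "df b e = 0" by (simp add: df_def b_def nn)
  qed
  then have "b (nd i) = b (nd z2)"
    using flat_const[OF face_sub[OF T] face_indep[OF T] cT] i inY by blast
  then show False using n by (auto simp: b_def nn)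
qed

text \<open>Otherwise the rigid cluster of \<open>bot\<close> and \<open>top\<close> could slide
  against the rigid cluster of \<open>z1\<close>, \<open>z2\<close>, \<open>z3\<close>.\<close>

lemma clusters_meet: "\<exists>p\<in>{bot, top}. \<exists>r\<in>{z1, z2, z3}. (p, r) \<in> bl T"
proof (rule ccontr)
  assume n: "\<not> ?thesis"
  define K where "K = {v. (bot, v) \<in> bl T \<or> (top, v) \<in> bl T}"
  have nn: "nd j \<in> K \<longleftrightarrow> j \<in> K" for j using n by (auto simp: nd_def K_def)
  have "flat T (indicator K)"
    unfolding flat_def
  proof
    fix e assume e: "e \<in> T"
    then have "(fst e, snd e) \<in> bl T" by (auto simp: bl_def)
    then have "fst e \<in> K \<longleftrightarrow> snd e \<in> K" unfolding K_def
      using bl_trans[of _ "fst e" T "snd e"] bl_trans[of _ "snd e" T "fst e"] bl_sym[of "fst e" "snd e"] by blast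
    then show "df (indicator K) e = 0" by (simp add: df_def nn indicator_def)
  qed
  then have "(indicator K (nd bot) :: real) = indicator K (nd z2)"
    using flat_const[OF face_sub[OF T] face_indep[OF T] cT] inY by blast
  moreover have "bot \<in> K" "z2 \<notin> K" using n by (auto simp: K_def)
  ultimately show False by (simp add: indicator_def nn)
qed

text \<open>The clusters have lengths 3 and 2, and up to 1/16 the second lies inside the first, so
  they can touch only at a common end.\<close>

lemma cluster_cases: "(bot, z1) \<in> bl T \<or> (top, z3) \<in> bl T"
proof -
  let ?a = "pot T w0"
  let ?X = "pos_at 1 1 1 ?a"
  have ti: "slack w0 ?a e = 0" if "e \<in> T" for e by (rule pot[OF face_indep[OF T] that])
  have fe: "slack w0 ?a e \<ge> 0" if "e \<in> E" for e
    using adm_w0 T cT that ti by (cases "e \<in> T") (auto simp: adm_def intro: less_imp_le)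
  have "?X z1 - ?X bot \<ge> - (1 / 16)" "?X top - ?X z3 \<ge> - (1 / 16)"
    using feasible_path[OF fe] sE inY by (auto simp: spanning_def)
  moreover obtain p r where pr: "p \<in> {bot, top}" "r \<in> {z1, z2, z3}" "(p, r) \<in> bl T" using clusters_meet by blast
  moreover have "\<bar>?X r - ?X p\<bar> \<le> 1 / 16" by (rule tight_bl[OF T ti pr(3)])
  ultimately show ?thesis using pos_refs[of 1 1 1 ?a] by auto
qed

text \<open>Every element is tied to a reference point, so a vertex is described by five positions.
  These depend on \<open>s\<close>, \<open>t\<close>, \<open>u\<close> but keep their order, which
  makes the polytope of \<open>H s t u\<close> a degeneration of that of \<open>w0\<close>.\<close>

lemma vertex_order:
  assumes i: "i \<in> Y" and j: "j \<in> Y" and stu: "s \<ge> 0" "t \<ge> 0" "u \<ge> 0"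
    and X: "pos_at 1 1 1 (pot T w0) j - pos_at 1 1 1 (pot T w0) i \<ge> - (1 / 4)"
  shows "pos_at s t u (pot T (H s t u)) j \<ge> pos_at s t u (pot T (H s t u)) i"
proof -
  let ?a = "pot T w0"
  let ?X = "pos_at 1 1 1 ?a" and ?P = "pos_at s t u (pot T (H s t u))"
  have ti: "slack w0 ?a e = 0" if "e \<in> T" for e by (rule pot[OF face_indep[OF T] that])
  have tP: "H s t u e + (pot T (H s t u) (nd (snd e)) - pot T (H s t u) (nd (fst e))) = 0" if "e \<in> T" for e
    using pot[OF face_indep[OF T] that, of "H s t u"] by (simp add: slack_def df_def)
  obtain p where p: "p \<in> {bot, z1, z2, z3, top}" "(i, p) \<in> bl T" using block_has_ref[OF i] by blast
  obtain q where q: "q \<in> {bot, z1, z2, z3, top}" "(j, q) \<in> bl T" using block_has_ref[OF j] by blast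
  have nearX: "\<bar>?X p - ?X i\<bar> \<le> 1 / 16" "\<bar>?X q - ?X j\<bar> \<le> 1 / 16"
    using tight_bl[OF T ti] p q by auto
  have PP: "?P i = ?P p" "?P j = ?P q" using pos_bl[OF _ tP] p q by auto
  have "\<bar>?X z1 - ?X bot\<bar> \<le> 1 / 16 \<and> ?P bot = ?P z1 \<or> \<bar>?X z3 - ?X top\<bar> \<le> 1 / 16 \<and> ?P top = ?P z3"
    using cluster_cases tight_bl[OF T ti] pos_bl[OF _ tP] by meson
  note disj = this
  note r = pos_refs[of 1 1 1 ?a] and r' = pos_refs[of s t u "pot T (H s t u)"]
  have r3: "?X top = ?X bot + 3" using r(3) by simp
  have "?P p \<le> ?P q"
  proof (rule five_points_order[OF r(1,2) r3 r' stu disj, where x = "?X p" and y = "?X q"])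
    show "(?X p, ?P p) \<in> {(?X bot, ?P bot), (?X z1, ?P z1), (?X z2, ?P z2), (?X z3, ?P z3), (?X top, ?P top)}"
      using p(1) by blast
    show "(?X q, ?P q) \<in> {(?X bot, ?P bot), (?X z1, ?P z1), (?X z2, ?P z2), (?X z3, ?P z3), (?X top, ?P top)}"
      using q(1) by blast
    show "?X q - ?X p \<ge> - (3 / 8)" using nearX X by linarith
  qed
  then show ?thesis using PP by simp
qed

text \<open>Reference points closer than 3/8 are equal or are the touching ends of the two clusters,
  which are tied already.\<close>

lemma vertex_close:
  assumes i: "i \<in> Y" and j: "j \<in> Y"
    and X: "\<bar>pos_at 1 1 1 (pot T w0) j - pos_at 1 1 1 (pot T w0) i\<bar> \<le> 1 / 4"
  shows "(i, j) \<in> bl T"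
proof -
  let ?a = "pot T w0"
  let ?X = "pos_at 1 1 1 ?a"
  have ti: "slack w0 ?a e = 0" if "e \<in> T" for e by (rule pot[OF face_indep[OF T] that])
  obtain p where p: "p \<in> {bot, z1, z2, z3, top}" "(i, p) \<in> bl T" using block_has_ref[OF i] by blast
  obtain q where q: "q \<in> {bot, z1, z2, z3, top}" "(j, q) \<in> bl T" using block_has_ref[OF j] by blast
  have nearX: "\<bar>?X p - ?X i\<bar> \<le> 1 / 16" "\<bar>?X q - ?X j\<bar> \<le> 1 / 16"
    using tight_bl[OF T ti] p q by auto
  have close: "\<bar>?X q - ?X p\<bar> \<le> 3 / 8" using nearX X by linarith
  note r = pos_refs[of 1 1 1 ?a]
  have r3: "?X top = ?X bot + 3" using r(3) by simp
  have "p = q \<or> (p, q) \<in> bl T"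
    using cluster_cases
  proof
    assume c: "(bot, z1) \<in> bl T"
    have d: "\<bar>?X z1 - ?X bot\<bar> \<le> 1 / 16" using tight_bl[OF T ti c] by auto
    have "\<not> \<bar>?X bot - ?X z2\<bar> \<le> 3 / 8" "\<not> \<bar>?X bot - ?X z3\<bar> \<le> 3 / 8" "\<not> \<bar>?X bot - ?X top\<bar> \<le> 3 / 8" "\<not> \<bar>?X z1 - ?X z2\<bar> \<le> 3 / 8" "\<not> \<bar>?X z1 - ?X z3\<bar> \<le> 3 / 8" "\<not> \<bar>?X z1 - ?X top\<bar> \<le> 3 / 8" "\<not> \<bar>?X z2 - ?X z3\<bar> \<le> 3 / 8" "\<not> \<bar>?X z2 - ?X top\<bar> \<le> 3 / 8" "\<not> \<bar>?X z3 - ?X top\<bar> \<le> 3 / 8" "\<not> \<bar>?X z2 - ?X bot\<bar> \<le> 3 / 8" "\<not> \<bar>?X z3 - ?X bot\<bar> \<le> 3 / 8" "\<not> \<bar>?X top - ?X bot\<bar> \<le> 3 / 8" "\<not> \<bar>?X z2 - ?X z1\<bar> \<le> 3 / 8" "\<not> \<bar>?X z3 - ?X z1\<bar> \<le> 3 / 8" "\<not> \<bar>?X top - ?X z1\<bar> \<le> 3 / 8" "\<not> \<bar>?X z3 - ?X z2\<bar> \<le> 3 / 8" "\<not> \<bar>?X top - ?X z2\<bar> \<le> 3 / 8" "\<not> \<bar>?X top - ?X z3\<bar> \<le> 3 / 8"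
      using r(1,2) r3 d by linarith+
    then have "p = q \<or> (p = bot \<and> q = z1) \<or> (p = z1 \<and> q = bot)"
      using p(1) q(1) close by blast
    then show ?thesis using c bl_sym by blast
  next
    assume c: "(top, z3) \<in> bl T"
    have d: "\<bar>?X z3 - ?X top\<bar> \<le> 1 / 16" using tight_bl[OF T ti c] by auto
    have "\<not> \<bar>?X bot - ?X z3\<bar> \<le> 3 / 8" "\<not> \<bar>?X bot - ?X top\<bar> \<le> 3 / 8" "\<not> \<bar>?X z1 - ?X z3\<bar> \<le> 3 / 8" "\<not> \<bar>?X z1 - ?X top\<bar> \<le> 3 / 8" "\<not> \<bar>?X z2 - ?X z3\<bar> \<le> 3 / 8" "\<not> \<bar>?X z2 - ?X top\<bar> \<le> 3 / 8" "\<not> \<bar>?X bot - ?X z1\<bar> \<le> 3 / 8" "\<not> \<bar>?X bot - ?X z2\<bar> \<le> 3 / 8" "\<not> \<bar>?X z1 - ?X z2\<bar> \<le> 3 / 8" "\<not> \<bar>?X z3 - ?X bot\<bar> \<le> 3 / 8" "\<not> \<bar>?X top - ?X bot\<bar> \<le> 3 / 8" "\<not> \<bar>?X z3 - ?X z1\<bar> \<le> 3 / 8" "\<not> \<bar>?X top - ?X z1\<bar> \<le> 3 / 8" "\<not> \<bar>?X z3 - ?X z2\<bar> \<le> 3 / 8" "\<not> \<bar>?X top - ?X z2\<bar> \<le> 3 / 8" "\<not> \<bar>?X z1 - ?X bot\<bar> \<le> 3 / 8" "\<not> \<bar>?X z2 - ?X bot\<bar> \<le> 3 / 8" "\<not>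 \<bar>?X z2 - ?X z1\<bar> \<le> 3 / 8"
      using r(1,2) r3 d by linarith+
    then have "p = q \<or> (p = top \<and> q = z3) \<or> (p = z3 \<and> q = top)"
      using p(1) q(1) close by blast
    then show ?thesis using c bl_sym by blast
  qed
  then show ?thesis using p(2) bl_sym[OF q(2)] bl_trans[of i p T q] bl_trans[of i q T j] by auto
qed

end

lemma wadm_H: "s \<ge> 0 \<Longrightarrow> t \<ge> 0 \<Longrightarrow> u \<ge> 0 \<Longrightarrow> wadm (H s t u)"
  unfolding wadm_def
proof (intro allI impI ballI)
  fix T e assume stu: "s \<ge> 0" "t \<ge> 0" "u \<ge> 0" and T: "face T" "card T = dim" and e: "e \<in> E - T"
  obtain i j where ij: "e = (i, j)" by (cases e)
  then have Y: "i \<in> Y" "j \<in> Y" using e EY by auto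
  have "slack w0 (pot T w0) (i, j) > 0" using adm_w0 T e ij by (auto simp: adm_def)
  moreover have "1 / (16 * 2 ^ card (Y \<times> Y)) \<le> (1 / 16 :: real)" by simp
  ultimately have "pos_at 1 1 1 (pot T w0) j - pos_at 1 1 1 (pot T w0) i \<ge> - (1 / 4)"
    unfolding slack_w0 using g_small[of "(i, j)"] by linarith
  from vertex_order[OF T Y stu this] show "slack (H s t u) (pot T (H s t u)) e \<ge> 0"
    unfolding ij slack_pos by simp
qed

text \<open>A system containing a directed 3-cycle describes a polytope that is degenerate in all
  directions \<open>H s t u\<close>, hence has no mixed volume there.\<close>

lemma directed_cycle_degenerate:
  assumes cyc: "(i, v) \<in> E" "(v, j) \<in> E" "(j, i) \<in> E"
    and S: "card S + length hs = dim" "S \<subseteq> E" "\<not> ((i, v) \<in> bl S \<and> (v, j) \<in> bl S)"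
    and hs: "\<And>h. h \<in> set hs \<Longrightarrow> \<exists>s t u. h = H s t u"
  shows "W S hs = 0"
  using S hs
proof (induction hs arbitrary: S)
  case Nil
  show ?case
  proof (cases "face S")
    case True
    have c: "card S = dim" using Nil by simp
    have Y: "i \<in> Y" "v \<in> Y" "j \<in> Y" using cyc EY by auto
    let ?X = "pos_at 1 1 1 (pot S w0)"
    have fe: "slack w0 (pot S w0) e \<ge> 0" if "e \<in> E" for e
      using adm_w0 True c that pot[OF face_indep[OF True], of e w0] by (cases "e \<in> S") (auto simp: adm_def intro: less_imp_le)
    have "?X v - ?X i \<ge> - (1 / 16)" "?X j - ?X v \<ge> - (1 / 16)" "?X i - ?X j \<ge> - (1 / 16)"
      using feasible_path[OF fe] cyc by blast+
    then have "\<bar>?X v - ?X i\<bar> \<le> 1 / 4" "\<bar>?X j - ?X v\<bar> \<le> 1 / 4" by linarith+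
    then have "(i, v) \<in> bl S" "(v, j) \<in> bl S" using vertex_close[OF True c] Y by auto
    then show ?thesis using Nil by simp
  qed simp
next
  case (Cons h hs)
  show ?case
  proof (cases "face S")
    case False then show ?thesis by (rule W_nonface)
  next
    case F: True
    obtain s t u where h: "h = H s t u" using Cons.prems(4)[of h] by auto
    have IH: "W (insert e S) hs = 0"
      if "e \<in> link S" "\<not> ((i, v) \<in> bl (insert e S) \<and> (v, j) \<in> bl (insert e S))" for e
      by (rule Cons.IH) (use Cons.prems that card_link[OF F that(1)] link_sub[OF F that(1)] in auto)
    show ?thesis
    proof (cases "\<exists>e\<in>link S. (i, v) \<in> bl (insert e S) \<and> (v, j) \<in> bl (insert e S)")
      case False
      then show ?thesis using IH by simp
    next
      case True
      \<comment> \<open>If some facet \<open>e0\<close> ties the whole cycle together, gauge by its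
        potential. Any other facet that does so joins the classes of the same pair
        \<open>(x, y)\<close>, so its slack vanishes in this gauge.\<close>
      then obtain e0 where e0: "e0 \<in> link S" "(i, v) \<in> bl (insert e0 S)" "(v, j) \<in> bl (insert e0 S)" by auto
      obtain x y where xy: "(x, y) \<notin> bl S" "(x, y) = (i, v) \<or> (x, y) = (v, j)" using Cons.prems(3) by blast
      let ?a = "pot (insert e0 S) h"
      have z: "slack h ?a e = 0" if "e \<in> insert e0 S" for e
        by (rule pot[OF face_indep[OF link_face[OF e0(1)]] that])
      have "W S (h # hs) = (\<Sum>e\<in>link S. slack h ?a e * W (insert e S) hs)"
        by (rule W_gauge[OF F Cons.prems(1)]) (use z in auto)
      also have "\<dots> = 0"
      proof (rule sum.neutral, rule ballI)
        fix e assume e: "e \<in> link S"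
        show "slack h ?a e * W (insert e S) hs = 0"
        proof (cases "(i, v) \<in> bl (insert e S) \<and> (v, j) \<in> bl (insert e S)")
          case False then show ?thesis using IH[OF e] by simp
        next
          case True
          then have "(x, y) \<in> bl (insert e S)" "(x, y) \<in> bl (insert e0 S)" using xy e0 by auto
          then have "(fst e, snd e) \<in> bl (insert e0 S)"
          proof -
            have sub: "bl S \<subseteq> bl (insert e0 S)" unfolding bl_def by (rule rtrancl_mono) auto
            from \<open>(x, y) \<in> bl (insert e S)\<close> xy(1) consider "(x, fst e) \<in> bl S" "(snd e, y) \<in> bl S" | "(x, snd e) \<in> bl S" "(fst e, y) \<in> bl S"
              unfolding bl_insert by blast
            then show ?thesis
            proof cases
              case 1
              then have "(x, fst e) \<in> bl (insert e0 S)" "(snd e, y) \<in> bl (insert e0 S)" using sub by auto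
              then show ?thesis
                using bl_trans[OF bl_trans[OF bl_sym \<open>(x, y) \<in> bl (insert e0 S)\<close>] bl_sym] by blast
            next
              case 2
              then have "(x, snd e) \<in> bl (insert e0 S)" "(fst e, y) \<in> bl (insert e0 S)" using sub by auto
              then show ?thesis
                using bl_trans[OF bl_trans[OF _ bl_sym[OF \<open>(x, y) \<in> bl (insert e0 S)\<close>]]] by blast
            qed
          qed
          then have "pos_at s t u ?a (fst e) = pos_at s t u ?a (snd e)"
            by (rule pos_bl) (use z in \<open>auto simp: h slack_def df_def\<close>)
          then have "slack h ?a (fst e, snd e) = 0" unfolding h slack_pos by simp
          then show ?thesis by simp
        qed
      qed
      finally show ?thesis .
    qed
  qed
qed

end

section \<open>Mixed volumes count linear extensions\<close>

context generic_config
begin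

text \<open>\<open>H s t u\<close> is linear in its arguments; these are its three unit directions,
  for the first gap, the second gap and the rest.\<close>

definition D :: "nat \<Rightarrow> 'b \<times> 'b \<Rightarrow> real" where
  "D a = H (if a = 0 then 1 else 0) (if a = 1 then 1 else 0) (if a = 2 then 1 else 0)"

definition full :: "('b \<times> 'b) set \<Rightarrow> bool" where
  "full E \<longleftrightarrow> oriented E \<and> (\<forall>y\<in>Y - {bot}. (bot, y) \<in> E) \<and> (\<forall>y\<in>Y - {top}. (y, top) \<in> E) \<and>
     (z1, z2) \<in> E \<and> (z2, z3) \<in> E"

definition LE :: "('b \<times> 'b) set \<Rightarrow> ('b \<Rightarrow> nat) set" where
  "LE E = {f \<in> extensional Y. bij_betw f Y {..<card Y} \<and> (\<forall>(i, j)\<in>E. f i < f j)}"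

lemma full_spanning: "full E \<Longrightarrow> spanning E"
  unfolding full_def spanning_def
proof (intro ballI conjI)
  fix i assume E: "oriented E \<and> (\<forall>y\<in>Y - {bot}. (bot, y) \<in> E) \<and> (\<forall>y\<in>Y - {top}. (y, top) \<in> E) \<and>
     (z1, z2) \<in> E \<and> (z2, z3) \<in> E" and i: "i \<in> Y"
  show "(bot, i) \<in> E\<^sup>*" using E i by (cases "i = bot") auto
  show "(i, top) \<in> E\<^sup>*" using E i by (cases "i = top") auto
qed

lemma config: "oriented E \<Longrightarrow> spanning E \<Longrightarrow> config_system Y bot top z1 z2 z3 g E"
  by (intro config_system.intro generic_config_axioms config_system_axioms.intro)

lemma spanning_mono: "spanning E \<Longrightarrow> E \<subseteq> E' \<Longrightarrow> spanning E'"
  unfolding spanning_def using rtrancl_mono[of E E'] by blast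

lemma D_anti: "D a (j, i) = - D a (i, j)" by (simp add: D_def H_def)

lemma split_pair:
  assumes E: "oriented E" "spanning E" and ij: "i \<in> Y" "j \<in> Y" "i \<noteq> j" "(i, j) \<notin> E" "(j, i) \<notin> E"
    and as: "length as = card (nd ` Y) - 1"
  shows "FW E {} (map D as) = FW (insert (i, j) E) {} (map D as) + FW (insert (j, i) E) {} (map D as)"
proof -
  have o: "oriented (insert (i, j) E)" "oriented (insert (j, i) E)"
    using E ij unfolding oriented_def by auto
  have s: "spanning (insert p E)" for p using spanning_mono[OF E(2)] by auto
  show ?thesis
  proof (rule cut_additive[OF system[OF E] system[OF o(1) s] system[OF o(2) s]])
    show "w0 (j, i) = - w0 (i, j)" using g_anti[of j i] by (simp add: w0_def H_def)
    show "v (j, i) = - v (i, j)" if v: "v \<in> set (map D as)" for v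
    proof -
      obtain a where "v = D a" using v by auto
      then show ?thesis using D_anti[of a j i] by (simp only:)
    qed
  qed (use ij as in auto)
qed

lemma cycle_zero:
  assumes E: "oriented E" "spanning E" and cyc: "(i, v) \<in> E" "(v, j) \<in> E" "(j, i) \<in> E"
    and as: "length as = card (nd ` Y) - 1"
  shows "FW E {} (map D as) = 0"
proof -
  interpret C: config_system Y bot top z1 z2 z3 g E by (rule config[OF E])
  have "i \<noteq> v" using cyc E(1) by (auto simp: oriented_def)
  then have "(i, v) \<notin> bl {}" by (simp add: bl_def)
  moreover have "\<exists>s t u. h = H s t u" if "h \<in> set (map D as)" for h using that by (auto simp: D_def)
  ultimately show ?thesis using C.directed_cycle_degenerate[OF cyc, of "{}" "map D as"] as by (simp add: C.dim_def)
qed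

text \<open>Split at the pair: the part that contains \<open>(j, i)\<close> has a directed cycle
  through \<open>v\<close> and vanishes.\<close>

lemma redundant_pair:
  assumes E: "oriented E" "spanning E" and v: "(i, v) \<in> E" "(v, j) \<in> E" and ij: "(i, j) \<notin> E" "(j, i) \<notin> E"
    and as: "length as = card (nd ` Y) - 1"
  shows "FW (insert (i, j) E) {} (map D as) = FW E {} (map D as)"
proof -
  have Y: "i \<in> Y" "j \<in> Y" using E v by (auto simp: oriented_def)
  have ne: "i \<noteq> j" using E v by (auto simp: oriented_def)
  have o: "oriented (insert (j, i) E)" using E Y ne ij unfolding oriented_def by auto
  have s: "spanning (insert (j, i) E)" using spanning_mono[OF E(2)] by auto
  have "FW (insert (j, i) E) {} (map D as) = 0"
    by (rule cycle_zero[OF o s, of i v j]) (use v as in auto)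
  then show ?thesis using split_pair[OF E Y ne ij as] by simp
qed

lemma redundant_set:
  assumes E: "oriented E'" "spanning E" "E \<subseteq> E'"
    and v: "\<And>i j. (i, j) \<in> E' - E \<Longrightarrow> \<exists>v. (i, v) \<in> E \<and> (v, j) \<in> E"
    and as: "length as = card (nd ` Y) - 1"
  shows "FW E' {} (map D as) = FW E {} (map D as)"
proof -
  have "finite E'" using E(1) finY by (auto simp: oriented_def intro: finite_subset[of E' "Y \<times> Y"])
  then have fin: "finite (E' - E)" by simp
  have "FW (E \<union> R) {} (map D as) = FW E {} (map D as)" if "R \<subseteq> E' - E" for R
    using finite_subset[OF that fin] that
  proof (induction R)
    case (insert p R)
    obtain i j where p: "p = (i, j)" by (cases p)
    obtain v where v': "(i, v) \<in> E" "(v, j) \<in> E" using v[of i j] insert.prems p by auto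
    have sub: "E \<union> R \<subseteq> E'" using insert.prems E by auto
    have o: "oriented (E \<union> R)" using E(1) sub unfolding oriented_def by blast
    have s: "spanning (E \<union> R)" using spanning_mono[OF E(2)] by auto
    have "(j, i) \<notin> E \<union> R" using insert.prems p sub E(1) unfolding oriented_def by blast
    then have "FW (insert (i, j) (E \<union> R)) {} (map D as) = FW (E \<union> R) {} (map D as)"
      by (intro redundant_pair[OF o s, of i v j]) (use v' insert p as in auto)
    then show ?case using insert p by simp
  qed simp
  from this[of "E' - E"] show ?thesis using E(3) by (simp add: Un_absorb1)
qed

end

section \<open>The mixed volumes of a chain\<close>

locale chain_config = generic_config Y bot top z1 z2 z3 g
  for Y :: "'b set" and bot top z1 z2 z3 :: 'b and g :: "'b \<times> 'b \<Rightarrow> real" +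
  fixes ps :: "'b \<Rightarrow> nat" and N :: nat
  assumes ps: "bij_betw ps Y {..N}" and ps_bot: "ps bot = 0" and ps_top: "ps top = N"
    and ps_z: "ps z1 < ps z2" "ps z2 < ps z3"
begin

definition c :: "nat \<Rightarrow> 'b" where "c = inv_into Y ps"
definition ed :: "nat \<Rightarrow> 'b \<times> 'b" where "ed m = (c m, c (Suc m))"
text \<open>Interpolates between the total order at \<open>m = N\<close> and the pairs of neighbours
  at \<open>m = 1\<close>: a pair at distance \<open>m + 1\<close> is implied by one at distance 1
  and one at distance \<open>m\<close>.\<close>

definition Lm :: "nat \<Rightarrow> ('b \<times> 'b) set" where "Lm m = {(i, j) \<in> Y \<times> Y. ps i < ps j \<and> ps j \<le> ps i + m}"
text \<open>Tying \<open>top\<close> to \<open>bot\<close> closes the chain to a circle, which the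
  marks cut into three arcs with increments adding up to \<open>s\<close>, \<open>t\<close> and
  \<open>u\<close>; the last arc wraps around. So the polytope is a product of three simplices, one
  for each arc.\<close>

definition arc :: "nat \<Rightarrow> nat set" where
  "arc a = (if a = 0 then {ps z1..<ps z2} else if a = 1 then {ps z2..<ps z3} else {..<ps z1} \<union> {ps z3..<N})"

lemma cY: "m \<le> N \<Longrightarrow> c m \<in> Y" "m \<le> N \<Longrightarrow> ps (c m) = m"
  using ps unfolding c_def by (auto simp: bij_betw_def inv_into_into f_inv_into_f)

lemma cps: "y \<in> Y \<Longrightarrow> c (ps y) = y" using ps unfolding c_def by (simp add: bij_betw_def)

lemma psN: "y \<in> Y \<Longrightarrow> ps y \<le> N" using ps by (auto simp: bij_betw_def)

lemma ps_inj: "x \<in> Y \<Longrightarrow> y \<in> Y \<Longrightarrow> ps x = ps y \<Longrightarrow> x = y" using cps by metis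

lemma z_bounds: "0 < ps z1" "ps z3 < N"
proof -
  have "ps z1 \<noteq> ps bot" "ps z3 \<noteq> ps top" using ps_inj[of z1 bot] ps_inj[of z3 top] inY dist by auto
  then show "0 < ps z1" "ps z3 < N" using ps_bot ps_top psN[of z3] inY by auto
qed

lemma Lm1: "Lm 1 = ed ` {..<N}"
proof
  show "Lm 1 \<subseteq> ed ` {..<N}"
  proof
    fix e assume "e \<in> Lm 1"
    then obtain i j where e: "e = (i, j)" "i \<in> Y" "j \<in> Y" "ps j = Suc (ps i)" by (auto simp: Lm_def)
    then have "e = ed (ps i)" using cps by (metis ed_def)
    moreover have "ps i < N" using psN[of j] e by simp
    ultimately show "e \<in> ed ` {..<N}" by auto
  qed
  show "ed ` {..<N} \<subseteq> Lm 1" using cY by (auto simp: Lm_def ed_def)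
qed

lemma ed_inj: "inj_on ed {..<N}"
  using cY by (auto simp: inj_on_def ed_def) (metis less_imp_le_nat)

lemma Lm_oriented: "oriented (Lm m)" by (auto simp: oriented_def Lm_def)

lemma Lm_spanning:
  assumes "m \<ge> 1" shows "spanning (Lm m)"
proof -
  have sub: "Lm 1 \<subseteq> Lm m" using assms by (auto simp: Lm_def)
  have step: "(c i, c j) \<in> (Lm 1)\<^sup>*" if "i \<le> j" "j \<le> N" for i j
    using that
  proof (induction j)
    case (Suc j)
    show ?case
    proof (cases "i = Suc j")
      case False
      then have "(c i, c j) \<in> (Lm 1)\<^sup>*" using Suc by auto
      moreover have "(c j, c (Suc j)) \<in> Lm 1" using Suc.prems unfolding Lm1 ed_def by auto
      ultimately show ?thesis by (rule rtrancl_into_rtrancl)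
    qed simp
  qed simp
  have "spanning (Lm 1)"
    unfolding spanning_def
  proof (intro ballI conjI)
    fix i assume i: "i \<in> Y"
    show "(bot, i) \<in> (Lm 1)\<^sup>*" using step[of 0 "ps i"] psN[OF i] cps[OF i] cps[OF inY(1)] ps_bot by simp
    show "(i, top) \<in> (Lm 1)\<^sup>*" using step[of "ps i" N] psN[OF i] cps[OF i] cps[OF inY(2)] ps_top by simp
  qed
  then show ?thesis using spanning_mono sub by blast
qed

lemma Lm_reduce:
  assumes "m \<ge> 1" and as: "length as = card (nd ` Y) - 1"
  shows "FW (Lm m) {} (map D as) = FW (Lm 1) {} (map D as)"
  using assms(1)
proof (induction m rule: dec_induct)
  case (step m)
  have "FW (Lm (Suc m)) {} (map D as) = FW (Lm m) {} (map D as)"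
  proof (rule redundant_set[OF Lm_oriented Lm_spanning _ _ as])
    show "Lm m \<subseteq> Lm (Suc m)" by (auto simp: Lm_def)
    show "\<exists>v. (i, v) \<in> Lm m \<and> (v, j) \<in> Lm m" if "(i, j) \<in> Lm (Suc m) - Lm m" for i j
    proof -
      have ij: "i \<in> Y" "j \<in> Y" "ps j = ps i + Suc m" using that by (auto simp: Lm_def)
      have "Suc (ps i) \<le> N" using psN[OF ij(2)] ij(3) by simp
      then have "(i, c (Suc (ps i))) \<in> Lm m \<and> (c (Suc (ps i)), j) \<in> Lm m"
        using cY[of "Suc (ps i)"] ij step.hyps by (auto simp: Lm_def)
      then show ?thesis by blast
    qed
  qed (use step in auto)
  then show ?case using step by simp
qed simp

lemma arcs: "a < 3 \<Longrightarrow> b < 3 \<Longrightarrow> a \<noteq> b \<Longrightarrow> arc a \<inter> arc b = {}" "arc 0 \<union> arc 1 \<union> arc 2 = {..<N}" "finite (arc a)"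
  "arc a \<subseteq> {..<N}"
  using ps_z z_bounds unfolding arc_def by auto

sublocale C: config_system Y bot top z1 z2 z3 g "Lm 1"
  by (rule config[OF Lm_oriented Lm_spanning]) simp

definition Rm :: "nat \<Rightarrow> ('b \<times> 'b) set \<Rightarrow> nat set" where "Rm a S = {m \<in> arc a. ed m \<notin> S}"

lemma card_Y: "card Y = Suc N" using bij_betw_same_card[OF ps] by simp

lemma dimN: "C.dim = N - 3" "N \<ge> 4"
proof -
  show "N \<ge> 4" using z_bounds ps_z by simp
  then show "C.dim = N - 3" by (simp add: C.dim_def card_nodes card_Y)
qed

lemma Rm_sum:
  assumes "S \<subseteq> Lm 1" shows "card (Rm 0 S) + card (Rm 1 S) + card (Rm 2 S) + card S = N"
proof -
  have fin: "finite (Rm a S)" for a using arcs(3) by (simp add: Rm_def)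
  have d: "Rm 0 S \<inter> Rm 1 S = {}" "(Rm 0 S \<union> Rm 1 S) \<inter> Rm 2 S = {}"
    using arcs(1)[of 0 1] arcs(1)[of 0 2] arcs(1)[of 1 2] unfolding Rm_def by auto
  have "ed ` (Rm 0 S \<union> Rm 1 S \<union> Rm 2 S) = Lm 1 - S"
    unfolding Lm1 arcs(2)[symmetric] Rm_def by auto
  moreover have "inj_on ed (Rm 0 S \<union> Rm 1 S \<union> Rm 2 S)"
    using arcs(4) by (intro inj_on_subset[OF ed_inj]) (auto simp: Rm_def)
  ultimately have "card (Lm 1 - S) = card (Rm 0 S) + card (Rm 1 S) + card (Rm 2 S)"
    using card_image[of ed "Rm 0 S \<union> Rm 1 S \<union> Rm 2 S"] d fin by (simp add: card_Un_disjoint)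
  moreover have "card (Lm 1) = N" unfolding Lm1 using card_image[OF ed_inj] by simp
  moreover have "card (Lm 1 - S) = card (Lm 1) - card S" "card S \<le> card (Lm 1)"
    using assms C.finE finite_subset[OF assms C.finE] by (auto simp: card_Diff_subset card_mono)
  ultimately show ?thesis by simp
qed

lemma run_bl:
  assumes "\<And>m. i \<le> m \<Longrightarrow> m < j \<Longrightarrow> ed m \<in> S" "i \<le> j" shows "(c i, c j) \<in> bl S"
  using assms(2,1)
proof (induction j rule: dec_induct)
  case (step j)
  have "(c j, c (Suc j)) \<in> bl S" using step.prems[of j] step.hyps by (auto simp: bl_def ed_def)
  then show ?case using bl_trans step by (metis less_SucI)
qed simp

text \<open>A completely tight arc would have length at most 1/16, or 1/8 for the one that wraps
  around, instead of 1.\<close>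

lemma face_arcs:
  assumes S: "C.face S" and a: "a < 3" shows "Rm a S \<noteq> {}"
proof
  assume R: "Rm a S = {}"
  obtain b where b: "\<And>e. e \<in> S \<Longrightarrow> C.slack w0 b e = 0" using S unfolding C.face_def by blast
  note t = C.tight_bl[OF S b]
  note r = C.pos_refs[of 1 1 1 b]
  have all: "ed m \<in> S" if "m \<in> arc a" for m using R that by (auto simp: Rm_def)
  have cz: "c (ps z1) = z1" "c (ps z2) = z2" "c (ps z3) = z3" "c 0 = bot" "c N = top"
    using cps inY ps_bot ps_top by metis+
  consider "a = 0" | "a = 1" | "a = 2" using a by linarith
  then show False
  proof cases
    case 1
    then have "(z1, z2) \<in> bl S" using run_bl[of "ps z1" "ps z2" S] all ps_z cz by (auto simp: arc_def)
    from t[OF _ this] r show False by simp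
  next
    case 2
    then have "(z2, z3) \<in> bl S" using run_bl[of "ps z2" "ps z3" S] all ps_z cz by (auto simp: arc_def)
    from t[OF _ this] r show False by simp
  next
    case 3
    then have "(bot, z1) \<in> bl S" "(z3, top) \<in> bl S"
      using run_bl[of 0 "ps z1" S] run_bl[of "ps z3" N S] all z_bounds cz by (auto simp: arc_def)
    then have "\<bar>pos_at 1 1 1 b z1 - pos_at 1 1 1 b bot\<bar> \<le> 1 / 16" "\<bar>pos_at 1 1 1 b top - pos_at 1 1 1 b z3\<bar> \<le> 1 / 16"
      using t by auto
    then show False using r by linarith
  qed
qed

lemma arcs_face:
  assumes S: "S \<subseteq> Lm 1" and R: "\<And>a. a < 3 \<Longrightarrow> Rm a S = {\<mu> a}"
  shows "C.face S"
proof -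
  define ar where "ar = (\<lambda>m. if m \<in> arc 0 then 0 else if m \<in> arc 1 then 1 else (2::nat))"
  have ar: "ar m = a" if "a < 3" "m \<in> arc a" for a m
    using that arcs(1)[of 0 1] arcs(1)[of 0 2] arcs(1)[of 1 2] by (auto simp: ar_def numeral_3_eq_3 less_Suc_eq numeral_2_eq_2)
  \<comment> \<open>Tight edges get the increment dictated by \<open>g\<close>, and the free edge of
    an arc takes what is missing to the length 1. Its slack is then 1 plus the sum of
    \<open>g\<close> over the arc, which is positive because \<open>g\<close> is tiny.\<close>
  define inc where "inc = (\<lambda>m. if ed m \<in> S then - g (ed m) else 1 + (\<Sum>k\<in>arc (ar m) - {m}. g (ed k)))"
  define X where "X = (\<lambda>y. \<Sum>k<ps y. inc k)"
  define b where "b = (\<lambda>v. X v - off 1 1 1 v)"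
  have mu: "\<mu> a \<in> arc a" "ed (\<mu> a) \<notin> S" "\<And>m. m \<in> arc a \<Longrightarrow> m \<noteq> \<mu> a \<Longrightarrow> ed m \<in> S" if "a < 3" for a
    using R[OF that] by (auto simp: Rm_def)
  have arcsum: "(\<Sum>k\<in>arc a. inc k) = 1" if a: "a < 3" for a
  proof -
    have "(\<Sum>k\<in>arc a. inc k) = inc (\<mu> a) + (\<Sum>k\<in>arc a - {\<mu> a}. inc k)"
      using mu(1)[OF a] arcs(3) by (simp add: sum.remove)
    also have "(\<Sum>k\<in>arc a - {\<mu> a}. inc k) = (\<Sum>k\<in>arc a - {\<mu> a}. - g (ed k))"
      using mu(3)[OF a] by (intro sum.cong) (auto simp: inc_def)
    also have "inc (\<mu> a) = 1 + (\<Sum>k\<in>arc a - {\<mu> a}. g (ed k))"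
      using mu(2)[OF a] ar[OF a mu(1)[OF a]] by (simp add: inc_def)
    finally show ?thesis by (simp add: sum_negf)
  qed
  have diff: "X y - X x = (\<Sum>k\<in>{ps x..<ps y}. inc k)" if "ps x \<le> ps y" for x y
    unfolding X_def using sum.atLeastLessThan_concat[of 0 "ps x" "ps y" inc] that by (simp add: atLeast0LessThan)
  have X12: "X z2 - X z1 = 1" "X z3 - X z2 = 1"
    using diff[of z1 z2] diff[of z2 z3] ps_z arcsum[of 0] arcsum[of 1] by (auto simp: arc_def)
  have Xbt: "X top - X bot = 3"
  proof -
    have "(\<Sum>k<N. inc k) = (\<Sum>k\<in>arc 0 \<union> arc 1. inc k) + (\<Sum>k\<in>arc 2. inc k)"
      unfolding arcs(2)[symmetric] by (rule sum.union_disjoint) (use arcs(1)[of 0 2] arcs(1)[of 1 2] arcs(3) in auto)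
    also have "(\<Sum>k\<in>arc 0 \<union> arc 1. inc k) = (\<Sum>k\<in>arc 0. inc k) + (\<Sum>k\<in>arc 1. inc k)"
      by (rule sum.union_disjoint) (use arcs(1)[of 0 1] arcs(3) in auto)
    finally show ?thesis using arcsum[of 0] arcsum[of 1] arcsum[of 2] ps_top ps_bot by (simp add: X_def)
  qed
  have pX: "pos_at 1 1 1 b y = X y" if "y \<in> Y" for y
    using X12 Xbt dist unfolding pos_at_def b_def nd_def off_def by auto
  have sl: "C.slack w0 b (ed m) = inc m + g (ed m)" if "m < N" for m
  proof -
    have "X (c (Suc m)) - X (c m) = inc m" using diff[of "c m" "c (Suc m)"] cY[of m] cY[of "Suc m"] that by simp
    then show ?thesis using pX cY[of m] cY[of "Suc m"] that unfolding ed_def C.slack_w0 by simp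
  qed
  have "C.slack w0 b e = 0" if e: "e \<in> S" for e
  proof -
    obtain m where m: "m < N" "e = ed m" using e S unfolding Lm1 by auto
    then show ?thesis using sl[OF m(1)] e by (simp add: inc_def)
  qed
  moreover have "C.slack w0 b e > 0" if e: "e \<in> Lm 1 - S" for e
  proof -
    obtain m where m: "m < N" "e = ed m" using e unfolding Lm1 by auto
    then have "m \<in> arc 0 \<union> arc 1 \<union> arc 2" using arcs(2) by auto
    then obtain a where a: "a < 3" "m \<in> arc a" by (metis UnE lessI numeral_2_eq_2 numeral_3_eq_3 one_less_numeral_iff semiring_norm(77) zero_less_numeral)
    have "\<bar>\<Sum>k\<in>arc a. g (ed k)\<bar> \<le> (\<Sum>k\<in>arc a. 1 / (16 * 2 ^ card (Y \<times> Y)))"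
      using g_small by (intro order_trans[OF sum_abs] sum_mono) auto
    also have "\<dots> = card (arc a) * (1 / (16 * 2 ^ card (Y \<times> Y)))" by simp
    also have "\<dots> < 1"
    proof -
      have "card (arc a) \<le> N" using card_mono[OF _ arcs(4)[of a]] by simp
      also have "N \<le> card (Y \<times> Y)" using card_Y by (simp add: card_cartesian_product)
      also have "card (Y \<times> Y) < 2 ^ card (Y \<times> Y)" by simp
      finally have "real (card (arc a)) < 2 ^ card (Y \<times> Y)" by (metis of_nat_less_iff of_nat_numeral of_nat_power)
      moreover have "(2::real) ^ card (Y \<times> Y) > 0" by simp
      ultimately have "real (card (arc a)) < 16 * 2 ^ card (Y \<times> Y)" by linarith
      then show ?thesis by (simp add: field_simps)
    qed
    finally have "1 + (\<Sum>k\<in>arc a. g (ed k)) > 0" by linarith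
    moreover have "(\<Sum>k\<in>arc a. g (ed k)) = g (ed m) + (\<Sum>k\<in>arc a - {m}. g (ed k))"
      using a arcs(3) by (simp add: sum.remove)
    ultimately show ?thesis unfolding m(2) sl[OF m(1)] using e m ar[OF a] by (simp add: inc_def)
  qed
  ultimately show ?thesis using S unfolding C.face_def by blast
qed

text \<open>The gauge is the vertex of the simplex of arc \<open>a\<close> at which all edges but
  \<open>m\<close> are tight, written as a step function along the chain.\<close>

lemma step_gauge:
  assumes a: "a < 3" and m: "m \<in> arc a"
  obtains b where "\<And>k. k < N \<Longrightarrow> C.slack (D a) b (ed k) = (if k = m then 1 else 0)"
proof -
  define P where "P = (\<lambda>y. if ps y \<le> m then -1 else (0::real))"
  define st where "st = (\<lambda>i::nat. if a = i then 1 else (0::real))"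
  define b where "b = (\<lambda>v. P v - off (st 0) (st 1) (st 2) v)"
  have mN: "m < N" using m arcs(4) by auto
  have D: "D a = H (st 0) (st 1) (st 2)" by (simp add: D_def st_def)
  have "P z2 - P z1 = st 0" "P z3 - P z2 = st 1" "P top - P bot = 1" "st 0 + st 1 + st 2 = 1"
    using a m mN ps_z z_bounds ps_top ps_bot unfolding P_def st_def arc_def
    by (auto simp: less_Suc_eq numeral_3_eq_3 numeral_2_eq_2 split: if_splits)
  then have pP: "pos_at (st 0) (st 1) (st 2) b y = P y" for y
    using dist unfolding pos_at_def b_def nd_def off_def by auto
  have "C.slack (D a) b (ed k) = (if k = m then 1 else 0)" if "k < N" for k
    unfolding D ed_def C.slack_pos pP using cY[of k] cY[of "Suc k"] that by (auto simp: P_def)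
  then show ?thesis using that by blast
qed

text \<open>In the gauge of \<open>step_gauge\<close> a single facet survives, so each occurrence of
  \<open>a\<close> makes one more edge of arc \<open>a\<close> tight. A vertex leaves exactly one
  edge of every arc free, whence the \<open>+ 1\<close>.\<close>

lemma chain_value:
  assumes "S \<subseteq> Lm 1" "card S + length as = C.dim" "set as \<subseteq> {..<3}"
  shows "C.W S (map D as) = (if \<forall>a<3. card (Rm a S) = count_list as a + 1 then 1 else 0)"
  using assms
proof (induction as arbitrary: S)
  case Nil
  have sum3: "card (Rm 0 S) + card (Rm 1 S) + card (Rm 2 S) = 3"
    using Rm_sum[OF Nil(1)] Nil(2) dimN by simp
  have "C.face S \<longleftrightarrow> (\<forall>a<3. card (Rm a S) = 1)"
  proof
    assume f: "C.face S"
    have "card (Rm a S) \<ge> 1" if "a < 3" for a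
      using face_arcs[OF f that] arcs(3)[of a] by (simp add: Rm_def card_gt_0_iff Suc_le_eq)
    from this[of 0] this[of 1] this[of 2] sum3
    have "card (Rm 0 S) = 1" "card (Rm 1 S) = 1" "card (Rm 2 S) = 1" by auto
    then show "\<forall>a<3. card (Rm a S) = 1" by (auto simp: less_Suc_eq numeral_3_eq_3 numeral_2_eq_2)
  next
    assume "\<forall>a<3. card (Rm a S) = 1"
    then have "\<forall>a. a < 3 \<longrightarrow> (\<exists>m. Rm a S = {m})" by (auto simp: card_1_singleton_iff)
    then obtain \<mu> where "\<And>a. a < 3 \<Longrightarrow> Rm a S = {\<mu> a}" by metis
    then show "C.face S" by (rule arcs_face[OF Nil(1)])
  qed
  moreover have "C.W S (map D []) = (if C.face S then 1 else 0)" unfolding list.map by (rule C.W.simps(1))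
  ultimately show ?case by (simp del: One_nat_def C.W.simps)
next
  case (Cons a as)
  have a: "a < 3" using Cons.prems by simp
  show ?case
  proof (cases "Rm a S = {}")
    case True
    then have "\<not> C.face S" using face_arcs a by blast
    then have "C.W S (map D (a # as)) = 0" by (rule C.W_nonface)
    moreover have "card (Rm a S) \<noteq> count_list (a # as) a + 1" using True by simp
    ultimately show ?thesis using a by (auto simp del: C.W.simps)
  next
    case False
    then obtain m where m: "m \<in> arc a" "ed m \<notin> S" by (auto simp: Rm_def)
    have mN: "m < N" using m arcs(4) by auto
    obtain b where b: "\<And>k. k < N \<Longrightarrow> C.slack (D a) b (ed k) = (if k = m then 1 else 0)"
      by (rule step_gauge[OF a m(1)]) blast
    have inj: "ed k = ed m \<longleftrightarrow> k = m" if "k < N" for k using ed_inj that mN by (auto simp: inj_on_def)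
    have bE: "C.slack (D a) b e = (if e = ed m then 1 else 0)" if "e \<in> Lm 1" for e
      using that b inj unfolding Lm1 by auto
    have "C.W S (map D (a # as)) = (\<Sum>e\<in>Lm 1 - S. C.slack (D a) b e * C.W (insert e S) (map D as))"
      unfolding list.map
    proof (rule C.W_gauge_all)
      show "C.slack (D a) b e = 0" if "e \<in> S" for e using bE[of e] that Cons.prems m by auto
    qed (use Cons.prems in simp)
    also have "\<dots> = (\<Sum>e\<in>Lm 1 - S. if e = ed m then C.W (insert (ed m) S) (map D as) else 0)"
      using bE by (intro sum.cong) auto
    also have "\<dots> = C.W (insert (ed m) S) (map D as)"
    proof -
      have "ed m \<in> Lm 1 - S" using m mN unfolding Lm1 by auto
      then show ?thesis using C.finE by simp
    qed
    also have "\<dots> = (if \<forall>a'<3. card (Rm a' (insert (ed m) S)) = count_list as a' + 1 then 1 else 0)"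
    proof (rule Cons.IH)
      show "insert (ed m) S \<subseteq> Lm 1" using Cons.prems mN unfolding Lm1 by auto
      show "card (insert (ed m) S) + length as = C.dim"
        using Cons.prems m finite_subset[OF Cons.prems(1) C.finE] by simp
    qed (use Cons.prems in auto)
    also have "(\<forall>a'<3. card (Rm a' (insert (ed m) S)) = count_list as a' + 1) \<longleftrightarrow>
      (\<forall>a'<3. card (Rm a' S) = count_list (a # as) a' + 1)"
    proof -
      have "card (Rm a' (insert (ed m) S)) = count_list as a' + 1 \<longleftrightarrow> card (Rm a' S) = count_list (a # as) a' + 1"
        if a': "a' < 3" for a'
      proof (cases "a' = a")
        case True
        have "Rm a S = insert m (Rm a (insert (ed m) S))" "m \<notin> Rm a (insert (ed m) S)"
          using m inj arcs(4)[of a] by (auto simp: Rm_def)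
        moreover have "finite (Rm a (insert (ed m) S))" using arcs(3) by (simp add: Rm_def)
        ultimately show ?thesis using True by simp
      next
        case False
        have "Rm a' (insert (ed m) S) = Rm a' S"
          using inj arcs(4)[of a'] arcs(1)[OF a' a False] m(1) by (auto simp: Rm_def)
        then show ?thesis using False by simp
      qed
      then show ?thesis by blast
    qed
    finally show ?thesis .
  qed
qed

lemma chain_count:
  assumes as: "length as = card (nd ` Y) - 1" "set as \<subseteq> {..<3}"
  shows "FW (Lm N) {} (map D as) =
    (if ps z2 = ps z1 + count_list as 0 + 1 \<and> ps z3 = ps z2 + count_list as 1 + 1 then 1 else 0)"
proof -
  have l: "count_list as 0 + count_list as 1 + count_list as 2 = length as"
    using as(2) by (induction as) (auto simp: less_Suc_eq numeral_3_eq_3 numeral_2_eq_2)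
  have dl: "length as = C.dim" using as by (simp add: C.dim_def)
  have R: "Rm a {} = arc a" for a by (simp add: Rm_def)
  have cs: "card (arc 0) + card (arc 1) + card (arc 2) = N" using Rm_sum[of "{}"] by (simp add: R)
  have "FW (Lm N) {} (map D as) = C.W {} (map D as)"
    using Lm_reduce[OF _ as(1), of N] dimN by simp
  also have "\<dots> = (if \<forall>a<3. card (arc a) = count_list as a + 1 then 1 else 0)"
    using chain_value[of "{}" as] dl as by (simp add: R)
  also have "(\<forall>a<3. card (arc a) = count_list as a + 1) \<longleftrightarrow>
     card (arc 0) = count_list as 0 + 1 \<and> card (arc 1) = count_list as 1 + 1"
    using cs l dl dimN by (auto simp: less_Suc_eq numeral_3_eq_3 numeral_2_eq_2)
  also have "\<dots> \<longleftrightarrow> ps z2 = ps z1 + count_list as 0 + 1 \<and> ps z3 = ps z2 + count_list as 1 + 1"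
    using ps_z by (auto simp: arc_def)
  finally show ?thesis .
qed

end

context generic_config
begin

text \<open>The list \<open>as\<close> selects mixed directions; only the multiplicities of the directions \<open>0\<close> and \<open>1\<close> matter,
  and they are the numbers of elements strictly inside the two gaps.\<close>

definition good :: "nat list \<Rightarrow> ('b \<Rightarrow> nat) \<Rightarrow> bool" where
  "good as f \<longleftrightarrow> f z2 = f z1 + count_list as 0 + 1 \<and> f z3 = f z2 + count_list as 1 + 1"

lemma finite_LE: "finite (LE E)"
proof -
  have "LE E \<subseteq> Pi\<^sub>E Y (\<lambda>_. {..<card Y})" by (auto simp: LE_def PiE_iff bij_betw_def extensional_def)
  then show ?thesis using finY finite_PiE[of Y "\<lambda>_. {..<card Y}"] finite_subset by blast
qed

lemma rank_card:
  assumes "bij_betw f Y {..<card Y}" "i \<in> Y" shows "f i = card {j \<in> Y. f j < f i}"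
proof -
  have "f ` {j \<in> Y. f j < f i} = {..<f i}"
  proof
    show "{..<f i} \<subseteq> f ` {j \<in> Y. f j < f i}"
    proof
      fix m assume m: "m \<in> {..<f i}"
      have im: "f ` Y = {..<card Y}" using assms(1) by (simp add: bij_betw_def)
      have "f i < card Y" using im assms(2) by auto
      then have "m \<in> f ` Y" using im m by simp
      then show "m \<in> f ` {j \<in> Y. f j < f i}" using m by auto
    qed
  qed auto
  moreover have "inj_on f {j \<in> Y. f j < f i}" using assms by (auto simp: bij_betw_def inj_on_def)
  ultimately show ?thesis using card_image by fastforce
qed

text \<open>If the relation is total, the system is that of a chain (or cyclic), where all pairs but the
  consecutive ones are redundant.\<close>

lemma tournament_count:
  assumes E: "full E" and tot: "\<And>i j. i \<in> Y \<Longrightarrow> j \<in> Y \<Longrightarrow> i \<noteq> j \<Longrightarrow> (i, j) \<in> E \<or> (j, i) \<in> E"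
    and as: "length as = card (nd ` Y) - 1" "set as \<subseteq> {..<3}"
  shows "FW E {} (map D as) = card {f \<in> LE E. good as f}"
proof (cases "trans E")
  case False
  then obtain i v j where v: "(i, v) \<in> E" "(v, j) \<in> E" "(i, j) \<notin> E" by (auto simp: trans_def)
  have oE: "oriented E" using E by (simp add: full_def)
  then have "i \<in> Y" "j \<in> Y" "i \<noteq> j" using v by (auto simp: oriented_def)
  then have "(j, i) \<in> E" using tot v by auto
  then have "FW E {} (map D as) = 0" using cycle_zero[OF oE full_spanning[OF E] v(1,2)] as by simp
  moreover have "LE E = {}"
  proof -
    have "False" if "f \<in> LE E" for f
    proof -
      have "f i < f v" "f v < f j" "f j < f i" using that v(1,2) \<open>(j, i) \<in> E\<close> by (auto simp: LE_def)
      then show False by simp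
    qed
    then show ?thesis by blast
  qed
  ultimately show ?thesis by simp
next
  case True
  have oE: "oriented E" using E by (simp add: full_def)
  define f where "f = restrict (\<lambda>i. card {j \<in> Y. (j, i) \<in> E}) Y"
  have mono: "f i < f j" if "(i, j) \<in> E" for i j
  proof -
    have Y: "i \<in> Y" "j \<in> Y" using that oE by (auto simp: oriented_def)
    have "(i, i) \<notin> E" using oE by (auto simp: oriented_def)
    then have "{k \<in> Y. (k, i) \<in> E} \<subset> {k \<in> Y. (k, j) \<in> E}"
      using that True Y by (auto simp: trans_def)
    then show ?thesis using Y finY by (auto simp: f_def intro!: psubset_card_mono)
  qed
  have "inj_on f Y"
  proof (rule inj_onI)
    fix x y assume "x \<in> Y" "y \<in> Y" "f x = f y"
    then show "x = y" using tot[of x y] mono[of x y] mono[of y x] by auto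
  qed
  moreover have "f ` Y \<subseteq> {..<card Y}"
  proof -
    have "f i < card Y" if i: "i \<in> Y" for i
    proof -
      have "(i, i) \<notin> E" using oE by (auto simp: oriented_def)
      then have "{j \<in> Y. (j, i) \<in> E} \<subset> Y" using i by auto
      then show ?thesis using i finY by (simp add: f_def psubset_card_mono)
    qed
    then show ?thesis by auto
  qed
  ultimately have bij: "bij_betw f Y {..<card Y}"
    using card_subset_eq[of "{..<card Y}" "f ` Y"] card_image[of f Y] by (auto simp: bij_betw_def)
  have Eeq: "(i, j) \<in> E \<longleftrightarrow> i \<in> Y \<and> j \<in> Y \<and> f' i < f' j" if "f' \<in> LE E" for f' i j
  proof
    assume "(i, j) \<in> E" then show "i \<in> Y \<and> j \<in> Y \<and> f' i < f' j" using that oE by (auto simp: LE_def oriented_def)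
  next
    assume a: "i \<in> Y \<and> j \<in> Y \<and> f' i < f' j"
    then have "\<not> (j, i) \<in> E" using that by (auto simp: LE_def)
    then show "(i, j) \<in> E" using a tot[of i j] by auto
  qed
  have fLE: "f \<in> LE E"
  proof -
    have "f \<in> extensional Y" unfolding f_def by (rule restrict_extensional)
    then show ?thesis using bij mono unfolding LE_def by auto
  qed
  have uniq: "f' = f" if f': "f' \<in> LE E" for f'
  proof (rule extensionalityI[of _ Y])
    fix i assume i: "i \<in> Y"
    have "f' i = card {j \<in> Y. f' j < f' i}" by (rule rank_card) (use f' i in \<open>auto simp: LE_def\<close>)
    also have "{j \<in> Y. f' j < f' i} = {j \<in> Y. (j, i) \<in> E}" using Eeq[OF f'] i by auto
    finally show "f' i = f i" using i by (simp add: f_def)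
  qed (use f' in \<open>auto simp: LE_def f_def\<close>)
  have LE1: "LE E = {f}" using fLE uniq by blast
  have cardY: "card Y = Suc (card Y - 1)" using inY finY card_gt_0_iff[of Y] by auto
  have b0: "f bot = 0"
  proof -
    have "{j \<in> Y. (j, bot) \<in> E} = {}" using E oE unfolding full_def oriented_def by blast
    then show ?thesis unfolding f_def restrict_apply'[OF inY(1)] by (simp only: card.empty)
  qed
  have t0: "f top = card Y - 1"
  proof -
    have "{j \<in> Y. (j, top) \<in> E} = Y - {top}" using E oE unfolding full_def oriented_def by auto
    then show ?thesis unfolding f_def restrict_apply'[OF inY(2)] using finY inY(2) by (simp only: card_Diff_singleton)
  qed
  interpret Ch: chain_config Y bot top z1 z2 z3 g f "card Y - 1"
  proof
    have "{..<card Y} = {..card Y - 1}" using cardY by auto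
    then show "bij_betw f Y {..card Y - 1}" using bij by simp
    show "f z1 < f z2" "f z2 < f z3" using mono E by (auto simp: full_def)
  qed (use b0 t0 in auto)
  have "Ch.Lm (card Y - 1) = E"
  proof -
    have "f j \<le> f i + (card Y - 1)" if "i \<in> Y" "j \<in> Y" for i j using Ch.psN[OF that(2)] by simp
    then show ?thesis using Eeq[OF fLE] by (auto simp: Ch.Lm_def)
  qed
  then have "FW E {} (map D as) = (if good as f then 1 else 0)"
    using Ch.chain_count[OF as] by (simp add: good_def)
  also have "\<dots> = card {f' \<in> LE E. good as f'}"
  proof -
    have "{f' \<in> LE E. good as f'} = (if good as f then {f} else {})" unfolding LE1 by auto
    then show ?thesis by simp
  qed
  finally show ?thesis .
qed

theorem extension_count:
  assumes "full E" and as: "length as = card (nd ` Y) - 1" "set as \<subseteq> {..<3}"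
  shows "FW E {} (map D as) = card {f \<in> LE E. good as f}"
  using assms(1)
proof (induction "card (Y \<times> Y) - card E" arbitrary: E rule: less_induct)
  case less
  have oE: "oriented E" using less.prems by (simp add: full_def)
  then have EY: "E \<subseteq> Y \<times> Y" by (auto simp: oriented_def)
  have fYY: "finite (Y \<times> Y)" using finY by simp
  have finE: "finite E" using EY fYY finite_subset by blast
  show ?case
  proof (cases "\<exists>i\<in>Y. \<exists>j\<in>Y. i \<noteq> j \<and> (i, j) \<notin> E \<and> (j, i) \<notin> E")
    case False
    then show ?thesis using tournament_count[OF less.prems _ as] by blast
  next
    case True
    then obtain i j where ij: "i \<in> Y" "j \<in> Y" "i \<noteq> j" "(i, j) \<notin> E" "(j, i) \<notin> E" by blast
    have F: "full (insert (i, j) E)" "full (insert (j, i) E)"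
      using less.prems ij unfolding full_def oriented_def by auto
    have lt: "card (Y \<times> Y) - card (insert p E) < card (Y \<times> Y) - card E" if "p \<in> Y \<times> Y" "p \<notin> E" for p
    proof -
      have "card (insert p E) \<le> card (Y \<times> Y)" using that EY by (intro card_mono fYY) auto
      then show ?thesis using that finE by simp
    qed
    have "FW E {} (map D as) = FW (insert (i, j) E) {} (map D as) + FW (insert (j, i) E) {} (map D as)"
      by (rule split_pair[OF oE full_spanning[OF less.prems] ij as(1)])
    also have "\<dots> = card {f \<in> LE (insert (i, j) E). good as f} + card {f \<in> LE (insert (j, i) E). good as f}"
      using less.hyps[OF lt F(1)] less.hyps[OF lt F(2)] ij by simp
    also have "\<dots> = card ({f \<in> LE (insert (i, j) E). good as f} \<union> {f \<in> LE (insert (j, i) E). good as f})"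
    proof -
      have "{f \<in> LE (insert (i, j) E). good as f} \<inter> {f \<in> LE (insert (j, i) E). good as f} = {}"
        by (auto simp: LE_def)
      then show ?thesis using finite_LE by (simp add: card_Un_disjoint)
    qed
    also have "{f \<in> LE (insert (i, j) E). good as f} \<union> {f \<in> LE (insert (j, i) E). good as f} = {f \<in> LE E. good as f}"
    proof -
      have "f i < f j \<or> f j < f i" if "f \<in> LE E" for f
        using that ij by (auto simp: LE_def bij_betw_def inj_on_def dest: linorder_neqE_nat)
      then show ?thesis by (auto simp: LE_def)
    qed
    finally show ?thesis .
  qed
qed

end

section \<open>Hyperbolicity of the gap counts\<close>

lemma quadratic_nonneg_discriminant:
  fixes A B C :: real
  assumes "\<And>t. A + 2 * t * B + t\<^sup>2 * C \<ge> 0"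
  shows "B\<^sup>2 \<le> A * C"
proof (cases "C = 0")
  case True
  have "B = 0"
  proof (rule ccontr)
    assume "B \<noteq> 0"
    then show False using assms[of "- (A + 1) / (2 * B)"] True by (simp add: field_simps)
  qed
  then show ?thesis using True by simp
next
  case False
  have C: "C > 0"
  proof (rule ccontr)
    assume "\<not> C > 0"
    then have c: "C < 0" using False by simp
    define t where "t = (\<bar>A\<bar> + 2 * \<bar>B\<bar> + 1) / (- C) + 1"
    have t1: "t \<ge> 1" using c by (simp add: t_def divide_nonneg_neg divide_nonpos_neg divide_le_0_iff)
    have "t * C = - (\<bar>A\<bar> + 2 * \<bar>B\<bar> + 1) + C" using c by (simp add: t_def field_simps)
    then have "t * (t * C) \<le> t * (- (\<bar>A\<bar> + 2 * \<bar>B\<bar> + 1))" using c t1 by (intro mult_left_mono) auto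
    moreover have "t * \<bar>A\<bar> \<ge> 1 * \<bar>A\<bar>" by (rule mult_right_mono[OF t1]) simp
    moreover have "t * B \<le> t * \<bar>B\<bar>" by (rule mult_left_mono) (use t1 in auto)
    moreover have "t * (- (\<bar>A\<bar> + 2 * \<bar>B\<bar> + 1)) = - (t * \<bar>A\<bar> + 2 * (t * \<bar>B\<bar>) + t)" by (simp add: algebra_simps)
    moreover have "A + 2 * t * B + t\<^sup>2 * C = A + 2 * (t * B) + t * (t * C)" by (simp add: power2_eq_square)
    ultimately have "A + 2 * t * B + t\<^sup>2 * C < 0" using t1 by linarith
    then show False using assms[of t] by simp
  qed
  have "A + 2 * (- B / C) * B + (- B / C)\<^sup>2 * C = A - B\<^sup>2 / C" using C by (simp add: power2_eq_square field_simps)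
  then have "B\<^sup>2 / C \<le> A" using assms[of "- B / C"] by simp
  then show ?thesis using C by (simp add: field_simps)
qed

locale marked_poset =
  fixes Y :: "'b set" and R :: "('b \<times> 'b) set" and bot top z1 z2 z3 :: 'b
  assumes finY: "finite Y" and inY: "bot \<in> Y" "top \<in> Y" "z1 \<in> Y" "z2 \<in> Y" "z3 \<in> Y"
    and dist: "distinct [bot, top, z1, z2, z3]"
    and RY: "R \<subseteq> Y \<times> Y" and irr: "(x, x) \<notin> R" and tr: "trans R"
    and least: "y \<in> Y \<Longrightarrow> y \<noteq> bot \<Longrightarrow> (bot, y) \<in> R" and greatest: "y \<in> Y \<Longrightarrow> y \<noteq> top \<Longrightarrow> (y, top) \<in> R"
    and z12: "(z1, z2) \<in> R" and z23: "(z2, z3) \<in> R"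
begin

definition LE :: "('b \<Rightarrow> nat) set" where
  "LE = {f \<in> extensional Y. bij_betw f Y {..<card Y} \<and> (\<forall>(i, j)\<in>R. f i < f j)}"

definition Gap :: "nat \<Rightarrow> nat \<Rightarrow> ('b \<Rightarrow> nat) set" where
  "Gap a b = {f \<in> LE. f z2 = f z1 + a \<and> f z3 = f z2 + b}"

definition F :: "nat \<Rightarrow> nat \<Rightarrow> nat" where "F a b = card (Gap a b)"

lemma finite_LE: "finite LE"
proof -
  have "LE \<subseteq> Pi\<^sub>E Y (\<lambda>_. {..<card Y})" by (auto simp: LE_def PiE_iff bij_betw_def extensional_def)
  then show ?thesis using finY finite_PiE[of Y "\<lambda>_. {..<card Y}"] finite_subset by blast
qed

lemma finite_Gap: "finite (Gap a b)"
  using finite_LE by (simp add: Gap_def)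

lemma gap_room:
  assumes "f \<in> Gap a b" shows "a + b + 3 \<le> card Y"
proof -
  have "(bot, z1) \<in> R" "(z3, top) \<in> R" using least[of z1] greatest[of z3] inY dist by auto
  then have "f bot < f z1" "f z3 < f top" "f top < card Y"
    using assms inY by (auto simp: Gap_def LE_def bij_betw_def)
  then show ?thesis using assms by (simp add: Gap_def)
qed

lemma F_room: "F a b > 0 \<Longrightarrow> a + b + 3 \<le> card Y"
  using gap_room finite_Gap by (auto simp: F_def card_gt_0_iff)

sublocale cfg: gap_config Y bot top z1 z2 z3 "\<lambda>_. 0"
  by unfold_locales (use finY inY dist in auto)

text \<open>For each edge set with dependent functionals fix one dependency. If all its edges were
  tight, \<open>w0\<close> would satisfy the same relation, and generic weights violate all these
  relations at once.\<close>

lemma generic_exists: obtains g where "generic_config Y bot top z1 z2 z3 g"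
proof -
  let ?d = "\<lambda>(b::'b \<Rightarrow> real) e. b (cfg.nd (snd e)) - b (cfg.nd (fst e))"
  define dep where "dep = (\<lambda>S c. (\<exists>e\<in>S. c e \<noteq> 0) \<and> (\<forall>b. (\<Sum>e\<in>S. c e * ?d b e) = 0))"
  define cc where "cc = (\<lambda>S. if \<exists>c. dep S c then SOME c. dep S c else (\<lambda>_. 0))"
  define K where "K = (\<lambda>S. \<Sum>e\<in>S. cc S e * cfg.H 1 1 1 e)"
  have d: "1 / (16 * 2 ^ card (Y \<times> Y)) > (0::real)" by simp
  obtain g where g: "\<And>i j. g (j, i) = - g (i, j)" "\<And>e. \<bar>g e\<bar> \<le> 1 / (16 * 2 ^ card (Y \<times> Y))"
    "\<And>S. S \<subseteq> Y \<times> Y - Id \<Longrightarrow> (\<forall>i j. (i, j) \<in> S \<longrightarrow> (j, i) \<notin> S) \<Longrightarrow> \<exists>e\<in>S. cc S e \<noteq> 0 \<Longrightarrow>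
      K S + (\<Sum>e\<in>S. cc S e * g e) \<noteq> 0"
    by (rule generic_weights[OF finY d, where c = cc and K = K]) blast
  interpret G: gap_config Y bot top z1 z2 z3 g by unfold_locales
  have "generic_config Y bot top z1 z2 z3 g"
  proof
    fix S and a :: "'b \<Rightarrow> real" and r :: "'b \<times> 'b \<Rightarrow> real"
    assume o: "G.oriented S" and t: "\<forall>e\<in>S. G.w0 e + (a (cfg.nd (snd e)) - a (cfg.nd (fst e))) = 0"
    have S: "S \<subseteq> Y \<times> Y - Id" "\<forall>i j. (i, j) \<in> S \<longrightarrow> (j, i) \<notin> S" using o by (auto simp: G.oriented_def)
    have fin: "finite S" using S(1) finY by (meson finite_Diff finite_SigmaI finite_subset)
    show "\<exists>b::'b \<Rightarrow> real. \<forall>e\<in>S. b (cfg.nd (snd e)) - b (cfg.nd (fst e)) = r e"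
    proof (rule ccontr)
      assume n: "\<not> ?thesis"
      have "(\<forall>r. \<exists>b. \<forall>e\<in>S. ?d b e = r e) \<or> (\<exists>c. (\<exists>e\<in>S. c e \<noteq> 0) \<and> (\<forall>b. (\<Sum>e\<in>S. c e * ?d b e) = 0))"
        by (rule functionals_dichotomy[OF fin, where \<phi> = "\<lambda>e b. ?d b e"]) (simp add: algebra_simps)
      then have ex: "\<exists>c. dep S c" using n unfolding dep_def by blast
      then have "dep S (cc S)" unfolding cc_def using someI_ex[of "dep S"] by simp
      then have c: "\<exists>e\<in>S. cc S e \<noteq> 0" "(\<Sum>e\<in>S. cc S e * ?d a e) = 0" by (auto simp: dep_def)
      have "K S + (\<Sum>e\<in>S. cc S e * g e) = (\<Sum>e\<in>S. cc S e * G.w0 e)"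
        by (simp add: K_def G.w0_def sum.distrib[symmetric] algebra_simps)
      also have "\<dots> = (\<Sum>e\<in>S. cc S e * G.w0 e) + (\<Sum>e\<in>S. cc S e * ?d a e)" using c by simp
      also have "\<dots> = (\<Sum>e\<in>S. cc S e * (G.w0 e + (a (cfg.nd (snd e)) - a (cfg.nd (fst e)))))"
        by (simp add: sum.distrib[symmetric] algebra_simps)
      also have "\<dots> = 0" using t by simp
      finally show False using g(3)[OF S c(1)] by simp
    qed
  qed (rule g(1), rule g(2))
  then show ?thesis using that by blast
qed

lemma hyperbolic:
  assumes k: "k \<ge> 1" "l \<ge> 1" "k + l + 4 \<le> card Y"
  shows "\<And>t::real. (F (k + 2) l + 2 * t * F (k + 1) (l + 1) + t\<^sup>2 * F k (l + 2)) * F k l \<le> (F (k + 1) l + t * F k (l + 1))\<^sup>2"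
    and "real (F k (l + 2)) * F k l \<le> (F k (l + 1))\<^sup>2"
proof -
  obtain g where "generic_config Y bot top z1 z2 z3 g" by (rule generic_exists)
  then interpret G: generic_config Y bot top z1 z2 z3 g .
  have full: "G.full R"
    unfolding G.full_def G.oriented_def
    using RY irr transD[OF tr] least greatest z12 z23 by blast
  have o: "G.oriented R" "G.spanning R" using full G.full_spanning by (auto simp: G.full_def)
  interpret C: config_system Y bot top z1 z2 z3 g R by (rule G.config[OF o])
  \<comment> \<open>Two slots short of the dimension. A gap of length \<open>k\<close> has
    \<open>k - 1\<close> inner elements.\<close>
  define as where "as = replicate (k - 1) 0 @ replicate (l - 1) 1 @ replicate (card Y - 4 - k - l) (2::nat)"
  let ?vs = "map G.D as"
  have len: "2 + length as = card (G.nd ` Y) - 1" using k by (simp add: as_def G.card_nodes)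
  have rep: "count_list (replicate n x) y = (if x = y then n else 0)" for n and x y :: nat by (induction n) auto
  have cnt: "count_list as 0 = k - 1" "count_list as 1 = l - 1"
    by (auto simp: as_def count_list_append rep)
  have LE: "G.LE R = LE" by (simp add: G.LE_def LE_def)
  have W: "C.W {} (G.D i # G.D j # ?vs) = card {f \<in> LE. G.good (i # j # as) f}" if "i < 3" "j < 3" for i j
  proof -
    have "C.W {} (map G.D (i # j # as)) = card {f \<in> G.LE R. G.good (i # j # as) f}"
      by (rule G.extension_count[OF full]) (use len that in \<open>auto simp: as_def\<close>)
    then show ?thesis by (simp add: LE del: C.W.simps)
  qed
  have wF: "C.W {} (G.D i # G.D j # ?vs) = F (k + (if i = 0 then 1 else 0) + (if j = 0 then 1 else 0)) (l + (if i = 1 then 1 else 0) + (if j = 1 then 1 else 0))"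
    if "i < 3" "j < 3" for i j
    unfolding W[OF that] F_def Gap_def G.good_def using cnt k
    by (intro arg_cong[where f = "\<lambda>A. real (card A)"]) auto
  have wadm: "C.wadm (G.D i)" for i unfolding G.D_def by (rule C.wadm_H) auto
  have AF: "C.W {} (x # x # ?vs) * C.W {} (G.D i # G.D i # ?vs) \<le> (C.W {} (x # G.D i # ?vs))\<^sup>2" for x i
  proof (cases "C.face {}")
    case True
    show ?thesis
      by (rule C.alexandrov_fenchel[OF True _ _ wadm]) (use len wadm in \<open>auto simp: C.dim_def\<close>)
  qed (simp add: C.W_nonface del: C.W.simps)
  show "real (F k (l + 2)) * F k l \<le> (F k (l + 1))\<^sup>2"
    using AF[of "G.D 1" 2] by (simp add: wF del: C.W.simps)
  fix t :: real
  show "(F (k + 2) l + 2 * t * F (k + 1) (l + 1) + t\<^sup>2 * F k (l + 2)) * F k l \<le> (F (k + 1) l + t * F k (l + 1))\<^sup>2"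
  proof (cases "C.face {}")
    case True
    have d: "card {} + 2 + length ?vs = C.dim" using len by (simp add: C.dim_def)
    have d': "card {} + length (G.D i # G.D j # ?vs) = C.dim" for i j using len by (simp add: C.dim_def)
    let ?x = "\<lambda>e. G.D 0 e + t * G.D 1 e"
    have "C.W {} (?x # G.D 2 # ?vs) = C.W {} (G.D 0 # G.D 2 # ?vs) + t * C.W {} (G.D 1 # G.D 2 # ?vs)"
      by (rule C.W_lin[OF True]) (use d in simp)
    then show ?thesis using AF[of ?x 2] C.W_quad(1)[OF True d, of "G.D 0" t "G.D 1"]
      by (simp add: wF del: C.W.simps)
  next
    case False
    have "F k l = 0" using wF[of 2 2] False by (simp add: C.W_nonface del: C.W.simps)
    then show ?thesis by simp
  qed
qed

text \<open>The first inequality of \<open>hyperbolic\<close> holds for every \<open>t\<close>; this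
  is the discriminant condition of that quadratic.\<close>

lemma hyperbolic_det:
  assumes "k \<ge> 1" "l \<ge> 1" "k + l + 4 \<le> card Y"
  shows "(real (F (k + 1) l) * F k (l + 1) - real (F k l) * F (k + 1) (l + 1))\<^sup>2 \<le>
    ((real (F (k + 1) l))\<^sup>2 - real (F k l) * F (k + 2) l) * ((real (F k (l + 1)))\<^sup>2 - real (F k l) * F k (l + 2))"
proof (rule quadratic_nonneg_discriminant)
  fix t
  show "0 \<le> (real (F (k + 1) l))\<^sup>2 - real (F k l) * F (k + 2) l + 2 * t *
     (real (F (k + 1) l) * F k (l + 1) - real (F k l) * F (k + 1) (l + 1)) +
     t\<^sup>2 * ((real (F k (l + 1)))\<^sup>2 - real (F k l) * F k (l + 2))"
    using hyperbolic(1)[OF assms, of t] by (simp add: power2_eq_square algebra_simps)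
qed

lemma log_concave:
  assumes "k \<ge> 1" "l \<ge> 1"
  shows "F k (l + 2) * F k l \<le> (F k (l + 1))\<^sup>2"
proof (cases "F k (l + 2) = 0")
  case False
  then have "k + l + 4 \<le> card Y" using F_room[of k "l + 2"] by simp
  from hyperbolic(2)[OF assms this] show ?thesis
    by (metis of_nat_le_iff of_nat_mult of_nat_power)
qed simp

end

section \<open>Moving single elements\<close>

text \<open>Cyclic rotation of the interval between \<open>i\<close> and \<open>j\<close>: the entry
  at \<open>i\<close> goes to \<open>j\<close>, and the others close up by one place.\<close>

definition shift :: "nat \<Rightarrow> nat \<Rightarrow> nat \<Rightarrow> nat" where
  "shift i j m = (if m = i then j else if i < m \<and> m \<le> j then m - 1 else if j \<le> m \<and> m < i then m + 1 else m)"

lemma shift_inv: "shift j i (shift i j m) = m"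
  unfolding shift_def by (simp split: if_splits) linarith

lemma shift_bound: "i < N \<Longrightarrow> j < N \<Longrightarrow> m < N \<Longrightarrow> shift i j m < N"
  unfolding shift_def by auto

lemma shift_bij: "i < N \<Longrightarrow> j < N \<Longrightarrow> bij_betw (shift i j) {..<N} {..<N}"
  by (rule bij_betw_byWitness[where f' = "shift j i"]) (auto simp: shift_inv shift_bound)

lemma ex_max_on:
  fixes f :: "'a \<Rightarrow> nat" assumes "finite S" "S \<noteq> {}"
  obtains w where "w \<in> S" "\<And>y. y \<in> S \<Longrightarrow> f y \<le> f w"
proof -
  have "Max (f ` S) \<in> f ` S" using assms by simp
  then obtain w where "w \<in> S" "f w = Max (f ` S)" by auto
  then show ?thesis using that assms by simp
qed

lemma ex_min_on:
  fixes f :: "'a \<Rightarrow> nat" assumes "finite S" "S \<noteq> {}"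
  obtains w where "w \<in> S" "\<And>y. y \<in> S \<Longrightarrow> f w \<le> f y"
proof -
  have "Min (f ` S) \<in> f ` S" using assms by simp
  then obtain w where "w \<in> S" "f w = Min (f ` S)" by auto
  then show ?thesis using that assms by simp
qed

context marked_poset
begin

lemma LE_D:
  assumes "f \<in> LE"
  shows "f \<in> extensional Y" "bij_betw f Y {..<card Y}" "(i, j) \<in> R \<Longrightarrow> f i < f j"
    "y \<in> Y \<Longrightarrow> f y < card Y" "x \<in> Y \<Longrightarrow> y \<in> Y \<Longrightarrow> f x = f y \<Longrightarrow> x = y"
  using assms by (auto simp: LE_def bij_betw_def inj_on_def)

lemma LE_at:
  assumes "f \<in> LE" "m < card Y" obtains y where "y \<in> Y" "f y = m"
proof -
  have "m \<in> f ` Y" using LE_D(2)[OF assms(1)] assms(2) by (simp add: bij_betw_def)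
  then show ?thesis using that by auto
qed

lemma R_in: "(i, j) \<in> R \<Longrightarrow> i \<in> Y" "(i, j) \<in> R \<Longrightarrow> j \<in> Y" using RY by auto

lemma card_between:
  assumes f: "f \<in> LE" and "a \<in> Y" "b \<in> Y"
  shows "card {y \<in> Y. f a < f y \<and> f y < f b} = f b - f a - 1"
proof -
  have "f ` {y \<in> Y. f a < f y \<and> f y < f b} = {f a<..<f b}"
  proof
    show "{f a<..<f b} \<subseteq> f ` {y \<in> Y. f a < f y \<and> f y < f b}"
    proof
      fix m assume m: "m \<in> {f a<..<f b}"
      then have "m < card Y" using LE_D(4)[OF f assms(3)] by simp
      then obtain y where "y \<in> Y" "f y = m" by (rule LE_at[OF f])
      then show "m \<in> f ` {y \<in> Y. f a < f y \<and> f y < f b}" using m by auto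
    qed
  qed auto
  moreover have "inj_on f {y \<in> Y. f a < f y \<and> f y < f b}" using LE_D(5)[OF f] by (auto simp: inj_on_def)
  ultimately show ?thesis using card_image by fastforce
qed

definition move :: "nat \<Rightarrow> nat \<Rightarrow> ('b \<Rightarrow> nat) \<Rightarrow> 'b \<Rightarrow> nat" where
  "move i j f = restrict (shift i j \<circ> f) Y"

lemma move_inv: "f \<in> extensional Y \<Longrightarrow> move j i (move i j f) = f"
  by (rule extensionalityI[of _ Y]) (auto simp: move_def shift_inv)

lemma move_apply: "y \<in> Y \<Longrightarrow> move i j f y = shift i j (f y)" by (simp add: move_def)

lemma move_LE:
  assumes f: "f \<in> LE" and w: "w \<in> Y" and j: "j < card Y"
    and up: "\<And>v. v \<in> Y \<Longrightarrow> f w < f v \<Longrightarrow> f v \<le> j \<Longrightarrow> (w, v) \<notin> R"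
    and down: "\<And>v. v \<in> Y \<Longrightarrow> j \<le> f v \<Longrightarrow> f v < f w \<Longrightarrow> (v, w) \<notin> R"
  shows "move (f w) j f \<in> LE"
proof -
  have "bij_betw (shift (f w) j \<circ> f) Y {..<card Y}"
    by (rule bij_betw_trans[OF LE_D(2)[OF f] shift_bij[OF LE_D(4)[OF f w] j]])
  then have b: "bij_betw (move (f w) j f) Y {..<card Y}"
    unfolding move_def using bij_betw_cong[of Y "restrict (shift (f w) j \<circ> f) Y" "shift (f w) j \<circ> f"] by simp
  have "move (f w) j f u < move (f w) j f v" if uv: "(u, v) \<in> R" for u v
  proof -
    have Y: "u \<in> Y" "v \<in> Y" using R_in uv by auto
    have lt: "f u < f v" by (rule LE_D(3)[OF f uv])
    consider "f u = f w" | "f v = f w" | "f u \<noteq> f w" "f v \<noteq> f w" by blast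
    then have "shift (f w) j (f u) < shift (f w) j (f v)"
    proof cases
      case 1
      then have "u = w" using LE_D(5)[OF f Y(1) w] by simp
      then have "\<not> f v \<le> j" using up[OF Y(2)] lt uv by auto
      then show ?thesis using lt 1 by (auto simp: shift_def)
    next
      case 2
      then have "v = w" using LE_D(5)[OF f Y(2) w] by simp
      then have "\<not> j \<le> f u" using down[OF Y(1)] lt uv by auto
      then show ?thesis using lt 2 by (auto simp: shift_def)
    next
      case 3
      then show ?thesis using lt unfolding shift_def by auto
    qed
    then show ?thesis using Y by (simp add: move_apply)
  qed
  moreover have "move (f w) j f \<in> extensional Y" unfolding move_def by (rule restrict_extensional)
  ultimately show ?thesis using b unfolding LE_def by auto
qed

text \<open>In \<open>f\<close> there are \<open>k\<close> elements between \<open>z1\<close> and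
  \<open>z2\<close>. If some of them is not below \<open>z2\<close>, the last such element moves
  past \<open>z2\<close>. Otherwise they cannot all be above \<open>z1\<close>, since an extension
  with gap \<open>k\<close> has only \<open>k - 1\<close> places there; the first exception moves
  before \<open>z1\<close>. The number \<open>s\<close> remembers its old position.\<close>

lemma first_move:
  assumes q: "F k (l + 2) > 0" and k: "k \<ge> 1" and f: "f \<in> Gap (k + 1) (l + 1)"
  shows "(\<exists>s\<in>{1..k}. \<exists>g\<in>Gap k (l + 2). f = move (g z2 + 1) (g z1 + s) g) \<or>
    (\<exists>s\<in>{1..k}. \<exists>g\<in>Gap k (l + 1). f = move (g z1 - 1) (g z1 - 1 + s) g \<and>
       (\<forall>y\<in>Y. g z1 \<le> g y \<and> g y < g z2 \<longrightarrow> (y, z2) \<in> R))"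
proof -
  have fL: "f \<in> LE" and p2: "f z2 = f z1 + (k + 1)" and p3: "f z3 = f z2 + (l + 1)" using f by (auto simp: Gap_def)
  note bound = LE_D(4)[OF fL] and inj = LE_D(5)[OF fL]
  define I where "I = {y \<in> Y. f z1 < f y \<and> f y < f z2}"
  define S where "S = {y \<in> I. (y, z2) \<notin> R}"
  have fin: "finite I" using finY by (simp add: I_def)
  show ?thesis
  proof (cases "S = {}")
    case False
    obtain w where w: "w \<in> S" "\<And>y. y \<in> S \<Longrightarrow> f y \<le> f w"
      by (rule ex_max_on[OF _ False, of f]) (use fin in \<open>auto simp: S_def\<close>)
    have wI: "w \<in> Y" "f z1 < f w" "f w < f z2" "(w, z2) \<notin> R" using w(1) by (auto simp: S_def I_def)
    have g: "move (f w) (f z2) f \<in> LE" (is "?g \<in> LE")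
    proof (rule move_LE[OF fL wI(1) bound[OF inY(4)]])
      fix v assume v: "v \<in> Y" "f w < f v" "f v \<le> f z2"
      show "(w, v) \<notin> R"
      proof (cases "v = z2")
        case False
        then have "f v < f z2" using inj[OF v(1) inY(4)] v(3) by linarith
        then have "v \<in> I" using v wI by (simp add: I_def)
        moreover have "v \<notin> S" using w(2)[of v] v(2) by auto
        ultimately have "(v, z2) \<in> R" by (simp add: S_def)
        then show ?thesis using wI(4) transD[OF tr, of w v z2] by blast
      qed (use wI in simp)
    qed (use wI in simp)
    have gz: "?g z1 = f z1" "?g z2 = f z2 - 1" "?g z3 = f z3"
      using wI p2 p3 inY by (auto simp: move_apply shift_def)
    have "?g \<in> Gap k (l + 2)" using g gz p2 p3 by (simp add: Gap_def)
    moreover have "f = move (?g z2 + 1) (?g z1 + (f w - f z1)) ?g"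
      using gz wI p2 move_inv[OF LE_D(1)[OF fL], of "f z2" "f w"] by simp
    moreover have "f w - f z1 \<in> {1..k}" using wI p2 by (simp; linarith)
    ultimately show ?thesis by blast
  next
    case True
    then have I2: "(y, z2) \<in> R" if "y \<in> I" for y using that by (auto simp: S_def)
    define T where "T = {y \<in> I. (z1, y) \<notin> R}"
    have "T \<noteq> {}"
    proof
      assume "T = {}"
      then have I1: "(z1, y) \<in> R" if "y \<in> I" for y using that by (auto simp: T_def)
      obtain h where h: "h \<in> Gap k (l + 2)" using q finite_Gap by (auto simp: F_def card_gt_0_iff)
      then have hL: "h \<in> LE" and h2: "h z2 = h z1 + k" by (auto simp: Gap_def)
      have "I \<subseteq> {y \<in> Y. h z1 < h y \<and> h y < h z2}"
        using I1 I2 LE_D(3)[OF hL] by (auto simp: I_def)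
      then have "card I \<le> h z2 - h z1 - 1"
        unfolding card_between[OF hL inY(3,4), symmetric] using finY by (intro card_mono) auto
      moreover have "card I = f z2 - f z1 - 1" unfolding I_def by (rule card_between[OF fL inY(3,4)])
      ultimately show False using h2 p2 k by simp
    qed
    then obtain w where w: "w \<in> T" "\<And>y. y \<in> T \<Longrightarrow> f w \<le> f y"
      by (rule ex_min_on[rotated, of T f]) (use fin in \<open>auto simp: T_def\<close>)
    have wI: "w \<in> Y" "f z1 < f w" "f w < f z2" "(z1, w) \<notin> R" using w(1) by (auto simp: T_def I_def)
    have g: "move (f w) (f z1) f \<in> LE" (is "?g \<in> LE")
    proof (rule move_LE[OF fL wI(1) bound[OF inY(3)]])
      fix v assume v: "v \<in> Y" "f z1 \<le> f v" "f v < f w"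
      show "(v, w) \<notin> R"
      proof (cases "v = z1")
        case False
        then have "f z1 < f v" using inj[OF v(1) inY(3)] v(2) by linarith
        then have "v \<in> I" using v wI by (simp add: I_def)
        moreover have "v \<notin> T" using w(2)[of v] v(3) by auto
        ultimately have "(z1, v) \<in> R" by (simp add: T_def)
        then show ?thesis using wI(4) transD[OF tr, of z1 v w] by blast
      qed (use wI in simp)
    qed (use wI in simp)
    have gz: "?g z1 = f z1 + 1" "?g z2 = f z2" "?g z3 = f z3"
      using wI p2 p3 inY by (auto simp: move_apply shift_def)
    have "?g \<in> Gap k (l + 1)" using g gz p2 p3 by (simp add: Gap_def)
    moreover have "f = move (?g z1 - 1) (?g z1 - 1 + (f w - f z1)) ?g"
      using gz wI p2 move_inv[OF LE_D(1)[OF fL], of "f z1" "f w"] by simp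
    moreover have "f w - f z1 \<in> {1..k}" using wI p2 by (simp; linarith)
    moreover have "(y, z2) \<in> R" if y: "y \<in> Y" "?g z1 \<le> ?g y" "?g y < ?g z2" for y
    proof -
      have "y = z1 \<or> y \<in> I"
        using y gz wI p2 inj[OF y(1) inY(3)] unfolding move_apply[OF y(1)] by (auto simp: I_def shift_def split: if_splits)
      then show ?thesis using I2 z12 by auto
    qed
    ultimately show ?thesis by blast
  qed
qed

text \<open>The element moved between \<open>z2\<close> and \<open>z3\<close> exists because \<open>h\<close> has more elements there than \<open>f\<close>.\<close>

lemma second_move:
  assumes h: "h \<in> LE" "h z2 + (l + 2) \<le> h z3" and f: "f \<in> Gap k (l + 1)"
    and I: "\<And>y. y \<in> Y \<Longrightarrow> f z1 \<le> f y \<Longrightarrow> f y < f z2 \<Longrightarrow> (y, z2) \<in> R"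
  shows "\<exists>g\<in>Gap k (l + 2). (\<exists>t\<in>{..g z1}. f = move (g z2 + 1) t g) \<or> (\<exists>t\<in>{g z3..<card Y}. f = move (g z3 - 1) t g)"
proof -
  have fL: "f \<in> LE" and p2: "f z2 = f z1 + k" and p3: "f z3 = f z2 + (l + 1)" using f by (auto simp: Gap_def)
  note bound = LE_D(4)[OF fL] and inj = LE_D(5)[OF fL]
  define S where "S = {y \<in> Y. f z3 < f y \<and> (z3, y) \<notin> R}"
  show ?thesis
  proof (cases "S = {}")
    case False
    obtain w where w: "w \<in> S" "\<And>y. y \<in> S \<Longrightarrow> f w \<le> f y"
      by (rule ex_min_on[OF _ False, of f]) (use finY in \<open>auto simp: S_def\<close>)
    have wI: "w \<in> Y" "f z3 < f w" "(z3, w) \<notin> R" using w(1) by (auto simp: S_def)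
    have g: "move (f w) (f z3) f \<in> LE" (is "?g \<in> LE")
    proof (rule move_LE[OF fL wI(1) bound[OF inY(5)]])
      fix v assume v: "v \<in> Y" "f z3 \<le> f v" "f v < f w"
      show "(v, w) \<notin> R"
      proof (cases "v = z3")
        case False
        then have "f z3 < f v" using inj[OF v(1) inY(5)] v(2) by linarith
        moreover have "v \<notin> S" using w(2)[of v] v(3) by auto
        ultimately have "(z3, v) \<in> R" using v by (simp add: S_def)
        then show ?thesis using wI(3) transD[OF tr, of z3 v w] by blast
      qed (use wI in simp)
    qed (use wI in simp)
    have gz: "?g z1 = f z1" "?g z2 = f z2" "?g z3 = f z3 + 1"
      using wI p2 p3 inY by (auto simp: move_apply shift_def)
    have "?g \<in> Gap k (l + 2)" using g gz p2 p3 by (simp add: Gap_def)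
    moreover have "f = move (?g z3 - 1) (f w) ?g"
      using gz move_inv[OF LE_D(1)[OF fL], of "f z3" "f w"] by simp
    moreover have "f w \<in> {?g z3..<card Y}" using wI gz bound by simp
    ultimately show ?thesis by blast
  next
    case True
    define T where "T = {y \<in> Y. f y < f z2 \<and> (y, z2) \<notin> R}"
    have "T \<noteq> {}"
    proof
      assume T: "T = {}"
      note hL = h(1) and h3 = h(2)
      have "{y \<in> Y. h z2 < h y \<and> h y < h z3} \<subseteq> {y \<in> Y. f z2 < f y \<and> f y < f z3}"
      proof
        fix y assume "y \<in> {y \<in> Y. h z2 < h y \<and> h y < h z3}"
        then have y: "y \<in> Y" "h z2 < h y" "h y < h z3" by auto
        have "\<not> f y < f z2"
        proof
          assume "f y < f z2"
          then have "(y, z2) \<in> R" using T y(1) by (auto simp: T_def)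
          then show False using LE_D(3)[OF hL] y by fastforce
        qed
        moreover have "\<not> f z3 < f y"
        proof
          assume "f z3 < f y"
          then have "(z3, y) \<in> R" using True y(1) by (auto simp: S_def)
          then show False using LE_D(3)[OF hL] y by fastforce
        qed
        moreover have "f y \<noteq> f z2" "f y \<noteq> f z3" using inj[OF y(1)] inY y(2,3) by auto
        ultimately show "y \<in> {y \<in> Y. f z2 < f y \<and> f y < f z3}" using y(1) by simp
      qed
      then have "h z3 - h z2 - 1 \<le> f z3 - f z2 - 1"
        unfolding card_between[OF hL inY(4,5), symmetric] card_between[OF fL inY(4,5), symmetric]
        using finY by (intro card_mono) auto
      then show False using h3 p3 by simp
    qed
    then obtain w where w: "w \<in> T" "\<And>y. y \<in> T \<Longrightarrow> f y \<le> f w"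
      by (rule ex_max_on[rotated, of T f]) (use finY in \<open>auto simp: T_def\<close>)
    have wI: "w \<in> Y" "f w < f z2" "(w, z2) \<notin> R" using w(1) by (auto simp: T_def)
    \<comment> \<open>Everything from \<open>z1\<close> up to \<open>z2\<close> lies below
      \<open>z2\<close>, so \<open>w\<close> comes before \<open>z1\<close>. Moving it past
      \<open>z2\<close> shifts both marks and preserves their distance.\<close>
    have w1: "f w < f z1" using I[OF wI(1)] wI by (meson not_le)
    have g: "move (f w) (f z2) f \<in> LE" (is "?g \<in> LE")
    proof (rule move_LE[OF fL wI(1) bound[OF inY(4)]])
      fix v assume v: "v \<in> Y" "f w < f v" "f v \<le> f z2"
      show "(w, v) \<notin> R"
      proof (cases "v = z2")
        case False
        then have "f v < f z2" using inj[OF v(1) inY(4)] v(3) by linarith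
        moreover have "v \<notin> T" using w(2)[of v] v(2) by auto
        ultimately have "(v, z2) \<in> R" using v by (simp add: T_def)
        then show ?thesis using wI(3) transD[OF tr, of w v z2] by blast
      qed (use wI in simp)
    qed (use wI in simp)
    have gz: "?g z1 = f z1 - 1" "?g z2 = f z2 - 1" "?g z3 = f z3"
      using wI w1 p2 p3 inY by (auto simp: move_apply shift_def)
    have "?g \<in> Gap k (l + 2)" using g gz p2 p3 w1 by (simp add: Gap_def)
    moreover have "f = move (?g z2 + 1) (f w) ?g"
      using gz w1 p2 move_inv[OF LE_D(1)[OF fL], of "f z2" "f w"] by simp
    moreover have "f w \<in> {..?g z1}" using w1 gz by simp
    ultimately show ?thesis by blast
  qed
qed

text \<open>Undoing the moves recovers every extension from one in \<open>G\<close> and the old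
  positions. The first move has \<open>k\<close> possible positions; a second one, if present,
  starts outside the marks and has \<open>card Y - k - l - 1\<close>.\<close>

lemma move_bound:
  assumes q: "F k (l + 2) > 0" and k: "k \<ge> 1"
  shows "F (k + 1) (l + 1) \<le> k * (card Y - k - l) * F k (l + 2)"
proof -
  define G where "G = Gap k (l + 2)"
  define N where "N = card Y"
  define mvI where "mvI = (\<lambda>(s, g). move (g z2 + 1) (g z1 + s) g)"
  define mvO where "mvO = (\<lambda>(g, t). if t \<le> g z1 then move (g z2 + 1) t g else move (g z3 - 1) t g)"
  define mvL where "mvL = (\<lambda>(s, g). move (g z1 - 1) (g z1 - 1 + s) g)"
  define P where "P = Sigma G (\<lambda>g. {..g z1} \<union> {g z3..<N})"
  obtain hq where "hq \<in> Gap k (l + 2)" using q finite_Gap by (auto simp: F_def card_gt_0_iff)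
  then have hq: "hq \<in> LE" "hq z2 + (l + 2) \<le> hq z3" by (auto simp: Gap_def)
  have N: "k + l + 5 \<le> N" using F_room[OF q] by (simp add: N_def)
  have finG: "finite G" by (simp add: G_def finite_Gap)
  have finP: "finite P" unfolding P_def using finG by (intro finite_SigmaI) auto
  have "Gap (k + 1) (l + 1) \<subseteq> mvI ` ({1..k} \<times> G) \<union> mvL ` ({1..k} \<times> mvO ` P)"
  proof
    fix f assume f: "f \<in> Gap (k + 1) (l + 1)"
    show "f \<in> mvI ` ({1..k} \<times> G) \<union> mvL ` ({1..k} \<times> mvO ` P)"
      using first_move[OF q k f]
    proof (elim disjE bexE conjE)
      fix s g assume "s \<in> {1..k}" "g \<in> Gap k (l + 2)" "f = move (g z2 + 1) (g z1 + s) g"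
      then have "f \<in> mvI ` ({1..k} \<times> G)" unfolding mvI_def G_def by (intro image_eqI[of _ _ "(s, g)"]) auto
      then show ?thesis by blast
    next
      fix s g assume s: "s \<in> {1..k}" and g: "g \<in> Gap k (l + 1)" "f = move (g z1 - 1) (g z1 - 1 + s) g"
        "\<forall>y\<in>Y. g z1 \<le> g y \<and> g y < g z2 \<longrightarrow> (y, z2) \<in> R"
      obtain h where h: "h \<in> G" "(\<exists>t\<in>{..h z1}. g = move (h z2 + 1) t h) \<or> (\<exists>t\<in>{h z3..<N}. g = move (h z3 - 1) t h)"
        using second_move[OF hq(1,2) g(1)] g(3) unfolding G_def N_def by blast
      have hz: "h z1 < h z3" using h(1) by (simp add: G_def Gap_def)
      from h(2) have "g \<in> mvO ` P"
      proof (elim disjE bexE)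
        fix t assume "t \<in> {..h z1}" "g = move (h z2 + 1) t h"
        then show ?thesis using h(1) unfolding mvO_def P_def by (intro image_eqI[of _ _ "(h, t)"]) auto
      next
        fix t assume "t \<in> {h z3..<N}" "g = move (h z3 - 1) t h"
        then show ?thesis using h(1) hz unfolding mvO_def P_def by (intro image_eqI[of _ _ "(h, t)"]) auto
      qed
      then have "f \<in> mvL ` ({1..k} \<times> mvO ` P)" using s g(2) unfolding mvL_def by (intro image_eqI[of _ _ "(s, g)"]) auto
      then show ?thesis by blast
    qed
  qed
  then have "card (Gap (k + 1) (l + 1)) \<le> card (mvI ` ({1..k} \<times> G) \<union> mvL ` ({1..k} \<times> mvO ` P))"
    using finG finP by (intro card_mono) auto
  also have "\<dots> \<le> card (mvI ` ({1..k} \<times> G)) + card (mvL ` ({1..k} \<times> mvO ` P))" by (rule card_Un_le)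
  also have "\<dots> \<le> card ({1..k} \<times> G) + card ({1..k} \<times> mvO ` P)"
    using finG finP by (intro add_mono card_image_le) auto
  also have "\<dots> \<le> k * card G + k * card P"
    using card_image_le[OF finP, of mvO] by (simp add: card_cartesian_product)
  also have "card P = (\<Sum>g\<in>G. card ({..g z1} \<union> {g z3..<N}))" unfolding P_def using finG by (intro card_SigmaI) auto
  also have "\<dots> = (\<Sum>g\<in>G. N - k - l - 1)"
  proof (rule sum.cong)
    fix g assume g: "g \<in> G"
    then have gz: "g z2 = g z1 + k" "g z3 = g z2 + (l + 2)" "g z3 < N" using LE_D(4)[of g z3] inY(5) by (auto simp: G_def Gap_def N_def)
    have "card ({..g z1} \<union> {g z3..<N}) = card {..g z1} + card {g z3..<N}"
      using gz by (intro card_Un_disjoint) auto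
    then show "card ({..g z1} \<union> {g z3..<N}) = N - k - l - 1" using gz by simp
  qed simp
  also have "k * card G + k * (\<Sum>g\<in>G. N - k - l - 1) = k * card G * (1 + (N - k - l - 1))"
    by (simp add: algebra_simps)
  also have "1 + (N - k - l - 1) = N - k - l" using N by simp
  finally show ?thesis unfolding F_def G_def N_def by (simp add: mult_ac)
qed

section \<open>Duality\<close>

lemma dual: "marked_poset Y (R\<inverse>) top bot z3 z2 z1"
proof
  show "trans (R\<inverse>)" using tr by simp
qed (use finY inY dist RY irr least greatest z12 z23 in auto)

lemma dual_F: "marked_poset.F Y (R\<inverse>) z3 z2 z1 a b = F b a"
proof -
  interpret d: marked_poset Y "R\<inverse>" top bot z3 z2 z1 by (rule dual)
  define rv where "rv = (\<lambda>f. restrict (\<lambda>y. card Y - 1 - f y) Y)"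
  have rvx: "rv f \<in> extensional Y" for f unfolding rv_def by (rule restrict_extensional)
  have dl: "card Y - 1 - (card Y - 1 - m) = m" if "m < card Y" for m using that by simp
  have bij: "bij_betw (\<lambda>m. card Y - 1 - m) {..<card Y} {..<card Y}"
    by (rule bij_betw_byWitness[where f' = "\<lambda>m. card Y - 1 - m"]) auto
  have ty: "bij_betw (rv f) Y {..<card Y}" if "bij_betw f Y {..<card Y}" for f
  proof -
    have "bij_betw ((\<lambda>m. card Y - 1 - m) \<circ> f) Y {..<card Y}" by (rule bij_betw_trans[OF that bij])
    then show ?thesis unfolding rv_def using bij_betw_cong[of Y "restrict (\<lambda>y. card Y - 1 - f y) Y" "(\<lambda>m. card Y - 1 - m) \<circ> f"] by simp
  qed
  have b: "f y < card Y" if "bij_betw f Y {..<card Y}" "y \<in> Y" for f y using that by (auto simp: bij_betw_def)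
  have inv: "rv (rv f) = f" if "bij_betw f Y {..<card Y}" "f \<in> extensional Y" for f
  proof (rule extensionalityI[of _ Y])
    fix y assume "y \<in> Y"
    then show "rv (rv f) y = f y" using dl[OF b[OF that(1)]] unfolding rv_def by (simp only: restrict_apply if_True)
  qed (use that rvx in auto)
  have "bij_betw rv (d.Gap a b) (Gap b a)"
  proof (rule bij_betw_byWitness[where f' = rv])
    show "\<forall>f\<in>d.Gap a b. rv (rv f) = f" using inv by (auto simp: d.Gap_def d.LE_def)
    show "\<forall>f\<in>Gap b a. rv (rv f) = f" using inv by (auto simp: Gap_def LE_def)
    show "rv ` d.Gap a b \<subseteq> Gap b a"
    proof (rule image_subsetI)
      fix f assume f: "f \<in> d.Gap a b"
      then have fL: "bij_betw f Y {..<card Y}" and m: "\<And>i j. (i, j) \<in> R \<Longrightarrow> f j < f i"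
        and g: "f z2 = f z3 + a" "f z1 = f z2 + b" by (auto simp: d.Gap_def d.LE_def)
      have "rv f i < rv f j" if "(i, j) \<in> R" for i j
        using m[OF that] b[OF fL R_in(1)[OF that]] R_in[OF that] unfolding rv_def by (simp; linarith)
      then have "rv f \<in> LE" using ty[OF fL] unfolding LE_def by (auto intro: rvx)
      then show "rv f \<in> Gap b a" using g b[OF fL inY(3)] inY by (simp add: Gap_def rv_def)
    qed
    show "rv ` Gap b a \<subseteq> d.Gap a b"
    proof (rule image_subsetI)
      fix f assume f: "f \<in> Gap b a"
      then have fL: "bij_betw f Y {..<card Y}" and m: "\<And>i j. (i, j) \<in> R \<Longrightarrow> f i < f j"
        and g: "f z2 = f z1 + b" "f z3 = f z2 + a" by (auto simp: Gap_def LE_def)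
      have "rv f j < rv f i" if "(i, j) \<in> R" for i j
        using m[OF that] b[OF fL R_in(2)[OF that]] R_in[OF that] unfolding rv_def by (simp; linarith)
      then have "rv f \<in> d.LE" using ty[OF fL] unfolding d.LE_def by (auto intro: rvx)
      then show "rv f \<in> d.Gap a b" using g b[OF fL inY(5)] inY by (simp add: d.Gap_def rv_def)
    qed
  qed
  then show ?thesis unfolding F_def d.F_def by (rule bij_betw_same_card)
qed

lemma move_bound_dual:
  assumes "F (k + 2) l > 0" "l \<ge> 1"
  shows "F (k + 1) (l + 1) \<le> l * (card Y - k - l) * F (k + 2) l"
proof -
  interpret d: marked_poset Y "R\<inverse>" top bot z3 z2 z1 by (rule dual)
  show ?thesis using d.move_bound[of l k] assms by (simp add: dual_F add.commute diff_commute)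
qed

end

section \<open>The four functions theorem\<close>

text \<open>With \<open>C = c1 * d0\<close> bounding both mixed products,
  \<open>(C - a0 * b1) * (C - a1 * b0) \<ge> 0\<close> bounds their sum by \<open>C\<close> plus
  their product divided by \<open>C\<close>.\<close>

lemma four_functions_point:
  fixes a0 a1 b0 b1 c0 c1 d0 d1 :: real
  assumes nn: "a0 \<ge> 0" "a1 \<ge> 0" "b0 \<ge> 0" "b1 \<ge> 0" "c0 \<ge> 0" "c1 \<ge> 0" "d0 \<ge> 0" "d1 \<ge> 0"
    and h: "a0 * b0 \<le> c0 * d0" "a0 * b1 \<le> c1 * d0" "a1 * b0 \<le> c1 * d0" "a1 * b1 \<le> c1 * d1"
  shows "(a0 + a1) * (b0 + b1) \<le> (c0 + c1) * (d0 + d1)"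
proof -
  have "a0 * b1 + a1 * b0 \<le> c1 * d0 + c0 * d1"
  proof (cases "c1 * d0 = 0")
    case True
    have "0 \<le> c0 * d1" using nn by simp
    then show ?thesis using True h by linarith
  next
    case False
    define C where "C = c1 * d0"
    have C: "C > 0" using False nn by (simp add: C_def less_le)
    have "(a0 * b0) * (a1 * b1) \<le> (c0 * d0) * (c1 * d1)" by (rule mult_mono[OF h(1,4)]) (use nn in auto)
    then have "(a0 * b1) * (a1 * b0) \<le> C * (c0 * d1)" by (simp add: C_def mult_ac)
    moreover have "(C - a0 * b1) * (C - a1 * b0) \<ge> 0" using h by (simp add: C_def)
    then have "C * (a0 * b1 + a1 * b0) \<le> C * C + (a0 * b1) * (a1 * b0)" by (simp add: algebra_simps)
    ultimately have "C * (a0 * b1 + a1 * b0) \<le> C * (C + c0 * d1)" by (simp add: algebra_simps)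
    then show ?thesis unfolding mult_le_cancel_left_pos[OF C] by (simp add: C_def)
  qed
  then show ?thesis using h by (simp add: algebra_simps)
qed

theorem four_functions:
  fixes \<alpha> \<beta> \<gamma> \<delta> :: "'a set \<Rightarrow> real"
  assumes "finite D"
    and nn: "\<And>A. A \<subseteq> D \<Longrightarrow> \<alpha> A \<ge> 0 \<and> \<beta> A \<ge> 0 \<and> \<gamma> A \<ge> 0 \<and> \<delta> A \<ge> 0"
    and h: "\<And>A B. A \<subseteq> D \<Longrightarrow> B \<subseteq> D \<Longrightarrow> \<alpha> A * \<beta> B \<le> \<gamma> (A \<union> B) * \<delta> (A \<inter> B)"
  shows "(\<Sum>A\<in>Pow D. \<alpha> A) * (\<Sum>A\<in>Pow D. \<beta> A) \<le> (\<Sum>A\<in>Pow D. \<gamma> A) * (\<Sum>A\<in>Pow D. \<delta> A)"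
  using assms
proof (induction D arbitrary: \<alpha> \<beta> \<gamma> \<delta> rule: finite_induct)
  case empty
  then show ?case by simp
next
  case (insert x D)
  define up where "up = (\<lambda>f A. f A + f (insert x A) :: real)"
  have S: "(\<Sum>A\<in>Pow (insert x D). f A) = (\<Sum>A\<in>Pow D. up f A)" for f
  proof -
    have "inj_on (insert x) (Pow D)" using insert.hyps by (auto simp: inj_on_def)
    moreover have "Pow D \<inter> insert x ` Pow D = {}" using insert.hyps by auto
    ultimately show ?thesis using insert.hyps
      by (simp add: Pow_insert sum.union_disjoint sum.reindex up_def sum.distrib)
  qed
  have "(\<Sum>A\<in>Pow D. up \<alpha> A) * (\<Sum>A\<in>Pow D. up \<beta> A) \<le> (\<Sum>A\<in>Pow D. up \<gamma> A) * (\<Sum>A\<in>Pow D. up \<delta> A)"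
  proof (rule insert.IH)
    fix A assume "A \<subseteq> D"
    then have "A \<subseteq> insert x D" "insert x A \<subseteq> insert x D" by auto
    then show "up \<alpha> A \<ge> 0 \<and> up \<beta> A \<ge> 0 \<and> up \<gamma> A \<ge> 0 \<and> up \<delta> A \<ge> 0"
      unfolding up_def using insert.prems(1) by (metis add_nonneg_nonneg)
  next
    fix A B assume AB: "A \<subseteq> D" "B \<subseteq> D"
    then have x: "x \<notin> A" "x \<notin> B" using insert.hyps by auto
    have s: "A \<subseteq> insert x D" "insert x A \<subseteq> insert x D" "B \<subseteq> insert x D" "insert x B \<subseteq> insert x D"
      "A \<union> B \<subseteq> insert x D" "insert x (A \<union> B) \<subseteq> insert x D" "A \<inter> B \<subseteq> insert x D" "insert x (A \<inter> B) \<subseteq> insert x D"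
      using AB by auto
    have e: "A \<union> insert x B = insert x (A \<union> B)" "insert x A \<union> B = insert x (A \<union> B)"
      "insert x A \<union> insert x B = insert x (A \<union> B)" "A \<inter> insert x B = A \<inter> B" "insert x A \<inter> B = A \<inter> B"
      "insert x A \<inter> insert x B = insert x (A \<inter> B)"
      using x by auto
    show "up \<alpha> A * up \<beta> B \<le> up \<gamma> (A \<union> B) * up \<delta> (A \<inter> B)"
      unfolding up_def
    proof (rule four_functions_point)
      show "\<alpha> A * \<beta> B \<le> \<gamma> (A \<union> B) * \<delta> (A \<inter> B)" by (rule insert.prems(2)[OF s(1,3)])
      show "\<alpha> A * \<beta> (insert x B) \<le> \<gamma> (insert x (A \<union> B)) * \<delta> (A \<inter> B)"
        using insert.prems(2)[OF s(1,4)] by (simp only: e)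
      show "\<alpha> (insert x A) * \<beta> B \<le> \<gamma> (insert x (A \<union> B)) * \<delta> (A \<inter> B)"
        using insert.prems(2)[OF s(2,3)] by (simp only: e)
      show "\<alpha> (insert x A) * \<beta> (insert x B) \<le> \<gamma> (insert x (A \<union> B)) * \<delta> (insert x (A \<inter> B))"
        using insert.prems(2)[OF s(2,4)] by (simp only: e)
    qed (use insert.prems(1) s in auto)
  qed
  then show ?case by (simp only: S)
qed

text \<open>Apply the four functions theorem to \<open>u A = \<alpha> A * \<beta> (D - A)\<close> and its complement; both sides become
  squares.\<close>

lemma four_functions_complement:
  fixes \<alpha> \<beta> \<gamma> \<delta> :: "'a set \<Rightarrow> real"
  assumes D: "finite D"
    and nn: "\<And>A. A \<subseteq> D \<Longrightarrow> \<alpha> A \<ge> 0 \<and> \<beta> A \<ge> 0 \<and> \<gamma> A \<ge> 0 \<and> \<delta> A \<ge> 0"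
    and h: "\<And>A B. A \<subseteq> D \<Longrightarrow> B \<subseteq> D \<Longrightarrow> \<alpha> A * \<beta> B \<le> \<gamma> (A \<union> B) * \<delta> (A \<inter> B)"
  shows "(\<Sum>A\<in>Pow D. \<alpha> A * \<beta> (D - A)) \<le> (\<Sum>A\<in>Pow D. \<gamma> A * \<delta> (D - A))"
proof -
  define u v where "u = (\<lambda>A. \<alpha> A * \<beta> (D - A))" and "v = (\<lambda>A. \<gamma> A * \<delta> (D - A))"
  have un: "u A \<ge> 0" "v A \<ge> 0" if "A \<subseteq> D" for A
    using nn[OF that] nn[of "D - A"] by (auto simp: u_def v_def)
  have c: "(\<Sum>A\<in>Pow D. f (D - A)) = (\<Sum>A\<in>Pow D. f A)" for f :: "'a set \<Rightarrow> real"
    by (rule sum.reindex_bij_witness[where i = "\<lambda>A. D - A" and j = "\<lambda>A. D - A"]) (auto simp: double_diff)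
  have "(\<Sum>A\<in>Pow D. u A) * (\<Sum>A\<in>Pow D. u (D - A)) \<le> (\<Sum>A\<in>Pow D. v A) * (\<Sum>A\<in>Pow D. v (D - A))"
  proof (rule four_functions[OF D])
    fix A B assume AB: "A \<subseteq> D" "B \<subseteq> D"
    have s: "D - A \<subseteq> D" "D - B \<subseteq> D" by auto
    have e: "D - (D - B) = B" "D - (A \<union> B) = (D - A) \<inter> (D - B)" "D - (A \<inter> B) = (D - A) \<union> (D - B)" using AB by auto
    have i: "A \<inter> B \<subseteq> D" using AB by auto
    have e': "D - (D - A \<inter> B) = A \<inter> B" using AB by auto
    have "u A * u (D - B) = (\<alpha> A * \<beta> B) * (\<alpha> (D - B) * \<beta> (D - A))" unfolding u_def e by (simp only: mult_ac)
    also have "\<dots> \<le> (\<gamma> (A \<union> B) * \<delta> (A \<inter> B)) * (\<gamma> ((D - B) \<union> (D - A)) * \<delta> ((D - B) \<inter> (D - A)))"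
      by (rule mult_mono[OF h h]) (use AB s nn[of "A \<union> B"] nn[OF i] nn[of "D - B"] nn[of "D - A"] in auto)
    also have "\<dots> = v (A \<union> B) * v (D - A \<inter> B)"
    proof -
      have "D - (A \<union> B) = (D - B) \<inter> (D - A)" "D - A \<inter> B = (D - B) \<union> (D - A)" by auto
      then show ?thesis unfolding v_def e' by (simp only: mult_ac)
    qed
    finally show "u A * u (D - B) \<le> v (A \<union> B) * v (D - A \<inter> B)" .
  qed (use un in auto)
  then have "(\<Sum>A\<in>Pow D. u A)\<^sup>2 \<le> (\<Sum>A\<in>Pow D. v A)\<^sup>2" by (simp add: c power2_eq_square)
  moreover have "(\<Sum>A\<in>Pow D. v A) \<ge> 0" using un by (intro sum_nonneg) auto
  ultimately have "(\<Sum>A\<in>Pow D. u A) \<le> (\<Sum>A\<in>Pow D. v A)" by (rule power2_le_imp_le)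
  then show ?thesis by (simp add: u_def v_def)
qed

definition mx :: "'a set \<Rightarrow> ('a \<Rightarrow> nat) \<Rightarrow> ('a \<Rightarrow> nat) \<Rightarrow> 'a \<Rightarrow> nat" where
  "mx W f g = (\<lambda>u\<in>W. max (f u) (g u))"
definition mn :: "'a set \<Rightarrow> ('a \<Rightarrow> nat) \<Rightarrow> ('a \<Rightarrow> nat) \<Rightarrow> 'a \<Rightarrow> nat" where
  "mn W f g = (\<lambda>u\<in>W. min (f u) (g u))"

text \<open>A pair with prescribed maximum and minimum is determined by the subset of
  \<open>D\<close> on which \<open>f\<close> takes the larger value, and \<open>g\<close> takes it
  on the complement. So this is the complement form on the subsets of \<open>D\<close>.\<close>

lemma four_functions_fibre:
  fixes W :: "'a set" and \<alpha> \<beta> \<gamma> \<delta> :: "('a \<Rightarrow> nat) \<Rightarrow> real"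
  assumes W: "finite W" and \<Phi>: "\<Phi> = Pi\<^sub>E W (\<lambda>_. {..<K})"
    and nn: "\<And>f. f \<in> \<Phi> \<Longrightarrow> \<alpha> f \<ge> 0 \<and> \<beta> f \<ge> 0 \<and> \<gamma> f \<ge> 0 \<and> \<delta> f \<ge> 0"
    and h: "\<And>f g. f \<in> \<Phi> \<Longrightarrow> g \<in> \<Phi> \<Longrightarrow> \<alpha> f * \<beta> g \<le> \<gamma> (mx W f g) * \<delta> (mn W f g)"
    and hl: "hi \<in> \<Phi>" "lo \<in> \<Phi>" "\<And>u. u \<in> W \<Longrightarrow> lo u \<le> hi u"
  shows "(\<Sum>(f, g)\<in>{(f, g) \<in> \<Phi> \<times> \<Phi>. mx W f g = hi \<and> mn W f g = lo}. \<alpha> f * \<beta> g) \<le>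
    (\<Sum>(f, g)\<in>{(f, g) \<in> \<Phi> \<times> \<Phi>. mx W f g = hi \<and> mn W f g = lo}. \<gamma> f * \<delta> g)"
proof -
  define D where "D = {u \<in> W. lo u < hi u}"
  define mix where "mix = (\<lambda>A. \<lambda>u\<in>W. if u \<in> A then hi u else lo u)"
  have mix: "mix A \<in> \<Phi>" for A using hl(1,2) unfolding \<Phi> mix_def by (auto simp: PiE_iff)
  have ext: "f \<in> extensional W" if "f \<in> \<Phi>" for f using that by (auto simp: \<Phi> PiE_iff)
  have mext: "mix A \<in> extensional W" for A by (rule ext[OF mix])
  have xext: "mx W f g \<in> extensional W" "mn W f g \<in> extensional W" for f g unfolding mx_def mn_def by (rule restrict_extensional)+
  have D: "finite D" using W by (simp add: D_def)
  have fib: "(\<Sum>(f, g)\<in>{(f, g) \<in> \<Phi> \<times> \<Phi>. mx W f g = hi \<and> mn W f g = lo}. a f * b g) =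
    (\<Sum>A\<in>Pow D. a (mix A) * b (mix (D - A)))" for a b :: "('a \<Rightarrow> nat) \<Rightarrow> real"
  proof (rule sum.reindex_bij_witness[where i = "\<lambda>A. (mix A, mix (D - A))" and j = "\<lambda>(f, g). {u \<in> D. f u = hi u}"])
    fix p assume "p \<in> {(f, g) \<in> \<Phi> \<times> \<Phi>. mx W f g = hi \<and> mn W f g = lo}"
    then obtain f g where p: "p = (f, g)" "f \<in> \<Phi>" "g \<in> \<Phi>" "mx W f g = hi" "mn W f g = lo" by auto
    have v: "max (f u) (g u) = hi u" "min (f u) (g u) = lo u" if "u \<in> W" for u
      using p(4,5) that by (auto simp: mx_def mn_def)
    let ?A = "{u \<in> D. f u = hi u}"
    have "mix ?A = f"
    proof (rule extensionalityI[of _ W])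
      fix u assume u: "u \<in> W"
      then show "mix ?A u = f u" using v[OF u] by (auto simp: mix_def D_def max_def min_def split: if_splits)
    qed (use ext p mext in auto)
    moreover have "mix (D - ?A) = g"
    proof (rule extensionalityI[of _ W])
      fix u assume u: "u \<in> W"
      then show "mix (D - ?A) u = g u" using v[OF u] by (auto simp: mix_def D_def max_def min_def split: if_splits)
    qed (use ext p mext in auto)
    ultimately show "(\<lambda>A. (mix A, mix (D - A))) (case p of (f, g) \<Rightarrow> {u \<in> D. f u = hi u}) = p"
      and "a (mix (case p of (f, g) \<Rightarrow> {u \<in> D. f u = hi u})) * b (mix (D - (case p of (f, g) \<Rightarrow> {u \<in> D. f u = hi u}))) = (case p of (f, g) \<Rightarrow> a f * b g)"
      by (simp_all add: p(1))
    show "(case p of (f, g) \<Rightarrow> {u \<in> D. f u = hi u}) \<in> Pow D" by (auto simp: p(1))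
  next
    fix A assume "A \<in> Pow D"
    then have A: "A \<subseteq> D" "A \<subseteq> W" by (auto simp: D_def)
    show "(case (mix A, mix (D - A)) of (f, g) \<Rightarrow> {u \<in> D. f u = hi u}) = A"
      using A by (auto simp: mix_def D_def)
    have "mx W (mix A) (mix (D - A)) = hi"
    proof (rule extensionalityI[of _ W])
      fix u assume u: "u \<in> W"
      then show "mx W (mix A) (mix (D - A)) u = hi u" using A hl(3)[OF u] by (auto simp: mx_def mix_def D_def max_def)
    qed (use ext hl xext in auto)
    moreover have "mn W (mix A) (mix (D - A)) = lo"
    proof (rule extensionalityI[of _ W])
      fix u assume u: "u \<in> W"
      then show "mn W (mix A) (mix (D - A)) u = lo u" using A hl(3)[OF u] by (auto simp: mn_def mix_def D_def min_def)
    qed (use ext hl xext in auto)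
    ultimately show "(mix A, mix (D - A)) \<in> {(f, g) \<in> \<Phi> \<times> \<Phi>. mx W f g = hi \<and> mn W f g = lo}" using mix by auto
  qed
  have "(\<Sum>A\<in>Pow D. \<alpha> (mix A) * \<beta> (mix (D - A))) \<le> (\<Sum>A\<in>Pow D. \<gamma> (mix A) * \<delta> (mix (D - A)))"
  proof (rule four_functions_complement[OF D])
    fix A B assume AB: "A \<subseteq> D" "B \<subseteq> D"
    have "mx W (mix A) (mix B) = mix (A \<union> B)"
      unfolding mx_def by (rule extensionalityI[of _ W]) (use hl(3) in \<open>auto simp: mix_def max_def intro: antisym\<close>)
    moreover have "mn W (mix A) (mix B) = mix (A \<inter> B)"
      unfolding mn_def by (rule extensionalityI[of _ W]) (use hl(3) in \<open>auto simp: mix_def min_def intro: antisym\<close>)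
    ultimately show "\<alpha> (mix A) * \<beta> (mix B) \<le> \<gamma> (mix (A \<union> B)) * \<delta> (mix (A \<inter> B))"
      using h[OF mix mix, of A B] by simp
  qed (use nn mix in blast)
  then show ?thesis unfolding fib .
qed

text \<open>Sum over the fibres of maximum and minimum. Unlike the product form of the theorem, this
  permits a side condition linking \<open>f\<close> and \<open>g\<close>, which later fixes the
  joint sizes of the levels.\<close>

lemma four_functions_pairs:
  fixes W :: "'a set" and \<alpha> \<beta> \<gamma> \<delta> :: "('a \<Rightarrow> nat) \<Rightarrow> real"
  assumes W: "finite W" and \<Phi>: "\<Phi> = Pi\<^sub>E W (\<lambda>_. {..<K})"
    and nn: "\<And>f. f \<in> \<Phi> \<Longrightarrow> \<alpha> f \<ge> 0 \<and> \<beta> f \<ge> 0 \<and> \<gamma> f \<ge> 0 \<and> \<delta> f \<ge> 0"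
    and h: "\<And>f g. f \<in> \<Phi> \<Longrightarrow> g \<in> \<Phi> \<Longrightarrow> \<alpha> f * \<beta> g \<le> \<gamma> (mx W f g) * \<delta> (mn W f g)"
    and Q: "\<And>f g. f \<in> \<Phi> \<Longrightarrow> g \<in> \<Phi> \<Longrightarrow> Q f g \<longleftrightarrow> Q (mx W f g) (mn W f g)"
  shows "(\<Sum>(f, g)\<in>{(f, g) \<in> \<Phi> \<times> \<Phi>. Q f g}. \<alpha> f * \<beta> g) \<le> (\<Sum>(f, g)\<in>{(f, g) \<in> \<Phi> \<times> \<Phi>. Q f g}. \<gamma> f * \<delta> g)"
proof -
  define P where "P = {(f, g) \<in> \<Phi> \<times> \<Phi>. Q f g}"
  define ty where "ty = (\<lambda>(f, g). (mx W f g, mn W f g))"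
  have fin: "finite \<Phi>" unfolding \<Phi> by (rule finite_PiE[OF W]) auto
  have finP: "finite P" unfolding P_def by (rule finite_subset[OF _ finite_cartesian_product[OF fin fin]]) auto
  have dec: "(\<Sum>(f, g)\<in>P. a f * b g) = (\<Sum>t\<in>ty ` P. \<Sum>(f, g)\<in>{p \<in> P. ty p = t}. a f * b g)" for a b :: "('a \<Rightarrow> nat) \<Rightarrow> real"
    by (rule sum.image_gen[OF finP])
  show ?thesis
    unfolding P_def[symmetric] dec
  proof (rule sum_mono)
    fix t assume "t \<in> ty ` P"
    then obtain f g where fg: "t = (mx W f g, mn W f g)" "f \<in> \<Phi>" "g \<in> \<Phi>" "Q f g" by (auto simp: ty_def P_def)
    have \<Phi>': "mx W f g \<in> \<Phi>" "mn W f g \<in> \<Phi>" using fg(2,3) by (auto simp: \<Phi> mx_def mn_def PiE_iff)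
    have eq: "{p \<in> P. ty p = t} = {(f', g') \<in> \<Phi> \<times> \<Phi>. mx W f' g' = mx W f g \<and> mn W f' g' = mn W f g}"
    proof -
      have "Q f' g'" if "f' \<in> \<Phi>" "g' \<in> \<Phi>" "mx W f' g' = mx W f g" "mn W f' g' = mn W f g" for f' g'
        using Q[OF that(1,2)] Q[OF fg(2,3)] fg(4) that(3,4) by simp
      then show ?thesis by (auto simp: P_def ty_def fg(1))
    qed
    show "(\<Sum>(f, g)\<in>{p \<in> P. ty p = t}. \<alpha> f * \<beta> g) \<le> (\<Sum>(f, g)\<in>{p \<in> P. ty p = t}. \<gamma> f * \<delta> g)"
      unfolding eq by (rule four_functions_fibre[OF W \<Phi> nn h \<Phi>']) (simp_all add: mx_def mn_def)
  qed
qed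

text \<open>The factorial is log-convex, and the two cardinalities on the right have the same sum as
  those on the left but are at least as far apart.\<close>

lemma fact_card_supermodular:
  assumes "finite A" "finite B"
  shows "fact (card A) * fact (card B) \<le> (fact (card (A \<union> B)) * fact (card (A \<inter> B)) :: real)"
proof -
  have f: "fact (i + p) * fact (i + q) \<le> (fact (i + p + q) * fact i :: nat)" for i p q :: nat
  proof (induction p)
    case (Suc p)
    have "fact (i + Suc p) * fact (i + q) = Suc (i + p) * (fact (i + p) * fact (i + q))" by (simp add: algebra_simps)
    also have "\<dots> \<le> Suc (i + p + q) * (fact (i + p + q) * fact i)" by (rule mult_le_mono[OF _ Suc]) simp
    also have "\<dots> = fact (i + Suc p + q) * fact i" by (simp add: algebra_simps)
    finally show ?case .
  qed simp
  define i where "i = card (A \<inter> B)"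
  have "card A + card B = card (A \<union> B) + i" "i \<le> card A" "i \<le> card B"
    using card_Un_Int[OF assms] assms by (auto simp: i_def card_mono)
  then have e: "i + (card A - i) = card A" "i + (card B - i) = card B" "card A + (card B - i) = card (A \<union> B)" by auto
  have "fact (card A) * fact (card B) \<le> (fact (card (A \<union> B)) * fact i :: nat)"
    using f[of i "card A - i" "card B - i"] unfolding e .
  then have "real (fact (card A) * fact (card B)) \<le> real (fact (card (A \<union> B)) * fact i)" by (simp only: of_nat_le_iff)
  then show ?thesis unfolding i_def of_nat_mult of_nat_fact .
qed

section \<open>Order-preserving maps into a fine chain\<close>

lemma card_levels:
  fixes n :: "nat \<Rightarrow> nat"
  assumes M: "M > 0"
  shows "card {U. U \<subseteq> {..<c * M} \<and> (\<forall>i<c. card {x \<in> U. x div M = i} = n i)} = (\<Prod>i<c. M choose n i)"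
proof -
  define A where "A = (\<lambda>i. {i * M..<i * M + M})"
  have A: "x \<in> A i \<longleftrightarrow> x div M = i" for x i
    unfolding A_def atLeastLessThan_iff using div_nat_eqI[of M i x] M
    by (auto simp: mult.commute) (metis div_mult_mod_eq mult.commute add_less_cancel_left mod_less_divisor)
  have lt: "x < c * M \<longleftrightarrow> x div M < c" for x using M by (simp add: div_less_iff_less_mult)
  let ?T = "Pi\<^sub>E {..<c} (\<lambda>i. {V. V \<subseteq> A i \<and> card V = n i})"
  have "bij_betw (\<lambda>U. \<lambda>i\<in>{..<c}. {x \<in> U. x div M = i}) {U. U \<subseteq> {..<c * M} \<and> (\<forall>i<c. card {x \<in> U. x div M = i} = n i)} ?T"
  proof (rule bij_betw_byWitness[where f' = "\<lambda>V. \<Union>i<c. V i"])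
    show "\<forall>U\<in>{U. U \<subseteq> {..<c * M} \<and> (\<forall>i<c. card {x \<in> U. x div M = i} = n i)}.
        (\<Union>i<c. (\<lambda>i\<in>{..<c}. {x \<in> U. x div M = i}) i) = U"
      using lt by auto
    have inv: "{x \<in> \<Union>i<c. V i. x div M = i} = V i" if "V \<in> ?T" "i < c" for V i
    proof -
      have "V j \<subseteq> A j" if "j < c" for j using \<open>V \<in> ?T\<close> that by (auto simp: PiE_iff)
      then have "x div M = j" if "x \<in> V j" "j < c" for x j using that A by auto
      then show ?thesis using \<open>i < c\<close> by auto
    qed
    show "\<forall>V\<in>?T. (\<lambda>i\<in>{..<c}. {x \<in> \<Union>i<c. V i. x div M = i}) = V"
    proof
      fix V assume V: "V \<in> ?T"
      show "(\<lambda>i\<in>{..<c}. {x \<in> \<Union>i<c. V i. x div M = i}) = V"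
        by (rule extensionalityI[of _ "{..<c}"]) (use inv[OF V] V in \<open>auto simp: PiE_iff\<close>)
    qed
    show "(\<lambda>U. \<lambda>i\<in>{..<c}. {x \<in> U. x div M = i}) ` {U. U \<subseteq> {..<c * M} \<and> (\<forall>i<c. card {x \<in> U. x div M = i} = n i)} \<subseteq> ?T"
      using A by (auto simp: PiE_iff)
    show "(\<lambda>V. \<Union>i<c. V i) ` ?T \<subseteq> {U. U \<subseteq> {..<c * M} \<and> (\<forall>i<c. card {x \<in> U. x div M = i} = n i)}"
    proof (rule image_subsetI)
      fix V assume V: "V \<in> ?T"
      have s: "V j \<subseteq> A j" "card (V j) = n j" if "j < c" for j using V that by (auto simp: PiE_iff)
      have "x < c * M" if "x \<in> V j" "j < c" for x j
      proof -
        have "x \<in> A j" using s(1)[OF that(2)] that(1) by auto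
        then have "x div M = j" by (simp only: A)
        then show ?thesis using lt that(2) by simp
      qed
      then have "(\<Union>i<c. V i) \<subseteq> {..<c * M}" by auto
      then show "(\<Union>i<c. V i) \<in> {U. U \<subseteq> {..<c * M} \<and> (\<forall>i<c. card {x \<in> U. x div M = i} = n i)}"
        using inv[OF V] s(2) by simp
    qed
  qed
  then have "card {U. U \<subseteq> {..<c * M} \<and> (\<forall>i<c. card {x \<in> U. x div M = i} = n i)} = card ?T"
    by (rule bij_betw_same_card)
  also have "\<dots> = (\<Prod>i<c. card {V. V \<subseteq> A i \<and> card V = n i})" by (rule card_PiE) simp
  also have "\<dots> = (\<Prod>i<c. M choose n i)" by (simp add: n_subsets A_def)
  finally show ?thesis .
qed

lemma binomial_ratio_limit: "(\<lambda>M. real (M choose n) * fact n / real M ^ n) \<longlonglongrightarrow> 1"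
proof -
  have e: "real (M choose n) * fact n / real M ^ n = (\<Prod>i<n. (real M - real i) / real M)" for M
    by (simp add: binomial_gbinomial gbinomial_prod_rev atLeast0LessThan prod_dividef)
  have "(\<lambda>M. \<Prod>i<n. (real M - real i) / real M) \<longlonglongrightarrow> (\<Prod>i<n. 1)"
  proof (rule tendsto_prod)
    fix i
    have "(\<lambda>M. 1 - real i / real M) \<longlonglongrightarrow> 1 - 0"
      by (intro tendsto_intros lim_const_over_n)
    moreover have "\<forall>\<^sub>F M in sequentially. 1 - real i / real M = (real M - real i) / real M"
      using eventually_gt_at_top[of 0] by eventually_elim (simp add: field_simps)
    ultimately show "(\<lambda>M. (real M - real i) / real M) \<longlonglongrightarrow> 1"
      using tendsto_cong by fastforce
  qed
  then show ?thesis by (simp add: e)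
qed

lemma noninjective_limit:
  assumes "finite W"
  shows "(\<lambda>M. real (card {f \<in> W \<rightarrow>\<^sub>E {..<c * M}. \<not> inj_on f W}) / real M ^ card W) \<longlonglongrightarrow> 0"
proof -
  define m where "m = card W"
  have tot: "real (card {f \<in> W \<rightarrow>\<^sub>E {..<c * M}. \<not> inj_on f W}) = real (c * M) ^ m - (\<Prod>i<m. real (c * M - i))" for M
  proof -
    have fin: "finite (W \<rightarrow>\<^sub>E {..<c * M})" by (rule finite_PiE[OF assms]) simp
    have "card (W \<rightarrow>\<^sub>E {..<c * M}) = card {f \<in> W \<rightarrow>\<^sub>E {..<c * M}. inj_on f W} + card {f \<in> W \<rightarrow>\<^sub>E {..<c * M}. \<not> inj_on f W}"
      using fin by (subst card_Un_disjoint[symmetric]) (auto intro!: arg_cong[where f = card])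
    moreover have "card (W \<rightarrow>\<^sub>E {..<c * M}) = (c * M) ^ m" using assms by (simp add: card_funcsetE m_def)
    moreover have "card {f \<in> W \<rightarrow>\<^sub>E {..<c * M}. inj_on f W} = (\<Prod>i<m. c * M - i)"
      using card_inj_on_subset_funcset[OF assms, of "{..<c * M}" W] by (simp add: m_def atLeast0LessThan)
    ultimately have "(c * M) ^ m = (\<Prod>i<m. c * M - i) + card {f \<in> W \<rightarrow>\<^sub>E {..<c * M}. \<not> inj_on f W}" by simp
    then have "real ((c * M) ^ m) = real ((\<Prod>i<m. c * M - i) + card {f \<in> W \<rightarrow>\<^sub>E {..<c * M}. \<not> inj_on f W})" by (rule arg_cong)
    then show ?thesis by simp
  qed
  have "(\<lambda>M. (\<Prod>i<m. real (c * M) / real M) - (\<Prod>i<m. real (c * M - i) / real M)) \<longlonglongrightarrow> (\<Prod>i<m. real c) - (\<Prod>i<m. real c)"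
  proof (intro tendsto_diff tendsto_prod)
    have ev: "\<forall>\<^sub>F M in sequentially. real c = real (c * M) / real M"
      using eventually_gt_at_top[of 0] by eventually_elim simp
    show "(\<lambda>M. real (c * M) / real M) \<longlonglongrightarrow> real c"
      using tendsto_cong[OF ev] tendsto_const by blast
    fix i
    show "(\<lambda>M. real (c * M - i) / real M) \<longlonglongrightarrow> real c"
    proof (cases "c = 0")
      case False
      have "(\<lambda>M. real c - real i / real M) \<longlonglongrightarrow> real c - 0"
        by (intro tendsto_intros lim_const_over_n)
      moreover have "\<forall>\<^sub>F M in sequentially. real c - real i / real M = real (c * M - i) / real M"
        using eventually_gt_at_top[of i]
      proof eventually_elim
        case (elim M)
        have "1 * M \<le> c * M" using False by (intro mult_right_mono) auto
        then have "i \<le> c * M" using elim by linarith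
        then show ?case using elim by (simp add: of_nat_diff field_simps)
      qed
      ultimately show ?thesis using tendsto_cong by fastforce
    qed simp
  qed
  moreover have "real (card {f \<in> W \<rightarrow>\<^sub>E {..<c * M}. \<not> inj_on f W}) / real M ^ card W =
      (\<Prod>i<m. real (c * M) / real M) - (\<Prod>i<m. real (c * M - i) / real M)" for M
    unfolding tot m_def[symmetric] by (simp add: prod_dividef diff_divide_distrib power_divide del: of_nat_mult)
  ultimately show ?thesis by simp
qed

context marked_poset
begin

lemma relabel:
  fixes P :: "nat set"
  assumes P: "finite P" "card P = card Y" and p: "p1 \<in> P" "p2 \<in> P" "p3 \<in> P"
  shows "card {e \<in> extensional Y. bij_betw e Y P \<and> (\<forall>(i, j)\<in>R. e i < e j) \<and> e z1 = p1 \<and> e z2 = p2 \<and> e z3 = p3} =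
    card {L \<in> LE. L z1 = card {x \<in> P. x < p1} \<and> L z2 = card {x \<in> P. x < p2} \<and> L z3 = card {x \<in> P. x < p3}}"
proof -
  let ?N = "card Y"
  obtain h where h: "bij_betw h {..<?N} P" "strict_mono_on {..<?N} h"
    using ex_bij_betw_strict_mono_card[OF P(1)] unfolding P(2) .
  have hlt: "h i < h j \<longleftrightarrow> i < j" if "i < ?N" "j < ?N" for i j
    using h(2) that by (simp add: strict_mono_on_less)
  have rank: "r = card {x \<in> P. x < h r}" if "r < ?N" for r
  proof -
    have "{x \<in> P. x < h r} = h ` {..<r}"
      using h(1) hlt that by (auto simp: bij_betw_def)
    moreover have "inj_on h {..<r}" using h(1) that by (auto simp: bij_betw_def inj_on_def)
    ultimately show ?thesis by (simp add: card_image)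
  qed
  have hin: "r < ?N \<Longrightarrow> h r \<in> P" for r using h(1) by (auto simp: bij_betw_def)
  define k where "k = inv_into {..<?N} h"
  have k: "k (h r) = r" if "r < ?N" for r using h(1) that by (simp add: k_def bij_betw_def inv_into_f_f)
  have hk: "h (k x) = x" "k x < ?N" if "x \<in> P" for x
    using h(1) that inv_into_into[of x h "{..<?N}"] by (auto simp: k_def bij_betw_def f_inv_into_f)
  have hz: "h r = x \<longleftrightarrow> r = card {y \<in> P. y < x}" if "r < ?N" "x \<in> P" for r x
    using rank[OF that(1)] rank[OF hk(2)[OF that(2)]] hk(1)[OF that(2)] by metis
  have kb: "bij_betw k P {..<?N}" unfolding k_def by (rule bij_betw_inv_into[OF h(1)])
  let ?A = "{e \<in> extensional Y. bij_betw e Y P \<and> (\<forall>(i, j)\<in>R. e i < e j) \<and> e z1 = p1 \<and> e z2 = p2 \<and> e z3 = p3}"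
  let ?B = "{L \<in> LE. L z1 = card {x \<in> P. x < p1} \<and> L z2 = card {x \<in> P. x < p2} \<and> L z3 = card {x \<in> P. x < p3}}"
  have bc: "bij_betw (restrict (f \<circ> e) Y) Y B" if "bij_betw e Y A" "bij_betw f A B" for e :: "'b \<Rightarrow> nat" and f :: "nat \<Rightarrow> nat" and A B
    using bij_betw_trans[OF that] bij_betw_cong[of Y "restrict (f \<circ> e) Y" "f \<circ> e"] by simp
  have "bij_betw (\<lambda>L. restrict (h \<circ> L) Y) ?B ?A"
  proof (rule bij_betw_byWitness[where f' = "\<lambda>e. restrict (k \<circ> e) Y"])
    show "\<forall>L\<in>?B. restrict (k \<circ> restrict (h \<circ> L) Y) Y = L"
    proof
      fix L assume "L \<in> ?B"
      then have L: "L \<in> LE" by simp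
      show "restrict (k \<circ> restrict (h \<circ> L) Y) Y = L"
        by (rule extensionalityI[of _ Y]) (use LE_D(1,4)[OF L] k in auto)
    qed
    show "\<forall>e\<in>?A. restrict (h \<circ> restrict (k \<circ> e) Y) Y = e"
    proof
      fix e assume e: "e \<in> ?A"
      then have "e y \<in> P" if "y \<in> Y" for y using that by (auto simp: bij_betw_def)
      then show "restrict (h \<circ> restrict (k \<circ> e) Y) Y = e"
        by (intro extensionalityI[of _ Y]) (use e hk in auto)
    qed
    show "(\<lambda>L. restrict (h \<circ> L) Y) ` ?B \<subseteq> ?A"
    proof (rule image_subsetI)
      fix L assume B: "L \<in> ?B"
      then have L: "L \<in> LE" by simp
      note b = LE_D(4)[OF L]
      have "h (L i) < h (L j)" if "(i, j) \<in> R" for i j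
        using hlt[OF b b] R_in[OF that] LE_D(3)[OF L that] by simp
      moreover have "h (L z1) = p1" "h (L z2) = p2" "h (L z3) = p3"
        using B hz[OF b[OF inY(3)] p(1)] hz[OF b[OF inY(4)] p(2)] hz[OF b[OF inY(5)] p(3)] by auto
      ultimately show "restrict (h \<circ> L) Y \<in> ?A" using bc[OF LE_D(2)[OF L] h(1)] R_in inY by auto
    qed
    show "(\<lambda>e. restrict (k \<circ> e) Y) ` ?A \<subseteq> ?B"
    proof (rule image_subsetI)
      fix e assume e: "e \<in> ?A"
      then have eP: "e y \<in> P" if "y \<in> Y" for y using that by (auto simp: bij_betw_def)
      have mono: "k (e i) < k (e j)" if "(i, j) \<in> R" for i j
      proof -
        have "e i \<in> P" "e j \<in> P" "e i < e j" using eP R_in[OF that] e that by auto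
        then show ?thesis using hlt[OF hk(2) hk(2), of "e i" "e j"] hk(1) by simp
      qed
      have kz: "k x = card {y \<in> P. y < x}" if "x \<in> P" for x using hz[OF hk(2)[OF that] that] hk(1)[OF that] by simp
      have "bij_betw e Y P" using e by simp
      from bc[OF this kb] mono have "restrict (k \<circ> e) Y \<in> LE"
        unfolding LE_def using R_in by auto
      then show "restrict (k \<circ> e) Y \<in> ?B" using e kz p inY by simp
    qed
  qed
  then show ?thesis by (rule bij_betw_same_card[THEN sym])
qed

definition W where "W = Y - {z1, z2, z3}"

lemma W: "finite W" "card W = card Y - 3" "z1 \<notin> W" "z2 \<notin> W" "z3 \<notin> W" "W \<subseteq> Y"
proof -
  have "card {z1, z2, z3} = 3" using dist by auto
  then show "card W = card Y - 3" unfolding W_def using inY finY by (subst card_Diff_subset) auto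
qed (auto simp: W_def finY)

text \<open>The chain \<open>{..<5 * M}\<close> consists of five levels of length \<open>M\<close>. The mark \<open>z2\<close> lies between the levels
  1 and 2, \<open>z1\<close> before or (if \<open>p\<close>) after level 1, and \<open>z3\<close> before or (if \<open>q\<close>) after level 3. The scaling
  by 3 leaves room for the marks, which thus are never tied.\<close>

definition lab :: "bool \<Rightarrow> bool \<Rightarrow> nat \<Rightarrow> ('b \<Rightarrow> nat) \<Rightarrow> 'b \<Rightarrow> nat" where
  "lab p q M f = (\<lambda>y\<in>Y. if y = z1 then 3 * ((if p then 2 else 1) * M) else if y = z2 then 6 * M + 1
     else if y = z3 then 3 * ((if q then 4 else 3) * M) else 3 * f y + 2)"

definition Mon :: "bool \<Rightarrow> bool \<Rightarrow> nat \<Rightarrow> ('b \<Rightarrow> nat) set" where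
  "Mon p q M = {f \<in> W \<rightarrow>\<^sub>E {..<5 * M}. \<forall>(i, j)\<in>R. lab p q M f i < lab p q M f j}"

definition lv :: "nat \<Rightarrow> ('b \<Rightarrow> nat) \<Rightarrow> nat \<Rightarrow> 'b set" where "lv M f i = {u \<in> W. f u div M = i}"

text \<open>Ranks of the marks when level \<open>i\<close> holds \<open>n i\<close> elements: each
  mark counts the levels and the marks before it. Level 1 is before \<open>z1\<close> exactly if
  \<open>p\<close>, and level 3 is before \<open>z3\<close> exactly if \<open>q\<close>.\<close>

definition zcond :: "bool \<Rightarrow> bool \<Rightarrow> (nat \<Rightarrow> nat) \<Rightarrow> ('b \<Rightarrow> nat) \<Rightarrow> bool" where
  "zcond p q n L \<longleftrightarrow> L z1 = (if p then n 0 + n 1 else n 0) \<and> L z2 = n 0 + n 1 + 1 \<and>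
     L z3 = n 0 + n 1 + n 2 + (if q then n 3 else 0) + 2"

text \<open>The image \<open>U\<close> fixes the set \<open>P\<close> of all labels, so an
  admissible map is a linear extension followed by the increasing enumeration of \<open>P\<close>,
  and the level sizes fix the ranks of the marks.\<close>

lemma count_injective_image:
  assumes M: "M > 0" and n: "(\<Sum>i<5. n i) = card W" and U: "U \<subseteq> {..<5 * M}" "\<And>i. i < 5 \<Longrightarrow> card {x \<in> U. x div M = i} = n i"
  shows "card {f \<in> Mon p q M. inj_on f W \<and> f ` W = U} = card {L \<in> LE. zcond p q n L}"
proof -
  define c1 c3 where "c1 = (if p then 2 else 1::nat)" and "c3 = (if q then 4 else 3::nat)"
  have c: "c1 \<le> 2" "3 \<le> c3" "c3 \<le> 5" by (auto simp: c1_def c3_def)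
  have finU: "finite U" using U(1) finite_subset by blast
  have below: "card {x \<in> U. x < j * M} = (\<Sum>i<j. n i)" if "j \<le> 5" for j
    using that
  proof (induction j)
    case (Suc j)
    have "{x \<in> U. x < Suc j * M} = {x \<in> U. x < j * M} \<union> {x \<in> U. x div M = j}"
      using M by (auto simp: less_mult_imp_div_less div_less_iff_less_mult[symmetric] simp del: mult_Suc)
    moreover have "{x \<in> U. x < j * M} \<inter> {x \<in> U. x div M = j} = {}"
      using M by (auto simp: div_less_iff_less_mult[symmetric])
    ultimately show ?case using Suc U(2)[of j] finU by (simp add: card_Un_disjoint)
  qed simp
  have "{x \<in> U. x < 5 * M} = U" using U(1) by auto
  then have cU: "card U = card W" using below[of 5] n by simp
  define f3 where "f3 = (\<lambda>x::nat. 3 * x + 2)"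
  define a1 a2 a3 where "a1 = 3 * (c1 * M)" and "a2 = 6 * M + 1" and "a3 = 3 * (c3 * M)"
  define Z where "Z = {a1, a2, a3}"
  define P where "P = f3 ` U \<union> Z"
  have a: "a1 < a2" "a2 < a3"
  proof -
    have "c1 * M \<le> 2 * M" "3 * M \<le> c3 * M" using c by (auto intro: mult_right_mono simp del: One_nat_def)
    then show "a1 < a2" "a2 < a3" using M unfolding a1_def a2_def a3_def by linarith+
  qed
  have f3a: "f3 x \<noteq> a1" "f3 x \<noteq> a2" "f3 x \<noteq> a3" "f3 x < a1 \<longleftrightarrow> x < c1 * M" "f3 x < a2 \<longleftrightarrow> x < 2 * M" "f3 x < a3 \<longleftrightarrow> x < c3 * M" for x
    unfolding f3_def a1_def a2_def a3_def by presburger+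
  have disj: "f3 ` A \<inter> Z = {}" for A using f3a by (auto simp: Z_def)
  have f3_inj: "f3 x = f3 y \<longleftrightarrow> x = y" for x y by (simp add: f3_def)
  have injf: "inj_on f3 A" for A by (auto simp: inj_on_def f3_inj)
  have cZ: "card Z = 3" "finite Z" using a by (auto simp: Z_def)
  have cP: "finite P" "card P = card Y"
  proof -
    show "finite P" using finU cZ by (simp add: P_def)
    have "card P = card U + 3"
      unfolding P_def using finU cZ disj by (subst card_Un_disjoint) (auto simp: card_image[OF injf])
    moreover have "3 \<le> card Y" using card_mono[OF finY, of "{z1, z2, z3}"] inY dist by auto
    ultimately show "card P = card Y" using cU W(2) by simp
  qed
  have rk: "card {x \<in> P. x < t} = card {x \<in> U. f3 x < t} + card {x \<in> Z. x < t}" for t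
  proof -
    have "{x \<in> P. x < t} = f3 ` {x \<in> U. f3 x < t} \<union> {x \<in> Z. x < t}"
      unfolding P_def by auto
    moreover have "f3 ` {x \<in> U. f3 x < t} \<inter> {x \<in> Z. x < t} = {}"
      using disj by blast
    ultimately show ?thesis using finU cZ by (simp add: card_Un_disjoint card_image[OF injf])
  qed
  have r1: "card {x \<in> P. x < a1} = (if p then n 0 + n 1 else n 0)"
  proof -
    have "{x \<in> Z. x < a1} = {}" using a by (auto simp: Z_def)
    then have "card {x \<in> P. x < a1} = (\<Sum>i<c1. n i)" unfolding rk f3a using below[of c1] c by simp
    then show ?thesis by (simp add: c1_def numeral_2_eq_2)
  qed
  have r2: "card {x \<in> P. x < a2} = n 0 + n 1 + 1"
  proof -
    have "{x \<in> Z. x < a2} = {a1}" using a by (auto simp: Z_def)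
    then show ?thesis unfolding rk f3a using below[of 2] by (simp add: numeral_2_eq_2)
  qed
  have r3: "card {x \<in> P. x < a3} = n 0 + n 1 + n 2 + (if q then n 3 else 0) + 2"
  proof -
    have "{x \<in> Z. x < a3} = {a1, a2}" using a by (auto simp: Z_def)
    then have "card {x \<in> P. x < a3} = (\<Sum>i<c3. n i) + 2" unfolding rk f3a using below[of c3] c a by simp
    then show ?thesis by (simp add: c3_def eval_nat_numeral)
  qed
  let ?A = "{f \<in> Mon p q M. inj_on f W \<and> f ` W = U}"
  let ?E = "{e \<in> extensional Y. bij_betw e Y P \<and> (\<forall>(i, j)\<in>R. e i < e j) \<and> e z1 = a1 \<and> e z2 = a2 \<and> e z3 = a3}"
  have lz: "lab p q M f z1 = a1" "lab p q M f z2 = a2" "lab p q M f z3 = a3" for f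
    using dist inY by (auto simp: lab_def c1_def c3_def a1_def a2_def a3_def)
  have lW: "lab p q M f u = f3 (f u)" if "u \<in> W" for f u using that by (auto simp: lab_def W_def f3_def)
  have YW: "Y = W \<union> {z1, z2, z3}" using inY by (auto simp: W_def)
  have "bij_betw (lab p q M) ?A ?E"
  proof (rule bij_betw_byWitness[where f' = "\<lambda>e. \<lambda>u\<in>W. (e u - 2) div 3"])
    show "\<forall>f\<in>?A. (\<lambda>u\<in>W. (lab p q M f u - 2) div 3) = f"
    proof
      fix f assume "f \<in> ?A"
      then have f: "f \<in> extensional W" by (auto simp: Mon_def PiE_iff)
      show "(\<lambda>u\<in>W. (lab p q M f u - 2) div 3) = f" by (rule extensionalityI[of _ W]) (use f lW in \<open>auto simp: f3_def\<close>)
    qed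
    have lab_inv: "lab p q M (\<lambda>u\<in>W. (e u - 2) div 3) = e \<and> (\<lambda>u\<in>W. (e u - 2) div 3) ` W = U \<and> inj_on (\<lambda>u\<in>W. (e u - 2) div 3) W"
      if "e \<in> ?E" for e
    proof -
      note e = that
      let ?f = "\<lambda>u\<in>W. (e u - 2) div 3"
      have b: "inj_on e Y" "e ` Y = P" using e by (auto simp: bij_betw_def)
      have eW: "e ` W = f3 ` U"
      proof -
        have "e ` W = e ` Y - e ` {z1, z2, z3}" unfolding W_def using inY by (intro inj_on_image_set_diff[OF b(1)]) auto
        also have "e ` {z1, z2, z3} = Z" using e by (auto simp: Z_def)
        finally show ?thesis unfolding b(2) P_def using disj by blast
      qed
      have ef: "e u = f3 (?f u)" if "u \<in> W" for u
      proof -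
        have "e u \<in> f3 ` U" unfolding eW[symmetric] using \<open>u \<in> W\<close> by (rule imageI)
        then obtain x where "e u = f3 x" by (rule imageE)
        then show ?thesis using that by (simp add: f3_def)
      qed
      have "lab p q M ?f = e"
      proof (rule extensionalityI[of _ Y])
        fix y assume "y \<in> Y"
        then consider "y \<in> W" | "y = z1" | "y = z2" | "y = z3" using YW by auto
        then show "lab p q M ?f y = e y" by cases (use lz lW ef e in auto)
      qed (use e in \<open>auto simp: lab_def\<close>)
      moreover have "?f ` W = U"
      proof -
        have "f3 ` (?f ` W) = f3 ` U"
          unfolding eW[symmetric] image_image using ef by (intro image_cong) auto
        then show ?thesis unfolding inj_image_eq_iff[OF injf[of UNIV]] .
      qed
      moreover have "inj_on ?f W"
      proof (rule inj_onI)
        fix x y assume "x \<in> W" "y \<in> W" "?f x = ?f y"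
        then have "e x = e y" "x \<in> Y" "y \<in> Y" using ef[of x] ef[of y] W(6) by (simp only:, blast, blast)
          then show "x = y" using inj_onD[OF b(1)] by simp
      qed
      ultimately show ?thesis by blast
    qed
    show "\<forall>e\<in>?E. lab p q M (\<lambda>u\<in>W. (e u - 2) div 3) = e" using lab_inv by blast
    show "lab p q M ` ?A \<subseteq> ?E"
    proof (rule image_subsetI)
      fix f assume f: "f \<in> ?A"
      have im: "lab p q M f ` Y = P"
      proof -
        have "lab p q M f ` W = f3 ` (f ` W)" unfolding image_image using lW by (intro image_cong) auto
        then show ?thesis using f lz by (subst YW) (simp add: image_Un P_def Z_def)
      qed
      have "bij_betw (lab p q M f) Y P"
        unfolding bij_betw_def using im eq_card_imp_inj_on[OF finY] cP(2) by metis
      then show "lab p q M f \<in> ?E" using f lz by (auto simp: Mon_def lab_def)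
    qed
    show "(\<lambda>e. \<lambda>u\<in>W. (e u - 2) div 3) ` ?E \<subseteq> ?A"
    proof (rule image_subsetI)
      fix e assume e: "e \<in> ?E"
      let ?f = "\<lambda>u\<in>W. (e u - 2) div 3"
      have "?f \<in> W \<rightarrow>\<^sub>E {..<5 * M}"
      proof (rule PiE_I)
        fix u assume "u \<in> W"
        then have "?f u \<in> U" using lab_inv[OF e] by blast
        then show "?f u \<in> {..<5 * M}" using U(1) by blast
      qed simp
      then show "?f \<in> ?A" using lab_inv[OF e] e by (simp add: Mon_def del: restrict_apply)
    qed
  qed
  then have "card ?A = card ?E" by (rule bij_betw_same_card)
  also have "\<dots> = card {L \<in> LE. L z1 = card {x \<in> P. x < a1} \<and> L z2 = card {x \<in> P. x < a2} \<and> L z3 = card {x \<in> P. x < a3}}"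
    by (rule relabel[OF cP]) (auto simp: P_def Z_def)
  also have "\<dots> = card {L \<in> LE. zcond p q n L}" unfolding r1 r2 r3 zcond_def ..
  finally show ?thesis .
qed

lemma count_injective:
  assumes M: "M > 0" and n: "(\<Sum>i<5. n i) = card W"
  shows "card {f \<in> Mon p q M. inj_on f W \<and> (\<forall>i<5. card (lv M f i) = n i)} =
    card {L \<in> LE. zcond p q n L} * (\<Prod>i<5. M choose n i)"
proof -
  define A where "A = {f \<in> Mon p q M. inj_on f W \<and> (\<forall>i<5. card (lv M f i) = n i)}"
  define Us where "Us = {U. U \<subseteq> {..<5 * M} \<and> (\<forall>i<5. card {x \<in> U. x div M = i} = n i)}"
  have finUs: "finite Us" unfolding Us_def by (rule finite_subset[of _ "Pow {..<5 * M}"]) auto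
  have finA: "finite A"
  proof -
    have "A \<subseteq> W \<rightarrow>\<^sub>E {..<5 * M}" by (auto simp: A_def Mon_def)
    then show ?thesis by (rule finite_subset) (use W in \<open>auto intro: finite_PiE\<close>)
  qed
  have lvU: "card (lv M f i) = card {x \<in> f ` W. x div M = i}" if "inj_on f W" for f i
  proof -
    have "{x \<in> f ` W. x div M = i} = f ` lv M f i" by (auto simp: lv_def)
    moreover have "inj_on f (lv M f i)" using that by (auto simp: lv_def inj_on_def)
    ultimately show ?thesis by (simp add: card_image)
  qed
  have "(\<lambda>f. f ` W) ` A \<subseteq> Us" using lvU by (auto simp: A_def Us_def Mon_def)
  then have "card A = (\<Sum>U\<in>Us. card {f \<in> A. f ` W = U})"
    using sum.group[OF finA finUs, of "\<lambda>f. f ` W" "\<lambda>_. 1::nat"] by simp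
  also have "\<dots> = (\<Sum>U\<in>Us. card {L \<in> LE. zcond p q n L})"
  proof (rule sum.cong)
    fix U assume U: "U \<in> Us"
    have "{f \<in> A. f ` W = U} = {f \<in> Mon p q M. inj_on f W \<and> f ` W = U}"
      using U lvU by (auto simp: A_def Us_def)
    then show "card {f \<in> A. f ` W = U} = card {L \<in> LE. zcond p q n L}"
      using count_injective_image[OF M n, of U p q] U by (simp add: Us_def)
  qed simp
  also have "\<dots> = card {L \<in> LE. zcond p q n L} * (\<Prod>i<5. M choose n i)"
    using card_levels[OF M, of 5 n] by (simp add: Us_def)
  finally show ?thesis unfolding A_def .
qed

end

lemma sum_over_pairs:
  fixes \<alpha> \<beta> :: "'a \<Rightarrow> real"
  assumes fin: "finite \<Phi>" "finite K"
    and Q: "\<And>f g. f \<in> \<Phi> \<Longrightarrow> g \<in> \<Phi> \<Longrightarrow> Q f g \<longleftrightarrow> key f \<in> K \<and> key g = cmp (key f)"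
  shows "(\<Sum>(f, g)\<in>{(f, g) \<in> \<Phi> \<times> \<Phi>. Q f g}. \<alpha> f * \<beta> g) =
    (\<Sum>a\<in>K. (\<Sum>f\<in>{f \<in> \<Phi>. key f = a}. \<alpha> f) * (\<Sum>g\<in>{g \<in> \<Phi>. key g = cmp a}. \<beta> g))"
proof -
  define P where "P = {(f, g) \<in> \<Phi> \<times> \<Phi>. Q f g}"
  have finP: "finite P" unfolding P_def by (rule finite_subset[OF _ finite_cartesian_product[OF fin(1) fin(1)]]) auto
  have "(\<lambda>(f, g). key f) ` P \<subseteq> K" using Q by (auto simp: P_def)
  then have "(\<Sum>(f, g)\<in>P. \<alpha> f * \<beta> g) = (\<Sum>a\<in>K. \<Sum>(f, g)\<in>{p \<in> P. (\<lambda>(f, g). key f) p = a}. \<alpha> f * \<beta> g)"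
    by (rule sum.group[OF finP fin(2), symmetric])
  also have "\<dots> = (\<Sum>a\<in>K. (\<Sum>f\<in>{f \<in> \<Phi>. key f = a}. \<alpha> f) * (\<Sum>g\<in>{g \<in> \<Phi>. key g = cmp a}. \<beta> g))"
  proof (rule sum.cong)
    fix a assume a: "a \<in> K"
    have "{p \<in> P. (\<lambda>(f, g). key f) p = a} = {f \<in> \<Phi>. key f = a} \<times> {g \<in> \<Phi>. key g = cmp a}"
      using a Q by (auto simp: P_def)
    then show "(\<Sum>(f, g)\<in>{p \<in> P. (\<lambda>(f, g). key f) p = a}. \<alpha> f * \<beta> g) =
      (\<Sum>f\<in>{f \<in> \<Phi>. key f = a}. \<alpha> f) * (\<Sum>g\<in>{g \<in> \<Phi>. key g = cmp a}. \<beta> g)"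
      by (simp add: sum_product sum.cartesian_product)
  qed simp
  finally show ?thesis by (simp add: P_def)
qed

lemma card_max_min:
  assumes "finite W"
  shows "card {u \<in> W. P (f u)} + card {u \<in> W. P (g u)} = card {u \<in> W. P (mx W f g u)} + card {u \<in> W. P (mn W f g u)}"
proof -
  have c: "card {u \<in> W. R u} = (\<Sum>u\<in>W. if R u then 1 else 0)" for R
    using assms by (simp add: sum.If_cases Int_def)
  show ?thesis
    unfolding c sum.distrib[symmetric] by (rule sum.cong) (auto simp: mx_def mn_def max_def min_def)
qed

context marked_poset
begin

text \<open>An image with \<open>n i\<close> elements in level \<open>i\<close> can be chosen in
  about \<open>M ^ card W\<close> ways divided by the product of the factorials of all
  \<open>n i\<close>. The weight cancels the factorials of the outer levels, over whose sizes one
  has to sum.\<close>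

definition wt :: "nat \<Rightarrow> ('b \<Rightarrow> nat) \<Rightarrow> real" where
  "wt M f = fact (card (lv M f 0)) * fact (card (lv M f 4))"

definition key :: "nat \<Rightarrow> ('b \<Rightarrow> nat) \<Rightarrow> nat \<times> nat \<times> nat" where
  "key M f = (card (lv M f 1), card (lv M f 2), card (lv M f 3))"

definition S :: "bool \<Rightarrow> bool \<Rightarrow> nat \<Rightarrow> nat \<times> nat \<times> nat \<Rightarrow> real" where
  "S p q M a = (\<Sum>f\<in>{f \<in> Mon p q M. key M f = a}. wt M f)"

lemma finite_lv: "finite (lv M f i)" using W by (simp add: lv_def)

lemma finite_Phi: "finite (W \<rightarrow>\<^sub>E {..<K::nat})" using W by (intro finite_PiE) auto

lemma Mon_Phi: "Mon p q M \<subseteq> W \<rightarrow>\<^sub>E {..<5 * M}" by (auto simp: Mon_def)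

lemma finite_Mon: "finite (Mon p q M)" using finite_subset[OF Mon_Phi finite_Phi] .

text \<open>The marks take part in the lattice operations: raising \<open>z1\<close> and raising
  \<open>z3\<close> are independent switches, so maximum and minimum of the two labellings with one
  raised mark have both marks raised and none.\<close>

lemma lab_max_min:
  "lab True True M (mx W f g) y = max (lab True False M f y) (lab False True M g y)"
  "lab False False M (mn W f g) y = min (lab True False M f y) (lab False True M g y)" if "y \<in> Y"
  using that dist by (auto simp: lab_def mx_def mn_def W_def)

lemma Mon_max_min:
  assumes f: "f \<in> Mon True False M" and g: "g \<in> Mon False True M"
  shows "mx W f g \<in> Mon True True M" "mn W f g \<in> Mon False False M"
proof -
  have \<Phi>: "mx W f g \<in> W \<rightarrow>\<^sub>E {..<5 * M}" "mn W f g \<in> W \<rightarrow>\<^sub>E {..<5 * M}"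
    using f g by (auto simp: Mon_def mx_def mn_def PiE_iff min_def)
  have lt: "lab True False M f i < lab True False M f j" "lab False True M g i < lab False True M g j" if "(i, j) \<in> R" for i j
    using f g that by (auto simp: Mon_def)
  have "lab True True M (mx W f g) i < lab True True M (mx W f g) j"
    "lab False False M (mn W f g) i < lab False False M (mn W f g) j" if "(i, j) \<in> R" for i j
    using lt[OF that] unfolding lab_max_min[OF R_in(1)[OF that]] lab_max_min[OF R_in(2)[OF that]]
    by (auto simp: max_def min_def)
  then show "mx W f g \<in> Mon True True M" "mn W f g \<in> Mon False False M"
    using \<Phi> by (auto simp: Mon_def)
qed

text \<open>Level 0 is closed downwards and level 4 upwards, so maximum and minimum act on these two
  levels as intersection and union, or the other way round.\<close>

lemma wt_supermodular:
  assumes M: "M > 0" and f: "f \<in> W \<rightarrow>\<^sub>E {..<5 * M}" and g: "g \<in> W \<rightarrow>\<^sub>E {..<5 * M}"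
  shows "wt M f * wt M g \<le> wt M (mx W f g) * wt M (mn W f g)"
proof -
  have 0: "x div M = 0 \<longleftrightarrow> x < M" for x using M by (simp add: div_eq_0_iff)
  have 4: "x div M = 4 \<longleftrightarrow> 4 * M \<le> x" if "x < 5 * M" for x
    using that M less_mult_imp_div_less[of x 5 M] less_eq_div_iff_mult_less_eq[of M 4 x] by auto
  have b: "f u < 5 * M" "g u < 5 * M" if "u \<in> W" for u using f g that by auto
  have l0: "lv M (mn W f g) 0 = lv M f 0 \<union> lv M g 0" "lv M (mx W f g) 0 = lv M f 0 \<inter> lv M g 0"
    by (auto simp: lv_def 0 mx_def mn_def min_def)
  have l4: "lv M (mx W f g) 4 = lv M f 4 \<union> lv M g 4" "lv M (mn W f g) 4 = lv M f 4 \<inter> lv M g 4"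
  proof -
    have "max (f u) (g u) div M = 4 \<longleftrightarrow> f u div M = 4 \<or> g u div M = 4"
      "min (f u) (g u) div M = 4 \<longleftrightarrow> f u div M = 4 \<and> g u div M = 4" if "u \<in> W" for u
      using b[OF that] by (simp_all add: 4 le_max_iff_disj)
    then show "lv M (mx W f g) 4 = lv M f 4 \<union> lv M g 4" "lv M (mn W f g) 4 = lv M f 4 \<inter> lv M g 4"
      by (auto simp: lv_def mx_def mn_def)
  qed
  have "wt M f * wt M g = (fact (card (lv M f 0)) * fact (card (lv M g 0))) * (fact (card (lv M f 4)) * fact (card (lv M g 4)))"
    by (simp add: wt_def)
  also have "\<dots> \<le> (fact (card (lv M f 0 \<union> lv M g 0)) * fact (card (lv M f 0 \<inter> lv M g 0))) *
      (fact (card (lv M f 4 \<union> lv M g 4)) * fact (card (lv M f 4 \<inter> lv M g 4)))"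
    by (rule mult_mono[OF fact_card_supermodular[OF finite_lv finite_lv] fact_card_supermodular[OF finite_lv finite_lv]]) auto
  also have "\<dots> = wt M (mx W f g) * wt M (mn W f g)"
    by (simp add: wt_def l0 l4)
  finally show ?thesis .
qed

text \<open>A key and its complement together account for one element in level 1, \<open>T\<close>
  in level 2 and one in level 3. With at most one element in a switched level, raising a mark
  changes a gap by at most one.\<close>

definition Keys :: "nat \<Rightarrow> (nat \<times> nat \<times> nat) set" where "Keys T = {..1} \<times> {..T} \<times> {..1}"
definition cmpl :: "nat \<Rightarrow> nat \<times> nat \<times> nat \<Rightarrow> nat \<times> nat \<times> nat" where
  "cmpl T = (\<lambda>(a, b, c). (1 - a, T - b, 1 - c))"

lemma S_inequality:
  assumes M: "M > 0"
  shows "(\<Sum>a\<in>Keys T. S True False M a * S False True M (cmpl T a)) \<le>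
    (\<Sum>a\<in>Keys T. S True True M a * S False False M (cmpl T a))"
proof -
  define \<Phi> where "\<Phi> = W \<rightarrow>\<^sub>E {..<5 * M}"
  define v where "v = (\<lambda>p q f. if f \<in> Mon p q M then wt M f else 0)"
  define Q where "Q = (\<lambda>f g. card (lv M f 1) + card (lv M g 1) = 1 \<and> card (lv M f 2) + card (lv M g 2) = T \<and>
     card (lv M f 3) + card (lv M g 3) = 1)"
  have w0: "wt M f \<ge> 0" for f by (simp add: wt_def)
  have Q: "Q f g \<longleftrightarrow> key M f \<in> Keys T \<and> key M g = cmpl T (key M f)" for f g
    unfolding Q_def key_def Keys_def cmpl_def by auto
  have fin: "finite (Keys T)" by (simp add: Keys_def)
  have vS: "(\<Sum>f\<in>{f \<in> \<Phi>. key M f = a}. v p q f) = S p q M a" for p q a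
  proof -
    have "S p q M a = (\<Sum>f\<in>{f \<in> Mon p q M. key M f = a}. v p q f)" by (simp add: S_def v_def)
    also have "\<dots> = (\<Sum>f\<in>{f \<in> \<Phi>. key M f = a}. v p q f)"
      using Mon_Phi[of p q M] finite_Phi by (intro sum.mono_neutral_left) (auto simp: v_def \<Phi>_def)
    finally show ?thesis ..
  qed
  have "(\<Sum>(f, g)\<in>{(f, g) \<in> \<Phi> \<times> \<Phi>. Q f g}. v True False f * v False True g) \<le>
    (\<Sum>(f, g)\<in>{(f, g) \<in> \<Phi> \<times> \<Phi>. Q f g}. v True True f * v False False g)"
  proof (rule four_functions_pairs[OF W(1)])
    show "\<Phi> = W \<rightarrow>\<^sub>E {..<5 * M}" by (rule \<Phi>_def)
    show "0 \<le> v True False f \<and> 0 \<le> v False True f \<and> 0 \<le> v True True f \<and> 0 \<le> v False False f" for f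
      using w0 by (simp add: v_def)
    show "v True False f * v False True g \<le> v True True (mx W f g) * v False False (mn W f g)" if fg: "f \<in> \<Phi>" "g \<in> \<Phi>" for f g
    proof (cases "f \<in> Mon True False M \<and> g \<in> Mon False True M")
      case True
      then show ?thesis using Mon_max_min[of f M g] wt_supermodular[OF M] fg by (simp add: v_def \<Phi>_def)
    next
      case False
      then have "v True False f * v False True g = 0" by (auto simp: v_def)
      moreover have "v True True (mx W f g) * v False False (mn W f g) \<ge> 0" using w0 by (simp add: v_def)
      ultimately show ?thesis by (simp only:)
    qed
    show "Q f g \<longleftrightarrow> Q (mx W f g) (mn W f g)" for f g
    proof -
      have "card (lv M f i) + card (lv M g i) = card (lv M (mx W f g) i) + card (lv M (mn W f g) i)" for i
        using card_max_min[OF W(1), of "\<lambda>x. x div M = i" f g] by (simp only: lv_def)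
      then show ?thesis unfolding Q_def by (simp only:)
    qed
  qed
  moreover have "finite \<Phi>" unfolding \<Phi>_def by (rule finite_Phi)
  ultimately show ?thesis
    using sum_over_pairs[OF _ fin, of \<Phi> Q "key M" "cmpl T"] Q by (simp add: vS)
qed

lemma lv_total:
  assumes "M > 0" "f \<in> W \<rightarrow>\<^sub>E {..<5 * M}" shows "(\<Sum>i<5. card (lv M f i)) = card W"
proof -
  have "(\<Union>i<5. lv M f i) = W"
  proof -
    have "f u div M < 5" if "u \<in> W" for u using assms that by (intro less_mult_imp_div_less) auto
    then show ?thesis by (auto simp: lv_def)
  qed
  moreover have "card (\<Union>i<5. lv M f i) = (\<Sum>i<5. card (lv M f i))"
    by (rule card_UN_disjoint) (auto simp: finite_lv, auto simp: lv_def)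
  ultimately show ?thesis by simp
qed

definition sizes :: "nat \<times> nat \<times> nat \<Rightarrow> nat \<Rightarrow> nat \<Rightarrow> nat" where
  "sizes = (\<lambda>(a, b, c) n0 i. if i = 0 then n0 else if i = 1 then a else if i = 2 then b else if i = 3 then c
     else card W - n0 - a - b - c)"

lemma sizes_total:
  assumes "n0 + a + b + c \<le> card W" shows "(\<Sum>i<5. sizes (a, b, c) n0 i) = card W"
  using assms by (simp add: sizes_def eval_nat_numeral)

text \<open>The size \<open>n0\<close> can be read off as \<open>L z2 - 1 - a\<close>, so the sum
  exhausts the set of extensions with these gaps. An element of level 1 is inside the first gap only
  if \<open>p\<close> is false, one of level 3 inside the second only if \<open>q\<close> is
  true.\<close>

lemma gap_sum:
  assumes ac: "a \<le> 1" "c \<le> 1"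
  shows "(\<Sum>n0\<in>{n0. n0 + a + b + c \<le> card W}. card {L \<in> LE. zcond p q (sizes (a, b, c) n0) L}) =
    F (1 + (if p then 0 else a)) (1 + b + (if q then c else 0))"
proof -
  define G where "G = Gap (1 + (if p then 0 else a)) (1 + b + (if q then c else 0))"
  define I where "I = {n0. n0 + a + b + c \<le> card W}"
  have finI: "finite I" unfolding I_def by (rule finite_subset[of _ "{..card W}"]) auto
  have room: "1 \<le> L z1" "L z3 + 2 \<le> card Y" if "L \<in> LE" for L
  proof -
    have "(bot, z1) \<in> R" "(z3, top) \<in> R" using least[of z1] greatest[of z3] inY dist by auto
    then show "1 \<le> L z1" "L z3 + 2 \<le> card Y"
      using LE_D(3)[OF that, of bot z1] LE_D(3)[OF that, of z3 top] LE_D(4)[OF that inY(2)] by auto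
  qed
  have sub: "(\<lambda>L. L z2 - 1 - a) ` G \<subseteq> I"
  proof
    fix x assume "x \<in> (\<lambda>L. L z2 - 1 - a) ` G"
    then obtain L where L: "L \<in> LE" "L z2 = L z1 + (1 + (if p then 0 else a))" "L z3 = L z2 + (1 + b + (if q then c else 0))"
      and x: "x = L z2 - 1 - a" by (auto simp: G_def Gap_def)
    have cY: "card Y = card W + 3" using gap_room[of L "1 + (if p then 0 else a)" "1 + b + (if q then c else 0)"] L W(2) by (simp add: Gap_def)
    show "x \<in> I" using L(2,3) room[OF L(1)] ac x cY by (auto simp: I_def split: if_splits)
  qed
  have "F (1 + (if p then 0 else a)) (1 + b + (if q then c else 0)) = card G" by (simp add: F_def G_def)
  also have "\<dots> = (\<Sum>n0\<in>I. card {L \<in> G. L z2 - 1 - a = n0})"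
    using sum.group[OF _ finI sub, of "\<lambda>_. 1::nat"] finite_Gap by (simp add: G_def)
  also have "\<dots> = (\<Sum>n0\<in>I. card {L \<in> LE. zcond p q (sizes (a, b, c) n0) L})"
  proof (intro sum.cong refl arg_cong[where f = card])
    fix n0 assume "n0 \<in> I"
    have "L \<in> G \<and> L z2 - 1 - a = n0 \<longleftrightarrow> zcond p q (sizes (a, b, c) n0) L" if "L \<in> LE" for L
      using that room[OF that] ac by (auto simp: G_def Gap_def zcond_def sizes_def)
    moreover have "G \<subseteq> LE" by (auto simp: G_def Gap_def)
    ultimately show "{L \<in> G. L z2 - 1 - a = n0} = {L \<in> LE. zcond p q (sizes (a, b, c) n0) L}" by blast
  qed
  finally show ?thesis by (simp add: I_def)
qed

text \<open>Almost all maps are injective for large \<open>M\<close>; an injective one is a linear extension together with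
  its image.\<close>

lemma S_limit:
  assumes ac: "a \<le> 1" "c \<le> 1"
  shows "(\<lambda>M. S p q M (a, b, c) / real M ^ card W) \<longlonglongrightarrow>
    F (1 + (if p then 0 else a)) (1 + b + (if q then c else 0)) / fact b"
proof -
  define m where "m = card W"
  define I where "I = {n0. n0 + a + b + c \<le> m}"
  define cnt where "cnt = (\<lambda>n0. real (card {L \<in> LE. zcond p q (sizes (a, b, c) n0) L}))"
  define rt where "rt = (\<lambda>n0 i M. real (M choose sizes (a, b, c) n0 i) * fact (sizes (a, b, c) n0 i) / real M ^ sizes (a, b, c) n0 i)"
  define Fm where "Fm = (\<lambda>M. {f \<in> Mon p q M. key M f = (a, b, c)})"
  define N where "N = (\<lambda>M. \<Sum>f\<in>{f \<in> Fm M. \<not> inj_on f W}. wt M f)"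
  have finI: "finite I" unfolding I_def by (rule finite_subset[of _ "{..m}"]) auto
  have finF: "finite (Fm M)" for M using finite_Mon by (simp add: Fm_def)
  have fac: "fact a = (1::real)" "fact c = (1::real)" using ac by (auto simp: le_Suc_eq)
  have inj: "(\<Sum>f\<in>{f \<in> Fm M. inj_on f W}. wt M f) / real M ^ m = (\<Sum>n0\<in>I. cnt n0 * (\<Prod>i<5. rt n0 i M) / fact b)" if M: "M > 0" for M
  proof -
    have sub: "(\<lambda>f. card (lv M f 0)) ` {f \<in> Fm M. inj_on f W} \<subseteq> I"
    proof
      fix x assume "x \<in> (\<lambda>f. card (lv M f 0)) ` {f \<in> Fm M. inj_on f W}"
      then obtain f where f: "f \<in> Mon p q M" "key M f = (a, b, c)" "x = card (lv M f 0)" by (auto simp: Fm_def)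
      then have "(\<Sum>i<5. card (lv M f i)) = m" using lv_total[OF M, of f] Mon_Phi[of p q M] unfolding m_def by blast
      then show "x \<in> I" using f(2,3) by (simp add: eval_nat_numeral key_def I_def)
    qed
    have "(\<Sum>f\<in>{f \<in> Fm M. inj_on f W}. wt M f) = (\<Sum>n0\<in>I. \<Sum>f\<in>{f \<in> {f \<in> Fm M. inj_on f W}. card (lv M f 0) = n0}. wt M f)"
      by (rule sum.group[OF _ finI sub, symmetric]) (simp add: finF)
    also have "\<dots> = (\<Sum>n0\<in>I. cnt n0 * (\<Prod>i<5. rt n0 i M) / fact b * real M ^ m)"
    proof (rule sum.cong)
      fix n0 assume n0: "n0 \<in> I"
      let ?s = "sizes (a, b, c) n0"
      have tot: "(\<Sum>i<5. ?s i) = card W" using sizes_total n0 by (simp add: I_def m_def)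
      have eq: "{f \<in> {f \<in> Fm M. inj_on f W}. card (lv M f 0) = n0} = {f \<in> Mon p q M. inj_on f W \<and> (\<forall>i<5. card (lv M f i) = ?s i)}"
      proof -
        have "(key M f = (a, b, c) \<and> card (lv M f 0) = n0) \<longleftrightarrow> (\<forall>i<5. card (lv M f i) = ?s i)" if f: "f \<in> Mon p q M" for f
        proof -
          have "(\<Sum>i<5. card (lv M f i)) = card W" using lv_total[OF M, of f] Mon_Phi[of p q M] f by blast
          then have t: "card (lv M f 0) + card (lv M f 1) + card (lv M f 2) + card (lv M f 3) + card (lv M f 4) = card W"
            by (simp add: eval_nat_numeral)
          have five: "(\<forall>i<5. P i) \<longleftrightarrow> P 0 \<and> P 1 \<and> P 2 \<and> P 3 \<and> P 4" for P :: "nat \<Rightarrow> bool"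
          proof -
            have "i < 5 \<longleftrightarrow> i = 0 \<or> i = 1 \<or> i = 2 \<or> i = 3 \<or> i = 4" for i :: nat by linarith
            then show ?thesis by (simp only: imp_disjL all_conj_distrib simp_thms)
          qed
          have "?s 0 = n0" "?s 1 = a" "?s 2 = b" "?s 3 = c" "?s 4 = card W - n0 - a - b - c" by (simp_all add: sizes_def)
          then show ?thesis unfolding five key_def prod.inject using t by linarith
        qed
        then show ?thesis by (auto simp: Fm_def)
      qed
      have wt: "wt M f = fact (?s 0) * fact (?s 4)" if "f \<in> {f \<in> {f \<in> Fm M. inj_on f W}. card (lv M f 0) = n0}" for f
        using that unfolding eq by (simp add: wt_def)
      have "(\<Sum>f\<in>{f \<in> {f \<in> Fm M. inj_on f W}. card (lv M f 0) = n0}. wt M f) =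
        real (card {f \<in> {f \<in> Fm M. inj_on f W}. card (lv M f 0) = n0}) * (fact (?s 0) * fact (?s 4))"
        using wt by simp
      also have "real (card {f \<in> {f \<in> Fm M. inj_on f W}. card (lv M f 0) = n0}) = cnt n0 * (\<Prod>i<5. real (M choose ?s i))"
        unfolding eq count_injective[OF M tot] by (simp add: cnt_def)
      also have "cnt n0 * (\<Prod>i<5. real (M choose ?s i)) * (fact (?s 0) * fact (?s 4)) =
        cnt n0 * (\<Prod>i<5. rt n0 i M) / fact b * real M ^ m"
      proof -
        have "(\<Prod>i<5. rt n0 i M) = (\<Prod>i<5. real (M choose ?s i)) * (\<Prod>i<5. fact (?s i)) / (\<Prod>i<5. real M ^ ?s i)"
          unfolding rt_def by (simp add: prod_dividef prod.distrib)
        also have "(\<Prod>i<5. real M ^ ?s i) = real M ^ m" unfolding power_sum[symmetric] tot m_def ..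
        also have "(\<Prod>i<5. fact (?s i)) = fact (?s 0) * fact (?s 4) * (fact b :: real)"
          by (simp add: eval_nat_numeral sizes_def fac del: fact_Suc)
        finally show ?thesis using M by simp
      qed
      finally show "(\<Sum>f\<in>{f \<in> {f \<in> Fm M. inj_on f W}. card (lv M f 0) = n0}. wt M f) = cnt n0 * (\<Prod>i<5. rt n0 i M) / fact b * real M ^ m" .
    qed simp
    also have "\<dots> = (\<Sum>n0\<in>I. cnt n0 * (\<Prod>i<5. rt n0 i M) / fact b) * real M ^ m" by (rule sum_distrib_right[symmetric])
    finally show ?thesis using M by simp
  qed
  have Sdec: "S p q M (a, b, c) = (\<Sum>f\<in>{f \<in> Fm M. inj_on f W}. wt M f) + N M" for M
  proof -
    have e: "Fm M = {f \<in> Fm M. inj_on f W} \<union> {f \<in> Fm M. \<not> inj_on f W}" by auto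
    have "S p q M (a, b, c) = sum (wt M) (Fm M)" by (simp add: S_def Fm_def)
    also have "\<dots> = sum (wt M) ({f \<in> Fm M. inj_on f W} \<union> {f \<in> Fm M. \<not> inj_on f W})" using e by (rule arg_cong)
    also have "\<dots> = (\<Sum>f\<in>{f \<in> Fm M. inj_on f W}. wt M f) + N M"
      unfolding N_def by (rule sum.union_disjoint) (use finF in auto)
    finally show ?thesis .
  qed
  have l1: "(\<lambda>M. \<Sum>n0\<in>I. cnt n0 * (\<Prod>i<5. rt n0 i M) / fact b) \<longlonglongrightarrow> (\<Sum>n0\<in>I. cnt n0 * (\<Prod>i<5::nat. 1) / fact b)"
    unfolding rt_def by (intro tendsto_intros binomial_ratio_limit) auto
  have l2: "(\<lambda>M. N M / real M ^ m) \<longlonglongrightarrow> 0"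
  proof (rule tendsto_sandwich)
    let ?C = "\<lambda>M. real (card {f \<in> W \<rightarrow>\<^sub>E {..<5 * M}. \<not> inj_on f W})"
    have wb: "wt M f \<le> fact m * fact m" for M f
      unfolding wt_def m_def using W(1) by (intro mult_mono fact_mono card_mono) (auto simp: lv_def)
    have "N M \<le> ?C M * (fact m * fact m)" for M
    proof -
      have "N M \<le> (\<Sum>f\<in>{f \<in> Fm M. \<not> inj_on f W}. fact m * fact m)" unfolding N_def by (rule sum_mono) (rule wb)
      also have "\<dots> = real (card {f \<in> Fm M. \<not> inj_on f W}) * (fact m * fact m)" by simp
      also have "\<dots> \<le> ?C M * (fact m * fact m)"
      proof (intro mult_right_mono)
        have "card {f \<in> Fm M. \<not> inj_on f W} \<le> card {f \<in> W \<rightarrow>\<^sub>E {..<5 * M}. \<not> inj_on f W}"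
          using finite_Phi[of "5 * M"] Mon_Phi[of p q M] unfolding Fm_def by (intro card_mono) (simp, blast)
        then show "real (card {f \<in> Fm M. \<not> inj_on f W}) \<le> ?C M" by simp
      qed simp
      finally show ?thesis .
    qed
    then show "\<forall>\<^sub>F M in sequentially. N M / real M ^ m \<le> ?C M / real M ^ card W * (fact m * fact m)"
      by (intro always_eventually allI) (simp add: divide_right_mono m_def)
    show "\<forall>\<^sub>F M in sequentially. 0 \<le> N M / real M ^ m"
      unfolding N_def by (intro always_eventually allI divide_nonneg_nonneg sum_nonneg) (auto simp: wt_def)
    show "(\<lambda>M. ?C M / real M ^ card W * (fact m * fact m)) \<longlonglongrightarrow> 0"
      using tendsto_mult_right[OF noninjective_limit[OF W(1), of 5], of "fact m * fact m"] by simp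
  qed simp
  have "(\<lambda>M. (\<Sum>n0\<in>I. cnt n0 * (\<Prod>i<5. rt n0 i M) / fact b) + N M / real M ^ m) \<longlonglongrightarrow> (\<Sum>n0\<in>I. cnt n0 * (\<Prod>i<5::nat. 1) / fact b) + 0"
    by (rule tendsto_add[OF l1 l2])
  moreover have "\<forall>\<^sub>F M in sequentially. (\<Sum>n0\<in>I. cnt n0 * (\<Prod>i<5. rt n0 i M) / fact b) + N M / real M ^ m = S p q M (a, b, c) / real M ^ card W"
    using eventually_gt_at_top[of 0]
  proof eventually_elim
    case (elim M)
    then show ?case unfolding Sdec inj[OF elim, symmetric] by (simp add: add_divide_distrib m_def)
  qed
  ultimately have "(\<lambda>M. S p q M (a, b, c) / real M ^ card W) \<longlonglongrightarrow> (\<Sum>n0\<in>I. cnt n0 * (\<Prod>i<5::nat. 1) / fact b) + 0"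
    by (rule Lim_transform_eventually)
  also have "(\<Sum>n0\<in>I. cnt n0 * (\<Prod>i<5::nat. 1) / fact b) + 0 = (\<Sum>n0\<in>I. cnt n0) / fact b"
    by (simp add: sum_divide_distrib)
  also have "(\<Sum>n0\<in>I. cnt n0) = F (1 + (if p then 0 else a)) (1 + b + (if q then c else 0))"
    unfolding cnt_def I_def m_def gap_sum[OF ac, symmetric] by simp
  finally show ?thesis .
qed

text \<open>Of the four patterns for levels 1 and 3, two contribute the same on both sides, and a
  third does so after replacing \<open>i\<close> by \<open>T - i\<close>. What remains is the
  claim.\<close>

theorem convolution_inequality:
  "(\<Sum>i\<le>T. real (F 1 (1 + i)) * F 2 (2 + (T - i)) / (fact i * fact (T - i))) \<le>
   (\<Sum>i\<le>T. real (F 1 (2 + i)) * F 2 (1 + (T - i)) / (fact i * fact (T - i)))"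
proof -
  define G where "G = (\<lambda>p q (a, b, c). real (F (1 + (if p then 0 else a)) (1 + b + (if q then c else 0))) / fact b)"
  have lim: "(\<lambda>M. \<Sum>x\<in>Keys T. (S p q M x / real M ^ card W) * (S p' q' M (cmpl T x) / real M ^ card W)) \<longlonglongrightarrow>
     (\<Sum>x\<in>Keys T. G p q x * G p' q' (cmpl T x))" for p q p' q'
  proof (intro tendsto_sum tendsto_mult)
    fix x assume "x \<in> Keys T"
    then obtain a b c where x: "x = (a, b, c)" "a \<le> 1" "c \<le> 1" by (auto simp: Keys_def)
    show "(\<lambda>M. S p q M x / real M ^ card W) \<longlonglongrightarrow> G p q x"
      unfolding x(1) G_def prod.case by (rule S_limit[OF x(2,3)])
    show "(\<lambda>M. S p' q' M (cmpl T x) / real M ^ card W) \<longlonglongrightarrow> G p' q' (cmpl T x)"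
      unfolding x(1) G_def cmpl_def prod.case by (rule S_limit) auto
  qed
  have "(\<Sum>x\<in>Keys T. G True False x * G False True (cmpl T x)) \<le> (\<Sum>x\<in>Keys T. G True True x * G False False (cmpl T x))"
  proof (rule LIMSEQ_le[OF lim lim], intro exI[of _ 1] allI impI)
    fix M :: nat assume "1 \<le> M"
    then have M: "M > 0" by simp
    have "(\<Sum>x\<in>Keys T. (S p q M x / real M ^ card W) * (S p' q' M (cmpl T x) / real M ^ card W)) =
      (\<Sum>x\<in>Keys T. S p q M x * S p' q' M (cmpl T x)) / (real M ^ card W * real M ^ card W)" for p q p' q'
      by (simp add: sum_divide_distrib)
    then show "(\<Sum>x\<in>Keys T. (S True False M x / real M ^ card W) * (S False True M (cmpl T x) / real M ^ card W)) \<le>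
      (\<Sum>x\<in>Keys T. (S True True M x / real M ^ card W) * (S False False M (cmpl T x) / real M ^ card W))"
      using divide_right_mono[OF S_inequality[OF M, of T], of "real M ^ card W * real M ^ card W"] by simp
  qed
  moreover have ex: "(\<Sum>x\<in>Keys T. h x) = (\<Sum>b\<le>T. h (0, b, 0)) + (\<Sum>b\<le>T. h (0, b, 1)) + (\<Sum>b\<le>T. h (1, b, 0)) + (\<Sum>b\<le>T. h (1, b, 1))"
    for h :: "nat \<times> nat \<times> nat \<Rightarrow> real"
  proof -
    have "{..1::nat} = {0, 1}" by auto
    then show ?thesis by (simp add: Keys_def sum.cartesian_product' sum.distrib)
  qed
  define u where "u = (\<lambda>r s r' s'. \<Sum>b\<le>T. real (F r (s + b)) * F r' (s' + (T - b)) / (fact b * fact (T - b)))"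
  have L: "(\<Sum>x\<in>Keys T. G True False x * G False True (cmpl T x)) = u 1 1 2 2 + u 1 1 2 1 + u 1 1 1 2 + u 1 1 1 1"
    unfolding ex u_def by (simp add: G_def cmpl_def numeral_2_eq_2 Suc_diff_le cong: sum.cong_simp)
  have R: "(\<Sum>x\<in>Keys T. G True True x * G False False (cmpl T x)) = u 1 1 2 1 + u 1 2 2 1 + u 1 1 1 1 + u 1 2 1 1"
    unfolding ex u_def by (simp add: G_def cmpl_def numeral_2_eq_2)
  have sw: "u 1 1 1 2 = u 1 2 1 1"
    unfolding u_def by (rule sum.reindex_bij_witness[where i = "\<lambda>i. T - i" and j = "\<lambda>i. T - i"]) (auto simp: mult_ac)
  have "u 1 1 2 2 \<le> u 1 2 2 1" using calculation(1) unfolding L R sw by linarith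
  then show ?thesis by (simp add: u_def Suc_diff_le cong: sum.cong_simp)
qed

end

section \<open>Comparison of the gap counts\<close>

lemma geometric_sum_bound:
  fixes T :: "nat \<Rightarrow> real"
  assumes "\<And>j. T j \<ge> 0" "\<And>j. j \<ge> 1 \<Longrightarrow> T (Suc j) \<le> \<kappa> * T j"
  shows "(1 - \<kappa>) * (\<Sum>j=1..J. T j) \<le> T 1"
proof (cases J)
  case 0 then show ?thesis using assms(1)[of 1] by simp
next
  case (Suc J')
  have "(\<Sum>j=1..J. T j) = T 1 + (\<Sum>j=1..J'. T (Suc j))"
    unfolding Suc by (simp add: sum.atLeast_Suc_atMost sum.shift_bounds_cl_Suc_ivl del: sum.cl_ivl_Suc)
  also have "(\<Sum>j=1..J'. T (Suc j)) \<le> (\<Sum>j=1..J'. \<kappa> * T j)" by (intro sum_mono assms(2)) simp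
  also have "(\<Sum>j=1..J'. \<kappa> * T j) = \<kappa> * (\<Sum>j=1..J. T j) - \<kappa> * T J" unfolding Suc by (simp add: sum_distrib_left algebra_simps)
  finally have "(1 - \<kappa>) * (\<Sum>j=1..J. T j) \<le> T 1 - \<kappa> * T J" by (simp add: algebra_simps)
  also have "\<dots> \<le> T 1"
  proof -
    have "0 \<le> T (Suc J)" "T (Suc J) \<le> \<kappa> * T J" using assms Suc by auto
    then show ?thesis by linarith
  qed
  finally show ?thesis .
qed

text \<open>With \<open>m = 2 * h + 1\<close> and \<open>G s = g s / (fact s * fact (m - s))\<close>
  the assumption says that the sum of \<open>(2 * s - m) * G s\<close> is nonnegative. Of the
  negative terms only \<open>s = h\<close>, with coefficient -1, is kept; the positive ones are
  indexed by \<open>s = h + 1 + j\<close>.\<close>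

lemma central_term_bound:
  fixes g :: "nat \<Rightarrow> real"
  assumes g: "\<And>s. g s \<ge> 0" and h: "h \<ge> 1"
    and c: "(\<Sum>s\<le>2 * h. g s / (fact s * fact (2 * h - s))) \<le> (\<Sum>s\<le>2 * h. g (Suc s) / (fact s * fact (2 * h - s)))"
  shows "g h \<le> (\<Sum>j\<le>h. (2 * real j + 1) * (fact h * fact (Suc h) / (fact (Suc h + j) * fact (h - j))) * g (Suc h + j))"
proof -
  define m where "m = Suc (2 * h)"
  define G where "G = (\<lambda>s. g s / (fact s * fact (m - s)))"
  have G0: "G s \<ge> 0" for s using g by (simp add: G_def)
  have l: "(\<Sum>s\<le>2 * h. g s / (fact s * fact (2 * h - s))) = (\<Sum>s\<le>m. real (m - s) * G s)"
  proof -
    have "(\<Sum>s\<le>m. real (m - s) * G s) = (\<Sum>s\<le>2 * h. real (m - s) * G s)" by (simp add: m_def)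
    also have "\<dots> = (\<Sum>s\<le>2 * h. g s / (fact s * fact (2 * h - s)))"
    proof (rule sum.cong)
      fix s assume "s \<in> {..2 * h}"
      then have "m - s = Suc (2 * h - s)" by (simp add: m_def)
      then show "real (m - s) * G s = g s / (fact s * fact (2 * h - s))"
        unfolding G_def by (simp del: of_nat_Suc)
    qed simp
    finally show ?thesis ..
  qed
  have r: "(\<Sum>s\<le>2 * h. g (Suc s) / (fact s * fact (2 * h - s))) = (\<Sum>s\<le>m. real s * G s)"
  proof -
    have "(\<Sum>s\<le>m. real s * G s) = (\<Sum>s\<le>2 * h. real (Suc s) * G (Suc s))" unfolding m_def by (subst sum.atMost_Suc_shift) simp
    also have "\<dots> = (\<Sum>s\<le>2 * h. g (Suc s) / (fact s * fact (2 * h - s)))"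
      by (rule sum.cong) (simp_all add: G_def m_def del: of_nat_Suc)
    finally show ?thesis ..
  qed
  have "0 \<le> (\<Sum>s\<le>m. real s * G s) - (\<Sum>s\<le>m. real (m - s) * G s)" using c unfolding l r by simp
  also have "\<dots> = (\<Sum>s\<le>m. (2 * real s - real m) * G s)"
    unfolding sum_subtractf[symmetric] by (rule sum.cong) (auto simp: of_nat_diff algebra_simps)
  also have "{..m} = {..h} \<union> {Suc h..m}" by (auto simp: m_def)
  also have "(\<Sum>s\<in>{..h} \<union> {Suc h..m}. (2 * real s - real m) * G s) =
      (\<Sum>s\<le>h. (2 * real s - real m) * G s) + (\<Sum>s=Suc h..m. (2 * real s - real m) * G s)"
    by (rule sum.union_disjoint) auto
  also have "(\<Sum>s\<le>h. (2 * real s - real m) * G s) \<le> (2 * real h - real m) * G h"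
  proof -
    have "(\<Sum>s\<le>h. (2 * real s - real m) * G s) = (\<Sum>s<h. (2 * real s - real m) * G s) + (2 * real h - real m) * G h"
      by (simp add: lessThan_Suc_atMost[symmetric])
    moreover have "(\<Sum>s<h. (2 * real s - real m) * G s) \<le> 0"
      by (intro sum_nonpos mult_nonpos_nonneg G0) (auto simp: m_def)
    ultimately show ?thesis by simp
  qed
  also have "(\<Sum>s=Suc h..m. (2 * real s - real m) * G s) = (\<Sum>j\<le>h. (2 * real j + 1) * G (Suc h + j))"
    by (rule sum.reindex_bij_witness[where i = "\<lambda>j. Suc h + j" and j = "\<lambda>s. s - Suc h"]) (auto simp: m_def of_nat_diff algebra_simps)
  finally have "G h \<le> (\<Sum>j\<le>h. (2 * real j + 1) * G (Suc h + j))" by (simp add: m_def)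
  then have "fact h * fact (Suc h) * G h \<le> fact h * fact (Suc h) * (\<Sum>j\<le>h. (2 * real j + 1) * G (Suc h + j))"
    by (intro mult_left_mono) auto
  also have "fact h * fact (Suc h) * G h = g h"
  proof -
    have "m - h = Suc h" by (simp add: m_def)
    then show ?thesis by (simp add: G_def del: fact_Suc)
  qed
  also have "fact h * fact (Suc h) * (\<Sum>j\<le>h. (2 * real j + 1) * G (Suc h + j)) =
    (\<Sum>j\<le>h. (2 * real j + 1) * (fact h * fact (Suc h) / (fact (Suc h + j) * fact (h - j))) * g (Suc h + j))"
    unfolding sum_distrib_left
  proof (rule sum.cong)
    fix j assume "j \<in> {..h}"
    then have "m - (Suc h + j) = h - j" by (simp add: m_def)
    then show "fact h * fact (Suc h) * ((2 * real j + 1) * G (Suc h + j)) =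
      (2 * real j + 1) * (fact h * fact (Suc h) / (fact (Suc h + j) * fact (h - j))) * g (Suc h + j)"
      by (simp add: G_def del: fact_Suc)
  qed simp
  finally show ?thesis .
qed

lemma two_sided_bound:
  fixes x a b c p q A B :: real
  assumes nn: "x \<ge> 0" "a \<ge> 0" "b \<ge> 0" "c \<ge> 0" "p \<ge> 0" "q \<ge> 0" and AB: "A > 0" "B > 0"
    and pq: "c \<le> A * q" "c \<le> B * p" and ap: "x * p \<le> a\<^sup>2" and bq: "x * q \<le> b\<^sup>2"
    and det: "(a * b - x * c)\<^sup>2 \<le> (a\<^sup>2 - x * p) * (b\<^sup>2 - x * q)"
  shows "x * c * (1 / 2 + 1 / (2 * sqrt (A * B))) \<le> a * b"
proof -
  define s where "s = sqrt p * sqrt q"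
  have s0: "s \<ge> 0" using nn by (simp add: s_def)
  have sp: "s * s = p * q" using nn by (simp add: s_def algebra_simps)
  \<comment> \<open>By the arithmetic-geometric mean the determinant bound becomes a comparison of
    the squares of \<open>x * c - a * b\<close> and \<open>a * b - x * s\<close>, where the second
    number is nonnegative because \<open>x * s \<le> a * b\<close>.\<close>
  have am: "2 * (a * b) * s \<le> a\<^sup>2 * q + b\<^sup>2 * p"
  proof -
    have "0 \<le> (a * sqrt q - b * sqrt p)\<^sup>2" by simp
    then show ?thesis using nn by (simp add: s_def power2_eq_square algebra_simps)
  qed
  have "(x * s)\<^sup>2 = (x * p) * (x * q)" using sp by (simp add: power2_eq_square algebra_simps)
  also have "\<dots> \<le> a\<^sup>2 * b\<^sup>2" by (rule mult_mono[OF ap bq]) (use nn in auto)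
  finally have "(x * s)\<^sup>2 \<le> (a * b)\<^sup>2" by (simp add: power_mult_distrib)
  then have xs: "x * s \<le> a * b" by (rule power2_le_imp_le) (use nn in simp)
  have "(x * c - a * b)\<^sup>2 = (a * b - x * c)\<^sup>2" by (rule power2_commute)
  also have "\<dots> \<le> a\<^sup>2 * b\<^sup>2 - x * (a\<^sup>2 * q + b\<^sup>2 * p) + x * x * (s * s)"
    using det unfolding sp by (simp add: power2_eq_square algebra_simps)
  also have "\<dots> \<le> a\<^sup>2 * b\<^sup>2 - x * (2 * (a * b) * s) + x * x * (s * s)"
    using mult_left_mono[OF am nn(1)] by linarith
  also have "\<dots> = (a * b - x * s)\<^sup>2" by (simp add: power2_eq_square algebra_simps)
  finally have "x * c - a * b \<le> a * b - x * s" by (rule power2_le_imp_le) (use xs in simp)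
  moreover have "c / sqrt (A * B) \<le> s"
  proof -
    have "c * c \<le> (A * q) * (B * p)" by (rule mult_mono[OF pq]) (use nn AB in auto)
    also have "\<dots> = (s * sqrt (A * B))\<^sup>2" using sp AB by (simp add: power_mult_distrib power2_eq_square[of s] algebra_simps)
    finally have "c\<^sup>2 \<le> (s * sqrt (A * B))\<^sup>2" by (simp add: power2_eq_square)
    then have "c \<le> s * sqrt (A * B)" by (rule power2_le_imp_le) (use s0 AB in simp)
    then show ?thesis using AB by (simp add: pos_divide_le_eq)
  qed
  then have "x * (c / sqrt (A * B)) \<le> x * s" using nn(1) by (rule mult_left_mono)
  ultimately have "(x * c + x * (c / sqrt (A * B))) / 2 \<le> a * b" by (simp add: field_simps del: times_divide_eq_right)
  moreover have "x * c * (1 / 2 + 1 / (2 * sqrt (A * B))) = (x * c + x * (c / sqrt (A * B))) / 2"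
    by (simp add: algebra_simps)
  ultimately show ?thesis by (simp only:)
qed

text \<open>The numerical inequality behind \<open>one_sided_bound\<close>. After clearing
  denominators and putting \<open>l = m + 2\<close>, the only negative coefficient is absorbed in
  the square of \<open>m - 2\<close>.\<close>

lemma cubic_gap:
  fixes l :: real assumes "l \<ge> 2"
  shows "3 * ((l - 1) / (l + 1)) * (10 / (7 * l + 8)) \<le> (1 - 10 / (7 * l + 8)) * (1 - 5 / 3 * ((l - 2) / (l + 2)) * (10 / (7 * l + 8)))"
proof -
  define m where "m = l - 2"
  define d where "d = 7 * l + 8"
  have m: "m \<ge> 0" "l = m + 2" using assms by (auto simp: m_def)
  have pos: "d > 0" "l + 1 > 0" "l + 2 > 0" using assms by (auto simp: d_def)
  have "90 * (l - 1) * (l + 2) * d \<le> (d - 10) * (l + 1) * (3 * d * (l + 2) - 50 * (l - 2))"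
  proof -
    have "(d - 10) * (l + 1) * (3 * d * (l + 2) - 50 * (l - 2)) - 90 * (l - 1) * (l + 2) * d =
      147 * m ^ 4 + 763 * m ^ 3 + 747 * m\<^sup>2 + 27 * (m - 2)\<^sup>2 + 1476"
      unfolding d_def m(2) by (simp add: algebra_simps power2_eq_square eval_nat_numeral)
    moreover have "\<dots> \<ge> 0" using m(1) by (intro add_nonneg_nonneg) auto
    ultimately show ?thesis by linarith
  qed
  then have "90 * (l - 1) * (l + 2) * d / (3 * d * d * (l + 1) * (l + 2)) \<le>
    (d - 10) * (l + 1) * (3 * d * (l + 2) - 50 * (l - 2)) / (3 * d * d * (l + 1) * (l + 2))"
    by (rule divide_right_mono) (use pos in simp)
  moreover have "90 * (l - 1) * (l + 2) * d / (3 * d * d * (l + 1) * (l + 2)) = 3 * ((l - 1) / (l + 1)) * (10 / d)"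
    using pos by (simp add: divide_simps)
  moreover have "(d - 10) * (l + 1) * (3 * d * (l + 2) - 50 * (l - 2)) / (3 * d * d * (l + 1) * (l + 2)) =
    (1 - 10 / d) * (1 - 5 / 3 * ((l - 2) / (l + 2)) * (10 / d))"
    using pos by (simp add: divide_simps)
  ultimately show ?thesis by (simp add: d_def)
qed

text \<open>If the claim failed, \<open>2 - y\<close> would be below
  \<open>2 / (sqrt B + 1)\<close>, and \<open>sqrt B \<ge> (7 * l + 3) / 5\<close> makes this at
  most \<open>10 / (7 * l + 8)\<close>. Then \<open>r\<close> is small too, so \<open>up\<close>
  keeps \<open>y - 1\<close> small, although \<open>y\<close> is close to 2.\<close>

lemma one_sided_bound:
  fixes y r l B :: real
  assumes l: "l \<ge> 2" and r: "r \<ge> 0" "r \<le> 2 - y" and B: "B \<ge> (2 * l + 7) * (l - 1) + 1"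
    and up: "5 / 3 * ((l - 2) / (l + 2)) * r < 1 \<Longrightarrow> (1 - 5 / 3 * ((l - 2) / (l + 2)) * r) * (y - 1) \<le> 3 * ((l - 1) / (l + 1)) * r"
  shows "y * (1 / 2 + 1 / (2 * sqrt B)) \<le> 1"
proof (rule ccontr)
  assume "\<not> ?thesis"
  then have v: "1 < y * (1 / 2 + 1 / (2 * sqrt B))" by simp
  define e where "e = 10 / (7 * l + 8)"
  define \<kappa> where "\<kappa> = 5 / 3 * ((l - 2) / (l + 2))"
  have k0: "\<kappa> \<ge> 0" using l by (simp add: \<kappa>_def)
  have "(7 * l + 3)\<^sup>2 \<le> 25 * ((2 * l + 7) * (l - 1) + 1)"
  proof -
    have "25 * ((2 * l + 7) * (l - 1) + 1) - (7 * l + 3)\<^sup>2 = (l - 2)\<^sup>2 + 87 * (l - 2) + 11"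
      by (simp add: power2_eq_square algebra_simps)
    moreover have "\<dots> \<ge> 0" using l by (intro add_nonneg_nonneg) auto
    ultimately show ?thesis by linarith
  qed
  then have "((7 * l + 3) / 5)\<^sup>2 \<le> B" using B by (simp add: power_divide)
  then have sB: "(7 * l + 3) / 5 \<le> sqrt B" by (rule real_le_rsqrt)
  have s0: "sqrt B > 0" using sB l by (intro less_le_trans[OF _ sB]) auto
  have "1 / sqrt B \<le> 5 / (7 * l + 3)" using sB s0 l by (simp add: field_simps)
  have y0: "y > 0"
  proof (rule ccontr)
    assume "\<not> y > 0"
    then have "y * (1 / 2 + 1 / (2 * sqrt B)) \<le> 0" using s0 by (intro mult_nonpos_nonneg) auto
    then show False using v by simp
  qed
  have "2 * sqrt B < y * (sqrt B + 1)" using v s0 by (simp add: field_simps)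
  then have "(2 - y) * (sqrt B + 1) < 2" by (simp add: algebra_simps)
  moreover have "(2 - y) * ((7 * l + 8) / 5) \<le> (2 - y) * (sqrt B + 1)"
    by (rule mult_left_mono) (use sB r in auto)
  ultimately have "(2 - y) * ((7 * l + 8) / 5) < 2" by linarith
  then have ye: "2 - y < e" using l by (simp add: e_def field_simps)
  have re: "r < e" using r ye by linarith
  have e1: "e < 1" "e > 0" using l by (auto simp: e_def)
  have kl: "\<kappa> * e < 1"
  proof -
    have "\<kappa> \<le> 5 / 3" using l by (simp add: \<kappa>_def field_simps)
    then have "\<kappa> * e \<le> 5 / 3 * e" using e1 by (intro mult_right_mono) auto
    also have "5 / 3 * e < 1" using l by (simp add: e_def field_simps)
    finally show ?thesis .
  qed
  have "3 * ((l - 1) / (l + 1)) * r \<le> 3 * ((l - 1) / (l + 1)) * e" using re l by (intro mult_left_mono) auto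
  also have "\<dots> \<le> (1 - e) * (1 - \<kappa> * e)" using cubic_gap[OF l] by (simp add: e_def \<kappa>_def)
  also have "\<dots> < (y - 1) * (1 - \<kappa> * e)" using ye kl by (intro mult_strict_right_mono) auto
  also have "\<dots> \<le> (y - 1) * (1 - \<kappa> * r)"
    using ye e1 re k0 by (intro mult_left_mono) (auto intro: mult_left_mono)
  also have "\<dots> \<le> 3 * ((l - 1) / (l + 1)) * r"
  proof -
    have "\<kappa> * r \<le> \<kappa> * e" using re k0 by (intro mult_left_mono) auto
    then show ?thesis using up kl by (simp add: \<kappa>_def mult.commute)
  qed
  finally show False by simp
qed

section \<open>Zeros and ratios of the sequences \<open>F 1\<close> and \<open>F 2\<close>, and the
  case \<open>k = 1\<close>\<close>

context marked_poset
begin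

lemma F_pos: "F k l > 0 \<longleftrightarrow> (\<exists>f. f \<in> Gap k l)"
  using finite_Gap by (auto simp: F_def card_gt_0_iff)

text \<open>Log-concavity alone does not exclude zeros inside the sequence.\<close>

lemma grow:
  assumes k: "k = 1 \<or> k = 2" and i: "i \<ge> 1" "F k i > 0" and j: "j > i" "F k j > 0"
  shows "F k (i + 1) > 0"
proof (cases "j = i + 1")
  case False
  obtain f where f: "f \<in> Gap k i" using i F_pos by blast
  obtain h where h: "h \<in> Gap k j" using j F_pos by blast
  have fL: "f \<in> LE" and p2: "f z2 = f z1 + k" and p3: "f z3 = f z2 + i" using f by (auto simp: Gap_def)
  have hL: "h \<in> LE" and h3: "h z3 = h z2 + j" using h by (auto simp: Gap_def)
  note bound = LE_D(4)[OF fL] and inj = LE_D(5)[OF fL]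
  define l where "l = i - 1"
  have il: "i = l + 1" using i by (simp add: l_def)
  show ?thesis
  proof (cases "\<forall>y\<in>Y. f z1 \<le> f y \<and> f y < f z2 \<longrightarrow> (y, z2) \<in> R")
    case True
    have "\<exists>g. g \<in> Gap k (l + 2)"
      using second_move[OF hL, of l f k] h3 j f il True by (auto simp: False)
    then show ?thesis using F_pos il by (metis add.assoc one_add_one)
  next
    case nb: False
    then obtain w where w: "w \<in> Y" "f z1 \<le> f w" "f w < f z2" "(w, z2) \<notin> R" by blast
    have "w \<noteq> z1" using w z12 by auto
    then have w1: "f z1 < f w" using inj[OF w(1) inY(3)] w(2) by linarith
    then have k2: "k = 2" and fw: "f w = f z1 + 1" using k w(3) p2 by auto
    show ?thesis
    proof (cases "\<exists>y\<in>Y. f z3 < f y \<and> (z3, y) \<notin> R")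
      case True
      define S where "S = {y \<in> Y. f z3 < f y \<and> (z3, y) \<notin> R}"
      have "S \<noteq> {}" using True by (auto simp: S_def)
      then obtain v where v: "v \<in> S" "\<And>y. y \<in> S \<Longrightarrow> f v \<le> f y"
        by (rule ex_min_on[rotated, of S f]) (use finY in \<open>auto simp: S_def\<close>)
      have vI: "v \<in> Y" "f z3 < f v" "(z3, v) \<notin> R" using v(1) by (auto simp: S_def)
      have g: "move (f v) (f z3) f \<in> LE" (is "?g \<in> LE")
      proof (rule move_LE[OF fL vI(1) bound[OF inY(5)]])
        fix u assume u: "u \<in> Y" "f z3 \<le> f u" "f u < f v"
        show "(u, v) \<notin> R"
        proof (cases "u = z3")
          case False
          then have "f z3 < f u" using inj[OF u(1) inY(5)] u(2) by linarith
          moreover have "u \<notin> S" using v(2)[of u] u(3) by auto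
          ultimately have "(z3, u) \<in> R" using u by (simp add: S_def)
          then show ?thesis using vI(3) transD[OF tr, of z3 u v] by blast
        qed (use vI in simp)
      qed (use vI in simp)
      have "?g z1 = f z1" "?g z2 = f z2" "?g z3 = f z3 + 1"
        using vI p2 p3 inY i(1) by (auto simp: move_apply shift_def)
      then have "?g \<in> Gap k (i + 1)" using g p2 p3 by (simp add: Gap_def)
      then show ?thesis using F_pos by blast
    next
      case False
      \<comment> \<open>No single move helps: nothing after \<open>z3\<close> can be moved in, and
        if \<open>w\<close> left alone, the first gap would shrink. So \<open>w\<close> moves past
        \<open>z2\<close>, and the last element \<open>v\<close> before \<open>z1\<close> that is
        not below \<open>z2\<close> takes its place. Such a \<open>v\<close> exists because
        \<open>h\<close> has at least two more elements between \<open>z2\<close> and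
        \<open>z3\<close> than \<open>f\<close>.\<close>
      define T where "T = {y \<in> Y. f y < f z1 \<and> (y, z2) \<notin> R}"
      have "T \<noteq> {}"
      proof
        assume T: "T = {}"
        have "{y \<in> Y. h z2 < h y \<and> h y < h z3} \<subseteq> insert w {y \<in> Y. f z2 < f y \<and> f y < f z3}"
        proof
          fix y assume "y \<in> {y \<in> Y. h z2 < h y \<and> h y < h z3}"
          then have y: "y \<in> Y" "h z2 < h y" "h y < h z3" by auto
          have n1: "\<not> f y < f z1"
          proof
            assume "f y < f z1"
            then have "(y, z2) \<in> R" using T y(1) by (auto simp: T_def)
            then show False using LE_D(3)[OF hL] y by fastforce
          qed
          have n3: "\<not> f z3 < f y"
          proof
            assume "f z3 < f y"
            then have "(z3, y) \<in> R" using False y(1) by auto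
            then show False using LE_D(3)[OF hL] y by fastforce
          qed
          have "h z1 < h z2" using LE_D(3)[OF hL z12] .
          then have "f y \<noteq> f z1" "f y \<noteq> f z2" "f y \<noteq> f z3" using inj[OF y(1)] inY y(2,3) by auto
          moreover have "f y = f w \<Longrightarrow> y = w" using inj[OF y(1) w(1)] .
          ultimately show "y \<in> insert w {y \<in> Y. f z2 < f y \<and> f y < f z3}"
            using n1 n3 y(1) fw p2 k2 by (cases "f y = f w") auto
        qed
        then have "card {y \<in> Y. h z2 < h y \<and> h y < h z3} \<le> card (insert w {y \<in> Y. f z2 < f y \<and> f y < f z3})"
          using finY by (intro card_mono) auto
        also have "\<dots> \<le> Suc (card {y \<in> Y. f z2 < f y \<and> f y < f z3})" using finY by (simp add: card_insert_if)
        finally show False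
          unfolding card_between[OF hL inY(4,5)] card_between[OF fL inY(4,5)] using h3 p3 j(1) i(1) \<open>j \<noteq> i + 1\<close> by linarith
      qed
      then obtain v where v: "v \<in> T" "\<And>y. y \<in> T \<Longrightarrow> f y \<le> f v"
        by (rule ex_max_on[rotated, of T f]) (use finY in \<open>auto simp: T_def\<close>)
      have vI: "v \<in> Y" "f v < f z1" "(v, z2) \<notin> R" using v(1) by (auto simp: T_def)
      have g: "move (f w) (f z2) f \<in> LE" (is "?g \<in> LE")
      proof (rule move_LE[OF fL w(1) bound[OF inY(4)]])
        fix u assume u: "u \<in> Y" "f w < f u" "f u \<le> f z2"
        then have "f u = f z2" using fw p2 k2 by simp
        then have "u = z2" using inj u inY by blast
        then show "(w, u) \<notin> R" using w(4) by simp
      qed (use w in simp)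
      have gz: "?g z1 = f z1" "?g z2 = f z2 - 1" "?g z3 = f z3" "?g v = f v"
        using fw p2 p3 k2 inY vI i(1) by (auto simp: move_apply shift_def)
      have g': "move (?g v) (?g z1) ?g \<in> LE" (is "?g' \<in> LE")
      proof (rule move_LE[OF g vI(1) LE_D(4)[OF g inY(3)]])
        fix u assume u: "u \<in> Y" "?g v < ?g u" "?g u \<le> ?g z1"
        have "f u \<le> f z1" "f v < f u"
          using u gz fw p2 k2 unfolding move_apply[OF u(1)] by (auto simp: shift_def split: if_splits)
        have "(u, z2) \<in> R"
        proof (cases "u = z1")
          case False
          then have "f u < f z1" using inj[OF u(1) inY(3)] \<open>f u \<le> f z1\<close> by linarith
          moreover have "u \<notin> T" using v(2)[of u] \<open>f v < f u\<close> by auto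
          ultimately show ?thesis using u by (simp add: T_def)
        qed (use z12 in simp)
        then show "(v, u) \<notin> R" using vI(3) transD[OF tr, of v u z2] by blast
      qed (use gz vI in simp)
      have e: "?g' y = shift (f v) (f z1) (?g y)" if "y \<in> Y" for y using move_apply[OF that] gz by simp
      have "?g' z1 = f z1 - 1" by (subst e[OF inY(3)], subst gz(1)) (use vI in \<open>simp add: shift_def\<close>)
      moreover have "?g' z2 = f z2 - 1" by (subst e[OF inY(4)], subst gz(2)) (use vI p2 k2 in \<open>simp add: shift_def\<close>)
      moreover have "?g' z3 = f z3" by (subst e[OF inY(5)], subst gz(3)) (use vI p2 p3 k2 i(1) in \<open>simp add: shift_def\<close>)
      ultimately have "?g' \<in> Gap k (i + 1)" using g' p2 p3 k2 vI by (simp add: Gap_def)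
      then show ?thesis using F_pos by blast
    qed
  qed
qed (use j in simp)

lemma no_internal_zeros:
  assumes k: "k = 1 \<or> k = 2" and i: "i \<ge> 1" "F k i > 0" and j: "F k j > 0" and m: "i \<le> m" "m \<le> j"
  shows "F k m > 0"
  using m
proof (induction m rule: dec_induct)
  case (step m)
  then show ?case using grow[OF k, of m j] i j by simp
qed (use i in simp)

text \<open>Log-concavity telescopes; the factor \<open>F k m\<close> that has to be cancelled is
  positive because there are no internal zeros.\<close>

lemma ratio_monotone:
  assumes k: "k = 1 \<or> k = 2" and s: "s \<ge> 1" "s \<le> m"
  shows "F k (m + 1) * F k s \<le> F k (s + 1) * F k m"
  using s(2)
proof (induction m rule: dec_induct)
  case (step m)
  show ?case
  proof (cases "F k (Suc m + 1) > 0 \<and> F k s > 0")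
    case True
    then have pos: "F k m > 0" using no_internal_zeros[OF k s(1), of "Suc m + 1" m] step by simp
    have "F k m * (F k (Suc m + 1) * F k s) = (F k (m + 2) * F k m) * F k s" by (simp add: mult_ac)
    also have "\<dots> \<le> (F k (m + 1))\<^sup>2 * F k s" using log_concave[of k m] k s step by (intro mult_le_mono1) auto
    also have "\<dots> = F k (m + 1) * (F k (m + 1) * F k s)" by (simp add: power2_eq_square)
    also have "\<dots> \<le> F k (m + 1) * (F k (s + 1) * F k m)" by (intro mult_le_mono2 step.IH)
    also have "\<dots> = F k m * (F k (s + 1) * F k (Suc m))" by (simp add: mult_ac)
    finally show ?thesis using pos by simp
  qed auto
qed simp

lemma adjacent_case:
  assumes l: "l \<ge> 1" and q: "F 1 (l + 2) > 0" and n: "card Y = n + 2"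
  shows "real (F 1 l) * F 2 (l + 1) * (1 / 2 + 1 / (2 * sqrt (2 * real n * real l - 2 * real n - real l + 2)))
    \<le> real (F 2 l) * F 1 (l + 1)"
proof (cases "l = 1")
  case True
  \<comment> \<open>For \<open>l = 1\<close> the square root is 1, so the whole factor is 1, and the
    convolution inequality with \<open>T = 0\<close> is the claim.\<close>
  have "real (F 1 1) * F 2 2 \<le> real (F 1 2) * F 2 1" using convolution_inequality[of 0] by simp
  then show ?thesis using True by (simp add: mult.commute numeral_2_eq_2)
next
  case False
  define h where "h = l - 1"
  have h: "h \<ge> 1" "l = Suc h" using False l by (auto simp: h_def)
  define x a b c q' where "x = real (F 1 l)" and "a = real (F 2 l)" and "b = real (F 1 (l + 1))" and "c = real (F 2 (l + 1))"
    and "q' = real (F 1 (l + 2))"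
  define B where "B = 2 * real n * real l - 2 * real n - real l + 2"
  have room: "l + 4 \<le> n" using F_room[OF q] n by simp
  show ?thesis
  proof (cases "x > 0 \<and> c > 0")
    case False
    then have e: "real (F 1 l) * F 2 (l + 1) = 0" unfolding x_def c_def by auto
    show ?thesis unfolding e by simp
  next
    case True
    then have x: "x > 0" and c: "c > 0" by auto
    have q0: "q' > 0" using q by (simp add: q'_def)
    have "q' * x \<le> b\<^sup>2" using log_concave[of 1 l] l unfolding q'_def x_def b_def
      by (metis of_nat_le_iff of_nat_mult of_nat_power order_refl)
    moreover have "q' * x > 0" using q0 x by simp
    ultimately have b: "b > 0" by (cases "b = 0") (auto simp: b_def)
    \<comment> \<open>The products in the convolution for \<open>T = 2 * h\<close>. The two central
      ones are \<open>g h = x * c\<close> and \<open>g (Suc h) = a * b\<close>.\<close>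
    define g where "g = (\<lambda>s. if s \<le> Suc (2 * h) then real (F 1 (1 + s)) * real (F 2 (Suc (Suc (2 * h)) - s)) else 0)"
    have g0: "g s \<ge> 0" for s by (simp add: g_def)
    have "g h \<le> (\<Sum>j\<le>h. (2 * real j + 1) * (fact h * fact (Suc h) / (fact (Suc h + j) * fact (h - j))) * g (Suc h + j))"
    proof (rule central_term_bound[OF g0 h(1)])
      have "(\<Sum>s\<le>2 * h. g s / (fact s * fact (2 * h - s))) =
          (\<Sum>i\<le>2 * h. real (F 1 (1 + i)) * F 2 (2 + (2 * h - i)) / (fact i * fact (2 * h - i)))"
        by (rule sum.cong) (auto simp: g_def Suc_diff_le)
      also have "\<dots> \<le> (\<Sum>i\<le>2 * h. real (F 1 (2 + i)) * F 2 (1 + (2 * h - i)) / (fact i * fact (2 * h - i)))"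
        by (rule convolution_inequality)
      also have "\<dots> = (\<Sum>s\<le>2 * h. g (Suc s) / (fact s * fact (2 * h - s)))"
        by (rule sum.cong) (auto simp: g_def Suc_diff_le)
      finally show "(\<Sum>s\<le>2 * h. g s / (fact s * fact (2 * h - s))) \<le> (\<Sum>s\<le>2 * h. g (Suc s) / (fact s * fact (2 * h - s)))" .
    qed
    define P where "P = (\<lambda>j. g (Suc h + j))"
    define T where "T = (\<lambda>j. if j \<le> h then (2 * real j + 1) * (fact h * fact (Suc h) / (fact (Suc h + j) * fact (h - j))) * P j else 0)"
    \<comment> \<open>By log-concavity of both sequences, \<open>r\<close> bounds the ratio of
      consecutive products from \<open>a * b\<close> on. With \<open>y = x * c / (a * b)\<close> the
      product \<open>r * y\<close> is \<open>x * q'\<close> divided by the square of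
      \<open>b\<close>, so the determinant inequality gives \<open>r \<le> 2 - y\<close>.\<close>
    define r where "r = q' * a / (b * c)"
    \<comment> \<open>\<open>r\<close> times a bound for the ratios of consecutive coefficients,
      whose factors are largest at \<open>j = 1\<close>: there
      \<open>(2 * j + 3) / (2 * j + 1)\<close> is 5/3 and \<open>(h - j) / (h + 2 + j)\<close> is
      \<open>(l - 2) / (l + 2)\<close>.\<close>
    define \<kappa> where "\<kappa> = 5 / 3 * ((real l - 2) / (real l + 2)) * r"
    have r0: "r \<ge> 0" using q0 b c by (simp add: r_def a_def)
    have gh: "g h = x * c" using h by (simp add: g_def x_def c_def)
    have P0: "P 0 = a * b" using h by (simp add: P_def g_def a_def b_def)
    have Pj: "P j = real (F 1 (l + 1 + j)) * real (F 2 (l - j))" if "j \<le> h" for j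
    proof -
      have "1 + (Suc h + j) = l + 1 + j" "Suc (Suc (2 * h)) - (Suc h + j) = l - j" using that h by auto
      then show ?thesis using that unfolding P_def g_def by simp
    qed
    have Pr: "P (Suc j) \<le> r * P j" if "Suc j \<le> h" for j
    proof -
      have u1: "real (F 1 (l + 1 + Suc j)) * b \<le> q' * real (F 1 (l + 1 + j))"
        using ratio_monotone[of 1 "l + 1" "l + 1 + j"] unfolding b_def q'_def
        by (simp del: of_nat_mult of_nat_add add: of_nat_mult[symmetric])
      have lj: "l - Suc j + 1 = l - j" "1 \<le> l - Suc j" using that h by auto
      have v1: "c * real (F 2 (l - Suc j)) \<le> a * real (F 2 (l - j))"
        using ratio_monotone[of 2 "l - Suc j" l] lj unfolding a_def c_def
        by (simp del: of_nat_mult of_nat_add add: of_nat_mult[symmetric] mult.commute)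
      have "P (Suc j) * (b * c) = (real (F 1 (l + 1 + Suc j)) * b) * (c * real (F 2 (l - Suc j)))"
        unfolding Pj[OF that] by (simp only: mult_ac)
      also have "\<dots> \<le> (q' * real (F 1 (l + 1 + j))) * (a * real (F 2 (l - j)))"
        by (rule mult_mono[OF u1 v1]) (use q0 c in auto)
      also have "\<dots> = (q' * a) * P j" using that by (simp add: Pj mult_ac)
      finally show ?thesis using b c by (simp add: r_def field_simps)
    qed
    have T0: "T j \<ge> 0" for j using g0 by (simp add: T_def P_def)
    have Tr: "T (Suc j) \<le> \<kappa> * T j" if j: "j \<ge> 1" for j
    proof (cases "Suc j \<le> h")
      case True
      define C where "C = fact h * fact (Suc h) / (fact (Suc h + j) * fact (h - j) :: real)"
      have C0: "C \<ge> 0" by (simp add: C_def)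
      have hj: "h - j = Suc (h - Suc j)" using True by simp
      have "fact h * fact (Suc h) / (fact (Suc h + Suc j) * fact (h - Suc j)) = C * (real (h - j) / real (Suc h + Suc j))"
      proof -
        have "fact (h - j) = real (h - j) * fact (h - Suc j)" unfolding hj by simp
        moreover have "fact (Suc h + Suc j) = real (Suc h + Suc j) * fact (Suc h + j)" by simp
        moreover have "real (h - j) \<noteq> 0" "real (Suc h + Suc j) \<noteq> 0" using True by auto
        ultimately show ?thesis unfolding C_def by (simp del: fact_Suc of_nat_Suc of_nat_add)
      qed
      then have Ts: "T (Suc j) = (2 * real (Suc j) + 1) * (C * (real (h - j) / real (Suc h + Suc j))) * P (Suc j)"
        using True by (simp add: T_def)
      have Tj: "T j = (2 * real j + 1) * C * P j"
        using Suc_leD[OF True] by (simp only: T_def C_def if_True)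
      have A1: "2 * real (Suc j) + 1 \<le> 5 / 3 * (2 * real j + 1)" using j by simp
      have A2: "real (h - j) / real (Suc h + Suc j) \<le> (real l - 2) / (real l + 2)"
      proof -
        have "real (h - j) * (real l + 2) \<le> (real l - 2) * real (Suc h + Suc j)"
        proof -
          have "real (h - j) = real h - real j" using True by simp
          then have "(real l - 2) * real (Suc h + Suc j) - real (h - j) * (real l + 2) = 2 * real l * (real j - 1)"
            using h by (simp add: algebra_simps)
          moreover have "0 \<le> 2 * real l * (real j - 1)" using j by simp
          ultimately show ?thesis by linarith
        qed
        moreover have "real (Suc h + Suc j) > 0" "real l + 2 > 0" by auto
        ultimately show ?thesis by (simp add: frac_le_eq divide_le_0_iff del: of_nat_add of_nat_Suc)
      qed
      have l2: "real l - 2 \<ge> 0" using h by simp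
      have "(2 * real (Suc j) + 1) * (C * (real (h - j) / real (Suc h + Suc j))) \<le> (5 / 3 * (2 * real j + 1)) * (C * ((real l - 2) / (real l + 2)))"
        by (rule mult_mono[OF A1 mult_left_mono[OF A2 C0]]) (use C0 in auto)
      then have "T (Suc j) \<le> (5 / 3 * (2 * real j + 1)) * (C * ((real l - 2) / (real l + 2))) * (r * P j)"
        unfolding Ts by (rule mult_mono[OF _ Pr[OF True]]) (use C0 l2 g0 in \<open>auto simp: P_def\<close>)
      also have "\<dots> = \<kappa> * T j" unfolding Tj \<kappa>_def by (simp add: mult_ac) (simp add: algebra_simps)
      finally show ?thesis .
    next
      case False
      then have "T (Suc j) = 0" by (simp add: T_def)
      moreover have "\<kappa> \<ge> 0" using h r0 by (simp add: \<kappa>_def)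
      ultimately show ?thesis using T0 by simp
    qed
    have T1: "T 1 \<le> 3 * ((real l - 1) / (real l + 1)) * (r * (a * b))"
    proof -
      have "fact h * fact (Suc h) / (fact (Suc h + 1) * fact (h - 1)) = real h / real (h + 2)"
      proof -
        have "h = Suc (h - 1)" using h by simp
        then have "fact h = real h * fact (h - 1)" by (metis fact_Suc)
        moreover have "fact (Suc h + 1) = real (h + 2) * fact (Suc h)" by (simp add: add.commute)
        ultimately show ?thesis by (simp del: fact_Suc of_nat_add)
      qed
      then have "T 1 = 3 * (real h / real (h + 2)) * P 1" using h by (simp add: T_def)
      also have "\<dots> \<le> 3 * (real h / real (h + 2)) * (r * P 0)" using Pr[of 0] h by (intro mult_left_mono) auto
      finally show ?thesis using h by (simp add: P0 add.commute)
    qed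
    have "x * c \<le> a * b + (\<Sum>j=1..h. T j)"
    proof -
      have "x * c \<le> (\<Sum>j\<le>h. T j)"
        using \<open>g h \<le> _\<close> unfolding gh by (simp add: T_def P_def)
      also have "{..h} = insert 0 {1..h}" by auto
      also have "(\<Sum>j\<in>insert 0 {1..h}. T j) = T 0 + (\<Sum>j=1..h. T j)" by simp
      also have "T 0 = a * b" by (simp add: T_def P0)
      finally show ?thesis .
    qed
    then have S: "x * c - a * b \<le> (\<Sum>j=1..h. T j)" by simp
    have det: "(a * b - x * c)\<^sup>2 \<le> (a\<^sup>2 - x * F 3 l) * (b\<^sup>2 - x * q')" and ap: "x * F 3 l \<le> a\<^sup>2"
      using hyperbolic_det[of 1 l] hyperbolic(1)[of 1 l 0] l room n
      by (simp_all add: x_def a_def b_def c_def q'_def numeral_2_eq_2 numeral_3_eq_3 mult.commute)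
    have bq: "x * q' \<le> b\<^sup>2" using \<open>q' * x \<le> b\<^sup>2\<close> by (simp add: mult.commute)
    have detq: "(a * b - x * c)\<^sup>2 \<le> a\<^sup>2 * (b\<^sup>2 - x * q')"
    proof -
      have "(a\<^sup>2 - x * F 3 l) * (b\<^sup>2 - x * q') \<le> a\<^sup>2 * (b\<^sup>2 - x * q')"
        using x bq by (intro mult_right_mono) auto
      then show ?thesis using det by linarith
    qed
    have a: "a > 0"
    proof (rule ccontr)
      assume "\<not> a > 0"
      then have "a = 0" by (simp add: a_def)
      then show False using detq x c by simp
    qed
    define y where "y = x * c / (a * b)"
    have yab: "x * c = y * (a * b)" using a b by (simp add: y_def)
    have "(1 - y)\<^sup>2 * (a * b)\<^sup>2 \<le> (a * b)\<^sup>2 - a\<^sup>2 * (x * q')"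
      using detq unfolding yab by (simp add: power2_eq_square algebra_simps)
    moreover have "a\<^sup>2 * (x * q') = (r * y) * (a * b)\<^sup>2"
      using a b c by (simp add: r_def y_def power2_eq_square field_simps)
    ultimately have "((1 - y)\<^sup>2 + r * y) * (a * b)\<^sup>2 \<le> 1 * (a * b)\<^sup>2" unfolding distrib_right mult_1 by linarith
    then have "(1 - y)\<^sup>2 + r * y \<le> 1" using a b by (simp only: mult_le_cancel_right_pos zero_less_power mult_pos_pos)
    then have "y * r \<le> y * (2 - y)" by (simp add: power2_eq_square algebra_simps)
    moreover have y0: "y > 0" using x c a b by (simp add: y_def)
    ultimately have ry: "r \<le> 2 - y" by simp
    have "y * (1 / 2 + 1 / (2 * sqrt B)) \<le> 1"
    proof (rule one_sided_bound[OF _ r0 ry])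
      show "2 \<le> real l" using h by simp
      \<comment> \<open>\<open>B\<close> equals \<open>(2 * n - 1) * (l - 1) + 1\<close>, and an
        extension counted by \<open>F 1 (l + 2)\<close> needs \<open>n \<ge> l + 4\<close>.\<close>
      show "(2 * real l + 7) * (real l - 1) + 1 \<le> B"
      proof -
        have "(2 * real l + 7) * (real l - 1) \<le> (2 * real n - 1) * (real l - 1)"
          using room h by (intro mult_right_mono) auto
        then show ?thesis by (simp add: B_def algebra_simps)
      qed
      show "(1 - 5 / 3 * ((real l - 2) / (real l + 2)) * r) * (y - 1) \<le> 3 * ((real l - 1) / (real l + 1)) * r"
        if k1: "5 / 3 * ((real l - 2) / (real l + 2)) * r < 1"
      proof -
        have "(1 - \<kappa>) * (x * c - a * b) \<le> (1 - \<kappa>) * (\<Sum>j=1..h. T j)"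
          using S k1 by (intro mult_left_mono) (auto simp: \<kappa>_def)
        also have "\<dots> \<le> T 1" by (rule geometric_sum_bound[of T \<kappa> h, OF T0 Tr])
        also have "\<dots> \<le> 3 * ((real l - 1) / (real l + 1)) * (r * (a * b))" by (rule T1)
        finally have "((1 - \<kappa>) * (y - 1)) * (a * b) \<le> (3 * ((real l - 1) / (real l + 1)) * r) * (a * b)"
          unfolding yab by (simp add: algebra_simps)
        then show ?thesis using a b unfolding \<kappa>_def by (simp only: mult_le_cancel_right_pos mult_pos_pos)
      qed
    qed
    then have "y * (1 / 2 + 1 / (2 * sqrt B)) * (a * b) \<le> 1 * (a * b)" using a b by (intro mult_right_mono) auto
    then have "x * c * (1 / 2 + 1 / (2 * sqrt B)) \<le> a * b" unfolding yab by (simp add: mult_ac)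
    then show ?thesis by (simp add: x_def a_def b_def c_def B_def)
  qed
qed

lemma cross_product_bound:
  assumes k: "k \<ge> 1" and l: "l \<ge> 1" and q: "F k (l + 2) > 0" and p: "F (k + 2) l > 0" and n: "card Y = n + 2"
  shows "real (F k l) * F (k + 1) (l + 1) * (1 / 2 + 1 / (2 * sqrt ((2 * real n * real k - 2 * real n - real k + 2) *
      (2 * real n * real l - 2 * real n - real l + 2)))) \<le> real (F (k + 1) l) * F k (l + 1)"
proof (cases "k = 1 \<or> l = 1")
  case True
  then consider "k = 1" | "l = 1" by blast
  then show ?thesis
  proof cases
    case 1
    then show ?thesis using adjacent_case[of l n] l q n by (simp add: numeral_2_eq_2)
  next
    case 2
    interpret d: marked_poset Y "R\<inverse>" top bot z3 z2 z1 by (rule dual)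
    show ?thesis using d.adjacent_case[of k n] k p n 2 by (simp add: dual_F numeral_2_eq_2 mult.commute)
  qed
next
  case False
  then have k2: "k \<ge> 2" and l2: "l \<ge> 2" using k l by auto
  have room: "k + l + 3 \<le> n" using F_room[OF q] n by simp
  have A: "real m * real n \<le> 2 * real n * real m - 2 * real n - real m + 2" if "m \<ge> 2" for m
  proof -
    have "0 \<le> (real n - 1) * (real m - 2)" using that room by (intro mult_nonneg_nonneg) auto
    then show ?thesis by (simp add: algebra_simps)
  qed
  have cb: "real (F (k + 1) (l + 1)) \<le> (2 * real n * real m - 2 * real n - real m + 2) * real t"
    if "F (k + 1) (l + 1) \<le> m * (card Y - k - l) * t" "m \<ge> 2" for m t
  proof -
    have "m * (card Y - k - l) * t \<le> m * n * t" using n k l by (intro mult_le_mono) auto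
    then have "real (F (k + 1) (l + 1)) \<le> real (m * n * t)" using that(1) of_nat_le_iff order_trans by blast
    also have "\<dots> = (real m * real n) * real t" by simp
    also have "\<dots> \<le> (2 * real n * real m - 2 * real n - real m + 2) * real t"
      by (rule mult_right_mono[OF A[OF that(2)]]) simp
    finally show ?thesis .
  qed
  have pos: "2 * real n * real m - 2 * real n - real m + 2 > 0" if "m \<ge> 2" for m
    using A[OF that] that room by (intro less_le_trans[OF _ A[OF that]]) auto
  have N: "k + l + 4 \<le> card Y" using room n by simp
  show ?thesis
  proof (rule two_sided_bound[where p = "real (F (k + 2) l)" and q = "real (F k (l + 2))"])
    show "real (F (k + 1) (l + 1)) \<le> (2 * real n * real k - 2 * real n - real k + 2) * real (F k (l + 2))"
      by (rule cb[OF move_bound[OF q k] k2])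
    show "real (F (k + 1) (l + 1)) \<le> (2 * real n * real l - 2 * real n - real l + 2) * real (F (k + 2) l)"
      by (rule cb[OF move_bound_dual[OF p l] l2])
    show "real (F k l) * real (F (k + 2) l) \<le> (real (F (k + 1) l))\<^sup>2"
      using hyperbolic(1)[OF k l N, of 0] by (simp add: mult.commute)
    show "real (F k l) * real (F k (l + 2)) \<le> (real (F k (l + 1)))\<^sup>2"
      using hyperbolic(2)[OF k l N] by (simp add: mult.commute)
    show "(real (F (k + 1) l) * real (F k (l + 1)) - real (F k l) * real (F (k + 1) (l + 1)))\<^sup>2 \<le>
      ((real (F (k + 1) l))\<^sup>2 - real (F k l) * real (F (k + 2) l)) * ((real (F k (l + 1)))\<^sup>2 - real (F k l) * real (F k (l + 2)))"
      by (rule hyperbolic_det[OF k l N])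
  qed (use pos k2 l2 in auto)
qed

end

section \<open>Reduction to a poset with least and greatest element\<close>

datatype 'a bounded = Bottom | Elem 'a | Top

locale ordered_triple =
  fixes X :: "'a set" and prec :: "'a \<Rightarrow> 'a \<Rightarrow> bool" and z1 z2 z3 :: 'a and L0 :: "'a \<Rightarrow> nat"
  assumes finX: "finite X" and zX: "z1 \<in> X" "z2 \<in> X" "z3 \<in> X" and dz: "z1 \<noteq> z2" "z1 \<noteq> z3" "z2 \<noteq> z3"
    and L0: "L0 \<in> linear_extensions X prec" "L0 z1 < L0 z2" "L0 z2 < L0 z3"
begin

text \<open>The added relations create no cycle, because every extension with positive gaps respects
  them and \<open>L0\<close> is such an extension. For the same reason they leave the counts
  unchanged.\<close>

definition Q :: "('a \<times> 'a) set" where "Q = ({(u, v) \<in> X \<times> X. prec u v} \<union> {(z1, z2), (z2, z3)})\<^sup>+"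

definition Y :: "'a bounded set" where "Y = {Bottom, Top} \<union> Elem ` X"

definition R :: "('a bounded \<times> 'a bounded) set" where
  "R = map_prod Elem Elem ` Q \<union> {Bottom} \<times> (Y - {Bottom}) \<union> (Y - {Top}) \<times> {Top}"

lemma Q_mono:
  assumes "L \<in> linear_extensions X prec" "L z1 < L z2" "L z2 < L z3" "(u, v) \<in> Q"
  shows "L u < L v"
  using assms(4) unfolding Q_def
  by (induction rule: trancl_induct) (use assms(1-3) in \<open>force simp: linear_extensions_def\<close>)+

lemma Q_sub: "Q \<subseteq> X \<times> X"
  unfolding Q_def by (rule trancl_subset_Sigma) (use zX in auto)

lemma card_Y: "card Y = card X + 2"
proof -
  have "card (Elem ` X) = card X" by (intro card_image) (auto simp: inj_on_def)
  moreover have "Y = insert Bottom (insert Top (Elem ` X))" by (auto simp: Y_def)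
  ultimately show ?thesis using finX by (simp add: image_iff)
qed

lemma marked: "marked_poset Y R Bottom Top (Elem z1) (Elem z2) (Elem z3)"
proof
  show "finite Y" using finX by (simp add: Y_def)
  show "Bottom \<in> Y" "Top \<in> Y" "Elem z1 \<in> Y" "Elem z2 \<in> Y" "Elem z3 \<in> Y" using zX by (auto simp: Y_def)
  show "distinct [Bottom, Top, Elem z1, Elem z2, Elem z3]" using dz by simp
  show "R \<subseteq> Y \<times> Y" using Q_sub by (auto simp: R_def Y_def)
  show "(x, x) \<notin> R" for x using Q_mono[OF L0] by (auto simp: R_def)
  show "trans R"
  proof (rule transI)
    fix x y z assume xy: "(x, y) \<in> R" and yz: "(y, z) \<in> R"
    have z: "z \<in> Y" "z \<noteq> Bottom" and x: "x \<in> Y" "x \<noteq> Top" using xy yz Q_sub by (auto simp: R_def Y_def)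
    show "(x, z) \<in> R"
    proof (cases "x = Bottom \<or> z = Top")
      case True
      then show ?thesis using z x by (auto simp: R_def)
    next
      case False
      then obtain u v where uv: "y = Elem v" "x = Elem u" "(u, v) \<in> Q" using xy yz by (auto simp: R_def)
      then obtain w where "z = Elem w" "(v, w) \<in> Q" using yz False by (auto simp: R_def)
      then show ?thesis using uv trancl_trans unfolding R_def Q_def by (force simp: Q_def)
    qed
  qed
  show "(Bottom, y) \<in> R" if "y \<in> Y" "y \<noteq> Bottom" for y using that by (auto simp: R_def)
  show "(y, Top) \<in> R" if "y \<in> Y" "y \<noteq> Top" for y using that by (auto simp: R_def)
  have "(z1, z2) \<in> Q" "(z2, z3) \<in> Q" by (auto simp: Q_def)
  then show "(Elem z1, Elem z2) \<in> R" "(Elem z2, Elem z3) \<in> R" by (auto simp: R_def)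
qed

sublocale mp: marked_poset Y R Bottom Top "Elem z1" "Elem z2" "Elem z3" by (rule marked)

lemma F_eq:
  assumes "a \<ge> 1" "b \<ge> 1"
  shows "num_ext_gaps X prec z1 z2 z3 (int a) (int b) = mp.F a b"
proof -
  let ?A = "{L \<in> linear_extensions X prec. int (L z2) - int (L z1) = int a \<and> int (L z3) - int (L z2) = int b}"
  define up where "up = (\<lambda>L. \<lambda>y\<in>Y. case y of Bottom \<Rightarrow> 0 | Elem x \<Rightarrow> L x | Top \<Rightarrow> card X + 1)"
  define dn where "dn = (\<lambda>f. \<lambda>x\<in>X. f (Elem x) :: nat)"
  have upE: "up L Bottom = 0" "up L Top = card X + 1" "x \<in> X \<Longrightarrow> up L (Elem x) = L x" for L x
    by (auto simp: up_def Y_def)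
  have ends: "f Bottom = 0" "f Top = card X + 1" if f: "f \<in> mp.LE" for f
  proof -
    obtain y where y: "y \<in> Y" "f y = 0" by (rule mp.LE_at[OF f, of 0]) (simp add: card_Y)
    show "f Bottom = 0" using mp.LE_D(3)[OF f mp.least[OF y(1)]] y(2) by auto
    obtain y where y: "y \<in> Y" "f y = card X + 1" by (rule mp.LE_at[OF f, of "card X + 1"]) (simp add: card_Y)
    show "f Top = card X + 1"
      using mp.LE_D(3)[OF f mp.greatest[OF y(1)]] mp.LE_D(4)[OF f mp.inY(2)] y(2) card_Y by (cases "y = Top") auto
  qed
  have "bij_betw up ?A (mp.Gap a b)"
  proof (rule bij_betw_byWitness[where f' = dn])
    show "\<forall>L\<in>?A. dn (up L) = L"
    proof
      fix L assume "L \<in> ?A"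
      then have "L \<in> extensional X" by (simp add: linear_extensions_def)
      then show "dn (up L) = L" by (intro extensionalityI[of _ X]) (auto simp: dn_def upE)
    qed
    show "\<forall>f\<in>mp.Gap a b. up (dn f) = f"
    proof
      fix f assume "f \<in> mp.Gap a b"
      then have f: "f \<in> mp.LE" by (simp add: mp.Gap_def)
      show "up (dn f) = f"
      proof (rule extensionalityI[of _ Y])
        fix y assume "y \<in> Y"
        then show "up (dn f) y = f y" using ends[OF f] upE by (cases y) (auto simp: Y_def dn_def)
      qed (use mp.LE_D(1)[OF f] in \<open>auto simp: up_def\<close>)
    qed
    show "up ` ?A \<subseteq> mp.Gap a b"
    proof (rule image_subsetI)
      fix L assume A: "L \<in> ?A"
      then have L: "L \<in> linear_extensions X prec" and g: "L z2 = L z1 + a" "L z3 = L z2 + b" by auto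
      have bij: "bij_betw L X {1..card X}" using L by (simp add: linear_extensions_def)
      have rg: "1 \<le> L x \<and> L x \<le> card X" if "x \<in> X" for x using bij that by (auto simp: bij_betw_def)
      have "bij_betw (up L) Y {..<card Y}"
      proof -
        have "up L ` Y = {0, card X + 1} \<union> L ` X" unfolding Y_def by (simp add: image_Un image_image upE)
        also have "L ` X = {1..card X}" using bij by (simp add: bij_betw_def)
        finally have im: "up L ` Y = {..<card Y}" unfolding card_Y by auto
        then have "inj_on (up L) Y" by (intro eq_card_imp_inj_on mp.finY) simp
        then show ?thesis using im by (simp add: bij_betw_def)
      qed
      moreover have "up L i < up L j" if "(i, j) \<in> R" for i j
      proof -
        have "L u < L v" if "(u, v) \<in> Q" for u v using Q_mono[OF L _ _ that] g assms by simp
        moreover have "u \<in> X" "v \<in> X" if "(u, v) \<in> Q" for u v using Q_sub that by auto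
        moreover have "(\<exists>u v. (u, v) \<in> Q \<and> i = Elem u \<and> j = Elem v) \<or> i = Bottom \<and> j = Top \<or>
            (\<exists>x\<in>X. i = Bottom \<and> j = Elem x) \<or> (\<exists>x\<in>X. i = Elem x \<and> j = Top)"
          using \<open>(i, j) \<in> R\<close> unfolding R_def Y_def by auto
        ultimately show ?thesis using rg by (elim disjE exE bexE conjE) (auto simp: upE less_Suc_eq_le Suc_le_eq)
      qed
      moreover have "up L \<in> extensional Y" unfolding up_def by (rule restrict_extensional)
      ultimately show "up L \<in> mp.Gap a b" using g upE zX by (auto simp: mp.Gap_def mp.LE_def)
    qed
    show "dn ` mp.Gap a b \<subseteq> ?A"
    proof (rule image_subsetI)
      fix f assume G: "f \<in> mp.Gap a b"
      then have f: "f \<in> mp.LE" and g: "f (Elem z2) = f (Elem z1) + a" "f (Elem z3) = f (Elem z2) + b" by (auto simp: mp.Gap_def)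
      have inj: "inj_on (dn f) X"
      proof (rule inj_onI)
        fix x y assume xy: "x \<in> X" "y \<in> X" "dn f x = dn f y"
        then have "Elem x = Elem y" by (intro mp.LE_D(5)[OF f]) (auto simp: dn_def Y_def)
        then show "x = y" by simp
      qed
      have "dn f ` X \<subseteq> {1..card X}"
      proof (rule image_subsetI)
        fix x assume x: "x \<in> X"
        have Y: "Elem x \<in> Y" using x by (simp add: Y_def)
        show "dn f x \<in> {1..card X}"
          using mp.LE_D(3)[OF f mp.least[OF Y]] mp.LE_D(3)[OF f mp.greatest[OF Y]] ends[OF f] x by (simp add: dn_def)
      qed
      then have "dn f ` X = {1..card X}" using card_image[OF inj] by (intro card_subset_eq) auto
      then have bij: "bij_betw (dn f) X {1..card X}" using inj by (simp add: bij_betw_def)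
      have "dn f u < dn f v" if "u \<in> X" "v \<in> X" "prec u v" for u v
      proof -
        have "(u, v) \<in> Q" using that by (auto simp: Q_def)
        then have "(Elem u, Elem v) \<in> R" by (auto simp: R_def)
        then show ?thesis using mp.LE_D(3)[OF f] that by (simp add: dn_def)
      qed
      moreover have "dn f \<in> extensional X" unfolding dn_def by (rule restrict_extensional)
      ultimately have "dn f \<in> linear_extensions X prec" using bij by (simp add: linear_extensions_def)
      then show "dn f \<in> ?A" using g zX by (simp add: dn_def)
    qed
  qed
  then show ?thesis unfolding num_ext_gaps_def mp.F_def by (rule bij_betw_same_card)
qed

end

theorem theorem5p6:
  fixes X :: "'a set" and prec :: "'a \<Rightarrow> 'a \<Rightarrow> bool"
    and z1 z2 z3 :: 'a and n :: nat and k l :: int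
    and F :: "int \<Rightarrow> int \<Rightarrow> nat"
  assumes "finite X" and "card X = n" and "strict_poset_on X prec"
    and "z1 \<in> X" and "z2 \<in> X" and "z3 \<in> X"
    and "z1 \<noteq> z2" and "z1 \<noteq> z3" and "z2 \<noteq> z3"
    and "F = num_ext_gaps X prec z1 z2 z3"
    and "k \<ge> 1" and "l \<ge> 1"
    and "F k (l + 2) * F (k + 2) l > 0"
  shows "real (F (k + 1) l) * real (F k (l + 1)) \<ge>
           real (F k l) * real (F (k + 1) (l + 1)) *
           (1 / 2 + 1 / (2 * sqrt ((2 * real n * real_of_int k - 2 * real n - real_of_int k + 2) *
                                   (2 * real n * real_of_int l - 2 * real n - real_of_int l + 2))))"
proof -
  obtain k' l' where kl: "k = int k'" "l = int l'" "k' \<ge> 1" "l' \<ge> 1"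
    using assms(11,12) by (metis nat_0_le nat_int of_nat_1 of_nat_le_iff order_trans zero_le_one)
  have "F k (l + 2) \<noteq> 0" using assms(13) by auto
  then have "{L \<in> linear_extensions X prec. int (L z2) - int (L z1) = k \<and> int (L z3) - int (L z2) = l + 2} \<noteq> {}"
    unfolding assms(10) num_ext_gaps_def by (metis card.empty)
  then obtain L0 where L0: "L0 \<in> linear_extensions X prec" "int (L0 z2) - int (L0 z1) = k" "int (L0 z3) - int (L0 z2) = l + 2"
    by blast
  interpret ordered_triple X prec z1 z2 z3 L0
    by unfold_locales (use assms L0 in auto)
  have F: "F (int a) (int b) = mp.F a b" if "a \<ge> 1" "b \<ge> 1" for a b using F_eq[OF that] assms(10) by simp
  have e: "k + 1 = int (k' + 1)" "k + 2 = int (k' + 2)" "l + 1 = int (l' + 1)" "l + 2 = int (l' + 2)" using kl by auto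
  have "F k (l + 2) = mp.F k' (l' + 2)" "F (k + 2) l = mp.F (k' + 2) l'" "F (k + 1) l = mp.F (k' + 1) l'"
    "F k (l + 1) = mp.F k' (l' + 1)" "F k l = mp.F k' l'" "F (k + 1) (l + 1) = mp.F (k' + 1) (l' + 1)"
    using F[of k' "l' + 2"] F[of "k' + 2" l'] F[of "k' + 1" l'] F[of k' "l' + 1"] F[of k' l'] F[of "k' + 1" "l' + 1"] kl(3,4)
    unfolding e[symmetric] kl(1,2)[symmetric] by simp_all
  then show ?thesis
    using mp.cross_product_bound[OF kl(3,4), of n] assms(2,13) card_Y kl(1,2) by simp
qed

end
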